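(* Let $n\ge 1$. For every $t\in(1,9]$ there are positive constants $a_1(t),a_2(t)$ (depending only on $t$) with $$a_{1}(t)\leq\frac{300(\sqrt{t}+1)t^{3/2}}{(t-1)^{2}},\qquad a_{2}(t)\leq \frac{36(\sqrt{t}+1)^{2}+162\ln\left(\frac{108e}{\sqrt{t}-1}\right)}{(\sqrt{t}-1)^{4}},$$ such that the following holds. Let $r>0$, $M_1,M_2>0$, and let $f$ be a holomorphic function in $\mathbf{B}_{tr}^{n}$ satisfying $$M_{f}(r/t)\geq M_{1},\qquad M_{f}(tr)\leq M_{2},\qquad R_{f}(r,t,t^{2})\geq t.$$ Let $p,q\ge 0$ and assume that $$p\leq \ln\left(\frac{1+t}{2\sqrt{t}}\right)\cdot N_{f}(r,t).$$ Then for every $g\in \mathcal{F}_{p,q}(r;t;M_{2})$, with $g_f(z):=g(z,f(z))$ for $z\in\mathbf{B}^n_{tr}$, $$\sup_{\mathbf{B}_{r}^{n}\times\mathbf{D}_{M_{2}}}|g|\leq\left(\frac{a_{1}(t)M_{2}}{M_{1}}\right)^{a_{2}(t)(p+q)}M_{g_{f}}(r)$$ and $$M_{g_{f}}(tr)\leq\left(\frac{a_{1}(t)M_{2}}{M_{1}}\right)^{a_{2}(t)(p+q)}M_{g_{f}}(r).$$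
   Context: $\mathbf{B}_r^n(z_0)\subset\mathbf{C}^n$ is the open Euclidean ball of radius $r$ centered at $z_0$; $\mathbf{B}_r^n:=\mathbf{B}_r^n(0)$, $\mathbf{D}_r(z_0):=\mathbf{B}_r^1(z_0)$, $\mathbf{D}_r:=\mathbf{B}_r^1$. For a function $f$, $M_f(r,z_0):=\sup_{\mathbf{B}_r^n(z_0)}|f|$, $m_f(r,z_0):=\ln M_f(r,z_0)$, $M_f(r):=M_f(r,0)$. For a univariate holomorphic $f$ on $\mathbf{D}_r(z_0)$: $n_f(r,z_0)$ is the number of zeros of $f$ in $\mathbf{D}_r(z_0)$, counted with multiplicity ($-\infty$ if $f\equiv0$); the valency is $v_f(r,z_0):=\sup_{c\in\mathbf{C}}n_{f+c}(r,z_0)$; the Bernstein index is $b_f(r,z_0):=\sup\{m_f(es,z)-m_f(s,z)\}$, the supremum over all discs $\mathbf{D}_{es}(z)$ relatively compact in $\mathbf{D}_r(z_0)$ (and $b_f:=0$ if $f\equiv 0$). Put $v_f(r):=v_f(r,0)$, $b_f(r):=b_f(r,0)$. $\mathcal{L}_n$ is the family of complex lines $l\subset\mathbf{C}^n$ through the origin; $l\cap\mathbf{B}_r^n$ is naturally (isometrically) identified with $\mathbf{D}_r$. For $f$ holomorphic on $\mathbf{B}_{tr}^n$ put $f_l:=f|_{l\cap\mathbf{B}_{tr}^n}$, and $$R_f(r,t,s):=\frac{M_f(r/t)}{M_f(r/s)},\quad t\le s<\infty;\qquad V_f(r,t):=\inf_{l\in\mathcal{L}_n}\{v_{f_l}(r/\sqrt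 t): f_l\ne const\};$$ $$k(t,s):=\ln\left(\frac{8e^{\pi^2}s\sqrt t}{(\sqrt t-1)^2}\right);$$ $N_f(r,t):=v_f(r/\sqrt t)$ if $n=1$, and $N_f(r,t):=\max\left\{\sup_{s\in[t,\infty)}\frac{\ln(R_f(r,t,s)/\sqrt t)}{k(t,s)},\,V_f(r,t)\right\}$ if $n\ge2$. Class $\mathcal{F}_{p,q}(r;t;M_2)$ ($p,q\ge0$): the holomorphic functions $g$ on $\mathbf{B}_{tr}^n\times\mathbf{D}_{3M_2}\subset\mathbf{C}^{n+1}$ such that, with $g_l:=g|_{(l\cap\mathbf{B}_{tr}^n)\times\mathbf{D}_{3M_2}}$, $$M_{g_l(\cdot,w)}(tr)\le e^pM_{g_l(\cdot,w)}(r)\ \text{ for all } l\in\mathcal{L}_n,\ w\in\mathbf{D}_{3M_2},\qquad b_{g(z,\cdot)}(3M_2)\le q\ \text{ for all } z\in\mathbf{B}_{tr}^n.$$ *)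

theory Defs
  imports "HOL-Complex_Analysis.Complex_Analysis"
begin

text \<open>
  The dimension has to be an ordinary natural number, since the constants of the theorem must not
  depend on it.  So, following the convention of \<open>Euclidean_space\<close> in
  \<open>HOL-Analysis.Abstract_Euclidean_Space\<close>, points of complex $n$-space are functions on the
  naturals that vanish from index $n$ on.
\<close>

definition Cn :: "nat \<Rightarrow> (nat \<Rightarrow> complex) set" where
  "Cn n = {z. \<forall>i\<ge>n. z i = 0}"

definition Cn_norm :: "nat \<Rightarrow> (nat \<Rightarrow> complex) \<Rightarrow> real" where
  "Cn_norm n z = L2_set (\<lambda>i. cmod (z i)) {..<n}"

definition Cn_ball :: "nat \<Rightarrow> (nat \<Rightarrow> complex) \<Rightarrow> real \<Rightarrow> (nat \<Rightarrow> complex) set" where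
  "Cn_ball n z0 r = {z \<in> Cn n. Cn_norm n (\<lambda>i. z i - z0 i) < r}"

abbreviation Cn_ball0 :: "nat \<Rightarrow> real \<Rightarrow> (nat \<Rightarrow> complex) set" where
  "Cn_ball0 n r \<equiv> Cn_ball n (\<lambda>_. 0) r"

text \<open>
  Complex Fr\'echet differentiability at every point of \<open>U\<close>: \<open>a\<close> is the complex gradient.
  It is used for open sets \<open>U\<close> only, so the values of \<open>f\<close> outside \<open>U\<close> play no role.
\<close>

definition Cn_holomorphic_on ::
    "nat \<Rightarrow> ((nat \<Rightarrow> complex) \<Rightarrow> complex) \<Rightarrow> (nat \<Rightarrow> complex) set \<Rightarrow> bool" where
  "Cn_holomorphic_on n f U \<longleftrightarrow>
     (\<forall>z\<in>U. \<exists>a. \<forall>\<epsilon>>0. \<exists>\<delta>>0. \<forall>h\<in>Cn n. Cn_norm n h < \<delta> \<longrightarrow>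
        cmod (f (\<lambda>i. z i + h i) - f z - (\<Sum>i<n. a i * h i)) \<le> \<epsilon> * Cn_norm n h)"

text \<open>
  The point $(z,w)$ of the product of complex $n$-space with the complex plane, viewed as a point
  of complex $(n+1)$-space (for \<open>z \<in> Cn n\<close>), is \<open>z(n := w)\<close>.
\<close>

definition Cn_prod ::
    "nat \<Rightarrow> (nat \<Rightarrow> complex) set \<Rightarrow> complex set \<Rightarrow> (nat \<Rightarrow> complex) set" where
  "Cn_prod n U D = {z(n := w) | z w. z \<in> U \<and> w \<in> D}"

definition complex_lines :: "nat \<Rightarrow> (nat \<Rightarrow> complex) set set" where
  "complex_lines n = {range (\<lambda>\<zeta> i. \<zeta> * u i) | u. u \<in> Cn n \<and> u \<noteq> (\<lambda>_. 0)}"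

text \<open>
  Suprema of moduli, and the quantities derived from them, are extended reals: nothing is assumed
  about boundedness up to the boundary.
\<close>

definition sup_abs :: "('a \<Rightarrow> complex) \<Rightarrow> 'a set \<Rightarrow> ereal" where
  "sup_abs f S = (SUP z\<in>S. ereal (cmod (f z)))"

definition ln_ext :: "ereal \<Rightarrow> ereal" where
  "ln_ext x = (if x \<le> 0 then -\<infinity> else if x = \<infinity> then \<infinity> else ereal (ln (real_of_ereal x)))"

definition zero_count :: "(complex \<Rightarrow> complex) \<Rightarrow> real \<Rightarrow> complex \<Rightarrow> ereal" where
  "zero_count f r z0 =
     (let Z = {z \<in> ball z0 r. f z = 0} in
      if Z = ball z0 r then -\<infinity>
      else if finite Z then ereal (\<Sum>z\<in>Z. real_of_int (zorder f z))
      else \<infinity>)"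

definition valency :: "(complex \<Rightarrow> complex) \<Rightarrow> real \<Rightarrow> complex \<Rightarrow> ereal" where
  "valency f r z0 = (SUP c. zero_count (\<lambda>z. f z + c) r z0)"

definition bernstein_index :: "(complex \<Rightarrow> complex) \<Rightarrow> real \<Rightarrow> complex \<Rightarrow> ereal" where
  "bernstein_index f r z0 =
     (if \<forall>z\<in>ball z0 r. f z = 0 then 0
      else SUP (s, z) \<in> {(s, z). 0 < s \<and> closure (ball z (exp 1 * s)) \<subseteq> ball z0 r}.
             ln_ext (sup_abs f (ball z (exp 1 * s))) - ln_ext (sup_abs f (ball z s)))"

definition R_ratio :: "nat \<Rightarrow> ((nat \<Rightarrow> complex) \<Rightarrow> complex) \<Rightarrow> real \<Rightarrow> real \<Rightarrow> real \<Rightarrow> ereal" where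
  "R_ratio n f r t s = sup_abs f (Cn_ball0 n (r / t)) / sup_abs f (Cn_ball0 n (r / s))"

text \<open>
  A unit vector \<open>u\<close> of a line \<open>l\<close> gives the isometric identification of the discs of \<open>l\<close> with
  those of the complex plane; the valency does not depend on the choice of \<open>u\<close>.
\<close>

definition V_min :: "nat \<Rightarrow> ((nat \<Rightarrow> complex) \<Rightarrow> complex) \<Rightarrow> real \<Rightarrow> real \<Rightarrow> ereal" where
  "V_min n f r t =
     Inf {valency (\<lambda>\<zeta>. f (\<lambda>i. \<zeta> * u i)) (r / sqrt t) 0 | l u.
            l \<in> complex_lines n \<and> u \<in> l \<and> Cn_norm n u = 1 \<and>
            \<not> f constant_on (l \<inter> Cn_ball0 n (t * r))}"

definition k_const :: "real \<Rightarrow> real \<Rightarrow> real" where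
  "k_const t s = ln (8 * exp (pi\<^sup>2) * s * sqrt t / (sqrt t - 1)\<^sup>2)"

definition N_index :: "nat \<Rightarrow> ((nat \<Rightarrow> complex) \<Rightarrow> complex) \<Rightarrow> real \<Rightarrow> real \<Rightarrow> ereal" where
  "N_index n f r t =
     (if n = 1 then valency (\<lambda>\<zeta>. f (\<lambda>i. if i = 0 then \<zeta> else 0)) (r / sqrt t) 0
      else max (SUP s\<in>{t..}. ln_ext (R_ratio n f r t s / ereal (sqrt t)) / ereal (k_const t s))
               (V_min n f r t))"

definition F_class ::
    "nat \<Rightarrow> real \<Rightarrow> real \<Rightarrow> real \<Rightarrow> real \<Rightarrow> real \<Rightarrow> ((nat \<Rightarrow> complex) \<Rightarrow> complex) set" where
  "F_class n p q r t M2 =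
     {g. Cn_holomorphic_on (n + 1) g (Cn_prod n (Cn_ball0 n (t * r)) (ball 0 (3 * M2))) \<and>
         (\<forall>l\<in>complex_lines n. \<forall>w\<in>ball 0 (3 * M2).
            sup_abs (\<lambda>z. g (z(n := w))) (l \<inter> Cn_ball0 n (t * r))
              \<le> ereal (exp p) * sup_abs (\<lambda>z. g (z(n := w))) (l \<inter> Cn_ball0 n r)) \<and>
         (\<forall>z\<in>Cn_ball0 n (t * r). bernstein_index (\<lambda>w. g (z(n := w))) (3 * M2) 0 \<le> ereal q)}"

end

theory Submission
  imports Defs
begin

text \<open>
  Write \<open>u = sqrt t\<close>, and let \<open>\<epsilon>\<close> be a bound of \<open>g(z, f z)\<close> on the ball of radius \<open>r\<close>.  The point is to
  bound \<open>g\<close> off the graph of \<open>f\<close>.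

  Restrict to a complex line, identified with the plane so that radius \<open>r\<close> becomes radius \<open>1\<close>, and
  fix the last variable \<open>w\<close>.  The difference \<open>g(\<zeta>, w) - g(\<zeta>, f \<zeta>)\<close> vanishes at the zeros of
  \<open>f - w\<close>.  If \<open>f - w\<close> has so many zeros in a disc of radius \<open>\<rho> < 1\<close> that their Blaschke product is at
  most \<open>exp (-5p/8)\<close> on the disc of radius \<open>\<rho>/u\<close>, then the difference shrinks by that factor
  between the two discs (\<open>perturbed_division_estimate\<close>), whereas the growth condition and
  Hadamard's three circles theorem allow \<open>g(\<cdot>, w)\<close> to grow by \<open>exp (p/2)\<close> only (\<open>growth_leD\<close>).
  Because \<open>5/8 > 1/2\<close>, the maximum of \<open>g(\<cdot>, w)\<close> on the smaller disc satisfies an inequality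
  \<open>m \<le> (1 - p1/10) m + 3 \<epsilon>\<close> as soon as \<open>p \<ge> p1 > 0\<close>, so it is at most \<open>30 \<epsilon> / p1\<close>
  (\<open>contraction_step\<close>).

  The required zeros come from the index \<open>N\<close> of \<open>f\<close> (\<open>zero_data_exists\<close>).  If the index is a
  valency, some value \<open>w0\<close> is taken sufficiently often in the disc of radius \<open>1/u\<close>.  If it is a growth
  ratio, Jensen's formula averaged over the circle \<open>|w| = \<tau>\<close> shows that a value \<open>w0\<close> of modulus \<open>\<tau>\<close>
  is taken often enough, the zeros being counted with their logarithmic depth
  (\<open>exists_value_with_many_zeros\<close>).

  The estimate is stable: it survives small changes of \<open>w\<close> and of the direction of the line,
  provided that \<open>f - w0\<close> is bounded below on the circle of radius \<open>\<rho>\<close>.  A circle with such a bound exists by an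
  argument of Cartan type (\<open>lower_bound_on_circle\<close>); the lower bound is a power of \<open>M1/M2\<close>, which is
  how this ratio enters the final constant.  From directions near one direction to all directions
  one passes by the three circles theorem applied to the parameter of a pencil of lines
  (\<open>slice_everywhere\<close>), and from \<open>w\<close> near \<open>w0\<close> to all \<open>w\<close> by iterating the Bernstein inequality
  (\<open>bernstein_chain\<close>).

  For \<open>p < p1\<close> the growth condition is so strong that Harnack's inequality makes \<open>g(0, w)\<close> dominate
  \<open>g(z, w)\<close> everywhere (\<open>growth_small_imp_center_large\<close>), and the single zero of \<open>f - f 0\<close> at the
  origin takes over the part of the many zeros.  If \<open>q\<close> is small as well, the same applies in the
  last variable, and \<open>g\<close> is comparable to its value at the one point \<open>(0, f 0)\<close> of the graph
  (\<open>graph_bound_small\<close>).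
\<close>

section \<open>Three circles and growth on discs\<close>

text \<open>
  Schwarz's lemma for \<open>f - f a\<close>, whose modulus is at most \<open>2 * K\<close>.  That lemma asks for a strict
  bound, hence the limit \<open>e \<rightarrow> 0\<close> in \<open>2 * K + e\<close>.
\<close>

lemma bounded_holomorphic_diff_le:
  assumes hol: "f holomorphic_on ball a R" and R: "0 < R"
    and K: "\<And>z. z \<in> ball a R \<Longrightarrow> cmod (f z) \<le> K" and z: "z \<in> ball a R"
  shows "cmod (f z - f a) \<le> 2 * K * cmod (z - a) / R"
proof -
  have K0: "0 \<le> K" using K[of a] R norm_ge_zero order_trans by (metis centre_in_ball)
  have main: "cmod (f z - f a) \<le> (2 * K + e) * cmod (z - a) / R" if e: "0 < e" for e
  proof -
    define d where "d = 2 * K + e"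
    define g where "g = (\<lambda>w::complex. (f (a + of_real R * w) - f a) / of_real d)"
    have pos: "0 < d" "2 * K < d" using K0 e by (simp_all add: d_def)
    have gn: "cmod (g w) = cmod (f (a + of_real R * w) - f a) / d" for w
      using pos by (simp add: g_def norm_divide)
    have ain: "a + of_real R * w \<in> ball a R" if "cmod w < 1" for w :: complex
      using that R by (simp add: dist_norm norm_mult)
    have "(f \<circ> (\<lambda>w. a + of_real R * w)) holomorphic_on ball 0 1"
      by (rule holomorphic_on_compose_gen[OF _ hol]) (use ain in \<open>auto intro!: holomorphic_intros simp del: mem_ball simp add: mem_ball_0\<close>)
    then have "g holomorphic_on ball 0 1"
      unfolding g_def o_def using pos by (intro holomorphic_intros) auto
    moreover have "g 0 = 0" by (simp add: g_def)
    moreover have "cmod (g w) < 1" if "cmod w < 1" for w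
    proof -
      have "cmod (f (a + of_real R * w) - f a) \<le> K + K"
        using K[OF ain[OF that]] K[of a] R by (intro order_trans[OF norm_triangle_ineq4] add_mono) auto
      then show ?thesis using pos unfolding gn by (simp add: divide_less_eq)
    qed
    moreover have z1: "cmod ((z - a) / of_real R) < 1"
      using z R by (simp add: norm_divide dist_norm norm_minus_commute)
    ultimately have "cmod (g ((z - a) / of_real R)) \<le> cmod ((z - a) / of_real R)"
      by (rule Schwarz_Lemma(1))
    then have "cmod (f z - f a) / d \<le> cmod (z - a) / R"
      using R unfolding gn by (simp add: norm_divide)
    then have "cmod (f z - f a) \<le> d * (cmod (z - a) / R)" using pos by (simp add: divide_le_eq mult.commute)
    then show ?thesis by (simp add: d_def)
  qed
  show ?thesis
  proof (rule tendsto_lowerbound)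
    show "((\<lambda>e. (2 * K + e) * cmod (z - a) / R) \<longlongrightarrow> 2 * K * cmod (z - a) / R) (at_right 0)"
      using R by (auto intro!: tendsto_eq_intros)
    show "\<forall>\<^sub>F e in at_right 0. cmod (f z - f a) \<le> (2 * K + e) * cmod (z - a) / R"
      using main by (auto simp: eventually_at_right_less intro: eventually_mono[OF eventually_at_right_less])
  qed simp
qed

text \<open>
  The exponential function unrolls the annulus to a vertical strip, where \<open>f (exp s) * exp (- \<sigma> * s)\<close> is bounded by
  \<open>C\<close> on the two boundary lines.  Its modulus has period \<open>2 * pi * \<i>\<close>, so the maximum over the
  strip is attained on a rectangle, and the maximum principle applies.  The bound is given by one
  power of \<open>cmod z\<close>, since growth exponents are what the theorem is used for.
\<close>

lemma hadamard_three_circles: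
  assumes hol: "f holomorphic_on S" and S: "open S" "{z. a \<le> cmod z \<and> cmod z \<le> b} \<subseteq> S"
    and ab: "0 < a" "a \<le> b"
    and A: "\<And>z. cmod z = a \<Longrightarrow> cmod (f z) \<le> C * a powr \<sigma>"
    and B: "\<And>z. cmod z = b \<Longrightarrow> cmod (f z) \<le> C * b powr \<sigma>"
    and z: "a \<le> cmod z" "cmod z \<le> b"
  shows "cmod (f z) \<le> C * cmod z powr \<sigma>"
proof -
  define \<alpha> \<beta> where "\<alpha> = ln a" and "\<beta> = ln b"
  define g where "g = (\<lambda>s::complex. f (exp s) * exp (- of_real \<sigma> * s))"
  define T where "T = {s::complex. \<alpha> \<le> Re s \<and> Re s \<le> \<beta>}"
  define T0 where "T0 = {s::complex. \<alpha> < Re s \<and> Re s < \<beta>}"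
  have b0: "0 < b" using ab by simp
  have ex: "a \<le> cmod (exp s) \<and> cmod (exp s) \<le> b" if "s \<in> T" for s
    using that ab b0 unfolding T_def \<alpha>_def \<beta>_def
    by (metis (mono_tags, lifting) exp_le_cancel_iff exp_ln mem_Collect_eq norm_exp_eq_Re)
  have exS: "exp ` T \<subseteq> S" using ex S(2) by blast
  have contg: "continuous_on T g"
    unfolding g_def
    by (intro continuous_intros continuous_on_compose2[OF holomorphic_on_imp_continuous_on[OF hol] _ exS])
  have T0T: "T0 \<subseteq> T" by (auto simp: T0_def T_def)
  have holg: "g holomorphic_on T0"
    unfolding g_def using exS T0T
    by (intro holomorphic_intros holomorphic_on_compose_gen[OF _ hol, unfolded o_def]) auto
  have ng: "cmod (g s) = cmod (f (exp s)) / cmod (exp s) powr \<sigma>" for s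
    by (simp add: g_def norm_mult powr_def exp_minus norm_divide field_simps)
  have bd: "cmod (g s) \<le> C" if "Re s = \<alpha> \<or> Re s = \<beta>" for s
  proof -
    have "cmod (exp s) = a \<or> cmod (exp s) = b" using that ab b0 by (auto simp: \<alpha>_def \<beta>_def)
    then show ?thesis using A[of "exp s"] B[of "exp s"] ab b0 unfolding ng by (auto simp: divide_simps)
  qed
  define Q where "Q = cbox (Complex \<alpha> 0) (Complex \<beta> (2*pi))"
  have Q: "s \<in> Q \<longleftrightarrow> \<alpha> \<le> Re s \<and> Re s \<le> \<beta> \<and> 0 \<le> Im s \<and> Im s \<le> 2*pi" for s
    by (auto simp: Q_def in_cbox_complex_iff)
  have QT: "Q \<subseteq> T" by (auto simp: Q T_def)
  have ab': "\<alpha> \<le> \<beta>" using ab by (simp add: \<alpha>_def \<beta>_def)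
  \<comment> \<open>Every point of the annulus has a logarithm in the rectangle, so a maximum over the rectangle is one over the strip.\<close>
  have lift: "\<exists>s\<in>Q. exp s = w" if "a \<le> cmod w" "cmod w \<le> b" for w
  proof -
    have w0: "w \<noteq> 0" using that ab by auto
    have "exp (of_real (ln (cmod w)) + \<i> * of_real (Arg2pi w)) = of_real (cmod w) * exp (\<i> * of_real (Arg2pi w))"
      using w0 by (simp add: exp_add exp_of_real)
    also have "\<dots> = w" using Arg2pi[of w] unfolding is_Arg_def by simp
    finally have "exp (Complex (ln (cmod w)) (Arg2pi w)) = w" by (simp add: Complex_eq)
    moreover have "Complex (ln (cmod w)) (Arg2pi w) \<in> Q"
      using that ab w0 Arg2pi_ge_0[of w] Arg2pi_lt_2pi[of w] by (auto simp: Q \<alpha>_def \<beta>_def)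
    ultimately show ?thesis by blast
  qed
  have "Complex \<alpha> 0 \<in> Q" using ab' by (auto simp: Q)
  then have Qne: "Q \<noteq> {}" by blast
  have Qc: "compact Q" unfolding Q_def by (rule compact_cbox)
  have "continuous_on Q (\<lambda>s. cmod (g s))" by (rule continuous_on_norm[OF continuous_on_subset[OF contg QT]])
  from continuous_attains_sup[OF Qc Qne this]
  obtain s0 where s0: "s0 \<in> Q" and mx: "\<And>s. s \<in> Q \<Longrightarrow> cmod (g s) \<le> cmod (g s0)" by blast
  have mxT: "cmod (g s) \<le> cmod (g s0)" if "s \<in> T" for s
  proof -
    note ex[OF that]
    then obtain s' where "s' \<in> Q" "exp s' = exp s" using lift by blast
    then show ?thesis using mx[of s'] by (simp add: ng)
  qed
  have gs0: "cmod (g s0) \<le> C"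
  proof (cases "Re s0 = \<alpha> \<or> Re s0 = \<beta>")
    case True then show ?thesis using bd by blast
  next
    case False
    then have s0T: "s0 \<in> T0" using s0 by (auto simp: Q T0_def)
    then have lt: "\<alpha> < \<beta>" by (auto simp: T0_def)
    have T0eq: "T0 = {s. \<alpha> < Re s} \<inter> {s. Re s < \<beta>}" by (auto simp: T0_def)
    have "g constant_on T0"
    proof (rule maximum_modulus_principle[OF holg _ _ _ subset_refl s0T])
      show "open T0" "open T0" unfolding T0eq by (intro open_Int open_halfspace_Re_gt open_halfspace_Re_lt)+
      show "connected T0" unfolding T0eq
        by (intro convex_connected convex_Int convex_halfspace_Re_gt convex_halfspace_Re_lt)
    qed (use mxT T0T in auto)
    then obtain c where c: "\<And>s. s \<in> T0 \<Longrightarrow> g s = c" by (auto simp: constant_on_def)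
    have cl: "of_real \<alpha> \<in> closure T0"
      unfolding closure_approachable
    proof (intro allI impI)
      fix e :: real assume e: "0 < e"
      show "\<exists>y\<in>T0. dist y (of_real \<alpha>) < e"
      proof (intro bexI)
        define d where "d = min (e/2) ((\<beta>-\<alpha>)/2)"
        have d: "0 < d" "d < e" "d < \<beta> - \<alpha>" using e lt by (auto simp: d_def min_def field_simps)
        show "of_real (\<alpha> + d) \<in> T0" using d by (simp add: T0_def)
        have "dist (complex_of_real (\<alpha> + d)) (of_real \<alpha>) = \<bar>d\<bar>" by (simp add: dist_norm)
        then show "dist (complex_of_real (\<alpha> + d)) (of_real \<alpha>) < e" using d by simp
      qed
    qed
    have clT: "closure T0 \<subseteq> T"
      by (rule closure_minimal[OF T0T])
         (simp add: T_def closed_Collect_conj closed_Collect_le continuous_intros)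
    have "g (of_real \<alpha>) = c"
      using continuous_constant_on_closure[OF continuous_on_subset[OF contg clT] c cl] .
    then show ?thesis using bd[of "of_real \<alpha>"] c[OF s0T] by simp
  qed
  obtain s where s: "s \<in> Q" "exp s = z" using lift z by blast
  have "cmod (g s) \<le> C" using mx[OF s(1)] gs0 by simp
  then show ?thesis using s(2) z ab unfolding ng by (simp add: divide_simps split: if_splits)
qed

text \<open>
  Bounds \<open>B\<close> take the place of suprema, so that an unbounded function on the unit disc satisfies
  the condition vacuously, as it does for extended real suprema.
\<close>

definition growth_le :: "real \<Rightarrow> real \<Rightarrow> (complex \<Rightarrow> complex) \<Rightarrow> bool" where
  "growth_le t p f \<longleftrightarrow>
     (\<forall>B. (\<forall>z\<in>ball 0 1. cmod (f z) \<le> B) \<longrightarrow> (\<forall>z\<in>ball 0 t. cmod (f z) \<le> exp p * B))"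

text \<open>
  With \<open>s = p / ln t\<close>, the growth condition forbids the modulus to grow faster than \<open>cmod z powr s\<close>
  between the circles of radii \<open>1\<close> and \<open>t\<close>; by convexity the same holds between \<open>a\<close> and \<open>t\<close>.  For an
  exponent \<open>\<sigma>\<close> slightly above \<open>s\<close>, the three circles theorem gives a constant that is the larger of
  two numbers, one from each boundary circle.  The outer one is below the maximum \<open>m\<close> on the unit
  disc, so it cannot be what bounds \<open>m\<close>; only the inner one remains.
\<close>

lemma growth_leD:
  assumes hol: "f holomorphic_on ball 0 t" and t: "1 < t" and p: "0 \<le> p" and gr: "growth_le t p f"
    and a: "0 < a" "a \<le> 1" and B: "\<And>z. cmod z \<le> a \<Longrightarrow> cmod (f z) \<le> B"
    and z: "a \<le> cmod z" "cmod z < t"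
  shows "cmod (f z) \<le> B * (cmod z / a) powr (p / ln t)"
proof -
  define s where "s = p / ln t"
  have lt: "0 < ln t" using t by simp
  have s0: "0 \<le> s" using p lt by (simp add: s_def)
  have ps: "p = s * ln t" using lt by (simp add: s_def)
  have B0: "0 \<le> B" using B[of 0] a by (smt (verit) norm_ge_zero norm_zero)
  have contf: "continuous_on (cball 0 1) f"
    by (rule continuous_on_subset[OF holomorphic_on_imp_continuous_on[OF hol]]) (use t in auto)
  have "cball (0::complex) 1 \<noteq> {}" by simp
  from continuous_attains_sup[OF compact_cball this continuous_on_norm[OF contf]]
  obtain z1 where z1: "cmod z1 \<le> 1" and mx: "\<And>z. cmod z \<le> 1 \<Longrightarrow> cmod (f z) \<le> cmod (f z1)" by auto
  define m where "m = cmod (f z1)"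
  have m0: "0 \<le> m" by (simp add: m_def)
  have big: "cmod (f w) \<le> exp p * m" if "cmod w < t" for w
    using gr mx that unfolding growth_le_def m_def by auto
  have main: "cmod (f z) \<le> B * (cmod z / a) powr \<sigma>" if \<sigma>: "s < \<sigma>" for \<sigma>
  proof -
    have \<sigma>0: "0 < \<sigma>" using s0 \<sigma> by simp
    have "p / \<sigma> < ln t" using \<sigma> \<sigma>0 lt by (simp add: ps field_simps)
    moreover have "ln (max (cmod z) 1) < ln t" using z t by (subst ln_less_cancel_iff) auto
    ultimately have "max (p / \<sigma>) (ln (max (cmod z) 1)) < ln t" by simp
    then obtain l where l: "max (p / \<sigma>) (ln (max (cmod z) 1)) < l" "l < ln t" using dense by blast
    define t' where "t' = exp l"
    have l0: "0 < l" using l(1) p \<sigma>0 by (smt (verit, best) divide_nonneg_pos)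
    have t'1: "1 < t'" using l0 by (simp add: t'_def)
    have t't: "t' < t" using l(2) t by (metis exp_less_cancel_iff exp_ln less_trans t'_def zero_less_one)
    have zt': "cmod z \<le> t'"
    proof -
      have "max (cmod z) 1 < t'" using l(1) unfolding t'_def
        by (smt (verit) exp_gt_zero ln_exp ln_less_cancel_iff)
      then show ?thesis by simp
    qed
    have "p < \<sigma> * l" using l(1) \<sigma>0 by (simp add: field_simps)
    then have et: "exp p < t' powr \<sigma>" by (simp add: t'_def powr_def mult.commute)
    have tp: "0 < t' powr \<sigma>" using t'1 by simp
    define C where "C = max (B / a powr \<sigma>) (exp p * m / t' powr \<sigma>)"
    have ap: "0 < a powr \<sigma>" "a powr \<sigma> \<le> 1" using a \<sigma>0 by (auto intro: powr_le1)
    have C0: "0 \<le> C" using B0 ap by (simp add: C_def le_max_iff_disj)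
    have circ: "cmod (f w) \<le> C * cmod w powr \<sigma>" if "a \<le> cmod w" "cmod w \<le> t'" for w
    proof (rule hadamard_three_circles[where S = "ball 0 t" and a = a and b = t'])
      show "cmod (f z) \<le> C * a powr \<sigma>" if "cmod z = a" for z
      proof -
        have "cmod (f z) \<le> (B / a powr \<sigma>) * a powr \<sigma>" using B that ap by simp
        also have "\<dots> \<le> C * a powr \<sigma>" using ap by (intro mult_right_mono) (auto simp: C_def)
        finally show ?thesis .
      qed
      show "cmod (f z) \<le> C * t' powr \<sigma>" if "cmod z = t'" for z
      proof -
        have "cmod (f z) \<le> (exp p * m / t' powr \<sigma>) * t' powr \<sigma>" using big[of z] that tp t't by simp
        also have "\<dots> \<le> C * t' powr \<sigma>" using tp by (intro mult_right_mono) (auto simp: C_def)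
        finally show ?thesis .
      qed
    qed (use hol that a t't t'1 in auto)
    \<comment> \<open>The outer term would give \<open>m \<le> exp p * m / t powr \<sigma>\<close>, which is less than \<open>m\<close>.\<close>
    have mB: "m \<le> B / a powr \<sigma>"
    proof (cases "cmod z1 \<le> a")
      case True
      then have "m \<le> B" using B by (simp add: m_def)
      also have "B \<le> B / a powr \<sigma>" using ap B0 by (simp add: field_simps mult_left_le)
      finally show ?thesis .
    next
      case False
      then have "m \<le> C * cmod z1 powr \<sigma>" using circ[of z1] z1 t'1 by (simp add: m_def)
      also have "\<dots> \<le> C" using C0 z1 \<sigma>0 by (intro mult_left_le) (auto intro: powr_le1)
      finally have mC: "m \<le> C" .
      show ?thesis
      proof (rule ccontr)
        assume n: "\<not> ?thesis"
        then have "m \<le> exp p * m / t' powr \<sigma>" using mC by (simp add: C_def max_def split: if_splits)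
        moreover have "0 < m" using n B0 ap by (smt (verit) divide_nonneg_pos)
        ultimately show False using et tp by (simp add: field_simps)
      qed
    qed
    have "exp p * m / t' powr \<sigma> \<le> m" using mult_left_mono[OF less_imp_le[OF et] m0] tp by (simp add: divide_le_eq mult.commute)
    then have "C \<le> B / a powr \<sigma>" using mB by (simp add: C_def)
    then have "C * cmod z powr \<sigma> \<le> B / a powr \<sigma> * cmod z powr \<sigma>" by (intro mult_right_mono) auto
    then show ?thesis using circ[OF z(1) zt'] a z by (simp add: powr_divide)
  qed
  have "cmod (f z) \<le> B * (cmod z / a) powr s"
  proof (rule tendsto_lowerbound)
    show "((\<lambda>\<sigma>. B * (cmod z / a) powr \<sigma>) \<longlongrightarrow> B * (cmod z / a) powr s) (at_right s)"
      using a z by (auto intro!: tendsto_eq_intros simp: zero_less_divide_iff)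
    show "\<forall>\<^sub>F \<sigma> in at_right s. cmod (f z) \<le> B * (cmod z / a) powr \<sigma>"
      by (rule eventually_mono[OF eventually_at_right_less]) (use main in auto)
  qed simp
  then show ?thesis by (simp add: s_def)
qed

section \<open>Poisson formula, Harnack inequality and Blaschke factors\<close>

definition poisson_kernel :: "real \<Rightarrow> complex \<Rightarrow> complex \<Rightarrow> real" where
  "poisson_kernel R w \<zeta> = (R\<^sup>2 - (cmod w)\<^sup>2) / (cmod (\<zeta> - w))\<^sup>2"

lemma poisson_kernel_bounds:
  assumes "cmod w < R" "cmod \<zeta> = R"
  shows "(R - cmod w) / (R + cmod w) \<le> poisson_kernel R w \<zeta>"
    and "poisson_kernel R w \<zeta> \<le> (R + cmod w) / (R - cmod w)"
proof -
  have d: "R - cmod w \<le> cmod (\<zeta> - w)" "cmod (\<zeta> - w) \<le> R + cmod w"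
    using assms norm_triangle_ineq2[of \<zeta> w] norm_triangle_ineq4[of \<zeta> w] by auto
  have pos: "0 < R - cmod w" "0 < R + cmod w" using assms norm_ge_zero[of w] by linarith+
  have eq: "R\<^sup>2 - (cmod w)\<^sup>2 = (R - cmod w) * (R + cmod w)" by (simp add: power2_eq_square algebra_simps)
  have q: "(R - cmod w)\<^sup>2 \<le> (cmod (\<zeta> - w))\<^sup>2" "(cmod (\<zeta> - w))\<^sup>2 \<le> (R + cmod w)\<^sup>2"
    using d pos by (auto intro: power_mono)
  have nn: "0 < (cmod (\<zeta> - w))\<^sup>2" using d(1) pos by (intro zero_less_power) linarith
  have "(R - cmod w) / (R + cmod w) = (R - cmod w) * (R + cmod w) / (R + cmod w)\<^sup>2"
    using pos by (simp add: power2_eq_square)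
  also have "\<dots> \<le> (R - cmod w) * (R + cmod w) / (cmod (\<zeta> - w))\<^sup>2"
    using q nn pos by (intro divide_left_mono) auto
  finally show "(R - cmod w) / (R + cmod w) \<le> poisson_kernel R w \<zeta>"
    by (simp add: poisson_kernel_def eq)
  have "(R - cmod w) * (R + cmod w) / (cmod (\<zeta> - w))\<^sup>2 \<le> (R - cmod w) * (R + cmod w) / (R - cmod w)\<^sup>2"
    using q nn pos by (intro divide_left_mono) auto
  also have "\<dots> = (R + cmod w) / (R - cmod w)" using pos by (simp add: power2_eq_square)
  finally show "poisson_kernel R w \<zeta> \<le> (R + cmod w) / (R - cmod w)"
    by (simp add: poisson_kernel_def eq)
qed

lemma poisson_formula:
  fixes f :: "complex \<Rightarrow> complex"
  assumes hol: "f holomorphic_on ball 0 R'" and R: "0 < R" "R < R'" and w: "cmod w < R"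
  shows "((\<lambda>\<theta>. f (of_real R * cis \<theta>) * of_real (poisson_kernel R w (of_real R * cis \<theta>)))
            has_integral of_real (2 * pi) * f w) {0..2*pi}"
proof -
  have cont: "continuous_on (cball 0 R) f"
    by (rule continuous_on_subset[OF holomorphic_on_imp_continuous_on[OF hol]]) (use R in auto)
  have holb: "f holomorphic_on ball 0 R" by (rule holomorphic_on_subset[OF hol]) (use R in auto)
  have "((\<lambda>u. f u/(u-w)) has_contour_integral (2 * of_real pi * \<i> * f w)) (circlepath 0 R)"
    by (rule Cauchy_integral_circlepath[OF cont holb]) (use w in simp)
  then have I1: "((\<lambda>\<theta>. f (of_real R * cis \<theta>) / (of_real R * cis \<theta> - w) * of_real R * \<i> * cis \<theta>)
      has_integral (2 * of_real pi * \<i> * f w)) {0..2*pi}"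
    unfolding circlepath_def by (subst (asm) has_contour_integral_part_circlepath_iff) auto
  have nz: "of_real (R\<^sup>2) - cnj w * u \<noteq> 0" if "cmod u \<le> R" for u
  proof
    assume "of_real (R\<^sup>2) - cnj w * u = 0"
    then have "cmod (of_real (R\<^sup>2)) = cmod (cnj w * u)" by (metis eq_iff_diff_eq_0)
    then have "R\<^sup>2 = cmod w * cmod u" unfolding norm_of_real by (simp add: norm_mult)
    also have "\<dots> \<le> cmod w * R" using that by (intro mult_left_mono) auto
    also have "\<dots> < R * R" using w R by (intro mult_strict_right_mono) auto
    finally show False by (simp add: power2_eq_square)
  qed
  define k where "k = (\<lambda>u. f u * cnj w * u / (of_real (R\<^sup>2) - cnj w * u))"
  have contk: "continuous_on (cball 0 R) k"
    unfolding k_def using nz by (intro continuous_intros cont) auto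
  have holk: "k holomorphic_on ball 0 R"
    unfolding k_def using nz by (intro holomorphic_intros holb) (auto simp: less_imp_le)
  have "((\<lambda>u. k u/(u-0)) has_contour_integral (2 * of_real pi * \<i> * k 0)) (circlepath 0 R)"
    by (rule Cauchy_integral_circlepath[OF contk holk]) (use R in simp)
  then have I2: "((\<lambda>\<theta>. k (of_real R * cis \<theta>) / (of_real R * cis \<theta> - 0) * of_real R * \<i> * cis \<theta>)
      has_integral (2 * of_real pi * \<i> * k 0)) {0..2*pi}"
    unfolding circlepath_def by (subst (asm) has_contour_integral_part_circlepath_iff) auto
  have "((\<lambda>\<theta>. (f (of_real R * cis \<theta>) / (of_real R * cis \<theta> - w) * of_real R * \<i> * cis \<theta>
       + k (of_real R * cis \<theta>) / (of_real R * cis \<theta> - 0) * of_real R * \<i> * cis \<theta>) / \<i>)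
      has_integral ((2 * of_real pi * \<i> * f w + 2 * of_real pi * \<i> * k 0) / \<i>)) {0..2*pi}"
    by (rule has_integral_divide[OF has_integral_add[OF I1 I2]])
  moreover have "(2 * of_real pi * \<i> * f w + 2 * of_real pi * \<i> * k 0) / \<i> = of_real (2 * pi) * f w"
    by (simp add: k_def)
  moreover have "(f \<zeta> / (\<zeta> - w) * of_real R * \<i> * cis \<theta> + k \<zeta> / (\<zeta> - 0) * of_real R * \<i> * cis \<theta>) / \<i>
      = f \<zeta> * of_real (poisson_kernel R w \<zeta>)" if \<zeta>: "\<zeta> = of_real R * cis \<theta>" for \<zeta> \<theta>
  proof -
    have n: "cmod \<zeta> = R" using R by (simp add: \<zeta> norm_mult)
    have z0: "\<zeta> \<noteq> 0" using n R by auto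
    have zw: "\<zeta> - w \<noteq> 0" using n w by auto
    then have zw': "cnj \<zeta> - cnj w \<noteq> 0" by (metis complex_cnj_diff complex_cnj_zero_iff)
    have RR: "complex_of_real (R\<^sup>2) = \<zeta> * cnj \<zeta>" using complex_norm_square[of \<zeta>] n by (metis of_real_power)
    have ww: "of_real ((cmod w)\<^sup>2) = w * cnj w" using complex_norm_square[of w] by simp
    have e2: "of_real (R\<^sup>2) - cnj w * \<zeta> = \<zeta> * (cnj \<zeta> - cnj w)" unfolding RR by (simp add: algebra_simps)
    have "(f \<zeta> / (\<zeta> - w) * of_real R * \<i> * cis \<theta> + k \<zeta> / (\<zeta> - 0) * of_real R * \<i> * cis \<theta>) / \<i>
       = f \<zeta> / (\<zeta> - w) * \<zeta> + k \<zeta>"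
      using z0 by (simp add: \<zeta> field_simps)
    also have "\<dots> = f \<zeta> * (\<zeta> / (\<zeta> - w) + cnj w / (cnj \<zeta> - cnj w))"
    proof -
      have "f \<zeta> * cnj w * \<zeta> / (\<zeta> * (cnj \<zeta> - cnj w)) = f \<zeta> * cnj w / (cnj \<zeta> - cnj w)"
        using z0 by (metis mult.commute mult_divide_mult_cancel_left_if)
      then show ?thesis unfolding k_def e2 by (simp add: distrib_left)
    qed
    also have "\<zeta> / (\<zeta> - w) + cnj w / (cnj \<zeta> - cnj w) = (\<zeta> * cnj \<zeta> - w * cnj w) / ((\<zeta> - w) * (cnj \<zeta> - cnj w))"
      using zw zw' by (simp add: divide_simps) (simp add: algebra_simps)
    also have "(\<zeta> - w) * (cnj \<zeta> - cnj w) = of_real ((cmod (\<zeta> - w))\<^sup>2)"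
      using complex_norm_square[of "\<zeta> - w"] by simp
    also have "(\<zeta> * cnj \<zeta> - w * cnj w) / of_real ((cmod (\<zeta> - w))\<^sup>2) = of_real (poisson_kernel R w \<zeta>)"
      unfolding poisson_kernel_def RR[symmetric] ww[symmetric] of_real_divide of_real_diff ..
    finally show ?thesis .
  qed
  ultimately show ?thesis by simp
qed

lemma poisson_formula_Re:
  assumes "f holomorphic_on ball 0 R'" "0 < R" "R < R'" "cmod w < R"
  shows "((\<lambda>\<theta>. Re (f (of_real R * cis \<theta>)) * poisson_kernel R w (of_real R * cis \<theta>))
            has_integral 2 * pi * Re (f w)) {0..2*pi}"
  using has_integral_Re[OF poisson_formula[OF assms]] by simp

lemma mean_value_Re:
  assumes "f holomorphic_on ball 0 R'" "0 < R" "R < R'"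
  shows "((\<lambda>\<theta>. Re (f (of_real R * cis \<theta>))) has_integral 2 * pi * Re (f 0)) {0..2*pi}"
  using poisson_formula_Re[OF assms, of 0] assms by (simp add: poisson_kernel_def norm_mult)

text \<open>
  The Poisson formula on circles of radius \<open>r < R\<close>, with \<open>r \<rightarrow> R\<close>.
\<close>

lemma harnack:
  assumes hol: "f holomorphic_on ball 0 R" and w: "cmod w < R"
    and pos: "\<And>z. cmod z < R \<Longrightarrow> 0 \<le> Re (f z)"
  shows "Re (f w) \<le> (R + cmod w) / (R - cmod w) * Re (f 0)"
    and "Re (f 0) \<le> (R + cmod w) / (R - cmod w) * Re (f w)"
proof -
  have *: "Re (f w) \<le> (r + cmod w) / (r - cmod w) * Re (f 0)
      \<and> Re (f 0) \<le> (r + cmod w) / (r - cmod w) * Re (f w)" if r: "cmod w < r" "r < R" for r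
  proof -
    have r0: "0 < r" using r norm_ge_zero[of w] by linarith
    note P = poisson_formula_Re[OF hol r0 r(2) r(1)]
    note M = mean_value_Re[OF hol r0 r(2)]
    have n: "cmod (of_real r * cis \<theta>) = r" for \<theta> using r0 by (simp add: norm_mult)
    have p: "0 \<le> Re (f (of_real r * cis \<theta>))" for \<theta> using pos n r by simp
    note b = poisson_kernel_bounds[OF r(1) n]
    define q where "q = (r + cmod w) / (r - cmod w)"
    have "0 < r - cmod w" "0 < r + cmod w" using r r0 by (auto intro: add_pos_nonneg)
    then have q: "0 < q" "(r - cmod w) / (r + cmod w) = 1 / q" by (auto simp: q_def)
    have "2 * pi * Re (f w) \<le> 2 * pi * Re (f 0) * q"
      by (rule has_integral_le[OF P has_integral_mult_left[OF M]])
         (use mult_left_mono[OF b(2) p] in \<open>auto simp: q_def\<close>)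
    then have 1: "Re (f w) \<le> q * Re (f 0)" by (simp add: mult.commute)
    have "2 * pi * Re (f 0) * (1 / q) \<le> 2 * pi * Re (f w)"
      by (rule has_integral_le[OF has_integral_mult_left[OF M] P])
         (use mult_left_mono[OF b(1) p] in \<open>auto simp: q(2)\<close>)
    then have "2 * pi * (Re (f 0) / q) \<le> 2 * pi * Re (f w)" by simp
    then have "Re (f 0) / q \<le> Re (f w)" by (rule mult_left_le_imp_le) simp
    then have "Re (f 0) \<le> q * Re (f w)" using q(1) by (simp add: divide_le_eq mult.commute)
    with 1 show ?thesis by (simp add: q_def)
  qed
  have ev: "\<forall>\<^sub>F r in at_left R. cmod w < r \<and> r < R"
    using eventually_at_left_real[OF w] by (auto elim: eventually_mono)
  have lim: "((\<lambda>r. (r + cmod w) / (r - cmod w) * c) \<longlongrightarrow> (R + cmod w) / (R - cmod w) * c) (at_left R)" for c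
    using w by (auto intro!: tendsto_eq_intros)
  show "Re (f w) \<le> (R + cmod w) / (R - cmod w) * Re (f 0)"
    by (rule tendsto_lowerbound[OF lim eventually_mono[OF ev]]) (use * in auto)
  show "Re (f 0) \<le> (R + cmod w) / (R - cmod w) * Re (f w)"
    by (rule tendsto_lowerbound[OF lim eventually_mono[OF ev]]) (use * in auto)
qed

text \<open>
  The Blaschke factor of the disc of radius \<open>R\<close> with zero \<open>a\<close>, of modulus one on the boundary circle.
\<close>

definition blaschke :: "real \<Rightarrow> complex \<Rightarrow> complex \<Rightarrow> complex" where
  "blaschke R a z = of_real R * (z - a) / (of_real (R\<^sup>2) - cnj a * z)"

lemma blaschke_denom_nonzero:
  assumes "0 < R" "cmod a < R" "cmod z \<le> R"
  shows "of_real (R\<^sup>2) - cnj a * z \<noteq> 0"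
proof
  assume "of_real (R\<^sup>2) - cnj a * z = 0"
  then have "cmod (of_real (R\<^sup>2)) = cmod (cnj a * z)" by (metis eq_iff_diff_eq_0)
  then have "R\<^sup>2 = cmod a * cmod z" unfolding norm_of_real by (simp add: norm_mult)
  also have "\<dots> \<le> cmod a * R" using assms by (intro mult_left_mono) auto
  also have "\<dots> < R * R" using assms by (intro mult_strict_right_mono) auto
  finally show False by (simp add: power2_eq_square)
qed

lemma blaschke_norm_sq:
  assumes "0 < R" "cmod a < R" "cmod z \<le> R"
  shows "(cmod (blaschke R a z))\<^sup>2 = 1 - (R\<^sup>2 - (cmod a)\<^sup>2) * (R\<^sup>2 - (cmod z)\<^sup>2) / (cmod (of_real (R\<^sup>2) - cnj a * z))\<^sup>2"
proof -
  have nz: "(cmod (of_real (R\<^sup>2) - cnj a * z))\<^sup>2 \<noteq> 0" using blaschke_denom_nonzero[OF assms] by simp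
  have "complex_of_real ((cmod (of_real (R\<^sup>2) - cnj a * z))\<^sup>2 - R\<^sup>2 * (cmod (z - a))\<^sup>2)
     = of_real ((R\<^sup>2 - (cmod a)\<^sup>2) * (R\<^sup>2 - (cmod z)\<^sup>2))"
    unfolding of_real_mult of_real_diff complex_norm_square
    by (simp add: algebra_simps power2_eq_square)
  then have "(cmod (of_real (R\<^sup>2) - cnj a * z))\<^sup>2 - R\<^sup>2 * (cmod (z - a))\<^sup>2 = (R\<^sup>2 - (cmod a)\<^sup>2) * (R\<^sup>2 - (cmod z)\<^sup>2)"
    using of_real_eq_iff by blast
  then show ?thesis using nz
    by (simp add: blaschke_def norm_divide norm_mult power_divide power_mult_distrib divide_simps)
qed

lemma blaschke_norm_circle:
  assumes "0 < R" "cmod a < R" "cmod z = R"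
  shows "cmod (blaschke R a z) = 1"
proof -
  have "(cmod (blaschke R a z))\<^sup>2 = 1\<^sup>2" using blaschke_norm_sq[of R a z] assms by simp
  then show ?thesis using norm_ge_zero[of "blaschke R a z"] by (auto simp: power2_eq_1_iff simp del: norm_ge_zero)
qed

text \<open>
  For given bounds of the two moduli, the factor is largest when \<open>a\<close> and \<open>z\<close> lie on opposite rays.
\<close>

lemma blaschke_norm_le:
  assumes R: "0 < R" "cmod a < R" "cmod a \<le> y" "y \<le> R" and z: "cmod z \<le> x" "x \<le> R"
  shows "cmod (blaschke R a z) \<le> R * (x + y) / (R\<^sup>2 + x * y)"
proof -
  have x0: "0 \<le> x" "0 \<le> y" using R z norm_ge_zero order_trans by blast+
  have zR: "cmod z \<le> R" using z by simp
  have pos: "0 < R\<^sup>2 + x * y" using R x0 by (intro add_pos_nonneg) auto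
  have sq: "1 - (R\<^sup>2 - y\<^sup>2) * (R\<^sup>2 - x\<^sup>2) / (R\<^sup>2 + x * y)\<^sup>2 = (R * (x + y) / (R\<^sup>2 + x * y))\<^sup>2"
    using pos by (simp add: power_divide divide_simps) (simp add: power2_eq_square algebra_simps)
  have nz: "0 < (cmod (of_real (R\<^sup>2) - cnj a * z))\<^sup>2" using blaschke_denom_nonzero[OF R(1,2) zR] by simp
  have dn: "cmod (of_real (R\<^sup>2) - cnj a * z) \<le> R\<^sup>2 + x * y"
  proof -
    have "cmod (of_real (R\<^sup>2) - cnj a * z) \<le> cmod (of_real (R\<^sup>2)) + cmod (cnj a * z)" by (rule norm_triangle_ineq4)
    also have "\<dots> = R\<^sup>2 + cmod a * cmod z" unfolding norm_of_real by (simp add: norm_mult)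
    also have "cmod a * cmod z \<le> y * x" using R z x0 by (intro mult_mono) auto
    finally show ?thesis by (simp add: mult.commute)
  qed
  have sqs: "(cmod a)\<^sup>2 \<le> y\<^sup>2" "(cmod z)\<^sup>2 \<le> x\<^sup>2" "y\<^sup>2 \<le> R\<^sup>2" "x\<^sup>2 \<le> R\<^sup>2"
    using R z x0 by (simp_all add: power_mono)
  have "(R\<^sup>2 - y\<^sup>2) * (R\<^sup>2 - x\<^sup>2) \<le> (R\<^sup>2 - (cmod a)\<^sup>2) * (R\<^sup>2 - (cmod z)\<^sup>2)"
    by (rule mult_mono) (use sqs in linarith)+
  moreover have "0 \<le> (R\<^sup>2 - (cmod a)\<^sup>2) * (R\<^sup>2 - (cmod z)\<^sup>2)"
    by (rule mult_nonneg_nonneg) (use sqs in linarith)+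
  moreover have "(cmod (of_real (R\<^sup>2) - cnj a * z))\<^sup>2 \<le> (R\<^sup>2 + x * y)\<^sup>2" by (rule power_mono[OF dn norm_ge_zero])
  ultimately have "(R\<^sup>2 - y\<^sup>2) * (R\<^sup>2 - x\<^sup>2) / (R\<^sup>2 + x * y)\<^sup>2 \<le> (R\<^sup>2 - (cmod a)\<^sup>2) * (R\<^sup>2 - (cmod z)\<^sup>2) / (cmod (of_real (R\<^sup>2) - cnj a * z))\<^sup>2"
    using nz by (intro frac_le) auto
  then have "(cmod (blaschke R a z))\<^sup>2 \<le> (R * (x + y) / (R\<^sup>2 + x * y))\<^sup>2"
    unfolding blaschke_norm_sq[OF R(1,2) zR] sq[symmetric] by simp
  then show ?thesis by (rule power2_le_imp_le) (use R x0 pos in auto)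
qed

lemma blaschke_norm_le_1:
  assumes "0 < R" "cmod a < R" "cmod z \<le> R"
  shows "cmod (blaschke R a z) \<le> 1"
proof -
  have "0 \<le> (R\<^sup>2 - (cmod a)\<^sup>2) * (R\<^sup>2 - (cmod z)\<^sup>2)"
    using assms by (auto intro!: mult_nonneg_nonneg power_mono)
  then have "(cmod (blaschke R a z))\<^sup>2 \<le> 1\<^sup>2"
    unfolding blaschke_norm_sq[OF assms] by (simp add: divide_nonneg_nonneg)
  then show ?thesis by (rule power2_le_imp_le) auto
qed

text \<open>
  For given moduli, the factor is smallest when \<open>a\<close> and \<open>z\<close> lie on the same ray.
\<close>

lemma blaschke_norm_ge:
  assumes R: "0 < R" "cmod a < R" "cmod z \<le> R"
  shows "R * \<bar>cmod z - cmod a\<bar> / (R\<^sup>2 + cmod a * cmod z) \<le> cmod (blaschke R a z)"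
proof -
  have nz: "0 < cmod (of_real (R\<^sup>2) - cnj a * z)" using blaschke_denom_nonzero[OF assms] by simp
  have dn: "cmod (of_real (R\<^sup>2) - cnj a * z) \<le> R\<^sup>2 + cmod a * cmod z"
  proof -
    have "cmod (of_real (R\<^sup>2) - cnj a * z) \<le> cmod (of_real (R\<^sup>2)) + cmod (cnj a * z)" by (rule norm_triangle_ineq4)
    also have "\<dots> = R\<^sup>2 + cmod a * cmod z" unfolding norm_of_real by (simp add: norm_mult)
    finally show ?thesis .
  qed
  have "R * \<bar>cmod z - cmod a\<bar> / (R\<^sup>2 + cmod a * cmod z) \<le> R * cmod (z - a) / cmod (of_real (R\<^sup>2) - cnj a * z)"
    using R nz dn norm_triangle_ineq3[of z a] by (intro frac_le mult_left_mono) auto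
  also have "\<dots> = cmod (blaschke R a z)" using R by (simp add: blaschke_def norm_divide norm_mult)
  finally show ?thesis .
qed

lemma blaschke_eq_0_iff:
  assumes "0 < R" "cmod a < R" "cmod z \<le> R"
  shows "blaschke R a z = 0 \<longleftrightarrow> z = a"
  using blaschke_denom_nonzero[OF assms] assms by (simp add: blaschke_def)

lemma blaschke_norm_center:
  assumes "0 < R" shows "cmod (blaschke R a 0) = cmod a / R"
  using assms by (simp add: blaschke_def norm_divide norm_mult power2_eq_square norm_minus_commute)

lemma extract_zero:
  assumes hol: "F holomorphic_on S" and S: "open S" "connected S" "a \<in> S" and nz: "\<exists>w\<in>S. F w \<noteq> 0"
  obtains H where "H holomorphic_on S" "H a \<noteq> 0" "\<And>z. z \<in> S \<Longrightarrow> F z = (z - a) ^ nat (zorder F a) * H z"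
proof -
  define n where "n = nat (zorder F a)"
  have "\<exists>r. r > 0 \<and> cball a r \<subseteq> S \<and> zor_poly F a holomorphic_on cball a r
    \<and> (\<forall>w\<in>cball a r. F w = zor_poly F a w * (w - a) ^ n \<and> zor_poly F a w \<noteq> 0)"
    unfolding n_def by (rule conjunct2[OF zorder_exist_zero[OF hol S nz]])
  then obtain r where r: "0 < r" "cball a r \<subseteq> S" "zor_poly F a holomorphic_on cball a r"
      and r4: "\<And>w. w \<in> cball a r \<Longrightarrow> F w = zor_poly F a w * (w - a) ^ n"
        "\<And>w. w \<in> cball a r \<Longrightarrow> zor_poly F a w \<noteq> 0"
    by blast
  define H where "H = (\<lambda>z. if z = a then zor_poly F a a else F z / (z - a) ^ n)"
  have eqb: "H z = zor_poly F a z" if "z \<in> ball a r" for z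
    using r4(1)[of z] that by (auto simp: H_def)
  have "H holomorphic_on ball a r"
    by (rule holomorphic_transform[OF holomorphic_on_subset[OF r(3)]]) (use eqb in auto)
  moreover have "H holomorphic_on S - {a}"
  proof (rule holomorphic_transform)
    show "(\<lambda>z. F z / (z - a) ^ n) holomorphic_on S - {a}"
      by (intro holomorphic_intros holomorphic_on_subset[OF hol]) auto
  qed (auto simp: H_def)
  ultimately have "H holomorphic_on ball a r \<union> (S - {a})"
    using S by (intro holomorphic_on_Un) auto
  moreover have "ball a r \<union> (S - {a}) = S" using r S ball_subset_cball by fastforce
  ultimately have "H holomorphic_on S" by simp
  moreover have "H a \<noteq> 0" using r(1) r4(2)[of a] by (simp add: H_def)
  moreover have "F z = (z - a) ^ nat (zorder F a) * H z" if "z \<in> S" for z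
  proof (cases "z = a")
    case True
    then show ?thesis using r4(1)[of a] r(1) by (simp add: H_def n_def mult.commute)
  qed (simp add: H_def n_def)
  ultimately show ?thesis using that by blast
qed

text \<open>
  Zeros are divided out one at a time.  What has to be seen is that dividing out the zeros in \<open>Z\<close>
  does not change the order at a further point \<open>b\<close>.
\<close>

lemma extract_zeros:
  assumes S: "open S" "connected S" and hol: "F holomorphic_on S" and nz: "\<exists>w\<in>S. F w \<noteq> 0"
    and fin: "finite Z" and Z: "Z \<subseteq> S"
  shows "\<exists>H. H holomorphic_on S \<and> (\<forall>a\<in>Z. H a \<noteq> 0) \<and>
     (\<forall>z\<in>S. F z = (\<Prod>a\<in>Z. (z - a) ^ nat (zorder F a)) * H z)"
  using fin Z
proof (induction Z)
  case empty
  then show ?case using hol by auto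
next
  case (insert b Z)
  then obtain H where H: "H holomorphic_on S" "\<And>a. a\<in>Z \<Longrightarrow> H a \<noteq> 0"
    "\<And>z. z\<in>S \<Longrightarrow> F z = (\<Prod>a\<in>Z. (z - a) ^ nat (zorder F a)) * H z" by auto
  have b: "b \<in> S" "b \<notin> Z" using insert by auto
  obtain H1 where H1: "H1 holomorphic_on S" "H1 b \<noteq> 0" "\<And>z. z \<in> S \<Longrightarrow> F z = (z - b) ^ nat (zorder F b) * H1 z"
    using extract_zero[OF hol S b(1) nz] by blast
  define n where "n = nat (zorder F b)"
  obtain w where w: "w \<in> S" "F w \<noteq> 0" using nz by blast
  have nzH: "\<exists>w\<in>S. H w \<noteq> 0" using H(3)[OF w(1)] w by auto
  obtain H2 where H2: "H2 holomorphic_on S" "H2 b \<noteq> 0" "\<And>z. z \<in> S \<Longrightarrow> H z = (z - b) ^ nat (zorder H b) * H2 z"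
    using extract_zero[OF H(1) S b(1) nzH] by blast
  define P where "P = (\<lambda>z. \<Prod>a\<in>Z. (z - a) ^ nat (zorder F a))"
  have Pb: "P b \<noteq> 0" using b insert.hyps by (auto simp: P_def)
  have Pc: "isCont P b" unfolding P_def by (intro continuous_intros)
  define m where "m = nat (zorder H b)"
  have mn: "m = n"
  proof -
    obtain e where e: "0 < e" "ball b e \<subseteq> S" using S b openE by blast
    have ev: "\<forall>\<^sub>F z in at b. (z - b) ^ n * H1 z = (z - b) ^ m * (P z * H2 z)"
    proof (rule eventually_mono[OF eventually_at_in_open[OF open_ball[of b e]]])
      show "b \<in> ball b e" using e by simp
      fix z assume "z \<in> ball b e - {b}"
      then have "z \<in> S" using e by blast
      then show "(z - b) ^ n * H1 z = (z - b) ^ m * (P z * H2 z)"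
        using H1(3)[of z] H(3)[of z] H2(3)[of z] unfolding P_def m_def n_def by (metis mult.left_commute)
    qed
    have "isCont H1 b" "isCont H2 b"
      using H1(1) H2(1) S(1) b(1) by (meson holomorphic_on_imp_continuous_on continuous_on_eq_continuous_at)+
    then have c1: "(H1 \<longlongrightarrow> H1 b) (at b)" "(H2 \<longlongrightarrow> H2 b) (at b)" "(P \<longlongrightarrow> P b) (at b)"
      using Pc by (auto intro: isContD)
    have z0: "((\<lambda>z. (z - b) ^ k) \<longlongrightarrow> 0) (at b)" if "0 < k" for k
      using that by (auto intro!: tendsto_eq_intros)
    have ne: "\<forall>\<^sub>F z in at b. z \<noteq> b" by (simp add: eventually_at_filter)
    show ?thesis
    proof (rule ccontr)
      assume "m \<noteq> n"
      then consider "m < n" | "n < m" by linarith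
      then show False
      proof cases
        case 1
        have ev1: "\<forall>\<^sub>F z in at b. P z * H2 z = (z - b) ^ (n - m) * H1 z"
          using ev ne
        proof eventually_elim
          case (elim z)
          have "(z - b) ^ n = (z - b) ^ m * (z - b) ^ (n - m)" using 1 by (simp flip: power_add)
          with elim show ?case by simp
        qed
        have "((\<lambda>z. (z - b) ^ (n - m) * H1 z) \<longlongrightarrow> 0 * H1 b) (at b)"
          by (rule tendsto_mult[OF z0 c1(1)]) (use 1 in simp)
        then have "((\<lambda>z. P z * H2 z) \<longlongrightarrow> 0 * H1 b) (at b)"
          using tendsto_cong[OF ev1] by blast
        moreover have "((\<lambda>z. P z * H2 z) \<longlongrightarrow> P b * H2 b) (at b)" by (intro tendsto_mult c1)
        ultimately have "P b * H2 b = 0" using tendsto_unique[OF trivial_limit_at] by fastforce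
        then show False using Pb H2 by simp
      next
        case 2
        have ev1: "\<forall>\<^sub>F z in at b. H1 z = (z - b) ^ (m - n) * (P z * H2 z)"
          using ev ne
        proof eventually_elim
          case (elim z)
          have "(z - b) ^ m = (z - b) ^ n * (z - b) ^ (m - n)" using 2 by (simp flip: power_add)
          with elim show ?case by simp
        qed
        have "((\<lambda>z. (z - b) ^ (m - n) * (P z * H2 z)) \<longlongrightarrow> 0 * (P b * H2 b)) (at b)"
          by (rule tendsto_mult[OF z0 tendsto_mult[OF c1(3) c1(2)]]) (use 2 in simp)
        then have "(H1 \<longlongrightarrow> 0 * (P b * H2 b)) (at b)"
          using tendsto_cong[OF ev1] by blast
        then have "H1 b = 0" using tendsto_unique[OF trivial_limit_at c1(1)] by fastforce
        then show False using H1 by simp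
      qed
    qed
  qed
  have "H2 a \<noteq> 0" if "a \<in> Z" for a
    using H(2)[OF that] H2(3)[of a] that insert.prems by auto
  then show ?case
    using H2 H(3) insert.hyps mn
    by (intro exI[of _ H2]) (auto simp: m_def n_def mult_ac)
qed

text \<open>
  The quotient \<open>G\<close> of \<open>F\<close> by the Blaschke product of its zeros.  It has no zeros inside the disc and
  the modulus of \<open>F\<close> on its boundary, so that lower and upper bounds on the boundary pass to
  the interior.
\<close>

lemma blaschke_factorization:
  assumes hol: "F holomorphic_on ball 0 R'" and R: "0 < R" "R < R'" and nz: "\<exists>w\<in>ball 0 R'. F w \<noteq> 0"
  defines "Z \<equiv> {z \<in> ball 0 R. F z = 0}"
  obtains G where "finite Z" "G holomorphic_on ball 0 R'"
    "\<And>z. cmod z < R \<Longrightarrow> G z \<noteq> 0"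
    "\<And>z. cmod z \<le> R \<Longrightarrow> F z = G z * (\<Prod>a\<in>Z. blaschke R a z ^ nat (zorder F a))"
    "\<And>z. cmod z \<le> R \<Longrightarrow> cmod (F z) \<le> cmod (G z)"
    "\<And>z. cmod z = R \<Longrightarrow> cmod (F z) = cmod (G z)"
proof -
  have fin: "finite Z"
  proof (cases "F constant_on ball 0 R'")
    case True
    then have "Z = {}" using nz R by (auto simp: constant_on_def Z_def)
    then show ?thesis by simp
  next
    case False
    have "finite {z \<in> cball 0 R. F z = 0}"
      by (rule holomorphic_compact_finite_zeros[OF hol _ _ _ _ False]) (use R in auto)
    then show ?thesis by (rule finite_subset[rotated]) (auto simp: Z_def)
  qed
  obtain H where H: "H holomorphic_on ball 0 R'" "\<And>a. a\<in>Z \<Longrightarrow> H a \<noteq> 0"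
    "\<And>z. z \<in> ball 0 R' \<Longrightarrow> F z = (\<Prod>a\<in>Z. (z - a) ^ nat (zorder F a)) * H z"
    using extract_zeros[OF open_ball connected_ball hol nz fin] R by (auto simp: Z_def subset_iff)
  define G where "G = (\<lambda>z. H z * (\<Prod>a\<in>Z. ((of_real (R\<^sup>2) - cnj a * z) / of_real R) ^ nat (zorder F a)))"
  have aR: "cmod a < R" if "a \<in> Z" for a using that by (simp add: Z_def)
  have "G holomorphic_on ball 0 R'" unfolding G_def by (intro holomorphic_intros H) (use R in auto)
  moreover have "G z \<noteq> 0" if "cmod z < R" for z
  proof -
    have "H z \<noteq> 0"
    proof
      assume "H z = 0"
      moreover from this have "z \<in> Z" using H(3)[of z] that R by (auto simp: Z_def)
      ultimately show False using H(2) by auto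
    qed
    then show ?thesis using blaschke_denom_nonzero[OF R(1) aR, of _ z] that R fin by (auto simp: G_def)
  qed
  moreover have fac: "F z = G z * (\<Prod>a\<in>Z. blaschke R a z ^ nat (zorder F a))" if "cmod z \<le> R" for z
  proof -
    have "(\<Prod>a\<in>Z. ((of_real (R\<^sup>2) - cnj a * z) / of_real R) ^ nat (zorder F a)) * (\<Prod>a\<in>Z. blaschke R a z ^ nat (zorder F a))
      = (\<Prod>a\<in>Z. (z - a) ^ nat (zorder F a))"
      unfolding prod.distrib[symmetric] power_mult_distrib[symmetric]
    proof (rule prod.cong[OF refl])
      fix a assume "a \<in> Z"
      then show "((of_real (R\<^sup>2) - cnj a * z) / of_real R * blaschke R a z) ^ nat (zorder F a) = (z - a) ^ nat (zorder F a)"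
        using blaschke_denom_nonzero[OF R(1) aR that, of a] R by (simp add: blaschke_def)
    qed
    then show ?thesis using H(3)[of z] that R by (simp add: G_def mult_ac)
  qed
  moreover have "cmod (F z) \<le> cmod (G z)" if "cmod z \<le> R" for z
  proof -
    have "cmod (\<Prod>a\<in>Z. blaschke R a z ^ nat (zorder F a)) \<le> 1"
      unfolding prod_norm[symmetric] norm_power
      using blaschke_norm_le_1[OF R(1) aR that] by (intro prod_le_1) (auto intro: power_le_one)
    then show ?thesis using fac[OF that] by (simp add: norm_mult mult_left_le)
  qed
  moreover have "cmod (F z) = cmod (G z)" if "cmod z = R" for z
  proof -
    have "cmod (\<Prod>a\<in>Z. blaschke R a z ^ nat (zorder F a)) = 1"
      unfolding prod_norm[symmetric] norm_power
      using blaschke_norm_circle[OF R(1) aR that] by (intro prod.neutral) auto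
    then show ?thesis using fac[of z] that by (simp add: norm_mult)
  qed
  ultimately show ?thesis using fin that by blast
qed

section \<open>A circle on which a bounded function is not small\<close>

definition forward_diff :: "real \<Rightarrow> real poly \<Rightarrow> real poly" where
  "forward_diff d p = pcompose p [:d, 1:] - p"

lemma poly_forward_diff: "poly (forward_diff d p) x = poly p (x + d) - poly p x"
  by (simp add: forward_diff_def poly_pcompose add.commute)

text \<open>
  Taking the two leading coefficients of \<open>p (x + d)\<close> together makes the induction work; they show that a forward
  difference lowers the degree by one and multiplies the leading coefficient by the degree times \<open>d\<close>.
\<close>

lemma coeff_pcompose_shift:
  fixes p :: "real poly" and d :: real
  shows "degree p \<le> n \<Longrightarrow> coeff (pcompose p [:d, 1:]) n = coeff p n \<and>
     (0 < n \<longrightarrow> coeff (pcompose p [:d, 1:]) (n - 1) = coeff p (n - 1) + n * d * coeff p n)"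
proof (induction p arbitrary: n)
  case 0
  then show ?case by simp
next
  case (pCons a p)
  have T: "pcompose (pCons a p) [:d, 1:] = [:a:] + (smult d (pcompose p [:d, 1:]) + pCons 0 (pcompose p [:d, 1:]))"
    by (simp add: pcompose_pCons)
  show ?case
  proof (cases "p = 0")
    case True
    then show ?thesis by (auto simp: coeff_pCons split: nat.split)
  next
    case False
    then obtain k where k: "n = Suc k" "degree p \<le> k" using pCons.prems by (cases n) auto
    note IH = pCons.IH[OF k(2)]
    have z: "coeff (pcompose p [:d, 1:]) n = 0" "coeff p n = 0"
      using k degree_pcompose[of p "[:d, 1:]"] by (auto intro!: coeff_eq_0)
    show ?thesis
      using IH z k unfolding T
      by (cases k) (auto simp: coeff_pCons algebra_simps split: nat.splits)
  qed
qed

lemma degree_forward_diff: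
  fixes p :: "real poly" and d :: real
  assumes "degree p \<le> Suc m"
  shows "degree (forward_diff d p) \<le> m" "coeff (forward_diff d p) m = Suc m * d * coeff p (Suc m)"
proof -
  have "coeff (forward_diff d p) k = 0" if "m < k" for k
    using coeff_pcompose_shift[of p k d] that assms by (simp add: forward_diff_def)
  then show "degree (forward_diff d p) \<le> m" by (intro degree_le) auto
  show "coeff (forward_diff d p) m = Suc m * d * coeff p (Suc m)"
    using coeff_pcompose_shift[OF assms, of d] by (simp add: forward_diff_def)
qed

text \<open>
  The \<open>m\<close>-th difference of a polynomial of degree \<open>m\<close> is the constant \<open>coeff p m * fact m * d ^ m\<close>, and it
  is a combination of \<open>m + 1\<close> values with coefficients whose moduli add up to \<open>2 ^ m\<close>.
\<close>

lemma poly_finite_difference_bound: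
  fixes p :: "real poly" and d :: real
  assumes "degree p \<le> m" and "\<And>j::nat. j \<le> m \<Longrightarrow> \<bar>poly p (x + j * d)\<bar> \<le> B"
  shows "\<bar>coeff p m * fact m * d ^ m\<bar> \<le> 2 ^ m * B"
  using assms
proof (induction m arbitrary: p B)
  case 0
  then obtain a where a: "p = [:a:]" using degree_eq_zeroE by (metis le_zero_eq)
  have "\<bar>poly p (x + (0::nat) * d)\<bar> \<le> B" by (rule 0) simp
  then show ?case by (simp add: a)
next
  case (Suc m)
  have "\<bar>coeff (forward_diff d p) m * fact m * d ^ m\<bar> \<le> 2 ^ m * (2 * B)"
  proof (rule Suc.IH[OF degree_forward_diff(1)[OF Suc.prems(1)]])
    fix j assume j: "j \<le> m"
    have eq: "x + j * d + d = x + Suc j * d" by (simp add: algebra_simps)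
    have "Suc j \<le> Suc m" using j by simp
    then have "\<bar>poly p (x + j * d + d)\<bar> \<le> B" unfolding eq by (rule Suc.prems(2))
    moreover have "\<bar>poly p (x + j * d)\<bar> \<le> B" using j by (intro Suc.prems(2)) simp
    ultimately show "\<bar>poly (forward_diff d p) (x + j * d)\<bar> \<le> 2 * B"
      unfolding poly_forward_diff by linarith
  qed
  moreover have "coeff (forward_diff d p) m * fact m * d ^ m = coeff p (Suc m) * fact (Suc m) * d ^ Suc m"
    by (simp add: degree_forward_diff(2)[OF Suc.prems(1)])
  ultimately show ?case by simp
qed

lemma power_div_fact_le_exp:
  assumes "0 \<le> (x::real)" shows "x ^ m / fact m \<le> exp x"
proof -
  have s: "(\<lambda>n. x ^ n / fact n) sums exp x" using exp_converges[of x] by (simp add: field_simps)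
  have "sum (\<lambda>n. x ^ n / fact n) {m} \<le> (\<Sum>n. x ^ n / fact n)"
    by (rule sum_le_suminf[OF sums_summable[OF s]]) (use assms in auto)
  then show ?thesis using sums_unique[OF s] by simp
qed

text \<open>
  A weak form of Chebyshev's theorem: differences at \<open>m + 1\<close> equidistant points, together with
  \<open>m ^ m \<le> exp m * fact m\<close>.
\<close>

lemma monic_poly_large_on_interval:
  fixes p :: "real poly"
  assumes "coeff p (degree p) = 1" and l: "0 < l"
  shows "\<exists>x\<in>{c..c+l}. (l / (2 * exp 1)) ^ degree p \<le> \<bar>poly p x\<bar>"
proof (cases "degree p = 0")
  case True
  then obtain a where "p = [:a:]" by (metis degree_eq_zeroE)
  then show ?thesis using assms by (intro bexI[of _ c]) auto
next
  case False
  define m where "m = degree p"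
  have m: "0 < m" using False by (simp add: m_def)
  show ?thesis
  proof (rule ccontr)
    assume n: "\<not> ?thesis"
    define xs where "xs = (\<lambda>j::nat. c + j * (l / m)) ` {..m}"
    define B where "B = Max ((\<lambda>x. \<bar>poly p x\<bar>) ` xs)"
    have xs: "x \<in> {c..c+l}" if xx: "x \<in> xs" for x
    proof -
      obtain j where j: "x = c + real j * (l / m)" "j \<le> m" using xx unfolding xs_def by blast
      have "real j * (l / m) \<le> real m * (l / m)" using j l by (intro mult_right_mono) auto
      then show ?thesis using j l m by auto
    qed
    have fx: "finite xs" "xs \<noteq> {}" by (auto simp: xs_def)
    have "B \<in> (\<lambda>x. \<bar>poly p x\<bar>) ` xs" unfolding B_def using fx by (intro Max_in) auto
    then have Bl: "B < (l / (2 * exp 1)) ^ m" using n xs by (force simp: m_def)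
    have "\<bar>coeff p m * fact m * (l / m) ^ m\<bar> \<le> 2 ^ m * B"
    proof (rule poly_finite_difference_bound)
      show "\<bar>poly p (c + j * (l / m))\<bar> \<le> B" if "j \<le> m" for j :: nat
        unfolding B_def using fx that by (intro Max_ge) (auto simp: xs_def)
    qed (simp add: m_def)
    also have "\<dots> < 2 ^ m * (l / (2 * exp 1)) ^ m" using Bl by simp
    also have "\<dots> = l ^ m / exp m" by (simp add: power_mult_distrib power_divide flip: exp_of_nat_mult)
    finally have "fact m * (l / m) ^ m < l ^ m / exp m" using assms l by (simp add: m_def)
    then have "fact m * exp m < real m ^ m" using l m by (simp add: power_divide field_simps)
    then show False using power_div_fact_le_exp[of m m] by (simp add: field_simps)
  qed
qed

lemma prod_dist_large_on_interval:
  fixes r :: "'a \<Rightarrow> real" and n :: "'a \<Rightarrow> nat"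
  assumes Z: "finite Z" and l: "0 < l"
  shows "\<exists>x\<in>{c..c+l}. (l / (2 * exp 1)) ^ sum n Z \<le> (\<Prod>a\<in>Z. \<bar>x - r a\<bar> ^ n a)"
proof -
  define p where "p = (\<Prod>a\<in>Z. [:- r a, 1:] ^ n a)"
  have deg: "degree p = sum n Z"
    unfolding p_def using Z by (subst degree_prod_eq_sum_degree) (auto simp: degree_power_eq)
  have lc: "coeff p (degree p) = 1"
    unfolding p_def lead_coeff_prod lead_coeff_power by simp
  have "\<bar>poly p x\<bar> = (\<Prod>a\<in>Z. \<bar>x - r a\<bar> ^ n a)" for x
    by (simp add: p_def poly_prod abs_prod power_abs)
  then show ?thesis using monic_poly_large_on_interval[OF lc l, of c] deg by simp
qed

text \<open>
  Factor \<open>F\<close> into the Blaschke product, for the disc of radius \<open>R\<close> between \<open>u\<close> and \<open>u\<^sup>2\<close>, of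
  its zeros in the disc of radius \<open>u\<close>, and a function \<open>G'\<close> that has no zeros there and is still bounded by
  \<open>K\<close>.  Then \<open>ln (K / cmod (G' z))\<close> is a nonnegative real part, and two applications of Harnack's
  inequality carry its bound \<open>ln (K / c)\<close> from the point \<open>w\<close> over the centre to the unit disc: this is the first
  summand of \<open>X\<close>.  Each Blaschke factor is at most \<open>1 - (u - 1)\<^sup>2 / (2 * u\<^sup>2)\<close> at \<open>w\<close>, which limits the
  number of zeros to a multiple of \<open>ln (K / c)\<close>.  On the circle of radius \<open>\<rho>\<close>, the Blaschke product is bounded below by a multiple of a
  monic polynomial in \<open>\<rho>\<close> of that degree, which is not small for all \<open>\<rho>\<close> in an interval: this is
  the second summand.
\<close>

lemma lower_bound_on_circle:
  fixes u K c :: real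
  assumes u: "1 < u" "u \<le> 3" and hol: "F holomorphic_on ball 0 (u\<^sup>2)"
    and K: "\<And>z. cmod z < u\<^sup>2 \<Longrightarrow> cmod (F z) \<le> K"
    and c: "0 < c" "c \<le> cmod (F w)" and w: "cmod w \<le> 1 / u\<^sup>2"
  defines "X \<equiv> ((u + 1) / (u - 1))\<^sup>2 + 2 * u\<^sup>2 / (u - 1)\<^sup>2 * ln (336 * exp 1 / (u - 1))"
  shows "\<exists>\<rho>. 1 - (u - 1) / (4 * u) \<le> \<rho> \<and> \<rho> \<le> 1 - (u - 1) / (8 * u) \<and>
    (\<forall>z. cmod z = \<rho> \<longrightarrow> K * exp (- X * ln (K / c)) \<le> cmod (F z))"
proof -
  define E where "E = u - 1"
  define L where "L = ln (K / c)"
  \<comment> \<open>The zeros inside radius \<open>u\<close> have to stay away from the circle that carries the Blaschke factors.\<close>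
  define R where "R = (u + u\<^sup>2) / 2"
  have E: "0 < E" "E \<le> 2" using u by (auto simp: E_def)
  have uu: "u < u\<^sup>2" using u by (simp add: power2_eq_square)
  have R: "u < R" "R < u\<^sup>2" "0 < R" using uu u by (auto simp: R_def)
  have w1: "cmod w \<le> 1"
    using w u by (smt (verit, best) divide_le_eq_1 one_le_power)
  have wR: "cmod w < u" using w1 u by simp
  have Kc: "c \<le> K" using K[of w] c uu wR by simp
  have L0: "0 \<le> L" using Kc c by (simp add: L_def)
  have K0: "0 < K" using Kc c by simp
  have nz: "\<exists>w\<in>ball 0 (u\<^sup>2). F w \<noteq> 0" using c wR uu by (intro bexI[of _ w]) auto
  define Z where "Z = {z \<in> ball 0 R. F z = 0}"
  define n where "n = (\<lambda>a. nat (zorder F a))"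
  obtain G where G0: "finite {z \<in> ball 0 R. F z = 0}" "G holomorphic_on ball 0 (u\<^sup>2)"
    "\<And>z. cmod z < R \<Longrightarrow> G z \<noteq> 0"
    "\<And>z. cmod z \<le> R \<Longrightarrow> F z = G z * (\<Prod>a\<in>{z \<in> ball 0 R. F z = 0}. blaschke R a z ^ nat (zorder F a))"
    "\<And>z. cmod z \<le> R \<Longrightarrow> cmod (F z) \<le> cmod (G z)"
    "\<And>z. cmod z = R \<Longrightarrow> cmod (F z) = cmod (G z)"
    by (rule blaschke_factorization[OF hol R(3,2) nz]) (rule that; assumption)
  note fin = G0(1)[folded Z_def] and G = G0(2,3) and G2 = G0(6)
  have fac: "F z = G z * (\<Prod>a\<in>Z. blaschke R a z ^ n a)" if "cmod z \<le> R" for z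
    using G0(4)[OF that] by (simp add: Z_def n_def)
  define Z1 where "Z1 = {a\<in>Z. cmod a < u}"
  have Z1: "finite Z1" "Z1 \<subseteq> Z" using fin by (auto simp: Z1_def)
  have aR: "cmod a < R" if "a \<in> Z" for a using that by (simp add: Z_def)
  define P where "P = (\<lambda>A z. \<Prod>a\<in>A. blaschke R a z ^ n a)"
  have Pn: "cmod (P A z) = (\<Prod>a\<in>A. cmod (blaschke R a z) ^ n a)" for A z
    by (simp add: P_def flip: prod_norm norm_power)
  have P1: "cmod (P A z) \<le> 1" if "A \<subseteq> Z" "cmod z \<le> R" for A z
    unfolding Pn using blaschke_norm_le_1[OF R(3) aR that(2)] that(1)
    by (intro prod_le_1) (auto intro!: power_le_one)
  define G' where "G' = (\<lambda>z. G z * P (Z - Z1) z)"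
  have fac': "F z = G' z * P Z1 z" if "cmod z \<le> R" for z
    using fac[OF that] prod.subset_diff[OF Z1(2) fin, of "\<lambda>a. blaschke R a z ^ n a"]
    by (simp add: G'_def P_def mult_ac)
  have holP: "P A holomorphic_on ball 0 R" if "A \<subseteq> Z" for A
  proof -
    have "of_real (R\<^sup>2) - cnj a * z \<noteq> 0" if "a \<in> A" "z \<in> ball 0 R" for a z
      using blaschke_denom_nonzero[OF R(3) aR[of a], of z] that \<open>A \<subseteq> Z\<close> by (simp add: subset_iff)
    then show ?thesis unfolding P_def blaschke_def by (intro holomorphic_intros) auto
  qed
  have holG: "G holomorphic_on ball 0 R" using G(1) by (rule holomorphic_on_subset) (use R in auto)
  have holG': "G' holomorphic_on ball 0 u"
    unfolding G'_def by (intro holomorphic_intros holomorphic_on_subset[OF holG] holomorphic_on_subset[OF holP]) (use R in auto)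
  have GK: "cmod (G z) \<le> K" if z: "cmod z \<le> R" for z
  proof (rule maximum_modulus_frontier[of G "cball 0 R"])
    show "G holomorphic_on interior (cball 0 R)" using holG by simp
    show "continuous_on (closure (cball 0 R)) G"
      using holomorphic_on_imp_continuous_on[OF G(1)] R by (auto elim!: continuous_on_subset)
    show "cmod (G z) \<le> K" if "z \<in> frontier (cball 0 R)" for z
      using that G2[of z] K[of z] R by auto
  qed (use z in auto)
  have G'K: "cmod (G' z) \<le> K" if "cmod z \<le> R" for z
  proof -
    have "cmod (G z) * cmod (P (Z - Z1) z) \<le> K * 1"
      using GK[OF that] P1[of "Z - Z1" z] that K0 by (intro mult_mono) auto
    then show ?thesis by (simp add: G'_def norm_mult)
  qed
  have G'0: "G' z \<noteq> 0" if "cmod z < u" for z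
  proof -
    have "blaschke R a z \<noteq> 0" if "a \<in> Z - Z1" for a
      using blaschke_eq_0_iff[of R a z] aR[of a] that \<open>cmod z < u\<close> R by (auto simp: Z1_def)
    then show ?thesis using G(2)[of z] that R fin by (auto simp: G'_def P_def)
  qed
  obtain g where g: "g holomorphic_on ball 0 u" "\<And>z. z \<in> ball 0 u \<Longrightarrow> G' z = exp (g z)"
    using contractible_imp_holomorphic_log[OF holG' convex_imp_contractible[OF convex_ball]] G'0
    by auto
  define v where "v = (\<lambda>z. of_real (ln K) - g z)"
  have vG: "Re (v z) = ln K - ln (cmod (G' z))" if "cmod z < u" for z
    using g(2)[of z] that by (simp add: v_def)
  have v0: "0 \<le> Re (v z)" if "cmod z < u" for z
    using G'K[of z] G'0[OF that] that R K0 vG[OF that] by simp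
  have holv: "v holomorphic_on ball 0 u" unfolding v_def by (intro holomorphic_intros g)
  have Fw: "cmod (F w) = cmod (G' w) * cmod (P Z1 w)" using fac'[of w] wR R by (simp add: norm_mult)
  have cG: "c \<le> cmod (G' w)"
    using c(2) P1[of Z1 w] wR R Z1 mult_left_le[of "cmod (P Z1 w)" "cmod (G' w)"] unfolding Fw by simp
  have vw: "Re (v w) \<le> L"
    using cG c K0 ln_le_cancel_iff[of c "cmod (G' w)"] G'0[OF wR] vG[OF wR] unfolding L_def by (simp add: ln_div)
  have q: "(u + x) / (u - x) \<le> (u + 1) / E" if "0 \<le> x" "x \<le> 1" for x
    unfolding E_def using that u by (intro frac_le) auto
  have q0: "0 \<le> (u + 1) / E" using u E by simp
  have "Re (v 0) \<le> (u + cmod w) / (u - cmod w) * Re (v w)" by (rule harnack(2)[OF holv wR v0])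
  also have "\<dots> \<le> (u + 1) / E * L"
    using q[of "cmod w"] w1 vw v0[OF wR] q0 by (intro mult_mono) auto
  finally have v00: "Re (v 0) \<le> (u + 1) / E * L" .
  have vz: "Re (v z) \<le> ((u + 1) / E)\<^sup>2 * L" if "cmod z \<le> 1" for z
  proof -
    have "Re (v z) \<le> (u + cmod z) / (u - cmod z) * Re (v 0)" by (rule harnack(1)[OF holv _ v0]) (use that u in auto)
    also have "\<dots> \<le> (u + 1) / E * ((u + 1) / E * L)"
      using q[of "cmod z"] that v00 v0[of 0] q0 u by (intro mult_mono) auto
    also have "\<dots> = ((u + 1) / E)\<^sup>2 * L" by (simp add: power2_eq_square)
    finally show ?thesis .
  qed
  have G'low: "K * exp (- ((u + 1) / E)\<^sup>2 * L) \<le> cmod (G' z)" if "cmod z \<le> 1" for z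
  proof -
    have zu: "cmod z < u" using that u by simp
    have "ln K - ((u + 1) / E)\<^sup>2 * L \<le> ln (cmod (G' z))" using vz[OF that] vG[OF zu] by simp
    then have "exp (ln K - ((u + 1) / E)\<^sup>2 * L) \<le> exp (ln (cmod (G' z)))" by simp
    then show ?thesis using K0 G'0[OF zu] by (simp add: exp_diff exp_minus field_simps)
  qed
  define m where "m = sum n Z1"
  have mL: "real m \<le> 2 * u\<^sup>2 / E\<^sup>2 * L"
  proof -
    define b where "b = R * (1 / u\<^sup>2 + u) / (R\<^sup>2 + 1 / u\<^sup>2 * u)"
    have b0: "0 \<le> b" using u R by (auto simp: b_def)
    have "1 / u\<^sup>2 \<le> 1" using u by (simp add: one_le_power)
    then have iR: "1 / u\<^sup>2 \<le> R" using u R by linarith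
    have "cmod (P Z1 w) \<le> (\<Prod>a\<in>Z1. b ^ n a)"
      unfolding Pn b_def using iR Z1 aR w wR R u
      by (intro prod_mono conjI power_mono blaschke_norm_le zero_le_power) (auto simp: Z1_def less_imp_le intro: order_trans[OF w] )
    also have "\<dots> = b ^ m" by (simp add: m_def power_sum)
    finally have Pb: "cmod (P Z1 w) \<le> b ^ m" .
    have "E\<^sup>2 / (2 * u\<^sup>2) \<le> 1 - b"
    proof -
      have "1 - b = (R - 1 / u\<^sup>2) * (R - u) / (R\<^sup>2 + 1 / u\<^sup>2 * u)"
      proof -
        have expand: "(R - i) * (R - u) = (R\<^sup>2 + i * u) - R * (i + u)" for i
          by (simp add: algebra_simps power2_eq_square)
        have D: "R\<^sup>2 + 1 / u\<^sup>2 * u \<noteq> 0" using u R by (intro less_imp_neq[symmetric] add_pos_pos) auto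
        have "(R - 1 / u\<^sup>2) * (R - u) = (R\<^sup>2 + 1 / u\<^sup>2 * u) - R * (1 / u\<^sup>2 + u)"
          using expand[of "1 / u\<^sup>2"] .
        then show ?thesis using D by (simp add: b_def diff_divide_distrib)
      qed
      moreover have "E\<^sup>2 / (2 * u\<^sup>2) = (1 - 1 / u\<^sup>2) / 2 * (E / (u + 1))"
      proof -
        have "1 - 1 / u\<^sup>2 = E * (u + 1) / u\<^sup>2" using u by (simp add: E_def field_simps power2_eq_square)
        then show ?thesis using u by (simp add: power2_eq_square)
      qed
      moreover have "E / (u + 1) = (R - u) / R"
      proof -
        have eqs: "R = u * (u + 1) / 2" "R - u = u * E / 2" by (simp_all add: E_def R_def field_simps power2_eq_square)
        have "E / (u + 1) = (u * E / 2) / (u * (u + 1) / 2)" using u by simp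
        then show ?thesis unfolding eqs(2) by (simp only: eqs(1))
      qed
      moreover have "(1 - 1 / u\<^sup>2) / 2 * ((R - u) / R) \<le> (R - 1 / u\<^sup>2) * (R - u) / (R\<^sup>2 + 1 / u\<^sup>2 * u)"
      proof -
        have i: "1 / u\<^sup>2 < 1" using u by (simp add: power_gt1)
        have le2: "R\<^sup>2 + 1 / u\<^sup>2 * u \<le> 2 * R\<^sup>2"
        proof -
          have "1 / u\<^sup>2 * u \<le> 1" using u by (simp add: power2_eq_square field_simps)
          also have "1 \<le> R\<^sup>2" using R u by (intro one_le_power) auto
          finally show ?thesis by simp
        qed
        have "(R - R / u\<^sup>2) * (R - u) / (2 * R\<^sup>2) \<le> (R - 1 / u\<^sup>2) * (R - u) / (R\<^sup>2 + 1 / u\<^sup>2 * u)"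
        proof (rule frac_le)
          have j: "1 / u\<^sup>2 \<le> R / u\<^sup>2" using R u by (intro divide_right_mono) auto
          then show "(R - R / u\<^sup>2) * (R - u) \<le> (R - 1 / u\<^sup>2) * (R - u)" using R by (intro mult_right_mono) auto
          show "0 \<le> (R - 1 / u\<^sup>2) * (R - u)" using R iR by (intro mult_nonneg_nonneg) auto
          show "0 < R\<^sup>2 + 1 / u\<^sup>2 * u" using R u by (intro add_pos_pos) auto
          show "R\<^sup>2 + 1 / u\<^sup>2 * u \<le> 2 * R\<^sup>2" by (rule le2)
        qed
        moreover have "(1 - 1 / u\<^sup>2) / 2 * ((R - u) / R) = (R - R / u\<^sup>2) * (R - u) / (2 * R\<^sup>2)"
          using R u by (simp add: field_simps power2_eq_square)
        ultimately show ?thesis by simp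
      qed
      ultimately show ?thesis by simp
    qed
    then have "b \<le> 1 - E\<^sup>2 / (2 * u\<^sup>2)" by simp
    also have "\<dots> \<le> exp (- (E\<^sup>2 / (2 * u\<^sup>2)))" using exp_ge_add_one_self[of "- (E\<^sup>2 / (2 * u\<^sup>2))"] by simp
    finally have bm: "b ^ m \<le> exp (- (E\<^sup>2 / (2 * u\<^sup>2))) ^ m" using b0 by (intro power_mono)
    have "c \<le> cmod (G' w) * cmod (P Z1 w)" using c(2) Fw by simp
    also have "\<dots> \<le> K * exp (- (E\<^sup>2 / (2 * u\<^sup>2))) ^ m"
      using G'K[of w] wR R K0 Pb bm by (intro mult_mono) auto
    also have "\<dots> = K * exp (- (m * (E\<^sup>2 / (2 * u\<^sup>2))))" by (simp flip: exp_of_nat_mult)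
    finally have "ln c \<le> ln (K * exp (- (m * (E\<^sup>2 / (2 * u\<^sup>2)))))" using c K0 by simp
    then have "m * (E\<^sup>2 / (2 * u\<^sup>2)) \<le> L" using K0 c by (simp add: ln_mult L_def ln_div)
    then show ?thesis using E u by (simp add: field_simps)
  qed
  \<comment> \<open>Radii between \<open>1 - 2 * l\<close> and \<open>1 - l\<close> are admissible.\<close>
  define l where "l = E / (8 * u)"
  have l0: "0 < l" using E u by (simp add: l_def)
  obtain \<rho> where \<rho>: "\<rho> \<in> {1 - 2 * l..1 - 2 * l + l}" "(l / (2 * exp 1)) ^ m \<le> (\<Prod>a\<in>Z1. \<bar>\<rho> - cmod a\<bar> ^ n a)"
    using prod_dist_large_on_interval[OF Z1(1) l0, of "1 - 2 * l" n cmod] unfolding m_def by blast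
  have \<rho>1: "\<rho> \<le> 1" using \<rho>(1) l0 by simp
  have "l \<le> 1/8" using u E by (simp add: l_def E_def field_simps)
  then have \<rho>0: "0 < \<rho>" using \<rho>(1) by simp
  define H where "H = ln (336 * exp 1 / E)"
  have H0: "0 \<le> H"
  proof -
    have "2 \<le> exp (1::real)" using exp_ge_add_one_self[of 1] by simp
    then have "1 \<le> 336 * exp 1 / E" using E by (simp add: field_simps)
    then show ?thesis by (simp add: H_def)
  qed
  have "K * exp (- X * L) \<le> cmod (F z)" if z: "cmod z = \<rho>" for z
  proof -
    have zR: "cmod z \<le> R" using z \<rho>1 u R by simp
    have bl: "\<bar>\<rho> - cmod a\<bar> / (R + 1) \<le> cmod (blaschke R a z)" if a: "a \<in> Z1" for a
    proof -
      have "cmod a * cmod z \<le> u * 1" using a z \<rho>1 \<rho>0 u by (intro mult_mono) (auto simp: Z1_def)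
      then have le: "R\<^sup>2 + cmod a * cmod z \<le> R * (R + 1)" using R by (simp add: power2_eq_square algebra_simps)
      have "\<bar>\<rho> - cmod a\<bar> / (R + 1) = R * \<bar>\<rho> - cmod a\<bar> / (R * (R + 1))" using R by simp
      also have "\<dots> \<le> R * \<bar>cmod z - cmod a\<bar> / (R\<^sup>2 + cmod a * cmod z)"
        unfolding z[symmetric] using R by (intro divide_left_mono le mult_pos_pos add_pos_nonneg) auto
      also have "\<dots> \<le> cmod (blaschke R a z)" using a Z1 aR zR R by (intro blaschke_norm_ge) auto
      finally show ?thesis .
    qed
    have "exp (- (m * H)) = (E / (336 * exp 1)) ^ m"
    proof -
      have "exp (- H) = E / (336 * exp 1)" using E by (simp add: H_def exp_minus)
      then show ?thesis using exp_of_nat_mult[of m "- H"] by simp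
    qed
    also have "\<dots> \<le> (l / (2 * exp 1) / (R + 1)) ^ m"
    proof (rule power_mono)
      have "u * (R + 1) \<le> 3 * 7"
      proof (rule mult_mono)
        have "u\<^sup>2 \<le> 3\<^sup>2" using u by (intro power_mono) auto
        then show "R + 1 \<le> 7" using u by (simp add: R_def)
      qed (use u R in auto)
      then have "E / (336 * exp 1) \<le> E / (16 * exp 1 * (u * (R + 1)))"
        using E u R by (intro divide_left_mono) (auto intro!: mult_pos_pos)
      also have "\<dots> = l / (2 * exp 1) / (R + 1)" by (simp add: l_def)
      finally show "E / (336 * exp 1) \<le> l / (2 * exp 1) / (R + 1)" .
    qed (use E in auto)
    also have "\<dots> = (l / (2 * exp 1)) ^ m / (R + 1) ^ m" by (rule power_divide)
    also have "\<dots> \<le> (\<Prod>a\<in>Z1. \<bar>\<rho> - cmod a\<bar> ^ n a) / (R + 1) ^ m"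
      using \<rho>(2) R by (intro divide_right_mono) auto
    also have "\<dots> = (\<Prod>a\<in>Z1. (\<bar>\<rho> - cmod a\<bar> / (R + 1)) ^ n a)"
      by (simp add: power_divide prod_dividef m_def power_sum)
    also have "\<dots> \<le> cmod (P Z1 z)"
      unfolding Pn using bl R by (intro prod_mono conjI power_mono zero_le_power) auto
    finally have PH: "exp (- (m * H)) \<le> cmod (P Z1 z)" .
    have "m * H \<le> 2 * u\<^sup>2 / E\<^sup>2 * L * H" using mL H0 by (rule mult_right_mono)
    then have "exp (- (2 * u\<^sup>2 / E\<^sup>2 * L * H)) \<le> cmod (P Z1 z)" using PH by (smt (verit) exp_le_cancel_iff)
    then have "K * exp (- ((u + 1) / E)\<^sup>2 * L) * exp (- (2 * u\<^sup>2 / E\<^sup>2 * L * H)) \<le> cmod (G' z) * cmod (P Z1 z)"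
      using G'low[of z] z \<rho>1 K0 by (intro mult_mono) auto
    also have "\<dots> = cmod (F z)" using fac'[OF zR] by (simp add: norm_mult)
    also have "K * exp (- ((u + 1) / E)\<^sup>2 * L) * exp (- (2 * u\<^sup>2 / E\<^sup>2 * L * H)) = K * exp (- X * L)"
      by (simp add: X_def E_def H_def mult_ac ring_distribs flip: exp_add)
    finally show ?thesis .
  qed
  moreover have "(u - 1) / (4 * u) = 2 * l" "(u - 1) / (8 * u) = l" using u by (simp_all add: l_def E_def field_simps)
  ultimately show ?thesis using \<rho>(1) by (intro exI[of _ \<rho>]) (auto simp: L_def)
qed

section \<open>Division by a function with given zeros\<close>

text \<open>
  The maximum principle for \<open>\<phi> / F\<close>, which is bounded near the zeros of \<open>F\<close> but undefined at them.
  Rather than to remove these singularities, multiply the power \<open>(\<phi> / F) ^ N\<close> by a Blaschke product \<open>b\<close> of the zeros: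
  the result extends continuously by zero, is bounded by \<open>A ^ N\<close> on the boundary circle, and
  \<open>N \<rightarrow> \<infinity>\<close> eliminates \<open>b\<close>.
\<close>

lemma maximum_principle_quotient:
  assumes \<phi>: "\<phi> holomorphic_on ball 0 R'" and F: "F holomorphic_on ball 0 R'" and R: "0 < R" "R < R'"
    and circ: "\<And>z. cmod z = R \<Longrightarrow> F z \<noteq> 0" "\<And>z. cmod z = R \<Longrightarrow> cmod (\<phi> z) \<le> A * cmod (F z)"
    and dom: "\<And>a. cmod a < R \<Longrightarrow> F a = 0 \<Longrightarrow> \<exists>C d. 0 < d \<and> (\<forall>z\<in>ball a d. cmod (\<phi> z) \<le> C * cmod (F z))"
    and z: "cmod z \<le> R"
  shows "cmod (\<phi> z) \<le> A * cmod (F z)"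
proof -
  have A0: "0 \<le> A"
  proof -
    have "0 \<le> A * cmod (F (of_real R))" using circ(2)[of "of_real R"] R norm_ge_zero order_trans
      by (smt (verit) norm_of_real)
    moreover have "0 < cmod (F (of_real R))" using circ(1)[of "of_real R"] R by simp
    ultimately show ?thesis by (simp add: zero_le_mult_iff)
  qed
  define Z where "Z = {z \<in> cball 0 R. F z = 0}"
  have nzF: "\<exists>w\<in>ball 0 R'. F w \<noteq> 0" using circ(1)[of "of_real R"] R by (intro bexI[of _ "of_real R"]) auto
  have fin: "finite Z"
  proof (cases "F constant_on ball 0 R'")
    case True
    then have "Z = {}" using nzF R by (auto simp: constant_on_def Z_def)
    then show ?thesis by simp
  next
    case False
    show ?thesis unfolding Z_def
      by (rule holomorphic_compact_finite_zeros[OF F _ _ _ _ False]) (use R in auto)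
  qed
  have Zi: "cmod a < R" if "a \<in> Z" for a using that circ(1)[of a] by (force simp: Z_def)
  define b where "b = (\<lambda>z. \<Prod>a\<in>Z. blaschke R a z)"
  define k where "k = (\<lambda>z. \<phi> z / F z)"
  have main: "cmod (k w) ^ N * cmod (b w) \<le> A ^ N" if w: "cmod w \<le> R" "w \<notin> Z" for w N
  proof -
    define K where "K = (\<lambda>z. if z \<in> Z then 0 else k z ^ N * b z)"
    have denom: "of_real (R\<^sup>2) - cnj a * z \<noteq> 0" if "a \<in> Z" "cmod z \<le> R" for a z
      using blaschke_denom_nonzero[OF R(1) Zi[OF that(1)] that(2)] .
    have contb: "continuous_on (cball 0 R) b"
      unfolding b_def blaschke_def using denom by (intro continuous_intros) auto
    have holb: "b holomorphic_on ball 0 R"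
      unfolding b_def blaschke_def using denom by (intro holomorphic_intros) (auto simp: less_imp_le)
    have contF: "continuous_on (cball 0 R) F" and cont\<phi>: "continuous_on (cball 0 R) \<phi>"
      using holomorphic_on_imp_continuous_on[OF F] holomorphic_on_imp_continuous_on[OF \<phi>] R
      by (auto elim!: continuous_on_subset)
    have holK: "K holomorphic_on ball 0 R - Z"
    proof (rule holomorphic_transform)
      show "(\<lambda>z. k z ^ N * b z) holomorphic_on ball 0 R - Z"
        unfolding k_def using R
        by (intro holomorphic_intros holomorphic_on_subset[OF holb] holomorphic_on_subset[OF F] holomorphic_on_subset[OF \<phi>])
           (auto simp: Z_def)
    qed (auto simp: K_def)
    have lim0: "(K \<longlongrightarrow> K a) (at a)" if a: "a \<in> Z" for a
    proof -
      obtain C d where d: "0 < d" "\<And>z. z \<in> ball a d \<Longrightarrow> cmod (\<phi> z) \<le> C * cmod (F z)"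
        using dom[OF Zi[OF a]] a unfolding Z_def by blast
      have ba: "(b \<longlongrightarrow> 0) (at a)"
      proof -
        have "isCont b a" using continuous_on_interior[OF contb, of a] Zi[OF a] by simp
        moreover have "b a = 0" using a fin by (auto simp: b_def blaschke_def)
        ultimately show ?thesis using isContD by force
      qed
      have kb: "cmod (k z) \<le> \<bar>C\<bar>" if "z \<in> ball a d" for z
      proof (cases "F z = 0")
        case False
        have "cmod (\<phi> z) \<le> \<bar>C\<bar> * cmod (F z)" using d(2)[OF that] abs_ge_self[of C]
          by (meson mult_right_mono norm_ge_zero order_trans)
        then show ?thesis using False by (simp add: k_def norm_divide divide_le_eq)
      qed (simp add: k_def)
      have "((\<lambda>z. \<bar>C\<bar> ^ N * cmod (b z)) \<longlongrightarrow> \<bar>C\<bar> ^ N * cmod 0) (at a)"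
        by (intro tendsto_intros ba)
      then have L: "((\<lambda>z. \<bar>C\<bar> ^ N * cmod (b z)) \<longlongrightarrow> 0) (at a)" by simp
      have ev: "\<forall>\<^sub>F z in at a. cmod (K z) \<le> \<bar>C\<bar> ^ N * cmod (b z)"
      proof (rule eventually_mono[OF eventually_at_in_open[OF open_ball[of a d]]])
        show "a \<in> ball a d" using d by simp
        fix z assume "z \<in> ball a d - {a}"
        then show "cmod (K z) \<le> \<bar>C\<bar> ^ N * cmod (b z)"
          using kb[of z] by (auto simp: K_def norm_mult norm_power intro!: mult_right_mono power_mono)
      qed
      have "(K \<longlongrightarrow> 0) (at a)" by (rule Lim_null_comparison[OF ev L])
      then show ?thesis using a by (simp add: K_def)
    qed
    have holK': "K holomorphic_on ball 0 R"
      by (rule no_isolated_singularity'[OF _ holK open_ball fin]) (use lim0 in \<open>auto intro: tendsto_within_subset\<close>)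
    have contK: "continuous_on (cball 0 R) K"
    proof -
      have "isCont K z" if "z \<in> ball 0 R" for z
        using continuous_on_interior[OF holomorphic_on_imp_continuous_on[OF holK'], of z] that by simp
      moreover have "continuous (at z within cball 0 R) K" if "cmod z = R" for z
      proof -
        define U where "U = cball 0 R - Z"
        have zU: "z \<in> U" using that Zi by (force simp: U_def)
        have "continuous_on U (\<lambda>z. k z ^ N * b z)"
          unfolding k_def U_def
          by (intro continuous_intros continuous_on_subset[OF contb] continuous_on_subset[OF contF] continuous_on_subset[OF cont\<phi>])
             (auto simp: Z_def)
        then have "continuous_on U K" by (rule continuous_on_eq) (auto simp: K_def U_def)
        then have "continuous (at z within U) K" using zU by (simp add: continuous_on_eq_continuous_within)
        moreover have "at z within U = at z within cball 0 R"
        proof (rule at_within_nhd[of z "- Z"])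
          show "open (- Z)" using fin by (simp add: finite_imp_closed open_Compl)
        qed (use zU in \<open>auto simp: U_def\<close>)
        ultimately show ?thesis by simp
      qed
      ultimately show ?thesis
        unfolding continuous_on_eq_continuous_within
        by (metis continuous_at_imp_continuous_at_within mem_ball_0 mem_cball_0 order_le_less)
    qed
    have "cmod (K w) \<le> A ^ N"
    proof (rule maximum_modulus_frontier[of K "cball 0 R"])
      show "cmod (K z) \<le> A ^ N" if "z \<in> frontier (cball 0 R)" for z
      proof -
        have zR: "cmod z = R" using that R by auto
        then have "z \<notin> Z" using Zi by force
        moreover have "cmod (b z) = 1"
          unfolding b_def using blaschke_norm_circle[OF R(1) Zi zR] by (simp add: prod_norm[symmetric])
        moreover have "cmod (k z) \<le> A" using circ[OF zR] by (simp add: k_def norm_divide divide_le_eq)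
        ultimately show ?thesis by (simp add: K_def norm_mult norm_power power_mono)
      qed
    qed (use holK' contK w R in auto)
    then show ?thesis using w by (simp add: K_def norm_mult norm_power)
  qed
  show ?thesis
  proof (cases "F z = 0")
    case True
    then have "cmod z < R" using circ(1)[of z] z by force
    then obtain C d where "0 < d" "\<And>y. y \<in> ball z d \<Longrightarrow> cmod (\<phi> y) \<le> C * cmod (F y)"
      using dom True by blast
    then have "cmod (\<phi> z) \<le> C * cmod (F z)" by simp
    then show ?thesis using True by simp
  next
    case False
    then have zZ: "z \<notin> Z" by (simp add: Z_def)
    have b0: "0 < cmod (b z)"
      using blaschke_eq_0_iff[OF R(1) Zi z] zZ fin by (auto simp: b_def)
    have "cmod (k z) \<le> A"
    proof (rule ccontr)
      assume n: "\<not> ?thesis"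
      define A' where "A' = (cmod (k z) + A) / 2"
      have A': "A < A'" "A' < cmod (k z)" "0 < A'" using n A0 by (auto simp: A'_def)
      have "1 < cmod (k z) / A'" using A' by simp
      then obtain N where N: "1 / cmod (b z) < (cmod (k z) / A') ^ N" using real_arch_pow by blast
      have "A' ^ N < cmod (k z) ^ N * cmod (b z)" using N b0 A' by (simp add: power_divide field_simps)
      also have "\<dots> \<le> A ^ N" by (rule main[OF z zZ])
      also have "\<dots> \<le> A' ^ N" using A0 A' by (intro power_mono) auto
      finally show False by simp
    qed
    then show ?thesis using False by (simp add: k_def norm_divide divide_le_eq)
  qed
qed

text \<open>
  Let \<open>F\<^sub>0 = G * P\<close> with the Blaschke product \<open>P\<close>.  On the boundary circle, \<open>\<phi> * G\<close> is at most \<open>m / (1 - \<kappa>)\<close> times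
  \<open>F\<close>, since \<open>G\<close> and \<open>F\<^sub>0\<close> have the same modulus there; the maximum principle for \<open>\<phi> * G / F\<close>
  extends this to the disc.  There \<open>F\<close> is at most \<open>cmod G * (cmod P + \<kappa>)\<close>, because
  \<open>\<delta> \<le> cmod G\<close> by the minimum principle, and \<open>G\<close> cancels.  So \<open>\<phi>\<close>, which vanishes at the zeros of
  the perturbed function \<open>F\<close>, inherits the smallness of the Blaschke product of the unperturbed one.
\<close>

lemma perturbed_division_estimate:
  assumes F0: "F\<^sub>0 holomorphic_on ball 0 R'" and F: "F holomorphic_on ball 0 R'" and \<phi>: "\<phi> holomorphic_on ball 0 R'"
    and R: "0 < R" "R < R'" and \<delta>: "0 < \<delta>" "\<And>z. cmod z = R \<Longrightarrow> \<delta> \<le> cmod (F\<^sub>0 z)"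
    and \<kappa>: "0 \<le> \<kappa>" "\<kappa> < 1" "\<And>z. cmod z \<le> R \<Longrightarrow> cmod (F z - F\<^sub>0 z) \<le> \<kappa> * \<delta>"
    and m: "\<And>z. cmod z = R \<Longrightarrow> cmod (\<phi> z) \<le> m"
    and dom: "\<And>a. cmod a < R \<Longrightarrow> F a = 0 \<Longrightarrow> \<exists>C d. 0 < d \<and> (\<forall>z\<in>ball a d. cmod (\<phi> z) \<le> C * cmod (F z))"
    and z: "cmod z \<le> R"
  shows "cmod (\<phi> z) \<le> m * ((\<Prod>a\<in>{z \<in> ball 0 R. F\<^sub>0 z = 0}. cmod (blaschke R a z) ^ nat (zorder F\<^sub>0 a)) + \<kappa>) / (1 - \<kappa>)"
proof -
  define Z where "Z = {z \<in> ball 0 R. F\<^sub>0 z = 0}"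
  have nz: "\<exists>w\<in>ball 0 R'. F\<^sub>0 w \<noteq> 0"
    using \<delta>(2)[of "of_real R"] \<delta>(1) R by (intro bexI[of _ "of_real R"]) auto
  obtain G where "finite {z \<in> ball 0 R. F\<^sub>0 z = 0}" and G1: "G holomorphic_on ball 0 R'"
    "\<And>z. cmod z < R \<Longrightarrow> G z \<noteq> 0"
    "\<And>z. cmod z \<le> R \<Longrightarrow> F\<^sub>0 z = G z * (\<Prod>a\<in>{z \<in> ball 0 R. F\<^sub>0 z = 0}. blaschke R a z ^ nat (zorder F\<^sub>0 a))"
    "\<And>z. cmod z \<le> R \<Longrightarrow> cmod (F\<^sub>0 z) \<le> cmod (G z)"
    "\<And>z. cmod z = R \<Longrightarrow> cmod (F\<^sub>0 z) = cmod (G z)"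
    by (rule blaschke_factorization[OF F0 R nz]) (rule that; assumption)
  define P where "P = (\<lambda>z. \<Prod>a\<in>Z. cmod (blaschke R a z) ^ nat (zorder F\<^sub>0 a))"
  have FP: "cmod (F\<^sub>0 z) = cmod (G z) * P z" if "cmod z \<le> R" for z
    unfolding G1(3)[OF that] P_def Z_def by (simp add: norm_mult norm_power flip: prod_norm)
  have G\<delta>: "\<delta> \<le> cmod (G z)" if zz: "cmod z \<le> R" for z
  proof -
    have nz: "G y \<noteq> 0" if "cmod y \<le> R" for y
      using G1(2)[of y] G1(5)[of y] \<delta> that by (cases "cmod y = R") force+
    have "cmod (1 / G z) \<le> 1 / \<delta>"
    proof (rule maximum_modulus_frontier[of "\<lambda>z. 1 / G z" "cball 0 R"])
      show "(\<lambda>z. 1 / G z) holomorphic_on interior (cball 0 R)"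
        using nz R by (intro holomorphic_intros holomorphic_on_subset[OF G1(1)]) auto
      show "continuous_on (closure (cball 0 R)) (\<lambda>z. 1 / G z)"
        using nz R by (intro continuous_intros continuous_on_subset[OF holomorphic_on_imp_continuous_on[OF G1(1)]]) auto
      show "cmod (1 / G y) \<le> 1 / \<delta>" if "y \<in> frontier (cball 0 R)" for y
      proof -
        have "cmod y = R" using that R by auto
        then have "\<delta> \<le> cmod (G y)" using \<delta>(2) G1(5) by metis
        then show ?thesis using \<delta>(1) by (simp add: norm_divide frac_le)
      qed
    qed (use zz in auto)
    then show ?thesis using \<delta>(1) nz[OF zz] by (simp add: norm_divide field_simps)
  qed
  have m0: "0 \<le> m" using m[of "of_real R"] R by (smt (verit) norm_ge_zero norm_of_real)
  have "cmod (\<phi> z * G z) \<le> m / (1 - \<kappa>) * cmod (F z)"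
  proof (rule maximum_principle_quotient[OF _ F R _ _ _ z])
    show "(\<lambda>z. \<phi> z * G z) holomorphic_on ball 0 R'" by (intro holomorphic_intros \<phi> G1)
    have low: "(1 - \<kappa>) * cmod (F\<^sub>0 y) \<le> cmod (F y)" if y: "cmod y = R" for y
    proof -
      have "cmod (F\<^sub>0 y) - \<kappa> * \<delta> \<le> cmod (F y)"
        using \<kappa>(3)[of y] y norm_triangle_ineq3[of "F y" "F\<^sub>0 y"] by simp
      moreover have "\<kappa> * \<delta> \<le> \<kappa> * cmod (F\<^sub>0 y)" using \<delta>(2)[OF y] \<kappa>(1) by (rule mult_left_mono)
      ultimately show ?thesis by (simp add: algebra_simps)
    qed
    show "F y \<noteq> 0" if y: "cmod y = R" for y
    proof -
      have "0 < cmod (F\<^sub>0 y)" using \<delta>(2)[OF y] \<delta>(1) by linarith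
      then have "0 < (1 - \<kappa>) * cmod (F\<^sub>0 y)" using \<kappa>(2) by simp
      then show ?thesis using low[OF y] by auto
    qed
    show "cmod (\<phi> y * G y) \<le> m / (1 - \<kappa>) * cmod (F y)" if y: "cmod y = R" for y
    proof -
      have "cmod (\<phi> y * G y) \<le> m * cmod (F\<^sub>0 y)"
        using m[OF y] G1(5)[OF y] by (simp add: norm_mult mult_right_mono)
      also have "\<dots> = m / (1 - \<kappa>) * ((1 - \<kappa>) * cmod (F\<^sub>0 y))" using \<kappa> by simp
      also have "\<dots> \<le> m / (1 - \<kappa>) * cmod (F y)" using low[OF y] m0 \<kappa> by (intro mult_left_mono) auto
      finally show ?thesis .
    qed
    show "\<exists>C d. 0 < d \<and> (\<forall>z\<in>ball a d. cmod (\<phi> z * G z) \<le> C * cmod (F z))" if a: "cmod a < R" "F a = 0" for a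
    proof -
      obtain C d where d: "0 < d" "\<And>z. z \<in> ball a d \<Longrightarrow> cmod (\<phi> z) \<le> C * cmod (F z)" using dom[OF a] by blast
      have "isCont G a" using continuous_on_interior[OF holomorphic_on_imp_continuous_on[OF G1(1)], of a] a R by simp
      then obtain e where e: "0 < e" "\<And>z. dist z a < e \<Longrightarrow> dist (G z) (G a) < 1"
        unfolding continuous_at_eps_delta by (metis zero_less_one)
      have "cmod (\<phi> z * G z) \<le> (C * (cmod (G a) + 1)) * cmod (F z)" if "z \<in> ball a (min d e)" for z
      proof -
        have "cmod (G z) \<le> cmod (G a) + 1"
          using e(2)[of z] that norm_triangle_ineq2[of "G z" "G a"] by (simp add: dist_commute dist_norm norm_minus_commute)
        moreover have "cmod (\<phi> z) \<le> C * cmod (F z)" using d that by auto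
        ultimately have "cmod (\<phi> z) * cmod (G z) \<le> (C * cmod (F z)) * (cmod (G a) + 1)"
          by (intro mult_mono) (auto intro: order_trans[OF norm_ge_zero])
        then show ?thesis by (simp add: norm_mult mult_ac)
      qed
      then show ?thesis using d e by (intro exI[of _ "C * (cmod (G a) + 1)"] exI[of _ "min d e"]) auto
    qed
  qed
  also have "\<dots> \<le> m / (1 - \<kappa>) * (cmod (G z) * (P z + \<kappa>))"
  proof (rule mult_left_mono)
    have "cmod (F z) \<le> cmod (F\<^sub>0 z) + \<kappa> * \<delta>"
      using \<kappa>(3)[OF z] norm_triangle_ineq2[of "F z" "F\<^sub>0 z"] by simp
    also have "\<kappa> * \<delta> \<le> \<kappa> * cmod (G z)" using G\<delta>[OF z] \<kappa>(1) by (rule mult_left_mono)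
    finally show "cmod (F z) \<le> cmod (G z) * (P z + \<kappa>)" using FP[OF z] by (simp add: algebra_simps)
  qed (use m0 \<kappa> in auto)
  finally have "cmod (\<phi> z) * cmod (G z) \<le> (m / (1 - \<kappa>) * (P z + \<kappa>)) * cmod (G z)"
    by (simp add: norm_mult mult_ac)
  moreover have "0 < cmod (G z)" using G\<delta>[OF z] \<delta>(1) by linarith
  ultimately have "cmod (\<phi> z) \<le> m / (1 - \<kappa>) * (P z + \<kappa>)" by (simp only: mult_le_cancel_right_pos)
  then show ?thesis by (simp add: P_def Z_def)
qed

section \<open>Jensen formula and values that are taken often\<close>

text \<open>
  By compactness \<open>G\<close> has no zeros in a slightly larger disc either.  A logarithm on that disc makes the integral
  formulas on the boundary circle available.
\<close>

lemma zero_free_log_on_larger_ball: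
  assumes G: "G holomorphic_on ball 0 R'" and R: "0 < R" "R < R'" and nz: "\<And>z. cmod z \<le> R \<Longrightarrow> G z \<noteq> 0"
  obtains R'' g where "R < R''" "R'' \<le> R'" "g holomorphic_on ball 0 R''" "\<And>z. cmod z < R'' \<Longrightarrow> G z = exp (g z)"
proof -
  have "\<exists>R''. R < R'' \<and> R'' \<le> R' \<and> (\<forall>z. cmod z < R'' \<longrightarrow> G z \<noteq> 0)"
  proof -
    define c where "c = (R + R') / 2"
    have c: "R < c" "c < R'" using R by (auto simp: c_def)
    have contG: "continuous_on (cball 0 c) G"
      using holomorphic_on_imp_continuous_on[OF G] c by (auto elim!: continuous_on_subset)
    define S where "S = {z \<in> cball 0 c. G z = 0}"
    have "closed S" unfolding S_def by (rule continuous_closed_preimage_constant[OF contG closed_cball])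
    moreover have "bounded S" unfolding S_def by (rule bounded_subset[OF bounded_cball[of 0 c]]) auto
    ultimately have "compact S" by (simp add: compact_eq_bounded_closed)
    show ?thesis
    proof (cases "S = {}")
      case True
      then show ?thesis using c by (intro exI[of _ c]) (auto simp: S_def)
    next
      case False
      obtain s where s: "s \<in> S" "\<And>z. z \<in> S \<Longrightarrow> cmod s \<le> cmod z"
        using continuous_attains_inf[OF \<open>compact S\<close> False, of cmod] continuous_on_norm_id by blast
      have "R < cmod s" using nz[of s] s(1) by (force simp: S_def)
      moreover have "cmod s \<le> c" using s(1) by (simp add: S_def)
      moreover have "G z \<noteq> 0" if "cmod z < cmod s" for z
        using s(2)[of z] that \<open>cmod s \<le> c\<close> by (auto simp: S_def)
      ultimately show ?thesis using c by (intro exI[of _ "cmod s"]) auto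
    qed
  qed
  then obtain R'' where R'': "R < R''" "R'' \<le> R'" "\<And>z. cmod z < R'' \<Longrightarrow> G z \<noteq> 0" by blast
  have "G holomorphic_on ball 0 R''" by (rule holomorphic_on_subset[OF G]) (use R'' in auto)
  then obtain g where "g holomorphic_on ball 0 R''" "\<And>z. z \<in> ball 0 R'' \<Longrightarrow> G z = exp (g z)"
    using contractible_imp_holomorphic_log[OF _ convex_imp_contractible[OF convex_ball]] R''(3)
    by (metis mem_ball_0)
  then show ?thesis using that[of R'' g] R'' by simp
qed

lemma blaschke_log_factor:
  assumes hol: "F holomorphic_on ball 0 R'" and R: "0 < R" "R < R'"
    and circ: "\<And>z. cmod z = R \<Longrightarrow> F z \<noteq> 0"
  obtains R'' g where "R < R''" "g holomorphic_on ball 0 R''"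
    "\<And>z. cmod z \<le> R \<Longrightarrow> F z = exp (g z) * (\<Prod>a\<in>{z \<in> ball 0 R. F z = 0}. blaschke R a z ^ nat (zorder F a))"
    "\<And>z. cmod z \<le> R \<Longrightarrow> cmod (F z) \<le> exp (Re (g z))"
    "\<And>z. cmod z = R \<Longrightarrow> ln (cmod (F z)) = Re (g z)"
    "finite {z \<in> ball 0 R. F z = 0}"
proof -
  have nz: "\<exists>w\<in>ball 0 R'. F w \<noteq> 0" using circ[of "of_real R"] R by (intro bexI[of _ "of_real R"]) auto
  obtain G where fin: "finite {z \<in> ball 0 R. F z = 0}" and G1: "G holomorphic_on ball 0 R'"
    "\<And>z. cmod z < R \<Longrightarrow> G z \<noteq> 0"
    "\<And>z. cmod z \<le> R \<Longrightarrow> F z = G z * (\<Prod>a\<in>{z \<in> ball 0 R. F z = 0}. blaschke R a z ^ nat (zorder F a))"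
    "\<And>z. cmod z \<le> R \<Longrightarrow> cmod (F z) \<le> cmod (G z)"
    "\<And>z. cmod z = R \<Longrightarrow> cmod (F z) = cmod (G z)"
    by (rule blaschke_factorization[OF hol R nz]) (rule that; assumption)
  have "G z \<noteq> 0" if "cmod z \<le> R" for z
    using G1(2)[of z] G1(5)[of z] circ[of z] that by (cases "cmod z = R") force+
  then obtain R'' g where g: "R < R''" "R'' \<le> R'" "g holomorphic_on ball 0 R''" "\<And>z. cmod z < R'' \<Longrightarrow> G z = exp (g z)"
    using zero_free_log_on_larger_ball[OF G1(1) R] by blast
  have eg: "G z = exp (g z)" if "cmod z \<le> R" for z using g(1,4) that by simp
  show ?thesis
    by (rule that[OF g(1,3) _ _ _ fin]) (use G1(3,4,5) eg in auto)
qed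

text \<open>
  The mean value property of \<open>Re g\<close>, where \<open>exp g\<close> is the zero-free factor of \<open>F\<close>; the Blaschke
  factors account for the sum over the zeros.
\<close>

lemma jensen_formula:
  assumes hol: "F holomorphic_on ball 0 R'" and R: "0 < R" "R < R'"
    and circ: "\<And>z. cmod z = R \<Longrightarrow> F z \<noteq> 0" and F0: "F 0 \<noteq> 0"
  shows "((\<lambda>\<theta>. ln (cmod (F (of_real R * cis \<theta>)))) has_integral
     2 * pi * (ln (cmod (F 0)) + (\<Sum>a\<in>{z \<in> ball 0 R. F z = 0}. nat (zorder F a) * ln (R / cmod a)))) {0..2*pi}"
proof -
  define Z where "Z = {z \<in> ball 0 R. F z = 0}"
  obtain R'' g where g: "R < R''" "g holomorphic_on ball 0 R''"
    and fac: "\<And>z. cmod z \<le> R \<Longrightarrow> F z = exp (g z) * (\<Prod>a\<in>{z \<in> ball 0 R. F z = 0}. blaschke R a z ^ nat (zorder F a))"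
    and "\<And>z. cmod z \<le> R \<Longrightarrow> cmod (F z) \<le> exp (Re (g z))"
    and bd: "\<And>z. cmod z = R \<Longrightarrow> ln (cmod (F z)) = Re (g z)"
    and fin: "finite {z \<in> ball 0 R. F z = 0}"
    by (rule blaschke_log_factor[OF hol R]) ((rule circ; assumption), (rule that; assumption))
  have a0: "a \<noteq> 0" if "a \<in> Z" for a using that F0 by (auto simp: Z_def)
  have "cmod (F 0) = exp (Re (g 0)) * (\<Prod>a\<in>Z. (cmod a / R) ^ nat (zorder F a))"
    using fac[of 0] R by (simp add: norm_mult norm_power blaschke_norm_center Z_def flip: prod_norm)
  then have "ln (cmod (F 0)) = Re (g 0) + (\<Sum>a\<in>Z. nat (zorder F a) * ln (cmod a / R))"
  proof -
    have fz: "finite Z" using fin by (simp add: Z_def)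
    have pos: "0 < (cmod a / R) ^ nat (zorder F a)" if "a \<in> Z" for a using a0[OF that] R by simp
    have "ln (\<Prod>a\<in>Z. (cmod a / R) ^ nat (zorder F a)) = (\<Sum>a\<in>Z. ln ((cmod a / R) ^ nat (zorder F a)))"
      by (rule ln_prod[OF fz], rule less_imp_neq[symmetric], rule pos)
    also have "\<dots> = (\<Sum>a\<in>Z. nat (zorder F a) * ln (cmod a / R))"
      by (simp add: ln_realpow)
    moreover have "0 < (\<Prod>a\<in>Z. (cmod a / R) ^ nat (zorder F a))" using pos by (rule prod_pos)
    ultimately show ?thesis using \<open>cmod (F 0) = _\<close> by (simp add: ln_mult_pos)
  qed
  moreover have "(\<Sum>a\<in>Z. nat (zorder F a) * ln (cmod a / R)) = - (\<Sum>a\<in>Z. nat (zorder F a) * ln (R / cmod a))"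
    unfolding sum_negf[symmetric] using a0 R by (intro sum.cong) (auto simp: ln_div algebra_simps)
  ultimately have "Re (g 0) = ln (cmod (F 0)) + (\<Sum>a\<in>Z. nat (zorder F a) * ln (R / cmod a))" by simp
  moreover have "((\<lambda>\<theta>. Re (g (of_real R * cis \<theta>))) has_integral 2 * pi * Re (g 0)) {0..2*pi}"
    by (rule mean_value_Re[OF g(2) R(1) g(1)])
  moreover have "ln (cmod (F (of_real R * cis \<theta>))) = Re (g (of_real R * cis \<theta>))" for \<theta>
    using R by (intro bd) (simp add: norm_mult)
  ultimately show ?thesis unfolding Z_def by simp
qed

text \<open>
  The zero-free factor of \<open>f\<close> dominates \<open>f\<close> in the disc.  Apply the Poisson formula to its logarithm, pass to
  the positive part and bound the kernel by its maximum.
\<close>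

lemma log_modulus_le_mean_log_plus:
  assumes hol: "f holomorphic_on ball 0 R'" and R: "0 < R" "R < R'"
    and circ: "\<And>z. cmod z = R \<Longrightarrow> f z \<noteq> 0" and z: "cmod z < R" "f z \<noteq> 0" and \<tau>: "0 < \<tau>"
    and I: "((\<lambda>\<theta>. max 0 (ln (cmod (f (of_real R * cis \<theta>)) / \<tau>))) has_integral I) {0..2*pi}"
  shows "2 * pi * ln (cmod (f z) / \<tau>) \<le> (R + cmod z) / (R - cmod z) * I"
proof -
  obtain R'' g where g: "R < R''" "g holomorphic_on ball 0 R''"
    and "\<And>z. cmod z \<le> R \<Longrightarrow> f z = exp (g z) * (\<Prod>a\<in>{z \<in> ball 0 R. f z = 0}. blaschke R a z ^ nat (zorder f a))"
    and le: "\<And>z. cmod z \<le> R \<Longrightarrow> cmod (f z) \<le> exp (Re (g z))"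
    and bd: "\<And>z. cmod z = R \<Longrightarrow> ln (cmod (f z)) = Re (g z)"
    and fin: "finite {z \<in> ball 0 R. f z = 0}"
    by (rule blaschke_log_factor[OF hol R]) ((rule circ; assumption), (rule that; assumption))
  define k where "k = (\<lambda>z. g z - of_real (ln \<tau>))"
  have holk: "k holomorphic_on ball 0 R''" unfolding k_def by (intro holomorphic_intros g)
  have n: "cmod (of_real R * cis \<theta>) = R" for \<theta> using R by (simp add: norm_mult)
  have kb: "Re (k (of_real R * cis \<theta>)) = ln (cmod (f (of_real R * cis \<theta>)) / \<tau>)" for \<theta>
    using bd[OF n] circ[OF n] \<tau> by (simp add: k_def ln_div)
  have "2 * pi * Re (k z) \<le> I * ((R + cmod z) / (R - cmod z))"
  proof (rule has_integral_le[OF poisson_formula_Re[OF holk R(1) g(1) z(1)] has_integral_mult_left[OF I]])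
    fix \<theta> assume "\<theta> \<in> {0..2*pi}"
    let ?v = "ln (cmod (f (of_real R * cis \<theta>)) / \<tau>)" and ?P = "poisson_kernel R z (of_real R * cis \<theta>)"
    have P: "?P \<le> (R + cmod z) / (R - cmod z)" "(R - cmod z) / (R + cmod z) \<le> ?P"
      using poisson_kernel_bounds[OF z(1) n] by auto
    have "0 \<le> ?P" using P(2) z(1) by (smt (verit) divide_nonneg_nonneg norm_ge_zero)
    then have "?v * ?P \<le> max 0 ?v * ?P" by (intro mult_right_mono) auto
    also have "\<dots> \<le> max 0 ?v * ((R + cmod z) / (R - cmod z))" using P by (intro mult_left_mono) auto
    finally show "Re (k (of_real R * cis \<theta>)) * ?P \<le> max 0 ?v * ((R + cmod z) / (R - cmod z))" unfolding kb .
  qed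
  moreover have "ln (cmod (f z) / \<tau>) \<le> Re (k z)"
  proof -
    have "ln (cmod (f z)) \<le> ln (exp (Re (g z)))" using le[of z] z by (subst ln_le_cancel_iff) auto
    then show ?thesis using z \<tau> by (simp add: k_def ln_div)
  qed
  ultimately show ?thesis by (smt (verit, ccfv_SIG) mult.commute mult_left_mono pi_ge_zero)
qed

text \<open>
  For \<open>\<tau> < cmod c\<close> this is the mean value property of \<open>ln (cmod (c - z))\<close>.  For \<open>cmod c < \<tau>\<close> that function has a
  singularity in the disc, but on the circle it agrees with \<open>ln (cmod (\<tau> - cnj c * z / \<tau>))\<close>,
  which has none.
\<close>

lemma mean_log_distance_to_circle:
  assumes \<tau>: "0 < \<tau>" and c: "cmod c \<noteq> \<tau>"
  shows "((\<lambda>\<phi>. ln (cmod (c - of_real \<tau> * cis \<phi>))) has_integral 2 * pi * ln (max (cmod c) \<tau>)) {0..2*pi}"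
proof (cases "\<tau> < cmod c")
  case True
  obtain g where g: "g holomorphic_on ball 0 (cmod c)" "\<And>z. z \<in> ball 0 (cmod c) \<Longrightarrow> c - z = exp (g z)"
  proof (rule contractible_imp_holomorphic_log[of "\<lambda>z. c - z" "ball 0 (cmod c)"])
    show "(\<lambda>z. c - z) holomorphic_on ball 0 (cmod c)" by (intro holomorphic_intros)
  qed (use convex_imp_contractible[OF convex_ball] that in auto)
  have e: "ln (cmod (c - z)) = Re (g z)" if "cmod z < cmod c" for z using g(2)[of z] that by simp
  have "ln (cmod (c - of_real \<tau> * cis \<phi>)) = Re (g (of_real \<tau> * cis \<phi>))" for \<phi>
    using True \<tau> by (intro e) (simp add: norm_mult)
  moreover have "Re (g 0) = ln (max (cmod c) \<tau>)" using e[of 0] True \<tau> by (cases "c = 0") (auto simp: max_def)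
  ultimately show ?thesis using mean_value_Re[OF g(1) \<tau> True] by simp
next
  case False
  then have lt: "cmod c < \<tau>" using c by simp
  define R' where "R' = (if c = 0 then 2 * \<tau> else \<tau>\<^sup>2 / cmod c)"
  have R': "\<tau> < R'" using lt \<tau> by (auto simp: R'_def field_simps power2_eq_square)
  have small: "cmod (cnj c / of_real \<tau> * z) < \<tau>" if "cmod z < R'" for z
    using that \<tau> lt by (cases "c = 0") (auto simp: R'_def norm_mult norm_divide field_simps power2_eq_square)
  have nz: "of_real \<tau> - cnj c / of_real \<tau> * z \<noteq> 0" if "cmod z < R'" for z
    using small[OF that] \<tau> by auto
  obtain g where g: "g holomorphic_on ball 0 R'"
    "\<And>z. z \<in> ball 0 R' \<Longrightarrow> of_real \<tau> - cnj c / of_real \<tau> * z = exp (g z)"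
  proof (rule contractible_imp_holomorphic_log[of "\<lambda>z. of_real \<tau> - cnj c / of_real \<tau> * z" "ball 0 R'"])
    show "(\<lambda>z. of_real \<tau> - cnj c / of_real \<tau> * z) holomorphic_on ball 0 R'"
      by (intro holomorphic_intros) (use \<tau> in auto)
    show "of_real \<tau> - cnj c / of_real \<tau> * z \<noteq> 0" if "z \<in> ball 0 R'" for z
      using nz[of z] that by (simp del: of_real_eq_0_iff)
  qed (use convex_imp_contractible[OF convex_ball] in auto)
  have e: "ln (cmod (of_real \<tau> - cnj c / of_real \<tau> * z)) = Re (g z)" if "cmod z < R'" for z using g(2)[of z] that by simp
  have "cmod (c - of_real \<tau> * cis \<phi>) = cmod (of_real \<tau> - cnj c / of_real \<tau> * (of_real \<tau> * cis \<phi>))" for \<phi>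
  proof -
    have "cmod (c - of_real \<tau> * cis \<phi>) = cmod (cis (-\<phi>) * (c - of_real \<tau> * cis \<phi>))" by (simp add: norm_mult)
    also have "cis (-\<phi>) * (c - of_real \<tau> * cis \<phi>) = cis (-\<phi>) * c - of_real \<tau> * (cis (-\<phi>) * cis \<phi>)"
      by (simp add: algebra_simps)
    also have "\<dots> = cis (-\<phi>) * c - of_real \<tau>" by (simp add: cis_mult)
    also have "cmod \<dots> = cmod (cnj (cis (-\<phi>) * c - of_real \<tau>))" by (simp only: complex_mod_cnj)
    also have "cnj (cis (-\<phi>) * c - of_real \<tau>) = - (of_real \<tau> - cnj c / of_real \<tau> * (of_real \<tau> * cis \<phi>))"
      using \<tau> by (simp add: cis_cnj)
    finally show ?thesis by (simp only: norm_minus_cancel)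
  qed
  moreover have "ln (cmod (of_real \<tau> - cnj c / of_real \<tau> * (of_real \<tau> * cis \<phi>))) = Re (g (of_real \<tau> * cis \<phi>))" for \<phi>
    using R' \<tau> by (intro e) (simp add: norm_mult)
  moreover have "Re (g 0) = ln (max (cmod c) \<tau>)" using e[of 0] lt \<tau> R' by (simp add: max_def)
  ultimately show ?thesis using mean_value_Re[OF g(1) \<tau> R'] by simp
qed

lemma finite_cis_eq: "finite {\<phi> \<in> {0..2*pi}. cis \<phi> = w}"
proof (rule finite_subset)
  show "{\<phi> \<in> {0..2*pi}. cis \<phi> = w} \<subseteq> {Arg2pi w, 2 * pi}"
  proof
    fix \<phi> assume "\<phi> \<in> {\<phi> \<in> {0..2*pi}. cis \<phi> = w}"
    then have "Arg2pi w = \<phi>" if "\<phi> \<noteq> 2 * pi"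
      using that by (intro Arg2pi_unique[of 1]) (auto simp: cis_conv_exp)
    then show "\<phi> \<in> {Arg2pi w, 2 * pi}" by auto
  qed
qed simp

text \<open>
  On the circle, \<open>(cmod (f z))\<^sup>2 - \<tau>\<^sup>2\<close> agrees with a function holomorphic on an annulus, obtained by
  reflecting \<open>f\<close>.  Infinitely many zeros would make \<open>cmod f\<close> constant \<open>\<tau>\<close> on the circle, which the
  maximum principle rules out because of the point \<open>z1\<close>.
\<close>

lemma finite_circle_modulus_eq:
  assumes hol: "f holomorphic_on ball 0 R'" and R: "0 < R" "R < R'" and \<tau>: "0 < \<tau>"
    and z1: "cmod z1 \<le> R" "\<tau> < cmod (f z1)"
  shows "finite {z \<in> sphere 0 R. cmod (f z) = \<tau>}"
proof -
  define A where "A = {z. R\<^sup>2 / R' < cmod (z - 0) \<and> cmod (z - 0) < R'}"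
  define k where "k = (\<lambda>z. f z * cnj (f (cnj (of_real (R\<^sup>2) / z))) - of_real (\<tau>\<^sup>2))"
  have A0: "z \<noteq> 0" if "z \<in> A" for z using that R by (auto simp: A_def divide_less_0_iff)
  have opA: "open A"
  proof -
    have "A = - cball 0 (R\<^sup>2 / R') \<inter> ball 0 R'" by (auto simp: A_def)
    then show ?thesis by (metis closed_cball open_Compl open_Int open_ball)
  qed
  have conA: "connected A" unfolding A_def by (rule connected_annulus) simp
  have sA: "sphere 0 R \<subseteq> A" using R by (auto simp: A_def field_simps power2_eq_square)
  have img: "of_real (R\<^sup>2) / z \<in> ball 0 R'" if "z \<in> A" for z
  proof -
    have "0 < cmod z" using A0[OF that] by simp
    then have "R\<^sup>2 / cmod z < R'" using that R by (simp add: A_def field_simps)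
    then show ?thesis by (simp add: norm_divide norm_power)
  qed
  have holc: "(\<lambda>z. cnj (f (cnj z))) holomorphic_on ball 0 R'"
  proof -
    have "x \<in> cnj ` ball 0 R'" if "cmod x < R'" for x
      using that by (intro image_eqI[of _ cnj "cnj x"]) auto
    then have "cnj ` ball 0 R' = ball 0 R'" by auto
    then have "(cnj \<circ> f \<circ> cnj) holomorphic_on ball 0 R'"
      using hol by (intro holomorphic_on_compose_cnj_cnj) auto
    then show ?thesis by (simp add: o_def)
  qed
  have holk: "k holomorphic_on A"
  proof -
    have "((\<lambda>z. cnj (f (cnj z))) \<circ> (\<lambda>z. of_real (R\<^sup>2) / z)) holomorphic_on A"
      by (rule holomorphic_on_compose_gen[OF _ holc]) (use img A0 in \<open>auto intro!: holomorphic_intros simp del: mem_ball mem_ball_0\<close>)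
    moreover have "f holomorphic_on A" by (rule holomorphic_on_subset[OF hol]) (auto simp: A_def)
    ultimately show ?thesis unfolding k_def o_def by (intro holomorphic_intros)
  qed
  have ks: "k z = of_real ((cmod (f z))\<^sup>2 - \<tau>\<^sup>2)" if "z \<in> sphere 0 R" for z
  proof -
    have "cmod z = R" using that by simp
    then have "of_real (R\<^sup>2) = z * cnj z" using complex_norm_square[of z] by simp
    then have "cnj (of_real (R\<^sup>2) / z) = z" using A0[of z] sA that by auto
    then show ?thesis unfolding k_def by (simp only: of_real_diff complex_norm_square)
  qed
  have "k z = 0 \<longleftrightarrow> cmod (f z) = \<tau>" if "z \<in> sphere 0 R" for z
    unfolding ks[OF that] of_real_eq_0_iff using \<tau> by (simp add: power2_eq_iff_nonneg)
  then have eq: "{z \<in> sphere 0 R. cmod (f z) = \<tau>} = {z \<in> sphere 0 R. k z = 0}" by blast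
  show ?thesis
  proof (cases "k constant_on A")
    case True
    then obtain c where c: "\<And>z. z \<in> A \<Longrightarrow> k z = c" by (auto simp: constant_on_def)
    show ?thesis
    proof (cases "c = 0")
      case True
      have "cmod (f z1) \<le> \<tau>"
      proof (rule maximum_modulus_frontier[of f "cball 0 R"])
        show "cmod (f z) \<le> \<tau>" if "z \<in> frontier (cball 0 R)" for z
        proof -
          have "z \<in> sphere 0 R" using that R by auto
          then have "z \<in> {z \<in> sphere 0 R. k z = 0}" using c sA True by blast
          then show ?thesis unfolding eq[symmetric] by simp
        qed
        show "f holomorphic_on interior (cball 0 R)" using R by (auto intro: holomorphic_on_subset[OF hol])
        show "continuous_on (closure (cball 0 R)) f"
          using R by (auto intro: continuous_on_subset[OF holomorphic_on_imp_continuous_on[OF hol]])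
      qed (use z1 in auto)
      then show ?thesis using z1 by simp
    next
      case False
      then have "{z \<in> sphere 0 R. k z = 0} = {}" using c sA by auto
      then show ?thesis unfolding eq by (simp only: finite.emptyI)
    qed
  next
    case False
    show ?thesis unfolding eq
      by (rule holomorphic_compact_finite_zeros[OF holk opA conA compact_sphere sA False])
  qed
qed

text \<open>
  Jensen's formula for \<open>f - w\<close>, averaged over \<open>cmod w = \<tau>\<close>.  The mean of \<open>ln (cmod (c - w))\<close> over this
  circle is \<open>ln (max (cmod c) \<tau>)\<close>, so the mean of the sum over the zeros is the mean of
  \<open>max 0 (ln (cmod f / \<tau>))\<close> over the circle of radius \<open>R\<close>, and this is bounded below in terms of
  the value at \<open>z\<^sub>1\<close>.  Some \<open>w\<close> does at least as well as the mean.  To exchange the two integrals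
  with Tonelli's theorem, the integrand is subtracted from an upper bound \<open>K\<close>: its
  logarithmic singularities are all downwards.
\<close>

lemma exists_value_with_many_zeros:
  assumes hol: "f holomorphic_on ball 0 R'" and R: "0 < R" "R < R'"
    and circ: "\<And>z. cmod z = R \<Longrightarrow> f z \<noteq> 0" and f0: "cmod (f 0) < \<tau>"
    and z1: "cmod z\<^sub>1 < R" "\<tau> < cmod (f z\<^sub>1)" and \<eta>: "\<eta> < (R - cmod z\<^sub>1) / (R + cmod z\<^sub>1) * ln (cmod (f z\<^sub>1) / \<tau>)"
  shows "\<exists>w. cmod w = \<tau> \<and> (\<forall>z. cmod z = R \<longrightarrow> f z \<noteq> w) \<and>
     \<eta> \<le> (\<Sum>a\<in>{z \<in> ball 0 R. f z - w = 0}. nat (zorder (\<lambda>z. f z - w) a) * ln (R / cmod a))"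
proof (rule ccontr)
  assume neg: "\<not> ?thesis"
  have \<tau>: "0 < \<tau>" using f0 norm_ge_zero[of "f 0"] by linarith
  define F where "F = (\<lambda>\<theta>. f (of_real R * cis \<theta>))"
  define I where "I = {0..2*pi}"
  define v where "v = (\<lambda>\<theta>. max 0 (ln (cmod (F \<theta>) / \<tau>)))"
  define X where "X = (\<lambda>w. \<Sum>a\<in>{z \<in> ball 0 R. f z - w = 0}. nat (zorder (\<lambda>z. f z - w) a) * ln (R / cmod a))"
  define Q where "Q = (\<lambda>\<phi> \<theta>. ln (cmod (F \<theta> - of_real \<tau> * cis \<phi>)) - ln (cmod (f 0 - of_real \<tau> * cis \<phi>)))"
  have n: "cmod (of_real R * cis \<theta>) = R" for \<theta> using R by (simp add: norm_mult)
  have Fn0: "F \<theta> \<noteq> 0" for \<theta> using circ[OF n] by (simp add: F_def)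
  have contF: "continuous_on UNIV F"
  proof -
    have "continuous_on (sphere 0 R) f"
      using holomorphic_on_imp_continuous_on[OF hol] R by (auto elim!: continuous_on_subset)
    then show ?thesis unfolding F_def
      by (rule continuous_on_compose2) (use R in \<open>auto intro!: continuous_intros simp: norm_mult\<close>)
  qed
  have Fm [measurable]: "F \<in> borel_measurable borel" by (rule borel_measurable_continuous_onI[OF contF])
  have cism [measurable]: "cis \<in> borel_measurable borel"
    by (rule borel_measurable_continuous_onI) (intro continuous_intros)
  have contv: "continuous_on UNIV v"
    unfolding v_def using Fn0 \<tau> by (intro continuous_intros contF) auto
  define J where "J = integral I v"
  have J: "(v has_integral J) I"
    unfolding J_def I_def by (intro integrable_integral integrable_continuous_real continuous_on_subset[OF contv]) auto
  have vnn: "0 \<le> v \<theta>" for \<theta> by (simp add: v_def)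
  \<comment> \<open>The mean of the positive logarithm is large because of the point \<open>z\<^sub>1\<close>.\<close>
  have J0: "2 * pi * \<eta> < J"
  proof -
    have fz: "f z\<^sub>1 \<noteq> 0" using z1 \<tau> by auto
    have pos: "0 < R - cmod z\<^sub>1" "0 < R + cmod z\<^sub>1" using z1 R by (auto intro: add_pos_nonneg)
    have "2 * pi * ln (cmod (f z\<^sub>1) / \<tau>) \<le> (R + cmod z\<^sub>1) / (R - cmod z\<^sub>1) * J"
      by (rule log_modulus_le_mean_log_plus[OF hol R circ z1(1) fz \<tau>]) (use J in \<open>simp_all add: v_def F_def I_def\<close>)
    then have "(R - cmod z\<^sub>1) / (R + cmod z\<^sub>1) * (2 * pi * ln (cmod (f z\<^sub>1) / \<tau>))
       \<le> (R - cmod z\<^sub>1) / (R + cmod z\<^sub>1) * ((R + cmod z\<^sub>1) / (R - cmod z\<^sub>1) * J)"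
      using pos by (intro mult_left_mono) auto
    also have "\<dots> = J" using pos by simp
    finally have "(R - cmod z\<^sub>1) / (R + cmod z\<^sub>1) * (2 * pi * ln (cmod (f z\<^sub>1) / \<tau>)) \<le> J" .
    moreover have "2 * pi * \<eta> < 2 * pi * ((R - cmod z\<^sub>1) / (R + cmod z\<^sub>1) * ln (cmod (f z\<^sub>1) / \<tau>))"
      by (rule mult_strict_left_mono[OF \<eta>]) simp
    moreover have "(R - cmod z\<^sub>1) / (R + cmod z\<^sub>1) * (2 * pi * ln (cmod (f z\<^sub>1) / \<tau>))
      = 2 * pi * ((R - cmod z\<^sub>1) / (R + cmod z\<^sub>1) * ln (cmod (f z\<^sub>1) / \<tau>))" by (rule mult.left_commute)
    ultimately show ?thesis by linarith
  qed
  have dist0: "\<tau> - cmod (f 0) \<le> cmod (f 0 - of_real \<tau> * cis \<phi>)" for \<phi>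
    using norm_triangle_ineq2[of "of_real \<tau> * cis \<phi>" "f 0"] \<tau> by (simp add: norm_mult norm_minus_commute)
  obtain M where M: "\<And>\<theta>. cmod (F \<theta>) \<le> M"
  proof -
    have "compact (f ` sphere 0 R)"
      by (rule compact_continuous_image[OF _ compact_sphere])
         (use holomorphic_on_imp_continuous_on[OF hol] R in \<open>auto elim!: continuous_on_subset\<close>)
    then obtain B where "\<forall>x\<in>f ` sphere 0 R. cmod x \<le> B" using compact_imp_bounded bounded_iff by metis
    then show ?thesis using that[of B] n by (auto simp: F_def)
  qed
  define K where "K = max 0 (ln (M + \<tau>)) - ln (\<tau> - cmod (f 0))"
  have QK: "Q \<phi> \<theta> \<le> K" for \<phi> \<theta>
  proof -
    have M0: "0 \<le> M" using M norm_ge_zero order_trans by blast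
    have "ln (cmod (F \<theta> - of_real \<tau> * cis \<phi>)) \<le> max 0 (ln (M + \<tau>))"
    proof (cases "F \<theta> - of_real \<tau> * cis \<phi> = 0")
      case False
      have "cmod (F \<theta> - of_real \<tau> * cis \<phi>) \<le> M + \<tau>"
        using norm_triangle_ineq4[of "F \<theta>" "of_real \<tau> * cis \<phi>"] M[of \<theta>] \<tau> by (simp add: norm_mult)
      then have "ln (cmod (F \<theta> - of_real \<tau> * cis \<phi>)) \<le> ln (M + \<tau>)"
        using False M0 \<tau> by (subst ln_le_cancel_iff) auto
      then show ?thesis by simp
    qed simp
    moreover have "ln (\<tau> - cmod (f 0)) \<le> ln (cmod (f 0 - of_real \<tau> * cis \<phi>))"
      using dist0[of \<phi>] f0 by (subst ln_le_cancel_iff) auto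
    ultimately show ?thesis by (simp add: Q_def K_def)
  qed
  \<comment> \<open>At these finitely many angles \<open>F\<close> meets the circle of radius \<open>\<tau>\<close>, and the mean value formulas fail.\<close>
  define \<Theta> where "\<Theta> = {\<theta> \<in> I. cmod (F \<theta>) = \<tau>}"
  have fin\<Theta>: "finite \<Theta>"
  proof -
    have "finite {z \<in> sphere 0 R. cmod (f z) = \<tau>}"
      using finite_circle_modulus_eq[OF hol R \<tau>, of "z\<^sub>1"] z1 by simp
    then have "finite (\<Union>z\<in>{z \<in> sphere 0 R. cmod (f z) = \<tau>}. {\<theta> \<in> {0..2*pi}. cis \<theta> = z / of_real R})"
      using finite_cis_eq by (intro finite_UN_I)
    moreover have "\<Theta> \<subseteq> (\<Union>z\<in>{z \<in> sphere 0 R. cmod (f z) = \<tau>}. {\<theta> \<in> {0..2*pi}. cis \<theta> = z / of_real R})"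
      using R n by (force simp: \<Theta>_def F_def I_def)
    ultimately show ?thesis by (rule finite_subset[rotated])
  qed
  define \<Phi> where "\<Phi> = (\<Union>\<theta>\<in>\<Theta>. {\<phi> \<in> {0..2*pi}. cis \<phi> = F \<theta> / of_real \<tau>})"
  have fin\<Phi>: "finite \<Phi>" unfolding \<Phi>_def using finite_cis_eq fin\<Theta> by (intro finite_UN_I)
  have inner1: "((\<lambda>\<phi>. K - Q \<phi> \<theta>) has_integral 2 * pi * (K - v \<theta>)) I" if \<theta>: "\<theta> \<in> I" "\<theta> \<notin> \<Theta>" for \<theta>
  proof -
    have a: "((\<lambda>\<phi>. ln (cmod (F \<theta> - of_real \<tau> * cis \<phi>))) has_integral 2 * pi * ln (max (cmod (F \<theta>)) \<tau>)) I"
      unfolding I_def by (rule mean_log_distance_to_circle[OF \<tau>]) (use \<theta> in \<open>simp add: \<Theta>_def\<close>)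
    have b: "((\<lambda>\<phi>. ln (cmod (f 0 - of_real \<tau> * cis \<phi>))) has_integral 2 * pi * ln (max (cmod (f 0)) \<tau>)) I"
      unfolding I_def by (rule mean_log_distance_to_circle[OF \<tau>]) (use f0 in simp)
    have c: "((\<lambda>\<phi>. K) has_integral 2 * pi * K) I"
      using has_integral_const_real[of K 0 "2*pi"] by (simp add: I_def)
    have "v \<theta> = ln (max (cmod (F \<theta>)) \<tau>) - ln (max (cmod (f 0)) \<tau>)"
      using \<tau> f0 Fn0[of \<theta>] by (auto simp: v_def max_def ln_div)
    note v\<theta> = this
    have eq: "2 * pi * (K - v \<theta>) = 2 * pi * K - (2 * pi * ln (max (cmod (F \<theta>)) \<tau>) - 2 * pi * ln (max (cmod (f 0)) \<tau>))"
      unfolding v\<theta> by (simp add: algebra_simps)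
    show ?thesis unfolding eq Q_def by (rule has_integral_diff[OF c has_integral_diff[OF a b]])
  qed
  have good: "f z \<noteq> of_real \<tau> * cis \<phi>" if \<phi>: "\<phi> \<in> I" "\<phi> \<notin> \<Phi>" and z: "cmod z = R" for \<phi> z
  proof
    assume eq: "f z = of_real \<tau> * cis \<phi>"
    define \<theta> where "\<theta> = Arg2pi z"
    have \<theta>: "\<theta> \<in> I" "z = of_real R * cis \<theta>"
      using Arg2pi[of z] z by (auto simp: \<theta>_def I_def is_Arg_def cis_conv_exp)
    then have "F \<theta> = of_real \<tau> * cis \<phi>" using eq by (simp add: F_def)
    then have "\<theta> \<in> \<Theta>" "cis \<phi> = F \<theta> / of_real \<tau>" using \<theta>(1) \<tau> by (auto simp: \<Theta>_def norm_mult)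
    then show False using \<phi> by (auto simp: \<Phi>_def I_def)
  qed
  have inner2: "((\<lambda>\<theta>. K - Q \<phi> \<theta>) has_integral 2 * pi * (K - X (of_real \<tau> * cis \<phi>))) I"
    if \<phi>: "\<phi> \<in> I" "\<phi> \<notin> \<Phi>" for \<phi>
  proof -
    define w where "w = of_real \<tau> * cis \<phi>"
    have w0: "f 0 - w \<noteq> 0" using dist0[of \<phi>] f0 by (auto simp: w_def)
    have a: "((\<lambda>\<theta>. ln (cmod (f (of_real R * cis \<theta>) - w))) has_integral 2 * pi * (ln (cmod (f 0 - w)) + X w)) I"
      unfolding X_def I_def
      by (rule jensen_formula[OF _ R, of "\<lambda>z. f z - w"])
         (use good[OF \<phi>] w0 in \<open>auto simp: w_def intro!: holomorphic_intros hol\<close>)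
    have c: "((\<lambda>\<theta>. K + ln (cmod (f 0 - w))) has_integral 2 * pi * (K + ln (cmod (f 0 - w)))) I"
      using has_integral_const_real[of "K + ln (cmod (f 0 - w))" 0 "2*pi"] by (simp add: I_def)
    show ?thesis
      using has_integral_diff[OF c a] by (simp add: Q_def w_def F_def algebra_simps)
  qed
  have XK: "X (of_real \<tau> * cis \<phi>) < \<eta>" if "\<phi> \<in> I" "\<phi> \<notin> \<Phi>" for \<phi>
    using neg good[OF that] \<tau> unfolding X_def by (force simp: norm_mult)
  \<comment> \<open>Tonelli for the nonnegative integrand \<open>K - Q\<close>.\<close>
  define h where "h = (\<lambda>\<phi> \<theta>. ennreal (K - Q \<phi> \<theta>) * indicator I \<phi> * indicator I \<theta>)"
  have Im [measurable]: "I \<in> sets borel" by (simp add: I_def)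
  have hm: "case_prod h \<in> borel_measurable (lborel \<Otimes>\<^sub>M lborel)"
    unfolding h_def Q_def by measurable
  have fub: "(\<integral>\<^sup>+ \<theta>. (\<integral>\<^sup>+ \<phi>. h \<phi> \<theta> \<partial>lborel) \<partial>lborel) = (\<integral>\<^sup>+ \<phi>. (\<integral>\<^sup>+ \<theta>. h \<phi> \<theta> \<partial>lborel) \<partial>lborel)"
    by (rule lborel_pair.Fubini'[OF hm])
  have Jc: "((\<lambda>\<theta>. 2 * pi * (K - v \<theta>)) has_integral 2 * pi * (2 * pi * K - J)) I"
  proof -
    have c: "((\<lambda>\<theta>. K) has_integral 2 * pi * K) I"
      using has_integral_const_real[of K 0 "2*pi"] by (simp add: I_def)
    show ?thesis by (rule has_integral_mult_right[OF has_integral_diff[OF c J]])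
  qed
  have i1: "(\<integral>\<^sup>+ \<phi>. h \<phi> \<theta> \<partial>lborel) = ennreal (2 * pi * (K - v \<theta>)) * indicator I \<theta>" if "\<theta> \<notin> \<Theta>" for \<theta>
  proof (cases "\<theta> \<in> I")
    case True
    have "(\<integral>\<^sup>+ \<phi>. ennreal (K - Q \<phi> \<theta>) * indicator I \<phi> \<partial>lborel) = ennreal (2 * pi * (K - v \<theta>))"
      by (rule nn_integral_has_integral_lebesgue'[OF _ inner1[OF True that]]) (use QK in simp)
    then show ?thesis using True by (simp add: h_def)
  qed (simp add: h_def)
  have vK: "v \<theta> \<le> K" if "\<theta> \<in> I" "\<theta> \<notin> \<Theta>" for \<theta>
  proof -
    have "0 \<le> 2 * pi * (K - v \<theta>)" by (rule has_integral_nonneg[OF inner1[OF that]]) (use QK in simp)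
    then show ?thesis using pi_gt_zero by (auto simp: zero_le_mult_iff)
  qed
  \<comment> \<open>Outside the exceptional angles the inner integral is known; at them any value in range will do.\<close>
  define v' where "v' = (\<lambda>\<theta>. if \<theta> \<in> \<Theta> then K else v \<theta>)"
  have Jc': "((\<lambda>\<theta>. 2 * pi * (K - v' \<theta>)) has_integral 2 * pi * (2 * pi * K - J)) I"
    by (rule has_integral_spike_finite[OF fin\<Theta> _ Jc]) (simp add: v'_def)
  have AE\<Theta>: "AE \<theta> in lborel. \<theta> \<notin> \<Theta>" using finite_imp_null_set_lborel[OF fin\<Theta>] by (rule AE_not_in)
  have AE\<Phi>: "AE \<phi> in lborel. \<phi> \<notin> \<Phi>" using finite_imp_null_set_lborel[OF fin\<Phi>] by (rule AE_not_in)
  have "(\<integral>\<^sup>+ \<theta>. (\<integral>\<^sup>+ \<phi>. h \<phi> \<theta> \<partial>lborel) \<partial>lborel) = (\<integral>\<^sup>+ \<theta>. ennreal (2 * pi * (K - v' \<theta>)) * indicator I \<theta> \<partial>lborel)"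
    by (rule nn_integral_cong_AE, rule AE_mp[OF AE\<Theta>]) (use i1 in \<open>auto simp: v'_def\<close>)
  also have "\<dots> = ennreal (2 * pi * (2 * pi * K - J))"
    by (rule nn_integral_has_integral_lebesgue'[OF _ Jc']) (use vK in \<open>auto simp: v'_def\<close>)
  finally have lhs: "(\<integral>\<^sup>+ \<theta>. (\<integral>\<^sup>+ \<phi>. h \<phi> \<theta> \<partial>lborel) \<partial>lborel) = ennreal (2 * pi * (2 * pi * K - J))" .
  have i2: "ennreal (2 * pi * (K - \<eta>)) * indicator I \<phi> \<le> (\<integral>\<^sup>+ \<theta>. h \<phi> \<theta> \<partial>lborel)" if "\<phi> \<notin> \<Phi>" for \<phi>
  proof (cases "\<phi> \<in> I")
    case True
    have "(\<integral>\<^sup>+ \<theta>. ennreal (K - Q \<phi> \<theta>) * indicator I \<theta> \<partial>lborel) = ennreal (2 * pi * (K - X (of_real \<tau> * cis \<phi>)))"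
      by (rule nn_integral_has_integral_lebesgue'[OF _ inner2[OF True that]]) (use QK in simp)
    moreover have "ennreal (2 * pi * (K - \<eta>)) \<le> ennreal (2 * pi * (K - X (of_real \<tau> * cis \<phi>)))"
      using XK[OF True that] by (intro ennreal_leI mult_left_mono) auto
    ultimately show ?thesis using True by (simp add: h_def)
  qed simp
  have "(\<integral>\<^sup>+ \<phi>. ennreal (2 * pi * (K - \<eta>)) * indicator I \<phi> \<partial>lborel) \<le> (\<integral>\<^sup>+ \<phi>. (\<integral>\<^sup>+ \<theta>. h \<phi> \<theta> \<partial>lborel) \<partial>lborel)"
    by (rule nn_integral_mono_AE, rule AE_mp[OF AE\<Phi>]) (use i2 in auto)
  moreover have "(\<integral>\<^sup>+ \<phi>. ennreal (2 * pi * (K - \<eta>)) * indicator I \<phi> \<partial>lborel) = ennreal (2 * pi * (K - \<eta>)) * ennreal (2 * pi)"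
    by (simp add: nn_integral_cmult I_def)
  ultimately have le: "ennreal (2 * pi * (K - \<eta>)) * ennreal (2 * pi) \<le> ennreal (2 * pi * (2 * pi * K - J))"
    using lhs fub by simp
  have JK: "0 \<le> 2 * pi * (2 * pi * K - J)"
    by (rule has_integral_nonneg[OF Jc']) (use vK in \<open>auto simp: v'_def\<close>)
  have "2 * pi * (K - \<eta>) * (2 * pi) \<le> 2 * pi * (2 * pi * K - J)"
  proof (cases "0 \<le> K - \<eta>")
    case True
    then have "ennreal (2 * pi * (K - \<eta>) * (2 * pi)) \<le> ennreal (2 * pi * (2 * pi * K - J))"
    proof -
      have "ennreal (2 * pi * (K - \<eta>) * (2 * pi)) = ennreal (2 * pi * (K - \<eta>)) * ennreal (2 * pi)"
        by (rule ennreal_mult) (use True in auto)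
      then show ?thesis using le by simp
    qed
    then show ?thesis using JK by (simp add: ennreal_le_iff)
  next
    case False
    then have "2 * pi * (K - \<eta>) * (2 * pi) \<le> 0" by (simp add: mult_nonneg_nonpos mult_nonpos_nonneg)
    then show ?thesis using JK by linarith
  qed
  then have "2 * pi * (2 * pi * (K - \<eta>)) \<le> 2 * pi * (2 * pi * K - J)" by (simp add: mult_ac)
  then have "2 * pi * (K - \<eta>) \<le> 2 * pi * K - J" by (rule mult_left_le_imp_le) simp
  then show False using J0 by (simp add: right_diff_distrib)
qed

section \<open>Several complex variables along curves\<close>

lemma Cn_norm_nonneg [simp]: "0 \<le> Cn_norm n z"
  by (simp add: Cn_norm_def)

lemma Cn_norm_zero [simp]: "Cn_norm n (\<lambda>_. 0) = 0"
  by (simp add: Cn_norm_def L2_set_def)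

lemma Cn_norm_scale: "Cn_norm n (\<lambda>i. c * z i) = cmod c * Cn_norm n z"
  by (simp add: Cn_norm_def norm_mult L2_set_right_distrib)

lemma Cn_norm_triangle: "Cn_norm n (\<lambda>i. z i + w i) \<le> Cn_norm n z + Cn_norm n w"
proof -
  have "Cn_norm n (\<lambda>i. z i + w i) \<le> L2_set (\<lambda>i. cmod (z i) + cmod (w i)) {..<n}"
    unfolding Cn_norm_def by (intro L2_set_mono norm_triangle_ineq) auto
  also have "\<dots> \<le> Cn_norm n z + Cn_norm n w" unfolding Cn_norm_def by (rule L2_set_triangle_ineq)
  finally show ?thesis .
qed

lemma Cn_norm_pos: "z \<in> Cn n \<Longrightarrow> z \<noteq> (\<lambda>_. 0) \<Longrightarrow> 0 < Cn_norm n z"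
proof -
  assume z: "z \<in> Cn n" "z \<noteq> (\<lambda>_. 0)"
  have "Cn_norm n z \<noteq> 0"
  proof
    assume "Cn_norm n z = 0"
    then have "z i = 0" if "i < n" for i using that by (simp add: Cn_norm_def L2_set_eq_0_iff)
    moreover have "z i = 0" if "\<not> i < n" for i using z(1) that by (simp add: Cn_def)
    ultimately have "z = (\<lambda>_. 0)" by blast
    then show False using z by simp
  qed
  then show ?thesis using Cn_norm_nonneg[of n z] by linarith
qed

lemma Cn_scale: "z \<in> Cn n \<Longrightarrow> (\<lambda>i. c * z i) \<in> Cn n" by (simp add: Cn_def)
lemma Cn_add: "z \<in> Cn n \<Longrightarrow> w \<in> Cn n \<Longrightarrow> (\<lambda>i. z i + w i) \<in> Cn n" by (simp add: Cn_def)
lemma Cn_diff: "z \<in> Cn n \<Longrightarrow> w \<in> Cn n \<Longrightarrow> (\<lambda>i. z i - w i) \<in> Cn n" by (simp add: Cn_def)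

lemma mem_Cn_ball0: "z \<in> Cn_ball0 n \<rho> \<longleftrightarrow> z \<in> Cn n \<and> Cn_norm n z < \<rho>"
  by (simp add: Cn_ball_def)

text \<open>
  The chain rule for a holomorphic curve \<open>c\<close>.  It turns every later question about several variables
  into one about a single complex variable.
\<close>

lemma Cn_holomorphic_compose:
  assumes hol: "Cn_holomorphic_on n f U" and S: "open S"
    and c: "\<And>\<zeta>. \<zeta> \<in> S \<Longrightarrow> c \<zeta> \<in> U" "\<And>\<zeta>. \<zeta> \<in> S \<Longrightarrow> c \<zeta> \<in> Cn n"
    and ci: "\<And>i. i < n \<Longrightarrow> (\<lambda>\<zeta>. c \<zeta> i) holomorphic_on S"
  shows "(\<lambda>\<zeta>. f (c \<zeta>)) holomorphic_on S"
  unfolding holomorphic_on_open[OF S]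
proof
  fix \<zeta>\<^sub>0 assume z0: "\<zeta>\<^sub>0 \<in> S"
  obtain a where a: "\<And>\<epsilon>. \<epsilon> > 0 \<Longrightarrow> \<exists>\<delta>>0. \<forall>h\<in>Cn n. Cn_norm n h < \<delta> \<longrightarrow>
        cmod (f (\<lambda>i. c \<zeta>\<^sub>0 i + h i) - f (c \<zeta>\<^sub>0) - (\<Sum>i<n. a i * h i)) \<le> \<epsilon> * Cn_norm n h"
    using hol c(1)[OF z0] unfolding Cn_holomorphic_on_def by blast
  define d where "d = (\<lambda>i. deriv (\<lambda>\<zeta>. c \<zeta> i) \<zeta>\<^sub>0)"
  define h where "h = (\<lambda>\<zeta> i. c \<zeta> i - c \<zeta>\<^sub>0 i)"
  define q where "q = (\<lambda>\<zeta> i. h \<zeta> i / (\<zeta> - \<zeta>\<^sub>0))"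
  have qd: "((\<lambda>\<zeta>. q \<zeta> i) \<longlongrightarrow> d i) (at \<zeta>\<^sub>0)" if "i < n" for i
  proof -
    have "((\<lambda>\<zeta>. c \<zeta> i) has_field_derivative d i) (at \<zeta>\<^sub>0)"
      unfolding d_def by (rule holomorphic_derivI[OF ci[OF that] S z0])
    then show ?thesis by (simp add: has_field_derivative_iff q_def h_def)
  qed
  have hC: "h \<zeta> \<in> Cn n" if "\<zeta> \<in> S" for \<zeta> unfolding h_def by (rule Cn_diff[OF c(2)[OF that] c(2)[OF z0]])
  have hq: "Cn_norm n (h \<zeta>) = cmod (\<zeta> - \<zeta>\<^sub>0) * Cn_norm n (q \<zeta>)" if "\<zeta> \<noteq> \<zeta>\<^sub>0" for \<zeta>
    using that by (simp add: q_def flip: Cn_norm_scale)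
  have nq: "((\<lambda>\<zeta>. Cn_norm n (q \<zeta>)) \<longlongrightarrow> Cn_norm n d) (at \<zeta>\<^sub>0)"
    unfolding Cn_norm_def L2_set_def by (intro tendsto_intros qd) auto
  have nh: "((\<lambda>\<zeta>. Cn_norm n (h \<zeta>)) \<longlongrightarrow> 0) (at \<zeta>\<^sub>0)"
  proof -
    have "((\<lambda>\<zeta>. cmod (\<zeta> - \<zeta>\<^sub>0) * Cn_norm n (q \<zeta>)) \<longlongrightarrow> cmod (\<zeta>\<^sub>0 - \<zeta>\<^sub>0) * Cn_norm n d) (at \<zeta>\<^sub>0)"
      by (intro tendsto_intros nq)
    moreover have "\<forall>\<^sub>F \<zeta> in at \<zeta>\<^sub>0. cmod (\<zeta> - \<zeta>\<^sub>0) * Cn_norm n (q \<zeta>) = Cn_norm n (h \<zeta>)"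
      using hq by (auto simp: eventually_at_filter)
    ultimately show ?thesis using tendsto_cong by fastforce
  qed
  define R where "R = (\<lambda>\<zeta>. f (c \<zeta>) - f (c \<zeta>\<^sub>0) - (\<Sum>i<n. a i * h \<zeta> i))"
  have inS: "\<forall>\<^sub>F \<zeta> in at \<zeta>\<^sub>0. \<zeta> \<in> S \<and> \<zeta> \<noteq> \<zeta>\<^sub>0"
    using eventually_at_in_open[OF S z0] by (auto elim: eventually_mono)
  have R0: "((\<lambda>\<zeta>. R \<zeta> / (\<zeta> - \<zeta>\<^sub>0)) \<longlongrightarrow> 0) (at \<zeta>\<^sub>0)"
  proof (rule tendstoI)
    fix e :: real assume e: "0 < e"
    define D where "D = Cn_norm n d + 1"
    define \<epsilon> where "\<epsilon> = e / (2 * D)"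
    have dp: "0 < D" unfolding D_def using Cn_norm_nonneg[of n d] by linarith
    have eps: "0 < \<epsilon>" using e dp by (simp add: \<epsilon>_def)
    obtain \<delta> where \<delta>: "0 < \<delta>" "\<And>h. h \<in> Cn n \<Longrightarrow> Cn_norm n h < \<delta> \<Longrightarrow>
        cmod (f (\<lambda>i. c \<zeta>\<^sub>0 i + h i) - f (c \<zeta>\<^sub>0) - (\<Sum>i<n. a i * h i)) \<le> \<epsilon> * Cn_norm n h"
      using a[OF eps] by blast
    have e1: "\<forall>\<^sub>F \<zeta> in at \<zeta>\<^sub>0. Cn_norm n (h \<zeta>) < \<delta>" using order_tendstoD(2)[OF nh \<delta>(1)] .
    have e2: "\<forall>\<^sub>F \<zeta> in at \<zeta>\<^sub>0. Cn_norm n (q \<zeta>) < D" by (rule order_tendstoD(2)[OF nq]) (simp add: D_def)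
    show "\<forall>\<^sub>F \<zeta> in at \<zeta>\<^sub>0. dist (R \<zeta> / (\<zeta> - \<zeta>\<^sub>0)) 0 < e"
      using inS e1 e2
    proof eventually_elim
      case (elim \<zeta>)
      have "(\<lambda>i. c \<zeta>\<^sub>0 i + h \<zeta> i) = c \<zeta>" by (auto simp: h_def)
      then have "cmod (R \<zeta>) \<le> \<epsilon> * Cn_norm n (h \<zeta>)"
        using \<delta>(2)[OF hC elim(2)] elim(1) by (simp add: R_def)
      then have "cmod (R \<zeta> / (\<zeta> - \<zeta>\<^sub>0)) \<le> \<epsilon> * Cn_norm n (q \<zeta>)"
        using elim(1) hq[of \<zeta>] by (simp add: norm_divide divide_le_eq mult_ac)
      also have "\<dots> \<le> \<epsilon> * D" using elim(3) eps by simp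
      also have "\<dots> = e / 2" using dp by (simp add: \<epsilon>_def)
      also have "\<dots> < e" using e by simp
      finally show ?case by simp
    qed
  qed
  have "((\<lambda>\<zeta>. R \<zeta> / (\<zeta> - \<zeta>\<^sub>0) + (\<Sum>i<n. a i * q \<zeta> i)) \<longlongrightarrow> 0 + (\<Sum>i<n. a i * d i)) (at \<zeta>\<^sub>0)"
    by (intro tendsto_intros R0 qd) auto
  moreover have "R \<zeta> / (\<zeta> - \<zeta>\<^sub>0) + (\<Sum>i<n. a i * q \<zeta> i) = (f (c \<zeta>) - f (c \<zeta>\<^sub>0)) / (\<zeta> - \<zeta>\<^sub>0)" for \<zeta>
    by (simp add: R_def q_def diff_divide_distrib sum_divide_distrib)
  ultimately have "((\<lambda>\<zeta>. f (c \<zeta>)) has_field_derivative (\<Sum>i<n. a i * d i)) (at \<zeta>\<^sub>0)"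
    by (simp add: has_field_derivative_iff)
  then show "\<exists>f'. ((\<lambda>\<zeta>. f (c \<zeta>)) has_field_derivative f') (at \<zeta>\<^sub>0)" by blast
qed

lemma Cn_holomorphic_imp_continuous:
  assumes hol: "Cn_holomorphic_on n f U" and z: "z \<in> U" and e: "0 < e"
  shows "\<exists>\<delta>>0. \<forall>h\<in>Cn n. Cn_norm n h < \<delta> \<longrightarrow> cmod (f (\<lambda>i. z i + h i) - f z) < e"
proof -
  obtain a where a: "\<And>\<epsilon>. \<epsilon> > 0 \<Longrightarrow> \<exists>\<delta>>0. \<forall>h\<in>Cn n. Cn_norm n h < \<delta> \<longrightarrow>
        cmod (f (\<lambda>i. z i + h i) - f z - (\<Sum>i<n. a i * h i)) \<le> \<epsilon> * Cn_norm n h"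
    using hol z unfolding Cn_holomorphic_on_def by blast
  obtain \<delta> where \<delta>: "0 < \<delta>" "\<And>h. h \<in> Cn n \<Longrightarrow> Cn_norm n h < \<delta> \<Longrightarrow>
        cmod (f (\<lambda>i. z i + h i) - f z - (\<Sum>i<n. a i * h i)) \<le> 1 * Cn_norm n h"
    using a[of 1] by auto
  define A where "A = (\<Sum>i<n. cmod (a i)) + 1"
  have A: "0 < A" unfolding A_def by (intro add_nonneg_pos sum_nonneg) auto
  have "cmod (f (\<lambda>i. z i + h i) - f z) < e" if h: "h \<in> Cn n" "Cn_norm n h < min \<delta> (e / A)" for h
  proof -
    have hi: "cmod (h i) \<le> Cn_norm n h" if "i < n" for i
      unfolding Cn_norm_def using that by (intro member_le_L2_set) auto
    have "cmod (\<Sum>i<n. a i * h i) \<le> (\<Sum>i<n. cmod (a i) * Cn_norm n h)"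
      by (intro order_trans[OF norm_sum] sum_mono) (auto simp: norm_mult intro!: mult_left_mono hi)
    then have "cmod (f (\<lambda>i. z i + h i) - f z) \<le> 1 * Cn_norm n h + (\<Sum>i<n. cmod (a i) * Cn_norm n h)"
      using \<delta>(2)[OF h(1)] h(2) norm_triangle_sub[of "f (\<lambda>i. z i + h i) - f z" "\<Sum>i<n. a i * h i"] by simp
    also have "\<dots> = A * Cn_norm n h" by (simp add: A_def distrib_right sum_distrib_right)
    also have "\<dots> < e" using h(2) A by (simp add: field_simps)
    finally show ?thesis .
  qed
  then show ?thesis using \<delta>(1) e A by (intro exI[of _ "min \<delta> (e / A)"]) auto
qed

text \<open>
  In the product topology on sequences: the coordinates from \<open>n\<close> on are zero, the others lie in a disc.
\<close>

lemma compact_Cn_cball: "compact {z \<in> Cn n. Cn_norm n z \<le> \<rho>}"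
proof -
  define B where "B = (\<lambda>i. if i < n then cball (0::complex) \<rho> else {0})"
  have cB: "compact (PiE UNIV B)"
  proof -
    have "compactin (product_topology (\<lambda>_. euclidean) UNIV) (PiE UNIV B)"
      by (subst compactin_PiE) (auto simp: B_def compactin_euclidean_iff)
    then show ?thesis by (simp add: euclidean_product_topology compactin_euclidean_iff)
  qed
  have "continuous_on UNIV (\<lambda>z. Cn_norm n z)"
    unfolding Cn_norm_def L2_set_def by (intro continuous_intros continuous_on_product_coordinates)
  then have cl: "closed {z. Cn_norm n z \<le> \<rho>}" by (intro closed_Collect_le continuous_intros) auto
  have "{z \<in> Cn n. Cn_norm n z \<le> \<rho>} = PiE UNIV B \<inter> {z. Cn_norm n z \<le> \<rho>}"
  proof (intro equalityI subsetI)
    fix z assume z: "z \<in> {z \<in> Cn n. Cn_norm n z \<le> \<rho>}"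
    have "cmod (z i) \<le> \<rho>" if "i < n" for i
    proof -
      have "cmod (z i) \<le> Cn_norm n z" unfolding Cn_norm_def using that by (intro member_le_L2_set) auto
      then show ?thesis using z by simp
    qed
    then show "z \<in> PiE UNIV B \<inter> {z. Cn_norm n z \<le> \<rho>}" using z by (auto simp: B_def Cn_def)
  next
    fix z assume z: "z \<in> PiE UNIV B \<inter> {z. Cn_norm n z \<le> \<rho>}"
    have "z i = 0" if "n \<le> i" for i
    proof -
      have "z i \<in> B i" using z by auto
      then show ?thesis using that by (simp add: B_def)
    qed
    then show "z \<in> {z \<in> Cn n. Cn_norm n z \<le> \<rho>}" using z by (auto simp: Cn_def)
  qed
  then show ?thesis using compact_Int_closed[OF cB cl] by simp
qed

lemma slice_in_Cn: "z \<in> Cn n \<Longrightarrow> z(n := w) \<in> Cn (n + 1)"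
  by (auto simp: Cn_def)

lemma Cn_norm_slice: "Cn_norm (n + 1) (z(n := 0)) = Cn_norm n z"
proof -
  have "(\<Sum>i<n. (cmod ((z(n := 0)) i))\<^sup>2) = (\<Sum>i<n. (cmod (z i))\<^sup>2)" by (rule sum.cong) auto
  then show ?thesis by (simp add: Cn_norm_def L2_set_def)
qed

text \<open>
  Compactness of closed balls; unlike on the open domain, suprema over smaller closed balls are finite.
\<close>

lemma slice_bounded:
  assumes hol: "Cn_holomorphic_on (n + 1) g (Cn_prod n (Cn_ball0 n \<rho>) D)" and w: "w \<in> D" and lt: "\<rho>' < \<rho>"
  shows "\<exists>B. \<forall>z\<in>Cn n. Cn_norm n z \<le> \<rho>' \<longrightarrow> cmod (g (z(n := w))) \<le> B"
proof -
  define T where "T = {z \<in> Cn n. Cn_norm n z \<le> \<rho>'}"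
  have "continuous_on T (\<lambda>z. g (z(n := w)))"
    unfolding continuous_on_def
  proof (intro ballI tendstoI)
    fix z e assume z: "z \<in> T" and e: "0 < (e::real)"
    have "z \<in> Cn_ball0 n \<rho>" using z lt by (simp add: T_def mem_Cn_ball0)
    then have "z(n := w) \<in> Cn_prod n (Cn_ball0 n \<rho>) D" using w unfolding Cn_prod_def by blast
    from Cn_holomorphic_imp_continuous[OF hol this e]
    obtain \<delta> where \<delta>: "0 < \<delta>" "\<And>h. h \<in> Cn (n+1) \<Longrightarrow> Cn_norm (n+1) h < \<delta> \<Longrightarrow>
       cmod (g (\<lambda>i. (z(n := w)) i + h i) - g (z(n := w))) < e" by blast
    have "continuous_on T (\<lambda>y. Cn_norm n (\<lambda>i. y i - z i))"
      unfolding Cn_norm_def L2_set_def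
      by (intro continuous_intros continuous_on_subset[OF continuous_on_product_coordinates]) auto
    then have "((\<lambda>y. Cn_norm n (\<lambda>i. y i - z i)) \<longlongrightarrow> Cn_norm n (\<lambda>i. z i - z i)) (at z within T)"
      using z unfolding continuous_on_def by blast
    then have "\<forall>\<^sub>F y in at z within T. Cn_norm n (\<lambda>i. y i - z i) < \<delta>"
      using \<delta>(1) by (intro order_tendstoD(2)) auto
    moreover have "\<forall>\<^sub>F y in at z within T. y \<in> T" by (simp add: eventually_at_filter)
    ultimately show "\<forall>\<^sub>F y in at z within T. dist (g (y(n := w))) (g (z(n := w))) < e"
    proof eventually_elim
      case (elim y)
      define h where "h = (\<lambda>i. y i - z i)(n := 0)"
      have "(\<lambda>i. y i - z i) \<in> Cn n" using elim(2) z by (intro Cn_diff) (auto simp: T_def)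
      then have "h \<in> Cn (n + 1)" unfolding h_def by (rule slice_in_Cn)
      moreover have "Cn_norm (n + 1) h < \<delta>" using elim(1) unfolding h_def Cn_norm_slice .
      moreover have "(\<lambda>i. (z(n := w)) i + h i) = y(n := w)" by (auto simp: h_def)
      ultimately show ?case using \<delta>(2)[of h] by (simp add: dist_norm)
    qed
  qed
  moreover have "compact T" unfolding T_def by (rule compact_Cn_cball)
  ultimately have "compact ((\<lambda>z. g (z(n := w))) ` T)" by (rule compact_continuous_image)
  then obtain B where "\<forall>x\<in>(\<lambda>z. g (z(n := w))) ` T. cmod x \<le> B" using compact_imp_bounded bounded_iff by metis
  then show ?thesis by (auto simp: T_def)
qed

section \<open>The growth condition in one variable\<close>

text \<open>
  Let \<open>m\<close> be the maximum of \<open>cmod f\<close> on the unit disc, attained at \<open>z1\<close>, and rotate \<open>f\<close> so that \<open>f z1 = m\<close>.  Then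
  \<open>exp p * m - f\<close> has nonnegative real part and the small value \<open>(exp p - 1) * m\<close> at \<open>z1\<close>.  Harnack's
  inequality carries the smallness to the centre, so \<open>cmod (f 0)\<close> is close to \<open>m\<close>.
\<close>

lemma growth_small_imp_center_large:
  assumes hol: "f holomorphic_on ball 0 t" and t: "1 < t" and p: "0 \<le> p" and gr: "growth_le t p f"
    and small: "(t + 1) / (t - 1) * p \<le> 1 / 2" and z: "cmod z < t"
  shows "cmod (f z) \<le> exp (2 * ((t + 1) / (t - 1)) * p) * cmod (f 0)"
proof -
  define C where "C = (t + 1) / (t - 1)"
  have C0: "0 \<le> C" using t by (simp add: C_def)
  have contf: "continuous_on (cball 0 1) f"
    by (rule continuous_on_subset[OF holomorphic_on_imp_continuous_on[OF hol]]) (use t in auto)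
  have "cball (0::complex) 1 \<noteq> {}" by simp
  from continuous_attains_sup[OF compact_cball this continuous_on_norm[OF contf]]
  obtain z1 where z1: "cmod z1 \<le> 1" and mx: "\<And>z. cmod z \<le> 1 \<Longrightarrow> cmod (f z) \<le> cmod (f z1)" by auto
  define m where "m = cmod (f z1)"
  have m0: "0 \<le> m" by (simp add: m_def)
  have big: "cmod (f w) \<le> exp p * m" if "cmod w < t" for w
    using gr mx that unfolding growth_le_def m_def by auto
  define \<omega> where "\<omega> = (if f z1 = 0 then 1 else of_real m / f z1)"
  have \<omega>: "cmod \<omega> = 1" "\<omega> * f z1 = of_real m" by (auto simp: \<omega>_def m_def norm_divide)
  define k where "k = (\<lambda>z. of_real (exp p * m) - \<omega> * f z)"
  have holk: "k holomorphic_on ball 0 t" unfolding k_def by (intro holomorphic_intros hol)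
  have Rek: "Re (k w) = exp p * m - Re (\<omega> * f w)" for w by (simp add: k_def)
  have kpos: "0 \<le> Re (k w)" if "cmod w < t" for w
    using big[OF that] complex_Re_le_cmod[of "\<omega> * f w"] \<omega>(1) by (simp add: Rek norm_mult)
  have z1t: "cmod z1 < t" using z1 t by simp
  have "Re (k 0) \<le> (t + cmod z1) / (t - cmod z1) * Re (k z1)" by (rule harnack(2)[OF holk z1t kpos])
  also have "\<dots> \<le> C * Re (k z1)"
    unfolding C_def using z1 t kpos[OF z1t] by (intro mult_right_mono frac_le) auto
  also have "Re (k z1) = (exp p - 1) * m" unfolding Rek \<omega>(2) by (simp add: algebra_simps)
  finally have "exp p * m - cmod (f 0) \<le> C * ((exp p - 1) * m)"
    using complex_Re_le_cmod[of "\<omega> * f 0"] \<omega>(1) unfolding Rek by (simp add: norm_mult)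
  moreover have "C * ((exp p - 1) * m) \<le> C * p * (exp p * m)"
  proof -
    have "exp p * (1 - p) \<le> exp p * exp (- p)" using exp_ge_add_one_self[of "-p"] by (intro mult_left_mono) auto
    then have "exp p - 1 \<le> p * exp p" by (simp add: algebra_simps flip: exp_add)
    then have "C * ((exp p - 1) * m) \<le> C * ((p * exp p) * m)" using m0 C0 by (intro mult_left_mono mult_right_mono) auto
    then show ?thesis by (simp add: mult_ac)
  qed
  ultimately have a: "exp p * m * (1 - C * p) \<le> cmod (f 0)" by (simp add: algebra_simps)
  define y where "y = C * p"
  have y: "0 \<le> y" "y \<le> 1/2" unfolding y_def using small[folded C_def] mult_nonneg_nonneg[OF C0 p] by auto
  have "exp (- (2 * y)) \<le> 1 - y"
  proof -
    have "exp (- (2 * y)) = 1 / exp (2 * y)" by (simp add: exp_minus field_simps)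
    also have "\<dots> \<le> 1 / (1 + 2 * y)" using y exp_ge_add_one_self[of "2 * y"] by (intro divide_left_mono) auto
    also have "\<dots> \<le> 1 - y"
    proof -
      have "1 \<le> (1 - y) * (1 + 2 * y)" using y mult_left_le[of "2*y" y] by (simp add: algebra_simps)
      then show ?thesis using y by (simp add: field_simps)
    qed
    finally show ?thesis .
  qed
  then have "exp p * m * exp (- (2 * y)) \<le> exp p * m * (1 - y)" using m0 by (intro mult_left_mono) auto
  then have "exp p * m * exp (- (2 * y)) \<le> cmod (f 0)" using a unfolding y_def by linarith
  then have "exp (2 * y) * (exp p * m * exp (- (2 * y))) \<le> exp (2 * y) * cmod (f 0)" by (intro mult_left_mono) auto
  moreover have "exp (2 * y) * (exp p * m * exp (- (2 * y))) = exp p * m" by (simp add: exp_minus)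
  ultimately have "exp p * m \<le> exp (2 * y) * cmod (f 0)" by simp
  then show ?thesis using big[OF z] by (simp add: y_def C_def mult_ac)
qed

text \<open>
  Let \<open>m\<close> be the maximum of \<open>cmod \<gamma>\<close> on the disc of radius \<open>\<rho>'\<close>.  The growth assumption bounds \<open>\<gamma> - \<psi>\<close> by
  \<open>exp (p / 2) * m + \<epsilon>\<close> on the circle of radius \<open>\<rho>\<close>, and the division estimate multiplies this by roughly \<open>exp (- 5 / 8 * p)\<close>
  inside.  The product of the two factors is at most \<open>1 - p\<^sub>1 / 10\<close>, and \<open>m \<le> (1 - p\<^sub>1 / 10) * m + 3 * \<epsilon>\<close> results.
\<close>

lemma contraction_step:
  fixes p p\<^sub>1 \<kappa> :: real
  assumes hol: "\<gamma> holomorphic_on ball 0 1" and \<rho>: "0 < \<rho>'" "\<rho>' \<le> \<rho>" "\<rho> < 1"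
    and p: "0 < p\<^sub>1" "p\<^sub>1 \<le> p" "p\<^sub>1 \<le> 1/2" and \<kappa>: "0 \<le> \<kappa>" "\<kappa> \<le> p\<^sub>1 * exp (- p / 2) / 200"
    and dbl: "\<And>B z. (\<And>z. cmod z \<le> \<rho>' \<Longrightarrow> cmod (\<gamma> z) \<le> B) \<Longrightarrow> cmod z \<le> \<rho> \<Longrightarrow> cmod (\<gamma> z) \<le> exp (p / 2) * B"
    and \<psi>: "\<And>z. cmod z \<le> \<rho> \<Longrightarrow> cmod (\<psi> z) \<le> \<epsilon>"
    and est: "\<And>m z. (\<And>z. cmod z = \<rho> \<Longrightarrow> cmod (\<gamma> z - \<psi> z) \<le> m) \<Longrightarrow> cmod z \<le> \<rho>'
      \<Longrightarrow> cmod (\<gamma> z - \<psi> z) \<le> m * (exp (- (5/8) * p) + \<kappa>) / (1 - \<kappa>)"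
    and z: "cmod z \<le> \<rho>'"
  shows "cmod (\<gamma> z) \<le> 30 * \<epsilon> / p\<^sub>1"
proof -
  have contf: "continuous_on (cball 0 \<rho>') \<gamma>"
    by (rule continuous_on_subset[OF holomorphic_on_imp_continuous_on[OF hol]]) (use \<rho> in auto)
  have "cball (0::complex) \<rho>' \<noteq> {}" using \<rho> by simp
  from continuous_attains_sup[OF compact_cball this continuous_on_norm[OF contf]]
  obtain z1 where z1: "cmod z1 \<le> \<rho>'" and mx: "\<And>z. cmod z \<le> \<rho>' \<Longrightarrow> cmod (\<gamma> z) \<le> cmod (\<gamma> z1)" by auto
  define m where "m = cmod (\<gamma> z1)"
  have m0: "0 \<le> m" by (simp add: m_def)
  have e0: "0 \<le> \<epsilon>" using \<psi>[of 0] \<rho> norm_ge_zero order_trans by (metis less_imp_le norm_zero order_trans)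
  have circ: "cmod (\<gamma> z - \<psi> z) \<le> exp (p / 2) * m + \<epsilon>" if "cmod z = \<rho>" for z
    using dbl[of m z] \<psi>[of z] mx that norm_triangle_ineq4[of "\<gamma> z" "\<psi> z"] by (simp add: m_def)
  define b where "b = (exp (- (5/8) * p) + \<kappa>) / (1 - \<kappa>)"
  have ep: "exp (- p / 2) \<le> 1" using p by simp
  have "p\<^sub>1 * exp (- p / 2) \<le> (1/2) * 1" using p ep by (intro mult_mono) auto
  then have \<kappa>2: "\<kappa> \<le> 1/400" using \<kappa> by simp
  have "cmod (\<gamma> z1 - \<psi> z1) \<le> (exp (p / 2) * m + \<epsilon>) * b"
    using est[OF circ z1] by (simp add: b_def)
  then have A: "m \<le> \<epsilon> + (exp (p / 2) * m + \<epsilon>) * b"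
    using \<psi>[of z1] z1 \<rho> norm_triangle_sub[of "\<gamma> z1" "\<psi> z1"] by (simp add: m_def)
  have b2: "b \<le> 2"
  proof -
    have "exp (- (5/8) * p) \<le> 1" using p by simp
    moreover have "x + \<kappa> \<le> 2 * (1 - \<kappa>)" if "x \<le> 1" for x using that \<kappa>2 by argo
    ultimately have "exp (- (5/8) * p) + \<kappa> \<le> 2 * (1 - \<kappa>)" by blast
    then show ?thesis using \<kappa>2 by (simp add: b_def divide_le_eq)
  qed
  \<comment> \<open>The factor \<open>exp (- p / 8)\<close> is left over; it leaves room for \<open>\<kappa>\<close>.\<close>
  have a: "exp (p / 2) * b \<le> 1 - p\<^sub>1 / 10"
  proof -
    have "exp (p / 2) * exp (- (5/8) * p) = exp (- p / 8)" by (simp flip: exp_add)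
    also have "\<dots> \<le> exp (- p\<^sub>1 / 8)" using p by simp
    also have "\<dots> \<le> 1 - 0.117 * p\<^sub>1"
    proof -
      have "exp (- p\<^sub>1 / 8) = 1 / exp (p\<^sub>1 / 8)" by (simp add: exp_minus field_simps)
      also have "\<dots> \<le> 1 / (1 + p\<^sub>1 / 8)" using p exp_ge_add_one_self[of "p\<^sub>1 / 8"] by (intro divide_left_mono) auto
      also have "\<dots> \<le> 1 - 0.117 * p\<^sub>1"
      proof -
        have "p\<^sub>1 * p\<^sub>1 \<le> p\<^sub>1 * (1/2)" using p by (intro mult_left_mono) auto
        then have "1 \<le> (1 - 0.117 * p\<^sub>1) * (1 + p\<^sub>1 / 8)" using p by (simp add: algebra_simps)
        then show ?thesis using p by (simp add: field_simps)
      qed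
      finally show ?thesis .
    qed
    finally have x1: "exp (p / 2) * exp (- (5/8) * p) \<le> 1 - 0.117 * p\<^sub>1" .
    have "exp (p / 2) * \<kappa> \<le> exp (p / 2) * (p\<^sub>1 * exp (- p / 2) / 200)" using \<kappa> by (intro mult_left_mono) auto
    also have "\<dots> = p\<^sub>1 / 200" by (simp add: exp_minus field_simps)
    finally have x2: "exp (p / 2) * \<kappa> \<le> p\<^sub>1 / 200" .
    have "p\<^sub>1 * exp (- p / 2) \<le> p\<^sub>1 * 1" using ep p by (intro mult_left_mono) auto
    then have "\<kappa> \<le> p\<^sub>1 / 200" using \<kappa>(2) by linarith
    then have "(1 - p\<^sub>1 / 10) * (1 - p\<^sub>1 / 200) \<le> (1 - p\<^sub>1 / 10) * (1 - \<kappa>)" using p by (intro mult_left_mono) auto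
    moreover have "1 - 0.117 * p\<^sub>1 + p\<^sub>1 / 200 \<le> (1 - p\<^sub>1 / 10) * (1 - p\<^sub>1 / 200)" using p by (simp add: algebra_simps)
    ultimately have "exp (p / 2) * (exp (- (5/8) * p) + \<kappa>) \<le> (1 - p\<^sub>1 / 10) * (1 - \<kappa>)"
      using x1 x2 by (simp add: distrib_left)
    then show ?thesis using \<kappa>2 by (simp add: b_def divide_le_eq)
  qed
  have "m \<le> \<epsilon> + m * (exp (p / 2) * b) + \<epsilon> * b" using A by (simp add: algebra_simps)
  also have "\<dots> \<le> \<epsilon> + m * (1 - p\<^sub>1 / 10) + \<epsilon> * 2" using a b2 m0 e0 by (intro add_mono mult_left_mono) auto
  finally have "m * p\<^sub>1 \<le> 30 * \<epsilon>" by (simp add: algebra_simps)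
  then have "m \<le> 30 * \<epsilon> / p\<^sub>1" using p by (simp add: field_simps)
  then show ?thesis using mx[OF z] by (simp add: m_def)
qed

section \<open>Blaschke products with many zeros\<close>

lemma finite_zeros_in_ball:
  assumes "F holomorphic_on ball 0 R'" "0 < R" "R < R'" "\<exists>w\<in>ball 0 R'. F w \<noteq> 0"
  shows "finite {z \<in> ball 0 R. F z = 0}"
  using blaschke_factorization[OF assms] by metis

lemma ln_ge_two_quotient:
  assumes "1 \<le> (z::real)" shows "2 * (z - 1) / (z + 1) \<le> ln z"
proof -
  define h where "h = (\<lambda>z::real. ln z - 2 * (z - 1) / (z + 1))"
  have "h 1 \<le> h z"
  proof (rule DERIV_nonneg_imp_nondecreasing[OF assms])
    fix x :: real assume x: "1 \<le> x" "x \<le> z"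
    have "(h has_real_derivative (1 / x - (2 * (x + 1) - 2 * (x - 1)) / ((x + 1) * (x + 1)))) (at x)"
      unfolding h_def using x by (auto intro!: derivative_eq_intros)
    moreover have "1 / x - (2 * (x + 1) - 2 * (x - 1)) / ((x + 1) * (x + 1)) = (x - 1)\<^sup>2 / (x * (x + 1)\<^sup>2)"
    proof -
      have "1 / x - 4 / ((x + 1) * (x + 1)) = (1 * ((x + 1) * (x + 1)) - 4 * x) / (x * ((x + 1) * (x + 1)))"
        by (rule diff_frac_eq) (use x in auto)
      moreover have "1 * ((x + 1) * (x + 1)) - 4 * x = (x - 1)\<^sup>2" by (simp add: power2_eq_square algebra_simps)
      ultimately show ?thesis by (simp add: power2_eq_square)
    qed
    moreover have "0 \<le> (x - 1)\<^sup>2 / (x * (x + 1)\<^sup>2)" using x by simp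
    ultimately show "\<exists>y. (h has_real_derivative y) (at x) \<and> 0 \<le> y" by metis
  qed
  then show ?thesis by (simp add: h_def)
qed

lemma blaschke_product_le:
  fixes c :: "complex \<Rightarrow> real"
  assumes \<rho>: "0 < \<rho>" and fin: "finite {z \<in> ball 0 \<rho>. F z = 0}" and Z: "Z \<subseteq> {z \<in> ball 0 \<rho>. F z = 0}"
    and b: "\<And>a. a \<in> Z \<Longrightarrow> cmod (blaschke \<rho> a z) \<le> exp (- c a)" and z: "cmod z \<le> \<rho>"
    and tot: "\<beta> \<le> (\<Sum>a\<in>Z. nat (zorder F a) * c a)"
  shows "(\<Prod>a\<in>{z \<in> ball 0 \<rho>. F z = 0}. cmod (blaschke \<rho> a z) ^ nat (zorder F a)) \<le> exp (- \<beta>)"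
proof -
  let ?A = "{z \<in> ball 0 \<rho>. F z = 0}"
  let ?n = "\<lambda>a. nat (zorder F a)"
  have le1: "cmod (blaschke \<rho> a z) \<le> 1" if "a \<in> ?A" for a
    using blaschke_norm_le_1[OF \<rho> _ z, of a] that by simp
  have "(\<Prod>a\<in>?A. cmod (blaschke \<rho> a z) ^ ?n a)
     = (\<Prod>a\<in>?A - Z. cmod (blaschke \<rho> a z) ^ ?n a) * (\<Prod>a\<in>Z. cmod (blaschke \<rho> a z) ^ ?n a)"
    by (rule prod.subset_diff[OF Z fin])
  also have "\<dots> \<le> 1 * (\<Prod>a\<in>Z. cmod (blaschke \<rho> a z) ^ ?n a)"
    using le1 by (intro mult_right_mono prod_le_1 prod_nonneg) (auto intro!: power_le_one)
  also have "\<dots> \<le> 1 * (\<Prod>a\<in>Z. exp (- c a) ^ ?n a)"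
    using b by (intro mult_left_mono prod_mono conjI power_mono) auto
  also have "(\<Prod>a\<in>Z. exp (- c a) ^ ?n a) = (\<Prod>a\<in>Z. exp (- (?n a * c a)))"
    by (intro prod.cong refl) (metis exp_of_nat_mult mult_minus_right)
  also have "\<dots> = exp (- (\<Sum>a\<in>Z. ?n a * c a))"
    using finite_subset[OF Z fin] by (simp add: exp_sum flip: sum_negf)
  also have "1 * \<dots> \<le> exp (- \<beta>)" using tot by simp
  finally show ?thesis .
qed

text \<open>
  On \<open>cmod z \<le> \<rho> / u\<close>, the Blaschke factor of a zero in the disc of radius \<open>1 / u\<close> is at most
  \<open>(7 * u + 1) / (3 * u\<^sup>2 + u + 4)\<close>, the value for antipodal points and the smallest admissible \<open>\<rho>\<close>.  With
  \<open>x = (u - 1)\<^sup>2 / (2 * u)\<close> its inverse is at least \<open>1 + 3 / 4 * x\<close>, and the logarithm in the bound of \<open>\<beta>\<close> is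
  \<open>ln (1 + x)\<close>; compare \<open>(1 + x) ^ 3\<close> with \<open>(1 + 3 / 4 * x) ^ 4\<close>.
\<close>

lemma product_le_from_inner_zeros:
  fixes u :: real
  assumes u: "1 < u" and \<rho>: "1 - (u - 1) / (4 * u) \<le> \<rho>" "\<rho> < 1"
    and hol: "F holomorphic_on ball 0 1" and nz: "\<exists>w\<in>ball 0 1. F w \<noteq> 0"
    and N: "N \<le> (\<Sum>a\<in>{z \<in> ball 0 (1 / u). F z = 0}. real (nat (zorder F a)))"
    and \<beta>: "\<beta> \<le> 3 / 4 * ln ((1 + u\<^sup>2) / (2 * u)) * N" and z: "cmod z \<le> \<rho> / u"
  shows "(\<Prod>a\<in>{z \<in> ball 0 \<rho>. F z = 0}. cmod (blaschke \<rho> a z) ^ nat (zorder F a)) \<le> exp (- \<beta>)"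
proof -
  define L where "L = ln ((1 + u\<^sup>2) / (2 * u))"
  define \<rho>\<^sub>0 where "\<rho>\<^sub>0 = 1 - (u - 1) / (4 * u)"
  have r0: "\<rho>\<^sub>0 = (3 * u + 1) / (4 * u)" using u by (simp add: \<rho>\<^sub>0_def field_simps)
  have iu: "1 / u < \<rho>\<^sub>0" unfolding r0 using u by (simp add: field_simps)
  have \<rho>0: "0 < \<rho>" "1 / u < \<rho>" using iu \<rho> u by (auto simp: \<rho>\<^sub>0_def intro: less_le_trans[of 0 "1/u"])
  have uu: "1 < u\<^sup>2" using u by (simp add: one_less_power)
  have L0: "0 \<le> L"
  proof -
    have "2 * u \<le> 1 + u\<^sup>2" using sum_squares_bound[of 1 u] by simp
    then have "1 \<le> (1 + u\<^sup>2) / (2 * u)" using u by simp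
    then show ?thesis by (simp add: L_def)
  qed
  have fin: "finite {z \<in> ball 0 \<rho>. F z = 0}" by (rule finite_zeros_in_ball[OF hol \<rho>0(1) \<rho>(2) nz])
  have "ln ((3 * u\<^sup>2 + u + 4) / (7 * u + 1)) \<ge> 3 / 4 * L"
  proof -
    define x where "x = (u - 1)\<^sup>2 / (2 * u)"
    have x0: "0 \<le> x" using u by (simp add: x_def)
    have Lx: "L = ln (1 + x)" using u by (simp add: L_def x_def field_simps power2_eq_square)
    have "(1 + x) ^ 3 \<le> (1 + 3 / 4 * x) ^ 4"
    proof -
      define y where "y = x / 4"
      have xy: "x = 4 * y" by (simp add: y_def)
      have y0: "0 \<le> y" using x0 by (simp add: y_def)
      have "(1 + 3 * y) ^ 4 - (1 + 4 * y) ^ 3 = 6 * y\<^sup>2 + 44 * y ^ 3 + 81 * y ^ 4"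
        by (simp add: eval_nat_numeral algebra_simps)
      moreover have "0 \<le> 6 * y\<^sup>2 + 44 * y ^ 3 + 81 * y ^ 4" using y0 by simp
      ultimately show ?thesis by (simp add: xy)
    qed
    then have "ln ((1 + x) ^ 3) \<le> ln ((1 + 3 / 4 * x) ^ 4)" using x0 by (subst ln_le_cancel_iff) auto
    then have "3 * ln (1 + x) \<le> 4 * ln (1 + 3 / 4 * x)" by (simp add: ln_realpow)
    then have "3 / 4 * L \<le> ln (1 + 3 / 4 * x)" by (simp add: Lx)
    also have "\<dots> \<le> ln ((3 * u\<^sup>2 + u + 4) / (7 * u + 1))"
    proof -
      have "1 + 3 / 4 * x \<le> (3 * u\<^sup>2 + u + 4) / (7 * u + 1)"
      proof -
        have "(3 * u\<^sup>2 + u + 4) / (7 * u + 1) = 1 + 3 * (u - 1)\<^sup>2 / (7 * u + 1)"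
          using u by (simp add: field_simps power2_eq_square)
        moreover have "3 / 4 * x = 3 * (u - 1)\<^sup>2 / (8 * u)" by (simp add: x_def)
        moreover have "3 * (u - 1)\<^sup>2 / (8 * u) \<le> 3 * (u - 1)\<^sup>2 / (7 * u + 1)" using u by (intro divide_left_mono) auto
        ultimately show ?thesis by simp
      qed
      then show ?thesis using x0 by (subst ln_le_cancel_iff) (auto intro: less_le_trans[of 0 "1 + 3/4*x"])
    qed
    finally show ?thesis by simp
  qed
  note key = this
  show ?thesis
  proof (rule blaschke_product_le[where Z = "{z \<in> ball 0 (1 / u). F z = 0}" and c = "\<lambda>_. 3 / 4 * L", OF \<rho>0(1) fin])
    show "{z \<in> ball 0 (1 / u). F z = 0} \<subseteq> {z \<in> ball 0 \<rho>. F z = 0}" using \<rho>0 by auto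
    show "cmod z \<le> \<rho>" using z u \<rho>0 by (smt (verit) divide_le_eq mult_le_cancel_left1)
    have "3 / 4 * L * N \<le> 3 / 4 * L * (\<Sum>a\<in>{z \<in> ball 0 (1 / u). F z = 0}. real (nat (zorder F a)))"
      using N L0 by (intro mult_left_mono) auto
    then show "\<beta> \<le> (\<Sum>a\<in>{z \<in> ball 0 (1 / u). F z = 0}. real (nat (zorder F a)) * (3 / 4 * L))"
      using \<beta> unfolding sum_distrib_right[symmetric] L_def[symmetric] by (simp only: mult.commute)
    show "cmod (blaschke \<rho> a z) \<le> exp (- (3 / 4 * L))" if a: "a \<in> {z \<in> ball 0 (1 / u). F z = 0}" for a
    proof -
      have pu: "\<rho> / u \<le> \<rho>" using u \<rho>0 by (simp add: divide_le_eq)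
      have "cmod (blaschke \<rho> a z) \<le> \<rho> * (\<rho> / u + 1 / u) / (\<rho>\<^sup>2 + \<rho> / u * (1 / u))"
        using a \<rho>0 z pu by (intro blaschke_norm_le) auto
      also have "\<dots> = (\<rho> + 1) * u / (\<rho> * u\<^sup>2 + 1)"
      proof -
        have "\<rho> * (\<rho> / u + 1 / u) = \<rho> / u\<^sup>2 * ((\<rho> + 1) * u)" "\<rho>\<^sup>2 + \<rho> / u * (1 / u) = \<rho> / u\<^sup>2 * (\<rho> * u\<^sup>2 + 1)"
          using u by (simp_all add: field_simps power2_eq_square)
        then show ?thesis using \<rho>0 u by simp
      qed
      also have "\<dots> \<le> (\<rho>\<^sub>0 + 1) * u / (\<rho>\<^sub>0 * u\<^sup>2 + 1)"
      proof -
        have p0: "0 < \<rho>\<^sub>0" using iu u by (smt (verit) zero_less_divide_1_iff)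
        have "(\<rho>\<^sub>0 - \<rho>) * (u\<^sup>2 - 1) \<le> 0" using \<rho> uu by (intro mult_nonpos_nonneg) (auto simp: \<rho>\<^sub>0_def)
        then have "(\<rho> + 1) * (\<rho>\<^sub>0 * u\<^sup>2 + 1) \<le> (\<rho>\<^sub>0 + 1) * (\<rho> * u\<^sup>2 + 1)" by (simp add: algebra_simps)
        then have "(\<rho> + 1) * (\<rho>\<^sub>0 * u\<^sup>2 + 1) * u \<le> (\<rho>\<^sub>0 + 1) * (\<rho> * u\<^sup>2 + 1) * u" using u by (intro mult_right_mono) auto
        moreover have "0 < \<rho> * u\<^sup>2 + 1" "0 < \<rho>\<^sub>0 * u\<^sup>2 + 1" using \<rho>0 p0 u by (auto intro!: add_pos_pos mult_pos_pos)
        ultimately show ?thesis by (simp add: divide_le_eq le_divide_eq mult_ac)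
      qed
      also have "\<dots> = (7 * u + 1) / (3 * u\<^sup>2 + u + 4)"
      proof -
        have eqs: "(\<rho>\<^sub>0 + 1) * u = (7 * u + 1) / 4" "\<rho>\<^sub>0 * u\<^sup>2 + 1 = (3 * u\<^sup>2 + u + 4) / 4"
          unfolding r0 using u by (simp_all add: field_simps power2_eq_square)
        have "(a / 4) / (b / 4) = a / b" for a b :: real by simp
        then show ?thesis unfolding eqs .
      qed
      also have "\<dots> = exp (- ln ((3 * u\<^sup>2 + u + 4) / (7 * u + 1)))"
        using u by (simp add: exp_minus add_pos_pos)
      also have "\<dots> \<le> exp (- (3 / 4 * L))" using key by simp
      finally show ?thesis .
    qed
  qed
qed

text \<open>
  This converts the weights \<open>ln (R / cmod a)\<close> of Jensen's formula into decay of the Blaschke product.  With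
  \<open>X = cmod a / \<rho>\<close> and \<open>Y = 1 / u\<close> the factor of \<open>a\<close> is at most \<open>(X + Y) / (1 + X * Y)\<close>, and minus its
  logarithm is at least \<open>2 * ((1 - X) / (1 + X)) * ((1 - Y) / (1 + Y))\<close>.  In terms of \<open>x = - ln X\<close> the quotient
  with \<open>X\<close> is at least \<open>x / (2 + x)\<close>, and \<open>x \<le> ln s\<close> since no zero is closer to the centre than \<open>1 / s\<close>.
\<close>

lemma product_le_from_deep_zeros:
  fixes u :: real
  assumes u: "1 < u" and \<rho>: "0 < \<rho>" "\<rho> < 1" and R: "R \<le> \<rho>" "0 < R"
    and hol: "F holomorphic_on ball 0 1" and nz: "\<exists>w\<in>ball 0 1. F w \<noteq> 0"
    and s: "1 \<le> s" "\<And>a. cmod a < 1 / s \<Longrightarrow> F a \<noteq> 0"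
    and \<eta>: "\<eta> \<le> (\<Sum>a\<in>{z \<in> ball 0 R. F z = 0}. nat (zorder F a) * ln (R / cmod a))"
    and \<beta>: "\<beta> \<le> 2 * (u - 1) / ((u + 1) * (2 + ln s)) * \<eta>" and z: "cmod z \<le> \<rho> / u"
  shows "(\<Prod>a\<in>{z \<in> ball 0 \<rho>. F z = 0}. cmod (blaschke \<rho> a z) ^ nat (zorder F a)) \<le> exp (- \<beta>)"
proof -
  define C where "C = 2 * (u - 1) / ((u + 1) * (2 + ln s))"
  have ls: "0 \<le> ln s" using s by simp
  have C0: "0 \<le> C" using u ls by (simp add: C_def)
  have fin: "finite {z \<in> ball 0 \<rho>. F z = 0}" by (rule finite_zeros_in_ball[OF hol \<rho> nz])
  show ?thesis
  proof (rule blaschke_product_le[where Z = "{z \<in> ball 0 R. F z = 0}" and c = "\<lambda>a. C * ln (R / cmod a)", OF \<rho>(1) fin])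
    show "{z \<in> ball 0 R. F z = 0} \<subseteq> {z \<in> ball 0 \<rho>. F z = 0}" using R by auto
    show "cmod z \<le> \<rho>" using z u \<rho> by (smt (verit) divide_le_eq mult_le_cancel_left1)
    have "C * \<eta> \<le> C * (\<Sum>a\<in>{z \<in> ball 0 R. F z = 0}. nat (zorder F a) * ln (R / cmod a))"
      using \<eta> C0 by (rule mult_left_mono)
    then show "\<beta> \<le> (\<Sum>a\<in>{z \<in> ball 0 R. F z = 0}. nat (zorder F a) * (C * ln (R / cmod a)))"
      using \<beta> by (simp add: C_def sum_distrib_left mult_ac)
    show "cmod (blaschke \<rho> a z) \<le> exp (- (C * ln (R / cmod a)))" if a: "a \<in> {z \<in> ball 0 R. F z = 0}" for a
    proof -
      have aR: "cmod a < R" using a by simp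
      have as: "1 / s \<le> cmod a" using s(2)[of a] a by force
      then have a0: "0 < cmod a" using s by (smt (verit) zero_less_divide_1_iff)
      define X where "X = cmod a / \<rho>"
      define Y where "Y = 1 / u"
      have X: "0 < X" "X < 1" using a0 aR R by (auto simp: X_def)
      have Y: "0 < Y" "Y < 1" using u by (auto simp: Y_def)
      define b where "b = (X + Y) / (1 + X * Y)"
      have d: "0 < 1 + X * Y" using X Y by (intro add_pos_pos) auto
      have b0: "0 < b" using X Y d by (auto simp: b_def)
      have "cmod (blaschke \<rho> a z) \<le> \<rho> * (\<rho> / u + cmod a) / (\<rho>\<^sup>2 + \<rho> / u * cmod a)"
        using a R \<rho> u z by (intro blaschke_norm_le) (auto simp: divide_le_eq)
      also have "\<dots> = b"
      proof -
        have "\<rho> * (\<rho> / u + cmod a) = \<rho>\<^sup>2 * (X + Y)" "\<rho>\<^sup>2 + \<rho> / u * cmod a = \<rho>\<^sup>2 * (1 + X * Y)"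
          using \<rho> u by (simp_all add: X_def Y_def field_simps power2_eq_square)
        then show ?thesis using \<rho> by (simp add: b_def)
      qed
      also have "b = exp (- ln (1 / b))" using b0 by (simp add: ln_div)
      also have "\<dots> \<le> exp (- (C * ln (R / cmod a)))"
      proof -
        define x where "x = ln (\<rho> / cmod a)"
        have x0: "0 \<le> x" using aR R a0 by (simp add: x_def)
        have Xe: "X = exp (- x)" using a0 \<rho> by (simp add: x_def X_def exp_minus field_simps)
        have b1: "b \<le> 1"
        proof -
          have "0 \<le> (1 - X) * (1 - Y)" using X Y by simp
          then have "X + Y \<le> 1 + X * Y" by (simp add: algebra_simps)
          then show ?thesis using d by (simp add: b_def)
        qed
        have "2 * (1 / b - 1) / (1 / b + 1) \<le> ln (1 / b)" by (rule ln_ge_two_quotient) (use b0 b1 in simp)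
        moreover have "2 * (1 / b - 1) / (1 / b + 1) = 2 * ((1 - X) / (1 + X)) * ((1 - Y) / (1 + Y))"
        proof -
          have "2 * (1 / b - 1) / (1 / b + 1) = 2 * (1 - b) / (1 + b)"
          proof -
            have "1 / b - 1 = (1 - b) / b" "1 / b + 1 = (1 + b) / b"
              using b0 by (simp_all add: diff_divide_distrib add_divide_distrib)
            then show ?thesis using b0 by simp
          qed
          also have "1 - b = (1 - X) * (1 - Y) / (1 + X * Y)" using d by (simp add: b_def field_simps)
          also have "1 + b = (1 + X) * (1 + Y) / (1 + X * Y)" using d by (simp add: b_def field_simps)
          finally show ?thesis using d by simp
        qed
        moreover have "(1 - Y) / (1 + Y) = (u - 1) / (u + 1)"
        proof -
          have "1 - Y = (u - 1) / u" "1 + Y = (u + 1) / u"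
            using u by (simp_all add: Y_def diff_divide_distrib add_divide_distrib)
          then show ?thesis using u by simp
        qed
        moreover have "x / (2 + x) \<le> (1 - X) / (1 + X)"
        proof -
          have "X * (1 + x) \<le> X * exp x" using exp_ge_add_one_self[of x] X by (intro mult_left_mono) auto
          also have "\<dots> = 1" by (simp add: Xe flip: exp_add)
          finally have "x * (1 + X) \<le> (1 - X) * (2 + x)" by (simp add: algebra_simps)
          then show ?thesis using X x0 by (simp add: divide_le_eq le_divide_eq)
        qed
        moreover have "ln (R / cmod a) / (2 + ln s) \<le> x / (2 + x)"
        proof -
          have y: "0 \<le> ln (R / cmod a)" using aR a0 by simp
          have yx: "ln (R / cmod a) \<le> x"
            unfolding x_def using R a0 \<rho> by (subst ln_le_cancel_iff) (auto simp: divide_right_mono)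
          have ys: "x \<le> ln s"
          proof -
            have "\<rho> / cmod a \<le> 1 / (1 / s)" using \<rho> as s a0 by (intro frac_le) auto
            then show ?thesis unfolding x_def using \<rho> a0 s by (subst ln_le_cancel_iff) auto
          qed
          show ?thesis using y yx ys x0 by (intro frac_le) auto
        qed
        ultimately have "2 * (ln (R / cmod a) / (2 + ln s)) * ((u - 1) / (u + 1)) \<le> ln (1 / b)"
          using u by (smt (verit, best) divide_nonneg_nonneg mult_left_mono mult_right_mono)
        moreover have "2 * e / (f * g) * x = 2 * (x / g) * (e / f)" for e f g x :: real by (simp add: mult_ac)
        ultimately have "C * ln (R / cmod a) \<le> ln (1 / b)" unfolding C_def by metis
        then show ?thesis by simp
      qed
      finally show ?thesis .
    qed
  qed
qed

lemma zorder_scale: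
  assumes hol: "F holomorphic_on ball 0 \<rho>" and nz: "\<exists>w\<in>ball 0 \<rho>. F w \<noteq> 0" and r: "0 < r" and a: "cmod (of_real r * a) < \<rho>"
  shows "zorder (\<lambda>z. F (of_real r * z)) a = zorder F (of_real r * a)"
proof -
  let ?b = "of_real r * a"
  have b: "?b \<in> ball 0 \<rho>" using a by simp
  obtain H where H: "H holomorphic_on ball 0 \<rho>" "H ?b \<noteq> 0" "\<And>z. z \<in> ball 0 \<rho> \<Longrightarrow> F z = (z - ?b) ^ nat (zorder F ?b) * H z"
    using extract_zero[OF hol open_ball connected_ball b nz] by blast
  have "zorder F ?b \<ge> 0"
    using zorder_exist_zero[OF hol open_ball connected_ball b nz] by (auto split: if_splits)
  define m where "m = nat (zorder F ?b)"
  define S where "S = ball (0::complex) (\<rho> / r)"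
  have inS: "of_real r * z \<in> ball 0 \<rho>" if "z \<in> S" for z
    using that r by (simp add: S_def norm_mult field_simps)
  have "(H \<circ> (\<lambda>z. of_real r * z)) holomorphic_on S"
    by (rule holomorphic_on_compose_gen[OF _ H(1)]) (use inS in \<open>auto intro!: holomorphic_intros simp del: mem_ball mem_ball_0\<close>)
  then have "(\<lambda>z. of_real r ^ m * H (of_real r * z)) holomorphic_on S" unfolding o_def by (intro holomorphic_intros)
  then have "zorder (\<lambda>z. F (of_real r * z)) a = int m"
  proof (rule zorder_eqI[rotated 2])
    show "a \<in> S" using a r by (simp add: S_def norm_mult field_simps)
    show "F (of_real r * w) = of_real r ^ m * H (of_real r * w) * (w - a) powi int m" if "w \<in> S" "w \<noteq> a" for w
      unfolding H(3)[OF inS[OF that(1)]] m_def[symmetric] by (simp add: power_mult_distrib flip: right_diff_distrib)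
  qed (use r H(2) in \<open>auto simp: S_def\<close>)
  then show ?thesis using \<open>zorder F ?b \<ge> 0\<close> by (simp add: m_def)
qed

section \<open>Lines on which a value is taken often\<close>

lemma sup_abs_le_iff: "sup_abs f S \<le> ereal B \<longleftrightarrow> (\<forall>z\<in>S. cmod (f z) \<le> B)"
  by (simp add: sup_abs_def SUP_le_iff)

lemma le_sup_abs: "z \<in> S \<Longrightarrow> ereal (cmod (f z)) \<le> sup_abs f S"
  using SUP_upper[of z S "\<lambda>z. ereal (cmod (f z))"] by (simp add: sup_abs_def)

lemma less_sup_absE:
  assumes "ereal x < sup_abs f S" obtains z where "z \<in> S" "x < cmod (f z)"
  using assms unfolding sup_abs_def less_SUP_iff by auto

lemma line_holomorphic:
  assumes "Cn_holomorphic_on n f (Cn_ball0 n (t * r))" "0 < r" "v \<in> Cn n" "Cn_norm n v = r"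
  shows "(\<lambda>\<zeta>. f (\<lambda>i. \<zeta> * v i)) holomorphic_on ball 0 t"
  by (rule Cn_holomorphic_compose[OF assms(1)])
     (use assms in \<open>auto simp: mem_Cn_ball0 Cn_scale Cn_norm_scale intro!: holomorphic_intros\<close>)

text \<open>
  The ratio hypothesis makes \<open>f\<close> smaller, by the factor \<open>t\<close>, at the centre than at the points of the ball of radius
  \<open>r / t\<close> where it is almost maximal.  So \<open>f\<close> varies on the line through such a point.
\<close>

lemma real_sup_and_center:
  assumes r: "0 < r" and t: "1 < t" and M1: "0 < M1" "ereal M1 \<le> sup_abs f (Cn_ball0 n (r / t))"
    and M2: "sup_abs f (Cn_ball0 n (t * r)) \<le> ereal M2" and R: "ereal t \<le> R_ratio n f r t (t\<^sup>2)"
  obtains A where "sup_abs f (Cn_ball0 n (r / t)) = ereal A" "M1 \<le> A" "A \<le> M2" "cmod (f (\<lambda>_. 0)) \<le> A / t"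
proof -
  have rt: "r / t \<le> t * r" using t r by (simp add: divide_le_eq) (metis less_eq_real_def mult_le_cancel_left1 mult_mono order_trans zero_le_one)
  have "sup_abs f (Cn_ball0 n (r / t)) \<le> ereal M2"
    unfolding sup_abs_le_iff using M2[unfolded sup_abs_le_iff] rt by (auto simp: mem_Cn_ball0)
  then obtain A where A: "sup_abs f (Cn_ball0 n (r / t)) = ereal A" "M1 \<le> A" "A \<le> M2"
    using M1 by (cases "sup_abs f (Cn_ball0 n (r / t))") auto
  define S where "S = sup_abs f (Cn_ball0 n (r / t\<^sup>2))"
  have z0: "(\<lambda>_. 0) \<in> Cn_ball0 n (r / t\<^sup>2)" using r t by (simp add: mem_Cn_ball0 Cn_def)
  have f0: "ereal (cmod (f (\<lambda>_. 0))) \<le> S" unfolding S_def by (rule le_sup_abs[OF z0])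
  have RA: "ereal t \<le> ereal A / S" using R A(1) by (simp add: R_ratio_def S_def)
  have "r / t\<^sup>2 \<le> r / t" using r t by (intro divide_left_mono) (auto simp: power2_eq_square)
  then have "S \<le> ereal A"
    unfolding S_def sup_abs_le_iff using A(1) le_sup_abs[of _ "Cn_ball0 n (r / t)" f]
    by (force simp: mem_Cn_ball0)
  moreover have "0 \<le> S" using f0 by (metis ereal_less_eq(5) norm_ge_zero order_trans)
  ultimately obtain x where x: "S = ereal x" "0 \<le> x" by (cases S) auto
  have "cmod (f (\<lambda>_. 0)) \<le> A / t"
  proof (cases "x = 0")
    case True
    then show ?thesis using f0 x A M1 t by simp
  next
    case False
    then have "t \<le> A / x" using RA x by simp
    then have "x \<le> A / t" using False x t by (simp add: field_simps)
    then show ?thesis using f0 x by simp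
  qed
  then show ?thesis using that A by blast
qed

lemma direction_of_point:
  assumes z: "z \<in> Cn_ball0 n x" "z \<noteq> (\<lambda>_. 0)" and r: "0 < r"
  obtains v \<zeta> where "v \<in> Cn n" "Cn_norm n v = r" "cmod \<zeta> < x / r" "z = (\<lambda>i. \<zeta> * v i)"
proof -
  define N where "N = Cn_norm n z"
  have N: "0 < N" "N < x" "z \<in> Cn n" using z Cn_norm_pos[of z n] by (auto simp: N_def mem_Cn_ball0)
  define v where "v = (\<lambda>i. of_real (r / N) * z i)"
  have "Cn_norm n v = r" unfolding v_def Cn_norm_scale using N r by (simp add: N_def norm_divide)
  moreover have "v \<in> Cn n" unfolding v_def by (rule Cn_scale[OF N(3)])
  moreover have "cmod (of_real (N / r)) < x / r" using N r by (simp add: norm_divide divide_strict_right_mono)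
  moreover have "z = (\<lambda>i. of_real (N / r) * v i)" using N r by (auto simp: v_def)
  ultimately show ?thesis using that by blast
qed

text \<open>
  Whatever \<open>w\<close> is, it is far from one of two values that are far apart.
\<close>

lemma separated_value:
  fixes a b w :: complex
  assumes "x \<le> cmod (a - b)" shows "x / 2 \<le> cmod (a - w) \<or> x / 2 \<le> cmod (b - w)"
  using assms norm_triangle_ineq4[of "a - w" "b - w"] by simp argo

lemma valency_zeros:
  assumes hol: "F holomorphic_on ball 0 t" and r: "0 < r" and u: "0 < u" "1 / u < t"
    and ncon: "\<And>c. \<exists>z\<in>ball 0 t. F z \<noteq> c" and F: "F = (\<lambda>\<zeta>. \<phi> (of_real r * \<zeta>))"
    and x: "0 \<le> x" "ereal x < valency \<phi> (r / u) 0"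
  obtains w where "w \<in> F ` ball 0 (1 / u)" "x \<le> (\<Sum>a\<in>{z \<in> ball 0 (1 / u). F z - w = 0}. real (nat (zorder (\<lambda>z. F z - w) a)))"
proof -
  obtain c where c: "ereal x < zero_count (\<lambda>z. \<phi> z + c) (r / u) 0"
    using x(2) unfolding valency_def less_SUP_iff by auto
  define w where "w = - c"
  define Z where "Z = {z \<in> ball 0 (r / u). \<phi> z + c = 0}"
  define Z' where "Z' = {z \<in> ball 0 (1 / u). F z - w = 0}"
  have holw: "(\<lambda>z. F z - w) holomorphic_on ball 0 t" by (intro holomorphic_intros hol)
  have nz: "\<exists>z\<in>ball 0 t. F z - w \<noteq> 0" using ncon[of w] by auto
  have finZ': "finite Z'" unfolding Z'_def by (rule finite_zeros_in_ball[OF holw _ u(2) nz]) (use u in simp)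
  have bij: "bij_betw (\<lambda>a. of_real r * a) Z' Z"
  proof (rule bij_betwI[where g = "\<lambda>z. z / of_real r"])
    show "(\<lambda>a. of_real r * a) \<in> Z' \<rightarrow> Z" using r u by (auto simp: Z_def Z'_def F w_def norm_mult field_simps)
    show "(\<lambda>z. z / of_real r) \<in> Z \<rightarrow> Z'" using r u by (auto simp: Z_def Z'_def F w_def norm_divide field_simps)
  qed (use r in auto)
  have finZ: "finite Z" using bij_betw_finite[OF bij] finZ' by simp
  have "Z \<noteq> ball 0 (r / u)"
  proof
    assume "Z = ball 0 (r / u)"
    then have "zero_count (\<lambda>z. \<phi> z + c) (r / u) 0 = - \<infinity>" by (simp add: zero_count_def Z_def)
    then show False using c by simp
  qed
  then have zc: "zero_count (\<lambda>z. \<phi> z + c) (r / u) 0 = ereal (\<Sum>z\<in>Z. real_of_int (zorder (\<lambda>z. \<phi> z + c) z))"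
    using finZ by (simp add: zero_count_def Z_def Let_def)
  have hol\<phi>: "\<phi> holomorphic_on ball 0 (t * r)"
  proof -
    have "(F \<circ> (\<lambda>z. z / of_real r)) holomorphic_on ball 0 (t * r)"
      by (rule holomorphic_on_compose_gen[OF _ hol]) (use r in \<open>auto intro!: holomorphic_intros simp: norm_divide field_simps\<close>)
    then show ?thesis using r by (simp add: F o_def)
  qed
  have hol\<phi>c: "(\<lambda>z. \<phi> z + c) holomorphic_on ball 0 (t * r)" by (intro holomorphic_intros hol\<phi>)
  have nz\<phi>: "\<exists>z\<in>ball 0 (t * r). \<phi> z + c \<noteq> 0"
  proof -
    obtain z where "z \<in> ball 0 t" "F z - w \<noteq> 0" using nz by blast
    then show ?thesis using r by (intro bexI[of _ "of_real r * z"]) (auto simp: F w_def norm_mult)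
  qed
  have zo: "zorder (\<lambda>z. \<phi> z + c) (of_real r * a) = zorder (\<lambda>z. F z - w) a" if "a \<in> Z'" for a
  proof -
    have "cmod a < t" using that u by (auto simp: Z'_def)
    then have "cmod (of_real r * a) < t * r" using r by (simp add: norm_mult mult.commute)
    from zorder_scale[OF hol\<phi>c nz\<phi> r this] show ?thesis by (simp add: F w_def)
  qed
  have "x < (\<Sum>z\<in>Z. real_of_int (zorder (\<lambda>z. \<phi> z + c) z))" using c zc by simp
  also have "\<dots> = (\<Sum>a\<in>Z'. real_of_int (zorder (\<lambda>z. F z - w) a))"
    using sum.reindex_bij_betw[OF bij, of "\<lambda>z. real_of_int (zorder (\<lambda>z. \<phi> z + c) z)"] zo by simp
  also have "\<dots> \<le> (\<Sum>a\<in>Z'. real (nat (zorder (\<lambda>z. F z - w) a)))" by (intro sum_mono) auto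
  finally have xs: "x < (\<Sum>a\<in>Z'. real (nat (zorder (\<lambda>z. F z - w) a)))" .
  then have "Z' \<noteq> {}" using x(1) by auto
  then have "w \<in> F ` ball 0 (1 / u)" by (force simp: Z'_def)
  then show ?thesis using that xs by (simp add: Z'_def)
qed

text \<open>
  A number of zeros slightly below the supremum, \<open>5 / 6\<close> of the required \<open>p / L\<close>, is attained for some
  value \<open>w\<close>.  The Blaschke estimate loses another factor \<open>3 / 4\<close>, and \<open>5 / 6 * (3 / 4) = 5 / 8\<close>.
\<close>

lemma zeros_from_valency:
  fixes u :: real
  assumes u: "1 < u" and r: "0 < r" and L: "L = ln ((1 + u\<^sup>2) / (2 * u))"
    and hol: "F holomorphic_on ball 0 (u\<^sup>2)" and ncon: "\<And>c. \<exists>z\<in>ball 0 1. F z \<noteq> c"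
    and F: "F = (\<lambda>\<zeta>. \<phi> (of_real r * \<zeta>))"
    and p: "0 < p" "ereal p \<le> ereal L * valency \<phi> (r / u) 0"
  shows "\<exists>w\<in>F ` ball 0 (1 / u). \<forall>\<rho> z. 1 - (u - 1) / (4 * u) \<le> \<rho> \<longrightarrow> \<rho> < 1 \<longrightarrow> cmod z \<le> \<rho> / u \<longrightarrow>
    (\<Prod>a\<in>{z \<in> ball 0 \<rho>. F z - w = 0}. cmod (blaschke \<rho> a z) ^ nat (zorder (\<lambda>z. F z - w) a)) \<le> exp (- (5 / 8 * p))"
proof -
  have "(u - 1)\<^sup>2 > 0" using u by simp
  then have "1 < (1 + u\<^sup>2) / (2 * u)" using u by (simp add: power2_eq_square algebra_simps)
  then have L0: "0 < L" by (simp add: L)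
  \<comment> \<open>Strictly below the supremum, which need not be attained.\<close>
  define x where "x = 5 / 6 * p / L"
  have x0: "0 \<le> x" using p L0 by (simp add: x_def)
  have xp: "x < p / L" unfolding x_def using p L0 by (intro divide_strict_right_mono) auto
  have V: "ereal x < valency \<phi> (r / u) 0"
  proof (cases "valency \<phi> (r / u) 0")
    case (real y)
    then have "p / L \<le> y" using p(2) L0 by (simp add: divide_le_eq mult.commute)
    then show ?thesis using real xp by simp
  next
    case MInf
    then show ?thesis using p L0 by simp
  qed simp
  have uu2: "1 < u\<^sup>2" "1 / u < 1" using u by (auto simp: one_less_power)
  have ncon2: "\<exists>z\<in>ball 0 (u\<^sup>2). F z \<noteq> c" for c using ncon[of c] uu2 by (auto intro: less_trans)
  have u0: "0 < u" "1 / u < u\<^sup>2" using u uu2 by linarith+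
  obtain w where w: "w \<in> F ` ball 0 (1 / u)"
    "x \<le> (\<Sum>a\<in>{z \<in> ball 0 (1 / u). F z - w = 0}. real (nat (zorder (\<lambda>z. F z - w) a)))"
    by (rule valency_zeros[OF hol r u0 ncon2 F x0 V]) (rule that)
  have uu: "1 < u\<^sup>2" using u by (simp add: one_less_power)
  have hol1: "(\<lambda>z. F z - w) holomorphic_on ball 0 1"
    by (intro holomorphic_intros holomorphic_on_subset[OF hol]) (use uu in auto)
  have nz: "\<exists>z\<in>ball 0 1. F z - w \<noteq> 0" using ncon[of w] by auto
  have \<beta>: "5 / 8 * p \<le> 3 / 4 * ln ((1 + u\<^sup>2) / (2 * u)) * x"
    unfolding L[symmetric] using L0 by (simp add: x_def)
  show ?thesis
    by (intro bexI[OF _ w(1)] allI impI) (rule product_le_from_inner_zeros[OF u _ _ hol1 nz w(2) \<beta>])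
qed

lemma circle_avoiding_zeros:
  assumes hol: "F holomorphic_on ball 0 1" and nz: "\<exists>w\<in>ball 0 1. F w \<noteq> 0" and ab: "0 < a" "a < b" "b < 1"
  obtains R where "a < R" "R < b" "\<And>z. cmod z = R \<Longrightarrow> F z \<noteq> 0"
proof -
  have "finite (cmod ` {z \<in> ball 0 b. F z = 0})" using finite_zeros_in_ball[OF hol _ ab(3) nz] ab by simp
  moreover have "infinite {a<..<b}" using ab by simp
  ultimately have "\<not> {a<..<b} \<subseteq> cmod ` {z \<in> ball 0 b. F z = 0}" using finite_subset by blast
  then obtain R where "R \<in> {a<..<b}" "R \<notin> cmod ` {z \<in> ball 0 b. F z = 0}" by blast
  then have R: "a < R" "R < b" "R \<notin> cmod ` {z \<in> ball 0 b. F z = 0}" by simp_all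
  have "F z \<noteq> 0" if "cmod z = R" for z using R that by force
  then show ?thesis using that R by blast
qed

text \<open>
  The logarithm is at most \<open>(u - 1)\<^sup>2 / (2 * u)\<close>.  What remains is a cubic inequality on
  \<open>1 \<le> u \<le> 3\<close>, where \<open>u\<^sup>2 \<le> 4 * u - 3\<close>.
\<close>

lemma deep_zero_numeric:
  fixes u :: real
  assumes u: "1 < u" "u \<le> 3"
  shows "5 / 8 * ln ((1 + u\<^sup>2) / (2 * u)) \<le> 2 * (u - 1) / (u + 1) * (18 / 25 * ((u + 2) * (u - 1) / (u\<^sup>2 + u + 2)))"
proof -
  have L: "ln ((1 + u\<^sup>2) / (2 * u)) \<le> (u - 1)\<^sup>2 / (2 * u)"
  proof -
    have "(1 + u\<^sup>2) / (2 * u) = 1 + (u - 1)\<^sup>2 / (2 * u)" using u by (simp add: field_simps power2_eq_square)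
    then show ?thesis using u ln_add_one_self_le_self[of "(u - 1)\<^sup>2 / (2 * u)"] by simp
  qed
  have poly: "5 * ((u + 1) * (u\<^sup>2 + u + 2)) \<le> 36 / 25 * (u + 2) * (16 * u)"
  proof -
    have a: "0 \<le> (u - 1) * (3 - u)" using u by (intro mult_nonneg_nonneg) auto
    then have "0 \<le> u * ((u - 1) * (3 - u))" using u by (intro mult_nonneg_nonneg) auto
    then have u3: "u ^ 3 \<le> 4 * u\<^sup>2 - 3 * u" by (simp add: algebra_simps power2_eq_square power3_eq_cube)
    have u2: "u\<^sup>2 \<le> 4 * u - 3" using a by (simp add: algebra_simps power2_eq_square)
    have "5 * ((u + 1) * (u\<^sup>2 + u + 2)) = 5 * u ^ 3 + 10 * u\<^sup>2 + 15 * u + 10"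
      by (simp add: algebra_simps power2_eq_square power3_eq_cube)
    moreover have "36 / 25 * (u + 2) * (16 * u) = 576 / 25 * u\<^sup>2 + 1152 / 25 * u" by (simp add: algebra_simps power2_eq_square)
    ultimately show ?thesis using u3 u2 u by linarith
  qed
  have "5 / 8 * ((u - 1)\<^sup>2 / (2 * u)) = (u - 1)\<^sup>2 * (5 / (16 * u))" by simp
  also have "\<dots> \<le> (u - 1)\<^sup>2 * (36 / 25 * (u + 2) / ((u + 1) * (u\<^sup>2 + u + 2)))"
  proof (rule mult_left_mono)
    have "0 < (u + 1) * (u\<^sup>2 + u + 2)" using u by (intro mult_pos_pos add_pos_pos) auto
    then show "5 / (16 * u) \<le> 36 / 25 * (u + 2) / ((u + 1) * (u\<^sup>2 + u + 2))"
      using poly u by (subst frac_le_eq) (auto simp: divide_le_0_iff algebra_simps)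
  qed simp
  also have "\<dots> = 2 * (u - 1) / (u + 1) * (18 / 25 * ((u + 2) * (u - 1) / (u\<^sup>2 + u + 2)))"
  proof -
    have "e\<^sup>2 * (36 / 25 * a / (b * c)) = 2 * e / b * (18 / 25 * (a * e / c))" for a b c e :: real
      by (simp add: power2_eq_square mult_ac)
    then show ?thesis .
  qed
  finally show ?thesis using L by simp
qed

text \<open>
  The function is bounded by \<open>\<mu>\<close> near the centre and exceeds \<open>\<tau> = u * \<mu>\<close> by the factor \<open>exp (9 / 10 * l)\<close> at \<open>\<zeta>\<close>.
  Values of modulus \<open>\<tau>\<close> are not taken within distance \<open>1 / s\<close> from the centre, and one of them is taken often in the sense of
  Jensen's formula on a circle of radius between \<open>1 - (u - 1) / (2 * u)\<close> and
  \<open>1 - (u - 1) / (4 * u)\<close>.  The assumption on \<open>p\<close> is the growth part of the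
  definition of the index, with a factor \<open>4 / 5\<close> to spare.
\<close>

lemma zeros_from_growth:
  fixes u :: real
  assumes u: "1 < u" "u \<le> 3" and L: "L = ln ((1 + u\<^sup>2) / (2 * u))"
    and hol: "F holomorphic_on ball 0 1"
    and s: "1 \<le> s" and \<mu>: "0 < \<mu>" "\<And>z. cmod z < 1 / s \<Longrightarrow> cmod (F z) \<le> \<mu>" and k: "2 + ln s \<le> k"
    and \<tau>: "\<tau> = u * \<mu>" and z1: "cmod \<zeta> < 1 / u\<^sup>2" "\<tau> < cmod (F \<zeta>)"
    and big: "0 < l" "9 / 10 * l < ln (cmod (F \<zeta>) / \<tau>)" and p: "4 / 5 * p * k \<le> L * l" "0 < p"
  shows "\<exists>w. cmod w = \<tau> \<and> (\<forall>\<rho> z. 1 - (u - 1) / (4 * u) \<le> \<rho> \<longrightarrow> \<rho> < 1 \<longrightarrow> cmod z \<le> \<rho> / u \<longrightarrow>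
    (\<Prod>a\<in>{z \<in> ball 0 \<rho>. F z - w = 0}. cmod (blaschke \<rho> a z) ^ nat (zorder (\<lambda>z. F z - w) a)) \<le> exp (- (5 / 8 * p)))"
proof -
  define E where "E = u - 1"
  have E: "0 < E" using u by (simp add: E_def)
  define a b where "a = 1 - E / (2 * u)" and "b = 1 - E / (4 * u)"
  have a: "a = (u + 1) / (2 * u)" using u by (simp add: a_def E_def field_simps)
  have ab: "0 < a" "a < b" "b < 1" using u E by (auto simp: a b_def) (auto simp: E_def field_simps)
  have \<tau>0: "\<mu> < \<tau>" "0 < \<tau>" using u \<mu> by (auto simp: \<tau>)
  have uu: "1 < u\<^sup>2" using u by (simp add: one_less_power)
  have "1 / u\<^sup>2 < 1 / u" using u by (simp add: field_simps power2_eq_square)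
  moreover have "1 / u < a" unfolding a using u by (simp add: field_simps)
  ultimately have za: "cmod \<zeta> < a" using z1 by linarith
  have nzF: "\<exists>w\<in>ball 0 1. F w \<noteq> 0" using z1 \<tau>0 za ab by (intro bexI[of _ \<zeta>]) auto
  obtain R where R: "a < R" "R < b" "\<And>z. cmod z = R \<Longrightarrow> F z \<noteq> 0"
    using circle_avoiding_zeros[OF hol nzF ab] by blast
  have R0: "0 < R" "R < 1" using R ab by auto
  have zR: "cmod \<zeta> < R" using za R by simp
  \<comment> \<open>The smallest possible value of the Harnack quotient, for \<open>R = a\<close> and \<open>cmod \<zeta> = 1 / u\<^sup>2\<close>.\<close>
  define q where "q = (u + 2) * (u - 1) / (u\<^sup>2 + u + 2)"
  have q0: "0 \<le> q" using u by (simp add: q_def)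
  have qle: "q \<le> (R - cmod \<zeta>) / (R + cmod \<zeta>)"
  proof -
    have i0: "0 < 1 / u\<^sup>2" using u by simp
    have eqs: "a - 1 / u\<^sup>2 = (u + 2) * (u - 1) / (2 * u\<^sup>2)" "a + 1 / u\<^sup>2 = (u\<^sup>2 + u + 2) / (2 * u\<^sup>2)"
      unfolding a using u by (simp_all add: field_simps power2_eq_square)
    have "q = (a - 1 / u\<^sup>2) / (a + 1 / u\<^sup>2)" unfolding eqs q_def using u by simp
    also have "\<dots> \<le> (R - cmod \<zeta>) / (R + cmod \<zeta>)"
    proof -
      have "(a - 1 / u\<^sup>2) * (R + cmod \<zeta>) \<le> (R - cmod \<zeta>) * (a + 1 / u\<^sup>2)"
      proof -
        have "a * cmod \<zeta> \<le> R * (1 / u\<^sup>2)" using R z1 ab by (intro mult_mono) auto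
        moreover have "(a - i) * (R + c) \<le> (R - c) * (a + i)" if "a * c \<le> R * i" for i c
          using that by (simp add: algebra_simps)
        ultimately show ?thesis by blast
      qed
      moreover have "0 < R + cmod \<zeta>" "0 < a + 1 / u\<^sup>2" using R0 ab i0 by (auto intro: add_pos_nonneg)
      ultimately show ?thesis by (simp add: divide_le_eq le_divide_eq)
    qed
    finally show ?thesis .
  qed
  have F0: "cmod (F 0) < \<tau>" using \<mu>(2)[of 0] s \<tau>0 by auto
  define \<eta> where "\<eta> = q * (9 / 10 * l)"
  have fr: "0 < (R - cmod \<zeta>) / (R + cmod \<zeta>)" using zR R0 by (intro divide_pos_pos add_pos_nonneg) auto
  have "\<eta> \<le> (R - cmod \<zeta>) / (R + cmod \<zeta>) * (9 / 10 * l)"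
    unfolding \<eta>_def by (rule mult_right_mono[OF qle]) (use big in simp)
  also have "\<dots> < (R - cmod \<zeta>) / (R + cmod \<zeta>) * ln (cmod (F \<zeta>) / \<tau>)"
    using big(2) fr by (rule mult_strict_left_mono)
  finally have \<eta>: "\<eta> < (R - cmod \<zeta>) / (R + cmod \<zeta>) * ln (cmod (F \<zeta>) / \<tau>)" .
  obtain w where w: "cmod w = \<tau>"
    "\<eta> \<le> (\<Sum>a\<in>{z \<in> ball 0 R. F z - w = 0}. nat (zorder (\<lambda>z. F z - w) a) * ln (R / cmod a))"
    using exists_value_with_many_zeros[OF hol R0 R(3) F0 zR z1(2) \<eta>] by blast
  have holw: "(\<lambda>z. F z - w) holomorphic_on ball 0 1" by (intro holomorphic_intros hol)
  have nzw: "\<exists>z\<in>ball 0 1. F z - w \<noteq> 0" using F0 w(1) by (intro bexI[of _ 0]) auto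
  have far: "F z - w \<noteq> 0" if "cmod z < 1 / s" for z using \<mu>(2)[OF that] \<tau>0 w(1) by auto
  have \<beta>: "5 / 8 * p \<le> 2 * (u - 1) / ((u + 1) * (2 + ln s)) * \<eta>"
  proof -
    have ls: "0 < 2 + ln s" using s by (simp add: add_pos_nonneg)
    have "4 / 5 * p * (2 + ln s) \<le> 4 / 5 * p * k" using k p by (intro mult_left_mono) auto
    then have pl: "4 / 5 * p * (2 + ln s) \<le> L * l" using p by linarith
    have key: "5 / 8 * L \<le> 2 * (u - 1) / (u + 1) * (18 / 25 * q)"
      using deep_zero_numeric[OF u] by (simp only: L q_def)
    have "4 / 5 * (5 / 8 * p * (2 + ln s)) \<le> 5 / 8 * L * l" using pl by simp
    also have "\<dots> \<le> 2 * (u - 1) / (u + 1) * (18 / 25 * q) * l" using key big(1) by (intro mult_right_mono) auto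
    also have "\<dots> = 4 / 5 * (2 * (u - 1) / (u + 1) * \<eta>)"
    proof -
      have "d * (18 / 25 * q) * l = 4 / 5 * (d * (q * (9 / 10 * l)))" for d by simp
      then show ?thesis unfolding \<eta>_def .
    qed
    finally have h: "4 / 5 * (5 / 8 * p * (2 + ln s)) \<le> 4 / 5 * (2 * (u - 1) / (u + 1) * \<eta>)" .
    have "5 / 8 * p * (2 + ln s) \<le> 2 * (u - 1) / (u + 1) * \<eta>" by (rule mult_left_le_imp_le[OF h]) simp
    then have "5 / 8 * p \<le> 2 * (u - 1) / (u + 1) * \<eta> / (2 + ln s)" using ls by (simp only: le_divide_eq if_True)
    moreover have "e / d * y / c = e / (d * c) * y" for e d y c :: real by simp
    ultimately show ?thesis by metis
  qed
  have "(\<Prod>a\<in>{z \<in> ball 0 \<rho>. F z - w = 0}. cmod (blaschke \<rho> a z) ^ nat (zorder (\<lambda>z. F z - w) a)) \<le> exp (- (5 / 8 * p))"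
    if "1 - (u - 1) / (4 * u) \<le> \<rho>" "\<rho> < 1" "cmod z \<le> \<rho> / u" for \<rho> z
  proof -
    have "R \<le> \<rho>" using R that by (simp add: b_def E_def)
    then show ?thesis
      using R0 that by (intro product_le_from_deep_zeros[OF u(1) _ that(2) _ R0(1) holw nzw s far w(2) \<beta> that(3)]) auto
  qed
  then show ?thesis using w(1) by blast
qed

text \<open>
  The index is a valency on the only line, a valency on a line chosen through a point where \<open>f\<close> is almost maximal, or a growth
  ratio; each case yields a value \<open>w\<^sub>0\<close> that is taken often on that line.  The point \<open>\<zeta>\<close> is the almost maximal
  point or the centre: the values of \<open>f\<close> at these two are \<open>M1 * (1 - 1 / t) / 2\<close> apart, so one of them is half that far from \<open>w\<^sub>0\<close>.
\<close>

lemma zero_data_exists: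
  fixes u t r p M1 M2 :: real
  assumes n: "1 \<le> n" and r: "0 < r" and u: "1 < u" "u \<le> 3" and t: "t = u\<^sup>2"
    and hol: "Cn_holomorphic_on n f (Cn_ball0 n (t * r))"
    and M1: "0 < M1" "ereal M1 \<le> sup_abs f (Cn_ball0 n (r / t))"
    and M2: "sup_abs f (Cn_ball0 n (t * r)) \<le> ereal M2" and R: "ereal t \<le> R_ratio n f r t (t\<^sup>2)"
    and p: "0 < p" "ereal p \<le> ereal (ln ((1 + t) / (2 * sqrt t))) * N_index n f r t"
  obtains v w\<^sub>0 \<zeta> where "v \<in> Cn n" "Cn_norm n v = r" "cmod w\<^sub>0 \<le> M2" "cmod \<zeta> \<le> 1 / t"
    "M1 * (1 - 1 / t) / 4 \<le> cmod (f (\<lambda>i. \<zeta> * v i) - w\<^sub>0)"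
    "\<And>\<rho> z. 1 - (u - 1) / (4 * u) \<le> \<rho> \<Longrightarrow> \<rho> < 1 \<Longrightarrow> cmod z \<le> \<rho> / u \<Longrightarrow>
      (\<Prod>a\<in>{z \<in> ball 0 \<rho>. f (\<lambda>i. z * v i) - w\<^sub>0 = 0}. cmod (blaschke \<rho> a z) ^ nat (zorder (\<lambda>z. f (\<lambda>i. z * v i) - w\<^sub>0) a))
        \<le> exp (- (5 / 8 * p))"
proof -
  note conclude = that
  define L where "L = ln ((1 + u\<^sup>2) / (2 * u))"
  have st: "sqrt t = u" using t u by simp
  have t1: "1 < t" using t u by (simp add: one_less_power)
  have pN: "ereal p \<le> ereal L * N_index n f r t" using p(2) unfolding L_def st t[symmetric] .
  have "(u - 1)\<^sup>2 > 0" using u by simp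
  then have "1 < (1 + u\<^sup>2) / (2 * u)" using u by (simp add: power2_eq_square algebra_simps)
  then have L0: "0 < L" by (simp add: L_def)
  obtain A where A: "sup_abs f (Cn_ball0 n (r / t)) = ereal A" "M1 \<le> A" "A \<le> M2" "cmod (f (\<lambda>_. 0)) \<le> A / t"
    using real_sup_and_center[OF r t1 M1 M2 R] by blast
  have A0: "0 < A" using A M1 by simp
  have fM2: "cmod (f z) \<le> M2" if "z \<in> Cn_ball0 n (t * r)" for z using M2[unfolded sup_abs_le_iff] that by blast
  \<comment> \<open>A threshold halfway between the supremum \<open>A\<close> and the bound \<open>A / t\<close> at the centre.\<close>
  define G where "G = A * (1 + 1 / t) / 2"
  have it: "1 / t < 1" using t1 by simp
  have "A * (1 / t) < A * 1" using A0 it by (rule mult_strict_left_mono[rotated])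
  moreover have Geq: "G = (A + A / t) / 2" by (simp add: G_def distrib_left)
  ultimately have GA: "G < A" "A / t < G" by simp_all
  define F where "F = (\<lambda>v \<zeta>. f (\<lambda>i. \<zeta> * v i))"
  have F0: "F v 0 = f (\<lambda>_. 0)" for v by (simp add: F_def)
  have holF: "F v holomorphic_on ball 0 t" if "v \<in> Cn n" "Cn_norm n v = r" for v
    unfolding F_def by (rule line_holomorphic[OF hol r that])
  have inball: "(\<lambda>i. \<zeta> * v i) \<in> Cn_ball0 n (x * r)" if "v \<in> Cn n" "Cn_norm n v = r" "cmod \<zeta> < x" for v \<zeta> x
    using that r by (simp add: mem_Cn_ball0 Cn_scale Cn_norm_scale)
  have sep: "\<exists>\<zeta>'. cmod \<zeta>' \<le> 1 / t \<and> M1 * (1 - 1 / t) / 4 \<le> cmod (F v \<zeta>' - w)"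
    if "cmod \<zeta> < 1 / t" "G < cmod (F v \<zeta>)" for v \<zeta> w
  proof -
    have "A * (1 - 1 / t) / 2 \<le> cmod (F v \<zeta>) - cmod (F v 0)"
    proof -
      have "A * (1 - 1 / t) / 2 = G - A / t" unfolding Geq by (simp add: right_diff_distrib)
      then show ?thesis using that(2) A(4) F0 by simp
    qed
    also have "\<dots> \<le> cmod (F v \<zeta> - F v 0)" by (rule norm_triangle_ineq2)
    finally have "A * (1 - 1 / t) / 2 / 2 \<le> cmod (F v \<zeta> - w) \<or> A * (1 - 1 / t) / 2 / 2 \<le> cmod (F v 0 - w)"
      by (rule separated_value)
    moreover have "M1 * (1 - 1 / t) / 4 \<le> A * (1 - 1 / t) / 2 / 2" using A(2) it by (simp add: mult_right_mono)
    moreover have "cmod (0::complex) \<le> 1 / t" using t1 by simp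
    ultimately show ?thesis using that(1) by (meson less_imp_le order_trans)
  qed
  have ncon: "\<exists>z\<in>ball 0 1. F v z \<noteq> c" if "cmod \<zeta> < 1 / t" "G < cmod (F v \<zeta>)" for v \<zeta> c
  proof -
    have "F v \<zeta> \<noteq> F v 0" using that(2) A(4) GA F0 by auto
    moreover have "\<zeta> \<in> ball 0 1" "0 \<in> ball (0::complex) 1" using that(1) it by auto
    ultimately show ?thesis by metis
  qed
  define good where "good = (\<lambda>v w. \<forall>\<rho> z. 1 - (u - 1) / (4 * u) \<le> \<rho> \<longrightarrow> \<rho> < 1 \<longrightarrow> cmod z \<le> \<rho> / u \<longrightarrow>
      (\<Prod>a\<in>{z \<in> ball 0 \<rho>. F v z - w = 0}. cmod (blaschke \<rho> a z) ^ nat (zorder (\<lambda>z. F v z - w) a)) \<le> exp (- (5 / 8 * p)))"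
  have fin: thesis if v: "v \<in> Cn n" "Cn_norm n v = r" and z: "cmod \<zeta> < 1 / t" "G < cmod (F v \<zeta>)"
    and w: "cmod w \<le> M2" "good v w" for v \<zeta> w
  proof -
    obtain \<zeta>' where "cmod \<zeta>' \<le> 1 / t" "M1 * (1 - 1 / t) / 4 \<le> cmod (F v \<zeta>' - w)" using sep[OF z] by blast
    then show thesis using w(2) unfolding good_def F_def by (intro conclude[OF v w(1)]) blast+
  qed
  have val: thesis if v: "v \<in> Cn n" "Cn_norm n v = r" and z: "cmod \<zeta> < 1 / t" "G < cmod (F v \<zeta>)"
    and F: "F v = (\<lambda>\<zeta>. \<phi> (of_real r * \<zeta>))" and pv: "ereal p \<le> ereal L * valency \<phi> (r / u) 0" for v \<zeta> \<phi>
  proof -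
    obtain w where w: "w \<in> F v ` ball 0 (1 / u)" "good v w"
      using zeros_from_valency[OF u(1) r L_def holF[OF v, unfolded t] ncon[OF z] F p(1) pv] unfolding good_def by blast
    have "1 / u < t" using u t1 by (smt (verit) divide_less_eq_1)
    then have "cmod w \<le> M2" using w(1) inball[OF v] fM2 unfolding F_def by force
    then show thesis using fin[OF v z _ w(2)] by blast
  qed
  show thesis
  proof (cases "n = 1")
    case True
    obtain z where z: "z \<in> Cn_ball0 n (r / t)" "G < cmod (f z)"
      using less_sup_absE[of G f "Cn_ball0 n (r / t)"] GA A(1) by auto
    define v where "v = (\<lambda>i::nat. if i = 0 then complex_of_real r else 0)"
    have v: "v \<in> Cn n" "Cn_norm n v = r" using True r by (auto simp: v_def Cn_def Cn_norm_def L2_set_def)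
    have nz: "Cn_norm n z = cmod (z 0)" using True by (simp add: Cn_norm_def L2_set_def)
    have zv: "z = (\<lambda>i. z 0 / of_real r * v i)" using z(1) True r by (auto simp: v_def mem_Cn_ball0 Cn_def)
    have zn: "cmod (z 0 / of_real r) < 1 / t" using z(1) nz r by (simp add: mem_Cn_ball0 norm_divide divide_less_eq)
    have "F v (z 0 / of_real r) = f z" using zv by (simp add: F_def)
    then have G: "G < cmod (F v (z 0 / of_real r))" using z(2) by simp
    show thesis
    proof (rule val[OF v zn G, of "\<lambda>\<zeta>. f (\<lambda>i. if i = 0 then \<zeta> else 0)"])
      have "(\<lambda>i. \<zeta> * v i) = (\<lambda>i. if i = 0 then of_real r * \<zeta> else 0)" for \<zeta> by (auto simp: v_def)
      then show "F v = (\<lambda>\<zeta>. f (\<lambda>i. if i = 0 then of_real r * \<zeta> else 0))" by (simp add: F_def)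
      show "ereal p \<le> ereal L * valency (\<lambda>\<zeta>. f (\<lambda>i. if i = 0 then \<zeta> else 0)) (r / u) 0"
        using pN True by (simp add: N_index_def st)
    qed
  next
    case False
    define S where "S = (SUP s\<in>{t..}. ln_ext (R_ratio n f r t s / ereal u) / ereal (k_const t s))"
    have Nmax: "N_index n f r t = max S (V_min n f r t)" using False by (simp add: N_index_def S_def st)
    show thesis
    proof (cases "V_min n f r t \<le> S")
      case False
      then have pV: "ereal p \<le> ereal L * V_min n f r t" using pN Nmax by (simp add: max_def split: if_splits)
      obtain z where z: "z \<in> Cn_ball0 n (r / t)" "G < cmod (f z)"
        using less_sup_absE[of G f "Cn_ball0 n (r / t)"] GA A(1) by auto
      have z0: "z \<noteq> (\<lambda>_. 0)" using z(2) A(4) GA by auto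
      obtain v \<zeta> where v: "v \<in> Cn n" "Cn_norm n v = r" and \<zeta>: "cmod \<zeta> < r / t / r" "z = (\<lambda>i. \<zeta> * v i)"
        using direction_of_point[OF z(1) z0 r] by blast
      have \<zeta>1: "cmod \<zeta> < 1 / t" using \<zeta>(1) r by simp
      have G: "G < cmod (F v \<zeta>)" using z(2) \<zeta>(2) by (simp add: F_def)
      define e where "e = (\<lambda>i. v i / of_real r)"
      define l where "l = range (\<lambda>\<zeta> i. \<zeta> * v i)"
      have v0: "v \<noteq> (\<lambda>_. 0)" using v r by auto
      have l: "l \<in> complex_lines n" unfolding complex_lines_def l_def using v v0 by blast
      have el: "e \<in> l" unfolding l_def e_def by (rule image_eqI[of _ _ "1 / of_real r"]) auto
      have "e = (\<lambda>i. (1 / of_real r) * v i)" by (simp add: e_def)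
      then have en: "Cn_norm n e = 1" using v r by (simp only: Cn_norm_scale) (simp add: norm_divide)
      have pts: "(\<lambda>i. \<xi> * v i) \<in> l \<inter> Cn_ball0 n (t * r)" if "cmod \<xi> < 1" for \<xi>
        using inball[OF v, of \<xi> t] that t1 by (auto simp: l_def)
      have nc: "\<not> f constant_on (l \<inter> Cn_ball0 n (t * r))"
      proof
        assume "f constant_on (l \<inter> Cn_ball0 n (t * r))"
        then obtain c where c: "\<And>y. y \<in> l \<inter> Cn_ball0 n (t * r) \<Longrightarrow> f y = c" unfolding constant_on_def by blast
        have "F v \<xi> = c" if "cmod \<xi> < 1" for \<xi> using c[OF pts[OF that]] by (simp add: F_def)
        then show False using ncon[OF \<zeta>1 G, of c] by auto
      qed
      have "V_min n f r t \<le> valency (\<lambda>\<zeta>. f (\<lambda>i. \<zeta> * e i)) (r / sqrt t) 0"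
        unfolding V_min_def by (rule Inf_lower) (use l el en nc in blast)
      then have "ereal L * V_min n f r t \<le> ereal L * valency (\<lambda>\<zeta>. f (\<lambda>i. \<zeta> * e i)) (r / u) 0"
        unfolding st using L0 by (intro ereal_mult_left_mono) auto
      then have pv: "ereal p \<le> ereal L * valency (\<lambda>\<zeta>. f (\<lambda>i. \<zeta> * e i)) (r / u) 0" using pV by (rule order_trans[rotated])
      show thesis
        by (rule val[OF v \<zeta>1 G _ pv]) (use r in \<open>simp add: F_def e_def mult_ac\<close>)
    next
      case True
      then have pS: "ereal p \<le> ereal L * S" using pN Nmax by (simp add: max_def split: if_splits)
      have "ereal (4 / 5 * p / L) < S"
      proof (cases S)
        case (real y)
        then have "p / L \<le> y" using pS L0 by (simp add: divide_le_eq mult.commute)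
        moreover have "4 / 5 * p / L < p / L" using p(1) L0 by (intro divide_strict_right_mono) auto
        ultimately show ?thesis using real by simp
      next
        case MInf
        then show ?thesis using pS L0 by simp
      qed simp
      then obtain s where s: "t \<le> s" "ereal (4 / 5 * p / L) < ln_ext (R_ratio n f r t s / ereal u) / ereal (k_const t s)"
        unfolding S_def less_SUP_iff by auto
      have s1: "1 < s" using s t1 by simp
      define k where "k = k_const t s"
      have k: "2 + ln s \<le> k"
      proof -
        have "0 \<le> (u - 1) * (3 - u)" using u by (intro mult_nonneg_nonneg) auto
        moreover have "(u - 1)\<^sup>2 = u\<^sup>2 - 2 * u + 1" by (simp add: power2_eq_square algebra_simps)
        ultimately have "(u - 1)\<^sup>2 \<le> 8 * u" using u by (simp add: power2_eq_square algebra_simps)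
        then have "1 \<le> 8 * u / (u - 1)\<^sup>2" using u by (simp add: le_divide_eq)
        then have "exp 2 * s * 1 \<le> exp (pi\<^sup>2) * s * (8 * u / (u - 1)\<^sup>2)"
        proof (intro mult_mono)
          have "2\<^sup>2 \<le> pi\<^sup>2" using pi_ge_two by (intro power_mono) auto
          then show "exp 2 \<le> exp (pi\<^sup>2)" by simp
        qed (use s1 in auto)
        then have le: "exp 2 * s \<le> 8 * exp (pi\<^sup>2) * s * u / (u - 1)\<^sup>2" by (simp add: mult_ac)
        have "ln (exp 2 * s) \<le> ln (8 * exp (pi\<^sup>2) * s * u / (u - 1)\<^sup>2)"
          using le s1 by (subst ln_le_cancel_iff) (auto intro: less_le_trans[OF _ le])
        then show ?thesis using s1 by (simp add: k_def k_const_def st ln_mult)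
      qed
      have k0: "0 < k" using k ln_gt_zero[OF s1] by linarith
      define m where "m = sup_abs f (Cn_ball0 n (r / s))"
      have "r / s \<le> r / t" using r s t1 by (intro divide_left_mono) auto
      then have "m \<le> ereal A"
        unfolding m_def sup_abs_le_iff using A(1) le_sup_abs[of _ "Cn_ball0 n (r / t)" f] by (force simp: mem_Cn_ball0)
      moreover have "0 \<le> m"
      proof -
        have "(\<lambda>_. 0) \<in> Cn_ball0 n (r / s)" using r s1 by (simp add: mem_Cn_ball0 Cn_def)
        from le_sup_abs[OF this, of f] show ?thesis unfolding m_def by (metis ereal_less_eq(5) norm_ge_zero order_trans)
      qed
      ultimately obtain \<mu> where \<mu>: "m = ereal \<mu>" "0 \<le> \<mu>" by (cases m) auto
      have f\<mu>: "cmod (F v \<xi>) \<le> \<mu>" if "v \<in> Cn n" "Cn_norm n v = r" "cmod \<xi> < 1 / s" for v \<xi>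
        using le_sup_abs[OF inball[OF that], of f] \<mu>(1) by (simp add: m_def F_def)
      \<comment> \<open>If \<open>f\<close> vanished near the centre, it would vanish on every line, by the identity theorem.\<close>
      have \<mu>0: "0 < \<mu>"
      proof (rule ccontr)
        assume "\<not> 0 < \<mu>"
        then have \<mu>z: "\<mu> = 0" using \<mu> by simp
        obtain z where z: "z \<in> Cn_ball0 n (r / t)" "G < cmod (f z)"
          using less_sup_absE[of G f "Cn_ball0 n (r / t)"] GA A(1) by auto
        have z0: "z \<noteq> (\<lambda>_. 0)" using z(2) A(4) GA by auto
        obtain v \<zeta> where v: "v \<in> Cn n" "Cn_norm n v = r" and \<zeta>: "cmod \<zeta> < r / t / r" "z = (\<lambda>i. \<zeta> * v i)"
          using direction_of_point[OF z(1) z0 r] by blast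
        have "F v \<zeta> = 0"
        proof (rule analytic_continuation_open[of "ball 0 (1 / s)" "ball 0 t" "F v" "\<lambda>_. 0"])
          have "1 / s < 1" using s1 by simp
          then show "ball (0::complex) (1 / s) \<subseteq> ball 0 t" using t1 by auto
          have "cmod \<zeta> < 1 / t" using \<zeta>(1) r by simp
          then have "cmod \<zeta> < t" using it t1 by linarith
          then show "\<zeta> \<in> ball 0 t" by simp
          show "F v \<xi> = 0" if "\<xi> \<in> ball 0 (1 / s)" for \<xi> using f\<mu>[OF v, of \<xi>] that \<mu>z by simp
        qed (use holF[OF v] s1 in auto)
        then show False using z(2) \<zeta>(2) GA A0 t1 by (simp add: F_def) (smt (verit) divide_pos_pos)
      qed
      define \<tau> where "\<tau> = u * \<mu>"
      have \<tau>0: "0 < \<tau>" using \<mu>0 u by (simp add: \<tau>_def)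
      define l where "l = ln (A / \<tau>)"
      have "R_ratio n f r t s / ereal u = ereal (A / \<tau>)"
        using A(1) \<mu> \<mu>0 u by (simp add: R_ratio_def m_def[symmetric] \<tau>_def mult.commute)
      moreover have "ln_ext (ereal (A / \<tau>)) = ereal l" using divide_pos_pos[OF A0 \<tau>0] by (simp add: ln_ext_def l_def not_le)
      ultimately have "4 / 5 * p / L < l / k" using s(2) k0 by (simp add: k_def[symmetric])
      then have pk: "4 / 5 * p * k < L * l" using L0 k0 by (simp add: divide_less_eq less_divide_eq mult_ac)
      moreover have "0 < 4 / 5 * p * k" using p k0 by simp
      ultimately have l0: "0 < l" using L0 by (smt (verit) zero_less_mult_pos)
      define G' where "G' = \<tau> * exp (9 / 10 * l)"
      have "G' < \<tau> * exp l" using l0 \<tau>0 by (simp add: G'_def)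
      also have "\<dots> = A" using A0 \<tau>0 by (simp add: l_def)
      finally have "G' < A" .
      then have "ereal (max G G') < sup_abs f (Cn_ball0 n (r / t))" using GA A(1) by simp
      then obtain z where z: "z \<in> Cn_ball0 n (r / t)" "max G G' < cmod (f z)" by (rule less_sup_absE)
      have z0: "z \<noteq> (\<lambda>_. 0)" using z(2) A(4) GA by auto
      obtain v \<zeta> where v: "v \<in> Cn n" "Cn_norm n v = r" and \<zeta>: "cmod \<zeta> < r / t / r" "z = (\<lambda>i. \<zeta> * v i)"
        using direction_of_point[OF z(1) z0 r] by blast
      have \<zeta>1: "cmod \<zeta> < 1 / t" using \<zeta>(1) r by simp
      have G: "G < cmod (F v \<zeta>)" "G' < cmod (F v \<zeta>)" using z(2) \<zeta>(2) by (auto simp: F_def)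
      have hol1: "F v holomorphic_on ball 0 1" by (rule holomorphic_on_subset[OF holF[OF v]]) (use t1 in auto)
      have big: "9 / 10 * l < ln (cmod (F v \<zeta>) / \<tau>)"
      proof -
        have "exp (9 / 10 * l) < cmod (F v \<zeta>) / \<tau>" using G(2) \<tau>0 by (simp add: G'_def less_divide_eq mult.commute)
        then show ?thesis by (metis exp_gt_zero ln_exp ln_less_cancel_iff less_trans)
      qed
      have \<tau>z: "\<tau> < cmod (F v \<zeta>)"
      proof -
        have "\<tau> * 1 \<le> G'" unfolding G'_def using \<tau>0 l0 by (intro mult_left_mono) auto
        then show ?thesis using G(2) by simp
      qed
      obtain w where w: "cmod w = \<tau>" "good v w"
        using zeros_from_growth[OF u L_def hol1 less_imp_le[OF s1] \<mu>0 f\<mu>[OF v] k \<tau>_def \<zeta>1[unfolded t] \<tau>z l0 big less_imp_le[OF pk] p(1)]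
        unfolding good_def by blast
      have "cmod (F v \<zeta>) \<le> M2" using fM2[OF inball[OF v, of \<zeta> t]] \<zeta>1 it t1 by (simp add: F_def)
      then show thesis using fin[OF v \<zeta>1 G(1) _ w(2)] w(1) \<tau>z by simp
    qed
  qed
qed

section \<open>Growth along lines and Bernstein inequalities in the fibres\<close>

lemma F_class_growth:
  assumes g: "g \<in> F_class n p q r t M2" and r: "0 < r" and v: "v \<in> Cn n" "Cn_norm n v = r"
    and w: "w \<in> ball 0 (3 * M2)"
  shows "growth_le t p (\<lambda>\<zeta>. g ((\<lambda>i. \<zeta> * v i)(n := w)))"
  unfolding growth_le_def
proof (intro allI impI ballI)
  fix B z assume B: "\<forall>z\<in>ball 0 1. cmod (g ((\<lambda>i. z * v i)(n := w))) \<le> B" and z: "z \<in> ball (0::complex) t"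
  define l where "l = range (\<lambda>\<zeta> i. \<zeta> * v i)"
  have "v \<noteq> (\<lambda>_. 0)" using v r by auto
  then have l: "l \<in> complex_lines n" unfolding complex_lines_def l_def using v by blast
  have in_l: "(\<lambda>i. \<zeta> * v i) \<in> l \<inter> Cn_ball0 n (x * r)" if "cmod \<zeta> < x" for \<zeta> x
    using that v r by (auto simp: l_def mem_Cn_ball0 Cn_scale Cn_norm_scale)
  have "sup_abs (\<lambda>z. g (z(n := w))) (l \<inter> Cn_ball0 n r) \<le> ereal B"
    unfolding sup_abs_le_iff using B v r by (auto simp: l_def mem_Cn_ball0 Cn_norm_scale)
  then have "ereal (exp p) * sup_abs (\<lambda>z. g (z(n := w))) (l \<inter> Cn_ball0 n r) \<le> ereal (exp p) * ereal B"
    by (intro ereal_mult_left_mono) auto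
  moreover have "sup_abs (\<lambda>z. g (z(n := w))) (l \<inter> Cn_ball0 n (t * r))
     \<le> ereal (exp p) * sup_abs (\<lambda>z. g (z(n := w))) (l \<inter> Cn_ball0 n r)"
    using g l w unfolding F_class_def by blast
  ultimately have "sup_abs (\<lambda>z. g (z(n := w))) (l \<inter> Cn_ball0 n (t * r)) \<le> ereal (exp p * B)"
    by (simp add: order_trans)
  then show "cmod (g ((\<lambda>i. z * v i)(n := w))) \<le> exp p * B"
    unfolding sup_abs_le_iff using in_l[of z t] z by auto
qed

text \<open>
  Letting the last coordinate vary with \<open>\<zeta>\<close> covers lines, fibres and the graph of \<open>f\<close> at once.
\<close>

lemma slice_curve_holomorphic:
  assumes hol: "Cn_holomorphic_on (n + 1) g (Cn_prod n U D)" and S: "open S"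
    and c: "\<And>\<zeta>. \<zeta> \<in> S \<Longrightarrow> c \<zeta> \<in> U" "\<And>\<zeta>. \<zeta> \<in> S \<Longrightarrow> c \<zeta> \<in> Cn n" "\<And>i. i < n \<Longrightarrow> (\<lambda>\<zeta>. c \<zeta> i) holomorphic_on S"
    and \<omega>: "\<And>\<zeta>. \<zeta> \<in> S \<Longrightarrow> \<omega> \<zeta> \<in> D" "\<omega> holomorphic_on S"
  shows "(\<lambda>\<zeta>. g ((c \<zeta>)(n := \<omega> \<zeta>))) holomorphic_on S"
proof (rule Cn_holomorphic_compose[OF hol S])
  show "(c \<zeta>)(n := \<omega> \<zeta>) \<in> Cn_prod n U D" if "\<zeta> \<in> S" for \<zeta>
    using c(1)[OF that] \<omega>(1)[OF that] unfolding Cn_prod_def by blast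
  show "(c \<zeta>)(n := \<omega> \<zeta>) \<in> Cn (n + 1)" if "\<zeta> \<in> S" for \<zeta> using slice_in_Cn[OF c(2)[OF that]] .
  show "(\<lambda>\<zeta>. ((c \<zeta>)(n := \<omega> \<zeta>)) i) holomorphic_on S" if "i < n + 1" for i
    using c(3)[of i] \<omega>(2) that by (cases "i = n") auto
qed

text \<open>
  One disc of the supremum that defines the Bernstein index.  The infinite values of the extended
  logarithm have to be excluded; they occur only for \<open>\<gamma> = 0\<close> and for unbounded \<open>\<gamma>\<close>.
\<close>

lemma bernstein_step:
  assumes hol: "\<gamma> holomorphic_on ball 0 R" and b: "bernstein_index \<gamma> R 0 \<le> ereal q"
    and s: "0 < s" "cball w\<^sub>0 (exp 1 * s) \<subseteq> ball 0 R"
    and B: "\<And>w. w \<in> ball w\<^sub>0 s \<Longrightarrow> cmod (\<gamma> w) \<le> B" and w: "w \<in> ball w\<^sub>0 (exp 1 * s)"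
  shows "cmod (\<gamma> w) \<le> exp q * B"
proof -
  have B0: "0 \<le> B" using B[of w\<^sub>0] s norm_ge_zero order_trans by (metis centre_in_ball)
  define S S' where "S = sup_abs \<gamma> (ball w\<^sub>0 (exp 1 * s))" and "S' = sup_abs \<gamma> (ball w\<^sub>0 s)"
  have S'B: "S' \<le> ereal B" unfolding S'_def sup_abs_le_iff using B by blast
  have wS: "ereal (cmod (\<gamma> w)) \<le> S" unfolding S_def by (rule le_sup_abs[OF w])
  show ?thesis
  proof (cases "\<gamma> w = 0")
    case True then show ?thesis using B0 by simp
  next
    case False
    have wR: "w \<in> ball 0 R" using subsetD[OF s(2), of w] w by simp
    then have ne: "\<not> (\<forall>z\<in>ball 0 R. \<gamma> z = 0)" using False by blast
    have es: "0 < exp 1 * s" using s by simp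
    have cl: "closure (ball w\<^sub>0 (exp 1 * s)) \<subseteq> ball 0 R" using s es by (simp add: closure_ball)
    obtain b where "\<And>z. z \<in> ball w\<^sub>0 (exp 1 * s) \<Longrightarrow> cmod (\<gamma> z) \<le> b"
    proof -
      have "compact (\<gamma> ` cball w\<^sub>0 (exp 1 * s))"
        by (rule compact_continuous_image[OF continuous_on_subset[OF holomorphic_on_imp_continuous_on[OF hol] s(2)] compact_cball])
      then obtain b where "\<forall>x\<in>\<gamma> ` cball w\<^sub>0 (exp 1 * s). cmod x \<le> b" using compact_imp_bounded bounded_iff by metis
      then show ?thesis using that[of b] by auto
    qed
    then have "S \<le> ereal b" unfolding S_def sup_abs_le_iff by blast
    moreover have Spos: "0 < S" using wS False by (metis ereal_less(2) less_le_trans zero_less_norm_iff)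
    ultimately obtain x where x: "S = ereal x" "0 < x" by (cases S) auto
    have "ln_ext S - ln_ext S' \<le> bernstein_index \<gamma> R 0"
      unfolding bernstein_index_def S_def S'_def if_not_P[OF ne]
      by (rule SUP_upper2[of "(s, w\<^sub>0)"]) (use s cl in auto)
    then have le: "ln_ext S - ln_ext S' \<le> ereal q" using b by simp
    have lnS: "ln_ext S = ereal (ln x)" using x by (simp add: ln_ext_def)
    have "0 \<le> S'" unfolding S'_def using le_sup_abs[of w\<^sub>0 "ball w\<^sub>0 s" \<gamma>] s by (metis centre_in_ball ereal_less_eq(5) norm_ge_zero order_trans)
    then obtain y where y: "S' = ereal y" "0 \<le> y" using S'B by (cases S') auto
    have "y \<noteq> 0" using le lnS y by (auto simp: ln_ext_def)
    then have y0: "0 < y" using y by simp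
    then have "ln x - ln y \<le> q" using le lnS y by (simp add: ln_ext_def)
    then have "ln (x / y) \<le> q" using x y0 by (simp add: ln_div)
    then have "x / y \<le> exp q" using x y0 by (metis divide_pos_pos exp_le_cancel_iff exp_ln)
    then have "x \<le> exp q * y" using y0 by (simp add: divide_le_eq)
    also have "\<dots> \<le> exp q * B" using S'B y by simp
    finally show ?thesis using wS x by simp
  qed
qed

text \<open>
  The radius grows from \<open>\<delta>\<close> by factors \<open>exp 1\<close>, and \<open>ln (2 * M / \<delta>) + 1\<close> bounds the number of steps.  Discs have to stay
  relatively compact, so the last radius \<open>\<rho>\<close> is taken slightly below \<open>2 * M\<close>, but beyond \<open>w\<close>.
\<close>

lemma bernstein_chain:
  assumes hol: "\<gamma> holomorphic_on ball 0 (3 * M)" and b: "bernstein_index \<gamma> (3 * M) 0 \<le> ereal q" and q: "0 \<le> q"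
    and w0: "cmod w\<^sub>0 \<le> M" and \<delta>: "0 < \<delta>" "\<delta> \<le> 2 * M"
    and B: "\<And>w. w \<in> ball w\<^sub>0 \<delta> \<Longrightarrow> cmod (\<gamma> w) \<le> B" and w: "w \<in> ball w\<^sub>0 (2 * M)"
  shows "cmod (\<gamma> w) \<le> exp (q * (ln (2 * M / \<delta>) + 1)) * B"
proof -
  have B0: "0 \<le> B" using B[of w\<^sub>0] \<delta> norm_ge_zero order_trans by (metis centre_in_ball)
  obtain \<rho> where \<rho>: "max (dist w\<^sub>0 w) \<delta> < \<rho> \<or> \<rho> = \<delta>" "dist w\<^sub>0 w < \<rho>" "\<delta> \<le> \<rho>" "\<rho> \<le> 2 * M" "\<rho> = \<delta> \<or> \<rho> < 2 * M"
  proof (cases "max (dist w\<^sub>0 w) \<delta> < 2 * M")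
    case True
    then obtain x where "max (dist w\<^sub>0 w) \<delta> < x" "x < 2 * M" using dense by blast
    then show ?thesis using that[of x] by auto
  next
    case False
    then show ?thesis using that[of \<delta>] \<delta> w by (auto simp: max_def split: if_splits)
  qed
  have \<rho>0: "0 < \<rho>" using \<rho> \<delta> by simp
  define k where "k = nat \<lceil>ln (\<rho> / \<delta>)\<rceil>"
  have lnn: "0 \<le> ln (\<rho> / \<delta>)" using \<rho> \<delta> by simp
  have k1: "ln (\<rho> / \<delta>) \<le> real k" unfolding k_def by (rule real_nat_ceiling_ge)
  have k2: "real k \<le> ln (\<rho> / \<delta>) + 1" unfolding k_def using lnn by linarith
  have step: "\<forall>w\<in>ball w\<^sub>0 (\<rho> * exp (real j - real k)). cmod (\<gamma> w) \<le> exp (q * j) * B" if "j \<le> k" for j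
    using that
  proof (induction j)
    case 0
    have "\<rho> / \<delta> \<le> exp (real k)" using k1 \<rho>0 \<delta> by (metis divide_pos_pos exp_le_cancel_iff exp_ln)
    then have "\<rho> * exp (- real k) \<le> \<delta>" using \<delta> by (simp add: exp_minus field_simps)
    then show ?case using B by (auto intro!: B)
  next
    case (Suc j)
    define s where "s = \<rho> * exp (real j - real k)"
    have es: "exp 1 * s = \<rho> * exp (real (Suc j) - real k)" by (simp add: s_def exp_add exp_diff)
    have s0: "0 < s" using \<rho>0 by (simp add: s_def)
    have kpos: "0 < k" using Suc.prems by simp
    then have "\<rho> \<noteq> \<delta>" using \<delta> by (auto simp: k_def)
    then have "\<rho> < 2 * M" using \<rho>(5) by blast
    moreover have "exp 1 * s \<le> \<rho>" unfolding es using Suc.prems \<rho>0 by (simp add: mult_left_le)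
    ultimately have "cball w\<^sub>0 (exp 1 * s) \<subseteq> ball 0 (3 * M)"
      using w0 by (auto simp: dist_norm) (smt (verit) norm_triangle_sub norm_minus_commute)
    then have "cmod (\<gamma> w) \<le> exp q * (exp (q * j) * B)" if "w \<in> ball w\<^sub>0 (exp 1 * s)" for w
      using bernstein_step[OF hol b s0 _ _ that] Suc by (auto simp: s_def)
    then show ?case unfolding es by (simp add: exp_add distrib_left mult_ac)
  qed
  have "cmod (\<gamma> w) \<le> exp (q * k) * B" using step[of k] \<rho>(2) by simp
  also have "\<dots> \<le> exp (q * (ln (2 * M / \<delta>) + 1)) * B"
  proof -
    have "ln (\<rho> / \<delta>) \<le> ln (2 * M / \<delta>)" using \<rho> \<rho>0 \<delta> by (simp add: divide_right_mono)
    then have "q * k \<le> q * (ln (2 * M / \<delta>) + 1)" using k2 q by (intro mult_left_mono) auto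
    then show ?thesis using B0 by (intro mult_right_mono) auto
  qed
  finally show ?thesis .
qed

text \<open>
  The Bernstein inequality is the growth condition with ratio \<open>exp 1\<close>.  For \<open>q \<le> 1 / 5\<close> the centre
  dominates, with the constant \<open>(exp 1 + 1) / (exp 1 - 1) \<le> 5 / 2\<close>.
\<close>

lemma bernstein_small_imp_comparable:
  assumes hol: "\<gamma> holomorphic_on ball 0 (3 * M)" and b: "bernstein_index \<gamma> (3 * M) 0 \<le> ereal q"
    and q: "0 \<le> q" "q \<le> 1/5" and M: "0 < M" and w0: "cmod w\<^sub>0 \<le> M" and w: "w \<in> ball w\<^sub>0 (2 * M)"
  shows "cmod (\<gamma> w) \<le> exp (5 * q) * cmod (\<gamma> w\<^sub>0)"
proof -
  obtain s where s: "dist w\<^sub>0 w < exp 1 * s" "exp 1 * s < 2 * M"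
  proof -
    obtain x where "dist w\<^sub>0 w < x" "x < 2 * M" using w dense by (metis mem_ball)
    then show ?thesis using that[of "x / exp 1"] by simp
  qed
  have es0: "0 < exp 1 * s" using s(1) zero_le_dist[of w\<^sub>0 w] by linarith
  then have s0: "0 < s" by (simp add: zero_less_mult_iff)
  have sub: "cball w\<^sub>0 (exp 1 * s) \<subseteq> ball 0 (3 * M)"
    using w0 s(2) by (auto simp: dist_norm) (smt (verit) norm_triangle_sub norm_minus_commute)
  define \<kappa> where "\<kappa> = (\<lambda>\<zeta>. \<gamma> (w\<^sub>0 + of_real s * \<zeta>))"
  have e2: "5/2 \<le> exp (1::real)"
  proof -
    have "1 + 1 + 1\<^sup>2 / 2 \<le> exp (1::real)" by (rule exp_lower_Taylor_quadratic) simp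
    then show ?thesis by simp
  qed
  have img: "w\<^sub>0 + of_real s * \<zeta> \<in> ball w\<^sub>0 (x * s)" if "cmod \<zeta> < x" for \<zeta> x
    using that s0 by (simp add: dist_norm norm_mult)
  have "(\<gamma> \<circ> (\<lambda>\<zeta>. w\<^sub>0 + of_real s * \<zeta>)) holomorphic_on ball 0 (exp 1)"
  proof (rule holomorphic_on_compose_gen[OF _ hol])
    show "(\<lambda>\<zeta>. w\<^sub>0 + of_real s * \<zeta>) ` ball 0 (exp 1) \<subseteq> ball 0 (3 * M)"
      using img[of _ "exp 1"] sub by (metis (no_types, lifting) ball_subset_cball image_subsetI mem_ball_0 subsetD)
  qed (intro holomorphic_intros)
  then have holk: "\<kappa> holomorphic_on ball 0 (exp 1)" by (simp add: \<kappa>_def o_def)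
  have gr: "growth_le (exp 1) q \<kappa>"
    unfolding growth_le_def
  proof (intro allI impI ballI)
    fix B z assume B: "\<forall>z\<in>ball 0 1. cmod (\<kappa> z) \<le> B" and z: "z \<in> ball (0::complex) (exp 1)"
    have "cmod (\<gamma> y) \<le> B" if y: "y \<in> ball w\<^sub>0 s" for y
    proof -
      have "cmod ((y - w\<^sub>0) / of_real s) < 1" using y s0 by (simp add: dist_norm norm_divide norm_minus_commute)
      then have "cmod (\<kappa> ((y - w\<^sub>0) / of_real s)) \<le> B" using B by simp
      then show ?thesis using s0 by (simp add: \<kappa>_def)
    qed
    then show "cmod (\<kappa> z) \<le> exp q * B"
      unfolding \<kappa>_def using bernstein_step[OF hol b s0 sub] img[of z "exp 1"] z by simp
  qed
  have C: "(exp 1 + 1) / (exp 1 - 1) \<le> (5/2 :: real)" using e2 by (simp add: divide_le_eq)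
  have C0: "0 \<le> (exp 1 + 1) / (exp 1 - (1::real))" using e2 by simp
  have z: "cmod ((w - w\<^sub>0) / of_real s) < exp 1"
    using s s0 by (simp add: dist_norm norm_divide norm_minus_commute divide_less_eq)
  have "cmod (\<kappa> ((w - w\<^sub>0) / of_real s)) \<le> exp (2 * ((exp 1 + 1) / (exp 1 - 1)) * q) * cmod (\<kappa> 0)"
  proof (rule growth_small_imp_center_large[OF holk _ q(1) gr _ z])
    have "(exp 1 + 1) / (exp 1 - 1) * q \<le> 5/2 * (1/5)" using C C0 q by (intro mult_mono) auto
    then show "(exp 1 + 1) / (exp 1 - 1) * q \<le> 1 / 2" by simp
  qed simp
  also have "\<dots> \<le> exp (5 * q) * cmod (\<kappa> 0)"
  proof -
    have "2 * x * q \<le> 5 * q" if "x \<le> 5/2" for x using mult_right_mono[OF that q(1)] by simp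
    from this[OF C] show ?thesis by (intro mult_right_mono) (simp_all only: exp_le_cancel_iff norm_ge_zero)
  qed
  finally show ?thesis using s0 by (simp add: \<kappa>_def)
qed

section \<open>The function on lines, on fibres and on the graph\<close>

locale graph_class =
  fixes n :: nat and r t u M2 p q :: real and f g :: "(nat \<Rightarrow> complex) \<Rightarrow> complex"
  assumes r: "0 < r" and u: "1 < u" "u \<le> 3" and t: "t = u\<^sup>2" and M2: "0 < M2"
    and holf: "Cn_holomorphic_on n f (Cn_ball0 n (t * r))"
    and fM2: "\<And>z. z \<in> Cn_ball0 n (t * r) \<Longrightarrow> cmod (f z) \<le> M2"
    and g: "g \<in> F_class n p q r t M2" and p0: "0 \<le> p" and q0: "0 \<le> q"
begin

lemma t1: "1 < t"
  using t u by (simp add: one_less_power)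

lemma holg: "Cn_holomorphic_on (n + 1) g (Cn_prod n (Cn_ball0 n (t * r)) (ball 0 (3 * M2)))"
  using g by (simp add: F_class_def)

lemma line_in_ball:
  assumes "v \<in> Cn n" "Cn_norm n v * x \<le> t * r" "cmod \<zeta> < x"
  shows "(\<lambda>i. \<zeta> * v i) \<in> Cn_ball0 n (t * r)"
proof (cases "Cn_norm n v = 0")
  case True
  then show ?thesis using assms r t1 by (simp add: mem_Cn_ball0 Cn_scale Cn_norm_scale)
next
  case False
  then have "0 < Cn_norm n v" using Cn_norm_nonneg[of n v] by linarith
  then have "cmod \<zeta> * Cn_norm n v < x * Cn_norm n v" using assms(3) by (rule mult_strict_right_mono[rotated])
  then show ?thesis using assms by (simp add: mem_Cn_ball0 Cn_scale Cn_norm_scale mult.commute)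
qed

lemma f_line_holomorphic:
  assumes "v \<in> Cn n" "Cn_norm n v * x \<le> t * r"
  shows "(\<lambda>\<zeta>. f (\<lambda>i. \<zeta> * v i)) holomorphic_on ball 0 x"
  by (rule Cn_holomorphic_compose[OF holf])
     (use assms line_in_ball in \<open>auto simp: Cn_scale intro!: holomorphic_intros\<close>)

lemma g_line_holomorphic:
  assumes "v \<in> Cn n" "Cn_norm n v * x \<le> t * r" "cmod w < 3 * M2"
  shows "(\<lambda>\<zeta>. g ((\<lambda>i. \<zeta> * v i)(n := w))) holomorphic_on ball 0 x"
  by (rule slice_curve_holomorphic[OF holg])
     (use assms line_in_ball in \<open>auto simp: Cn_scale intro!: holomorphic_intros\<close>)

lemma graph_line_holomorphic:
  assumes "v \<in> Cn n" "Cn_norm n v * x \<le> t * r"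
  shows "(\<lambda>\<zeta>. g ((\<lambda>i. \<zeta> * v i)(n := f (\<lambda>i. \<zeta> * v i)))) holomorphic_on ball 0 x"
proof (rule slice_curve_holomorphic[OF holg])
  show "f (\<lambda>i. \<zeta> * v i) \<in> ball 0 (3 * M2)" if "\<zeta> \<in> ball 0 x" for \<zeta>
    using fM2[OF line_in_ball[OF assms, of \<zeta>]] that M2 by simp
qed (use assms line_in_ball f_line_holomorphic[OF assms] in \<open>auto simp: Cn_scale intro!: holomorphic_intros\<close>)

lemma slice_fibre_holomorphic:
  assumes "z \<in> Cn_ball0 n (t * r)"
  shows "(\<lambda>w. g (z(n := w))) holomorphic_on ball 0 (3 * M2)"
  by (rule slice_curve_holomorphic[OF holg]) (use assms in \<open>auto simp: mem_Cn_ball0\<close>)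

lemma slice_fibre_bernstein:
  "z \<in> Cn_ball0 n (t * r) \<Longrightarrow> bernstein_index (\<lambda>w. g (z(n := w))) (3 * M2) 0 \<le> ereal q"
  using g by (simp add: F_class_def)

lemma line_growth:
  assumes v: "v \<in> Cn n" "Cn_norm n v = r" and w: "cmod w < 3 * M2" and a: "0 < a" "a \<le> 1"
    and B: "\<And>\<zeta>. cmod \<zeta> \<le> a \<Longrightarrow> cmod (g ((\<lambda>i. \<zeta> * v i)(n := w))) \<le> B" and z: "a \<le> cmod \<zeta>" "cmod \<zeta> < t"
  shows "cmod (g ((\<lambda>i. \<zeta> * v i)(n := w))) \<le> B * (cmod \<zeta> / a) powr (p / ln t)"
proof (rule growth_leD[OF g_line_holomorphic[OF v(1) _ w] t1 p0 F_class_growth[OF g r v] a B z])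
qed (use v w in auto)

text \<open>
  In the last variable, \<open>g\<close> is Lipschitz near the point in question, with a constant that is uniform in \<open>\<zeta>\<close>.  So \<open>g(\<zeta>, w) - g(\<zeta>, f \<zeta>)\<close>
  vanishes at least to the order of \<open>f - w\<close>, and no multiplicities have to be compared.
\<close>

lemma difference_dominated:
  assumes v: "v \<in> Cn n" "Cn_norm n v * x \<le> t * r" and w: "cmod w < 3 * M2" and a: "cmod a < x" "f (\<lambda>i. a * v i) - w = 0"
  shows "\<exists>C d. 0 < d \<and> (\<forall>\<zeta>\<in>ball a d. cmod (g ((\<lambda>i. \<zeta> * v i)(n := w)) - g ((\<lambda>i. \<zeta> * v i)(n := f (\<lambda>i. \<zeta> * v i))))
     \<le> C * cmod (f (\<lambda>i. \<zeta> * v i) - w))"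
proof -
  define z0 where "z0 = (\<lambda>i. a * v i)"
  have z0: "z0 \<in> Cn_ball0 n (t * r)" unfolding z0_def by (rule line_in_ball[OF v a(1)])
  then have "z0(n := w) \<in> Cn_prod n (Cn_ball0 n (t * r)) (ball 0 (3 * M2))" using w unfolding Cn_prod_def by auto
  from Cn_holomorphic_imp_continuous[OF holg this zero_less_one]
  obtain \<delta> where \<delta>: "0 < \<delta>" "\<And>h. h \<in> Cn (n + 1) \<Longrightarrow> Cn_norm (n + 1) h < \<delta> \<Longrightarrow>
      cmod (g (\<lambda>i. (z0(n := w)) i + h i) - g (z0(n := w))) < 1" by blast
  define C where "C = cmod (g (z0(n := w))) + 1"
  define N where "N = Cn_norm n v + 1"
  have N: "0 < N" unfolding N_def using Cn_norm_nonneg[of n v] by linarith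
  have gC: "cmod (g ((\<lambda>i. \<zeta> * v i)(n := \<omega>))) \<le> C" if \<zeta>: "cmod (\<zeta> - a) < \<delta> / (2 * N)" and \<omega>: "cmod (\<omega> - w) < \<delta> / 2" for \<zeta> \<omega>
  proof -
    define h1 h2 where "h1 = (\<lambda>i. (\<zeta> - a) * v i)(n := 0)" and "h2 = (\<lambda>i::nat. if i = n then \<omega> - w else 0)"
    have c1: "h1 \<in> Cn (n + 1)" unfolding h1_def by (intro slice_in_Cn Cn_scale v)
    have c2: "h2 \<in> Cn (n + 1)" by (auto simp: h2_def Cn_def)
    have n1: "Cn_norm (n + 1) h1 < \<delta> / 2"
    proof -
      have "Cn_norm (n + 1) h1 = cmod (\<zeta> - a) * Cn_norm n v" unfolding h1_def Cn_norm_slice Cn_norm_scale ..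
      also have "\<dots> \<le> cmod (\<zeta> - a) * N" by (intro mult_left_mono) (auto simp: N_def)
      also have "\<dots> < \<delta> / (2 * N) * N" using \<zeta> N by (rule mult_strict_right_mono)
      finally show ?thesis using N by simp
    qed
    have n2: "Cn_norm (n + 1) h2 < \<delta> / 2"
    proof -
      have "(\<Sum>i<n. (cmod (h2 i))\<^sup>2) = 0" by (rule sum.neutral) (simp add: h2_def)
      then have "Cn_norm (n + 1) h2 = cmod (\<omega> - w)" by (simp add: Cn_norm_def L2_set_def h2_def)
      then show ?thesis using \<omega> by simp
    qed
    have "Cn_norm (n + 1) (\<lambda>i. h1 i + h2 i) < \<delta>" using Cn_norm_triangle[of "n + 1" h1 h2] n1 n2 by linarith
    then have "cmod (g (\<lambda>i. (z0(n := w)) i + (h1 i + h2 i)) - g (z0(n := w))) < 1" by (intro \<delta>(2) Cn_add c1 c2)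
    moreover have "(\<lambda>i. (z0(n := w)) i + (h1 i + h2 i)) = (\<lambda>i. \<zeta> * v i)(n := \<omega>)"
      by (auto simp: h1_def h2_def z0_def algebra_simps)
    ultimately show ?thesis using norm_triangle_sub[of "g ((\<lambda>i. \<zeta> * v i)(n := \<omega>))" "g (z0(n := w))"] by (simp add: C_def)
  qed
  define e where "e = min (\<delta> / 2) (3 * M2 - cmod w)"
  have e: "0 < e" using \<delta> w by (simp add: e_def)
  have eM: "ball w e \<subseteq> ball 0 (3 * M2)"
    by (auto simp: e_def dist_norm) (smt (verit) norm_triangle_sub norm_minus_commute)
  have "isCont (\<lambda>\<zeta>. f (\<lambda>i. \<zeta> * v i)) a"
    using continuous_on_interior[OF holomorphic_on_imp_continuous_on[OF f_line_holomorphic[OF v]], of a] a(1) by simp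
  then obtain d' where d': "0 < d'" "\<And>\<zeta>. dist \<zeta> a < d' \<Longrightarrow> dist (f (\<lambda>i. \<zeta> * v i)) (f (\<lambda>i. a * v i)) < e"
    using e unfolding continuous_at_eps_delta by meson
  define d where "d = min d' (min (\<delta> / (2 * N)) (x - cmod a))"
  have d: "0 < d" using d' \<delta> N a by (simp add: d_def)
  have "cmod (g ((\<lambda>i. \<zeta> * v i)(n := w)) - g ((\<lambda>i. \<zeta> * v i)(n := f (\<lambda>i. \<zeta> * v i))))
     \<le> (2 * C / e) * cmod (f (\<lambda>i. \<zeta> * v i) - w)" if \<zeta>: "\<zeta> \<in> ball a d" for \<zeta>
  proof -
    have \<zeta>a: "cmod (\<zeta> - a) < d" using \<zeta> by (simp add: dist_norm norm_minus_commute)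
    have "cmod \<zeta> < x" using \<zeta>a norm_triangle_sub[of \<zeta> a] by (simp add: d_def)
    then have zb: "(\<lambda>i. \<zeta> * v i) \<in> Cn_ball0 n (t * r)" by (rule line_in_ball[OF v])
    have "f (\<lambda>i. \<zeta> * v i) \<in> ball w e" using d'(2)[of \<zeta>] \<zeta>a a(2) by (simp add: d_def dist_norm norm_minus_commute)
    moreover have "(\<lambda>\<omega>. g ((\<lambda>i. \<zeta> * v i)(n := \<omega>))) holomorphic_on ball w e"
      by (rule holomorphic_on_subset[OF slice_fibre_holomorphic[OF zb] eM])
    moreover have "cmod (g ((\<lambda>i. \<zeta> * v i)(n := \<omega>))) \<le> C" if "\<omega> \<in> ball w e" for \<omega>
      using that \<zeta>a by (intro gC) (auto simp: d_def e_def dist_norm norm_minus_commute)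
    ultimately have "cmod (g ((\<lambda>i. \<zeta> * v i)(n := f (\<lambda>i. \<zeta> * v i))) - g ((\<lambda>i. \<zeta> * v i)(n := w)))
        \<le> 2 * C * cmod (f (\<lambda>i. \<zeta> * v i) - w) / e"
      using bounded_holomorphic_diff_le[of "\<lambda>\<omega>. g ((\<lambda>i. \<zeta> * v i)(n := \<omega>))" w e C "f (\<lambda>i. \<zeta> * v i)"] e by blast
    then show ?thesis by (simp add: norm_minus_commute)
  qed
  then show ?thesis using d by blast
qed

lemma center_dominates:
  assumes sm: "(t + 1) / (t - 1) * p \<le> 1 / 2" and z: "z \<in> Cn_ball0 n (t * r)" and w: "cmod w < 3 * M2"
  shows "cmod (g (z(n := w))) \<le> exp (2 * ((t + 1) / (t - 1)) * p) * cmod (g ((\<lambda>_. 0)(n := w)))"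
proof (cases "z = (\<lambda>_. 0)")
  case True
  have "1 * cmod (g ((\<lambda>_. 0)(n := w))) \<le> exp (2 * ((t + 1) / (t - 1)) * p) * cmod (g ((\<lambda>_. 0)(n := w)))"
    using p0 t1 by (intro mult_right_mono) auto
  then show ?thesis using True by simp
next
  case False
  obtain v \<zeta> where v: "v \<in> Cn n" "Cn_norm n v = r" and \<zeta>: "cmod \<zeta> < t * r / r" "z = (\<lambda>i. \<zeta> * v i)"
    using direction_of_point[OF z False r] by blast
  have hol: "(\<lambda>\<zeta>. g ((\<lambda>i. \<zeta> * v i)(n := w))) holomorphic_on ball 0 t"
    by (rule g_line_holomorphic[OF v(1) _ w]) (use v in simp)
  have gr: "growth_le t p (\<lambda>\<zeta>. g ((\<lambda>i. \<zeta> * v i)(n := w)))"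
    by (rule F_class_growth[OF g r v]) (use w in simp)
  show ?thesis
    using growth_small_imp_center_large[OF hol t1 p0 gr sm, of \<zeta>] \<zeta> r by simp
qed

lemma graph_bound_small:
  assumes sm: "(t + 1) / (t - 1) * p \<le> 1 / 2" and q: "q \<le> 1 / 5" and z: "z \<in> Cn_ball0 n (t * r)" and w: "cmod w < M2"
  shows "cmod (g (z(n := w))) \<le> exp (2 * ((t + 1) / (t - 1)) * p + 5 * q) * cmod (g ((\<lambda>_. 0)(n := f (\<lambda>_. 0))))"
proof -
  have z0: "(\<lambda>_. 0) \<in> Cn_ball0 n (t * r)" using r t1 by (simp add: mem_Cn_ball0 Cn_def)
  have "cmod (w - f (\<lambda>_. 0)) < 2 * M2" using w fM2[OF z0] norm_triangle_ineq4[of w "f (\<lambda>_. 0)"] by linarith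
  then have "w \<in> ball (f (\<lambda>_. 0)) (2 * M2)" by (simp add: dist_norm norm_minus_commute)
  then have "cmod (g ((\<lambda>_. 0)(n := w))) \<le> exp (5 * q) * cmod (g ((\<lambda>_. 0)(n := f (\<lambda>_. 0))))"
    using bernstein_small_imp_comparable[OF slice_fibre_holomorphic[OF z0] slice_fibre_bernstein[OF z0] q0 q M2 fM2[OF z0]] by blast
  then have "exp (2 * ((t + 1) / (t - 1)) * p) * cmod (g ((\<lambda>_. 0)(n := w)))
     \<le> exp (2 * ((t + 1) / (t - 1)) * p) * (exp (5 * q) * cmod (g ((\<lambda>_. 0)(n := f (\<lambda>_. 0)))))" by (intro mult_left_mono) auto
  also have "\<dots> = exp (2 * ((t + 1) / (t - 1)) * p + 5 * q) * cmod (g ((\<lambda>_. 0)(n := f (\<lambda>_. 0))))" by (simp add: exp_add)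
  finally show ?thesis using center_dominates[OF sm z, of w] w M2 by simp
qed

text \<open>
  The disc of radius \<open>2 * M2\<close> about \<open>w\<^sub>0\<close> contains the disc of radius \<open>M2\<close> about \<open>0\<close> and lies in the
  domain of \<open>g\<close>.
\<close>

lemma fibre_spread:
  assumes z: "z \<in> Cn_ball0 n (t * r)" and w0: "cmod w\<^sub>0 \<le> M2" and \<delta>: "0 < \<delta>" "\<delta> \<le> 2 * M2"
    and B: "\<And>w. w \<in> ball w\<^sub>0 \<delta> \<Longrightarrow> cmod (g (z(n := w))) \<le> B" and w: "cmod w < M2"
  shows "cmod (g (z(n := w))) \<le> exp (q * (ln (2 * M2 / \<delta>) + 1)) * B"
proof (rule bernstein_chain[OF slice_fibre_holomorphic[OF z] slice_fibre_bernstein[OF z] q0 w0 \<delta> B])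
  show "w \<in> ball w\<^sub>0 (2 * M2)" using w w0 norm_triangle_ineq4[of w\<^sub>0 w] by (simp add: dist_norm)
qed

end

section \<open>From one direction to the whole ball\<close>

context graph_class
begin

lemma segment_norm:
  assumes "Cn_norm n v\<^sub>0 = r" "Cn_norm n v\<^sub>1 = r"
  shows "Cn_norm n (\<lambda>i. v\<^sub>0 i + \<xi> * (v\<^sub>1 i - v\<^sub>0 i)) \<le> r * (1 + 2 * cmod \<xi>)"
    and "r * (1 - 2 * cmod \<xi>) \<le> Cn_norm n (\<lambda>i. v\<^sub>0 i + \<xi> * (v\<^sub>1 i - v\<^sub>0 i))"
proof -
  have "Cn_norm n (\<lambda>i. v\<^sub>1 i - v\<^sub>0 i) \<le> 2 * r"
    using Cn_norm_triangle[of n v\<^sub>1 "\<lambda>i. (-1) * v\<^sub>0 i"] assms by (simp only: Cn_norm_scale) simp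
  then have le: "cmod \<xi> * Cn_norm n (\<lambda>i. v\<^sub>1 i - v\<^sub>0 i) \<le> cmod \<xi> * (2 * r)" by (intro mult_left_mono) auto
  have "Cn_norm n (\<lambda>i. v\<^sub>0 i + \<xi> * (v\<^sub>1 i - v\<^sub>0 i)) \<le> r + cmod \<xi> * (2 * r)"
    using Cn_norm_triangle[of n v\<^sub>0 "\<lambda>i. \<xi> * (v\<^sub>1 i - v\<^sub>0 i)"] assms le unfolding Cn_norm_scale by linarith
  then show "Cn_norm n (\<lambda>i. v\<^sub>0 i + \<xi> * (v\<^sub>1 i - v\<^sub>0 i)) \<le> r * (1 + 2 * cmod \<xi>)"
    by (simp add: distrib_left mult.commute mult.left_commute)
  have "(\<lambda>i. v\<^sub>0 i + \<xi> * (v\<^sub>1 i - v\<^sub>0 i) + - \<xi> * (v\<^sub>1 i - v\<^sub>0 i)) = v\<^sub>0" by (rule ext) (simp add: algebra_simps)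
  then have "r \<le> Cn_norm n (\<lambda>i. v\<^sub>0 i + \<xi> * (v\<^sub>1 i - v\<^sub>0 i)) + cmod \<xi> * (2 * r)"
    using Cn_norm_triangle[of n "\<lambda>i. v\<^sub>0 i + \<xi> * (v\<^sub>1 i - v\<^sub>0 i)" "\<lambda>i. - \<xi> * (v\<^sub>1 i - v\<^sub>0 i)"] assms le
    unfolding Cn_norm_scale by simp
  then show "r * (1 - 2 * cmod \<xi>) \<le> Cn_norm n (\<lambda>i. v\<^sub>0 i + \<xi> * (v\<^sub>1 i - v\<^sub>0 i))"
    by (simp add: right_diff_distrib mult.commute mult.left_commute)
qed

text \<open>
  The direction \<open>v\<close> and the value \<open>w\<close> are perturbations of \<open>v\<^sub>0\<close> and \<open>w\<^sub>0\<close>, for which the zeros are known.  The vector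
  \<open>v\<close> may be slightly longer than \<open>r\<close>; what counts is that \<open>\<rho>\<close> keeps the disc inside the ball of
  radius \<open>r\<close>, where the graph is under control.
\<close>

lemma slice_along_direction:
  fixes \<epsilon> p\<^sub>1 \<kappa> \<delta>\<^sub>0 \<rho> :: real
  assumes p1: "0 < p\<^sub>1" "p\<^sub>1 \<le> p" "p\<^sub>1 \<le> 1 / 2" and \<kappa>: "0 < \<kappa>" "\<kappa> \<le> p\<^sub>1 * exp (- p / 2) / 200"
    and eps: "\<And>z. z \<in> Cn_ball0 n r \<Longrightarrow> cmod (g (z(n := f z))) \<le> \<epsilon>"
    and \<rho>: "0 < \<rho>" "\<rho> < 1" and v0: "v\<^sub>0 \<in> Cn n" "Cn_norm n v\<^sub>0 = r"
    and circ: "0 < \<delta>\<^sub>0" "\<And>z. cmod z = \<rho> \<Longrightarrow> \<delta>\<^sub>0 \<le> cmod (f (\<lambda>i. z * v\<^sub>0 i) - w\<^sub>0)"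
    and prod: "\<And>z. cmod z \<le> \<rho> / u \<Longrightarrow>
      (\<Prod>a\<in>{z \<in> ball 0 \<rho>. f (\<lambda>i. z * v\<^sub>0 i) - w\<^sub>0 = 0}. cmod (blaschke \<rho> a z) ^ nat (zorder (\<lambda>z. f (\<lambda>i. z * v\<^sub>0 i) - w\<^sub>0) a))
        \<le> exp (- (5 / 8 * p))"
    and v: "v \<in> Cn n" "0 < Cn_norm n v" "Cn_norm n v * \<rho> < r" and w: "cmod w < 3 * M2"
    and near: "\<And>z. cmod z \<le> \<rho> \<Longrightarrow> cmod ((f (\<lambda>i. z * v i) - w) - (f (\<lambda>i. z * v\<^sub>0 i) - w\<^sub>0)) \<le> \<kappa> * \<delta>\<^sub>0"
    and vt: "Cn_norm n v \<le> t * r" and \<zeta>: "cmod \<zeta> \<le> \<rho> / u"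
  shows "cmod (g ((\<lambda>i. \<zeta> * v i)(n := w))) \<le> 30 * \<epsilon> / p\<^sub>1"
proof -
  define \<gamma> where "\<gamma> = (\<lambda>\<zeta>. g ((\<lambda>i. \<zeta> * v i)(n := w)))"
  define \<psi> where "\<psi> = (\<lambda>\<zeta>. g ((\<lambda>i. \<zeta> * v i)(n := f (\<lambda>i. \<zeta> * v i))))"
  define F0 where "F0 = (\<lambda>z. f (\<lambda>i. z * v\<^sub>0 i) - w\<^sub>0)"
  define F where "F = (\<lambda>z. f (\<lambda>i. z * v i) - w)"
  have vt': "Cn_norm n v * 1 \<le> t * r" using vt by simp
  have v0t: "Cn_norm n v\<^sub>0 * 1 \<le> t * r" using v0 t1 r by simp
  have hols: "\<gamma> holomorphic_on ball 0 1" "\<psi> holomorphic_on ball 0 1" "F holomorphic_on ball 0 1" "F0 holomorphic_on ball 0 1"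
    unfolding \<gamma>_def \<psi>_def F_def F0_def
    by (rule g_line_holomorphic[OF v(1) vt' w], rule graph_line_holomorphic[OF v(1) vt'],
        intro holomorphic_intros f_line_holomorphic[OF v(1) vt'], intro holomorphic_intros f_line_holomorphic[OF v0(1) v0t])
  have ru: "0 < \<rho> / u" "\<rho> / u \<le> \<rho>" using \<rho> u by (auto simp: divide_le_eq)
  have ep: "exp (- p / 2) \<le> 1" using p0 by simp
  have "p\<^sub>1 * exp (- p / 2) \<le> (1/2) * 1" using p1 ep by (intro mult_mono) auto
  then have \<kappa>1: "\<kappa> < 1" using \<kappa> by simp
  have "cmod (\<gamma> \<zeta>) \<le> 30 * \<epsilon> / p\<^sub>1"
  proof (rule contraction_step[OF hols(1) ru \<rho>(2) p1 _ \<kappa>(2) _ _ _ \<zeta>])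
    show "cmod (\<psi> z) \<le> \<epsilon>" if "cmod z \<le> \<rho>" for z
    proof -
      have "cmod z * Cn_norm n v \<le> \<rho> * Cn_norm n v" using that by (intro mult_right_mono) auto
      then have "cmod z * Cn_norm n v < r" using v(3) by (metis le_less_trans mult.commute)
      then have "(\<lambda>i. z * v i) \<in> Cn_ball0 n r" using v by (simp add: mem_Cn_ball0 Cn_scale Cn_norm_scale)
      then show ?thesis unfolding \<psi>_def by (rule eps)
    qed
    show "cmod (\<gamma> z) \<le> exp (p / 2) * B" if B: "\<And>z. cmod z \<le> \<rho> / u \<Longrightarrow> cmod (\<gamma> z) \<le> B" and z: "cmod z \<le> \<rho>" for B z
    proof -
      have B0: "0 \<le> B" using B[of 0] ru by (smt (verit) norm_ge_zero norm_zero)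
      have e1: "B \<le> exp (p / 2) * B" using B0 p0 mult_right_mono[of 1 "exp (p / 2)" B] by simp
      show ?thesis
      proof (cases "cmod z \<le> \<rho> / u")
        case True
        then show ?thesis using B[of z] e1 by simp
      next
        case False
        \<comment> \<open>The growth condition speaks of vectors of length \<open>r\<close>.\<close>
        define \<nu> where "\<nu> = Cn_norm n v / r"
        have \<nu>: "0 < \<nu>" using v r by (simp add: \<nu>_def)
        define v' where "v' = (\<lambda>i. of_real (1 / \<nu>) * v i)"
        have v': "v' \<in> Cn n" unfolding v'_def by (rule Cn_scale[OF v(1)])
        have v'n: "Cn_norm n v' = r"
          unfolding v'_def Cn_norm_scale using v(2) r by (simp add: \<nu>_def norm_divide)
        have sc: "(\<lambda>i. \<xi> * v i) = (\<lambda>i. (of_real \<nu> * \<xi>) * v' i)" for \<xi> using \<nu> by (auto simp: v'_def)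
        define a where "a = \<nu> * (\<rho> / u)"
        have \<nu>\<rho>: "\<nu> * \<rho> < 1" using v(3) r by (simp add: \<nu>_def)
        have a: "0 < a" unfolding a_def using \<nu> ru(1) by (rule mult_pos_pos)
        have a1: "a \<le> 1" using \<nu>\<rho> mult_left_mono[OF ru(2), of \<nu>] \<nu> by (simp add: a_def)
        have "cmod (g ((\<lambda>i. (of_real \<nu> * z) * v' i)(n := w))) \<le> B * (cmod (of_real \<nu> * z) / a) powr (p / ln t)"
        proof (rule line_growth[OF v' v'n w a a1])
          show "cmod (g ((\<lambda>i. \<xi> * v' i)(n := w))) \<le> B" if "cmod \<xi> \<le> a" for \<xi>
          proof -
            have "cmod (\<xi> / of_real \<nu>) \<le> \<rho> / u" using that \<nu> by (simp add: a_def norm_divide divide_le_eq mult.commute)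
            from B[OF this] show ?thesis unfolding \<gamma>_def sc using \<nu> by simp
          qed
          have "\<nu> * (\<rho> / u) \<le> \<nu> * cmod z" using False \<nu> by (intro mult_left_mono) auto
          then show "a \<le> cmod (of_real \<nu> * z)" using \<nu> by (simp add: a_def norm_mult)
          have "\<nu> * cmod z \<le> \<nu> * \<rho>" using z \<nu> by (intro mult_left_mono) auto
          then have "\<nu> * cmod z < t" using \<nu>\<rho> t1 by linarith
          then show "cmod (of_real \<nu> * z) < t" using \<nu> by (simp add: norm_mult)
        qed
        also have "cmod (of_real \<nu> * z) / a = cmod z * u / \<rho>" using \<nu> \<rho> u by (simp add: a_def norm_mult)
        also have "B * (cmod z * u / \<rho>) powr (p / ln t) \<le> B * u powr (p / ln t)"
        proof (intro mult_left_mono powr_mono2)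
          have "cmod z * u \<le> \<rho> * u" using z u by (intro mult_right_mono) auto
          then show "cmod z * u / \<rho> \<le> u" using \<rho> by (simp add: divide_le_eq mult.commute)
        qed (use B0 p0 t1 u \<rho> in auto)
        also have "u powr (p / ln t) = exp (p / 2)"
        proof -
          have "ln t = 2 * ln u" using u by (simp add: t ln_realpow)
          then show ?thesis using u by (simp add: powr_def)
        qed
        finally show ?thesis unfolding \<gamma>_def sc mult.commute[of "exp (p / 2)" B] .
      qed
    qed
    show "cmod (\<gamma> z - \<psi> z) \<le> m * (exp (- (5 / 8) * p) + \<kappa>) / (1 - \<kappa>)"
      if m: "\<And>z. cmod z = \<rho> \<Longrightarrow> cmod (\<gamma> z - \<psi> z) \<le> m" and z: "cmod z \<le> \<rho> / u" for m z
    proof -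
      let ?P = "\<Prod>a\<in>{z \<in> ball 0 \<rho>. F0 z = 0}. cmod (blaschke \<rho> a z) ^ nat (zorder F0 a)"
      have z\<rho>: "cmod z \<le> \<rho>" using z ru by simp
      have m0: "0 \<le> m" using m[of "of_real \<rho>"] \<rho> by (smt (verit) norm_ge_zero norm_of_real)
      have "cmod (\<gamma> z - \<psi> z) \<le> m * (?P + \<kappa>) / (1 - \<kappa>)"
      proof (rule perturbed_division_estimate[OF hols(4,3) _ \<rho> circ(1) _ _ \<kappa>1 _ _ _ z\<rho>])
        show "(\<lambda>z. \<gamma> z - \<psi> z) holomorphic_on ball 0 1" by (intro holomorphic_intros hols)
        show "\<exists>C d. 0 < d \<and> (\<forall>z\<in>ball a d. cmod (\<gamma> z - \<psi> z) \<le> C * cmod (F z))" if a: "cmod a < \<rho>" "F a = 0" for a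
          unfolding \<gamma>_def \<psi>_def F_def
          by (rule difference_dominated[OF v(1) vt' w]) (use a \<rho> in \<open>auto simp: F_def\<close>)
      qed (use circ near \<kappa> m in \<open>auto simp: F0_def F_def\<close>)
      also have "\<dots> \<le> m * (exp (- (5 / 8) * p) + \<kappa>) / (1 - \<kappa>)"
        using prod[OF z] m0 \<kappa>1 unfolding F0_def by (intro divide_right_mono mult_left_mono add_right_mono) auto
      finally show ?thesis .
    qed
  qed (use \<kappa> in simp)
  then show ?thesis by (simp add: \<gamma>_def)
qed

text \<open>
  Join \<open>v\<^sub>0\<close> to an arbitrary direction \<open>v\<^sub>1\<close> by the pencil \<open>v\<^sub>0 + \<xi> * (v\<^sub>1 - v\<^sub>0)\<close> and apply the three circles theorem in \<open>\<xi>\<close>,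
  between \<open>cmod \<xi> = \<eta>\<close>, where the bound \<open>B\<close> is known, and \<open>cmod \<xi> = 3\<close>.  For \<open>\<zeta>\<close> of modulus at most \<open>1 / 7\<close> the
  points with \<open>cmod \<xi> = 3\<close> still lie in the closed ball of radius \<open>r\<close>, where the growth condition bounds \<open>g\<close> by
  \<open>7 powr s\<close> times the supremum \<open>S\<close> over the ball of radius \<open>r / 7\<close>.  Interpolating with the exponent
  \<open>2 * s\<close> is possible, and since \<open>7 < 3\<^sup>2\<close> the bound that comes from the outer circle is less than \<open>S\<close> at
  \<open>\<xi> = 1\<close>.  So \<open>S\<close> is bounded by \<open>B * \<eta> powr (- 2 * s)\<close>.
\<close>

lemma slice_everywhere:
  fixes \<eta> B :: real
  assumes p: "0 < p" and w: "cmod w < 3 * M2" and \<eta>: "0 < \<eta>" "\<eta> \<le> 1" and v0: "v\<^sub>0 \<in> Cn n" "Cn_norm n v\<^sub>0 = r" and B0: "0 \<le> B"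
    and B: "\<And>v\<^sub>1 \<xi> \<zeta>. v\<^sub>1 \<in> Cn n \<Longrightarrow> Cn_norm n v\<^sub>1 = r \<Longrightarrow> cmod \<xi> \<le> \<eta> \<Longrightarrow> cmod \<zeta> \<le> 1 / 7 \<Longrightarrow>
      cmod (g ((\<lambda>i. \<zeta> * (v\<^sub>0 i + \<xi> * (v\<^sub>1 i - v\<^sub>0 i)))(n := w))) \<le> B"
    and z: "z \<in> Cn_ball0 n (t * r)"
  shows "cmod (g (z(n := w))) \<le> B * \<eta> powr (- 2 * (p / ln t)) * (7 * t) powr (p / ln t)"
proof -
  define s where "s = p / ln t"
  have s0: "0 < s" using p t1 by (simp add: s_def)
  define T where "T = {z \<in> Cn n. Cn_norm n z \<le> r / 7}"
  define G where "G = (\<lambda>z. cmod (g (z(n := w))))"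
  have wD: "w \<in> ball 0 (3 * M2)" using w by simp
  have "r / 7 < t * r" using r t1 by (simp add: less_trans[of _ r])
  from slice_bounded[OF holg wD this] obtain b where b: "\<And>z. z \<in> T \<Longrightarrow> G z \<le> b"
    unfolding T_def G_def by blast
  define S where "S = (SUP z\<in>T. G z)"
  have Tne: "T \<noteq> {}" using r by (auto simp: T_def Cn_def intro!: exI[of _ "\<lambda>_. 0"])
  have bdd: "bdd_above (G ` T)" using b by (auto simp: bdd_above_def)
  have GS: "G z \<le> S" if "z \<in> T" for z unfolding S_def by (rule cSUP_upper[OF that bdd])
  have S0: "0 \<le> S" using Tne GS by (force simp: G_def intro: order_trans[OF norm_ge_zero])
  have spread: "G z \<le> S * (7 * x) powr s" if z: "z \<in> Cn n" "Cn_norm n z \<le> x * r" "Cn_norm n z < t * r" and x: "1 \<le> 7 * x" for z x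
  proof (cases "z \<in> T")
    case True
    have "S * 1 \<le> S * (7 * x) powr s" using S0 s0 x by (intro mult_left_mono ge_one_powr_ge_zero) auto
    then show ?thesis using GS[OF True] by simp
  next
    case False
    then have nz: "r / 7 < Cn_norm n z" using z by (simp add: T_def)
    then have z0: "z \<noteq> (\<lambda>_. 0)" using r by auto
    have "z \<in> Cn_ball0 n (t * r)" using z by (simp add: mem_Cn_ball0)
    then obtain v \<zeta> where v: "v \<in> Cn n" "Cn_norm n v = r" and \<zeta>: "z = (\<lambda>i. \<zeta> * v i)"
      using direction_of_point[OF _ z0 r] by metis
    have nz': "Cn_norm n z = cmod \<zeta> * r" unfolding \<zeta> Cn_norm_scale v(2) ..
    have "G z \<le> S * (cmod \<zeta> / (1 / 7)) powr s"
      unfolding G_def \<zeta> s_def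
    proof (rule line_growth[OF v w])
      show "cmod (g ((\<lambda>i. \<xi> * v i)(n := w))) \<le> S" if "cmod \<xi> \<le> 1 / 7" for \<xi>
      proof -
        have "cmod \<xi> * r \<le> 1 / 7 * r" using that r by (intro mult_right_mono) auto
        then have "(\<lambda>i. \<xi> * v i) \<in> T" using v by (simp add: T_def Cn_scale Cn_norm_scale)
        from GS[OF this] show ?thesis by (simp add: G_def)
      qed
      show "1 / 7 \<le> cmod \<zeta>" using nz nz' r by (simp add: field_simps)
      show "cmod \<zeta> < t" using z(3) nz' r by simp
    qed auto
    also have "\<dots> \<le> S * (7 * x) powr s"
    proof (intro mult_left_mono powr_mono2)
      show "cmod \<zeta> / (1 / 7) \<le> 7 * x" using z(2) nz' r by simp
    qed (use S0 s0 in auto)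
    finally show ?thesis .
  qed
  \<comment> \<open>The exponent has to satisfy \<open>7 powr s < 3 powr \<sigma>\<close>.\<close>
  define \<sigma> where "\<sigma> = 2 * s"
  define C where "C = max (B / \<eta> powr \<sigma>) (S * 7 powr s / 3 powr \<sigma>)"
  have \<eta>p: "0 < \<eta> powr \<sigma>" using \<eta> by simp
  have \<eta>1: "\<eta> powr \<sigma> \<le> 1" using \<eta> s0 by (intro powr_le1) (auto simp: \<sigma>_def)
  have BB: "B \<le> B / \<eta> powr \<sigma>" using \<eta>p \<eta>1 B0 by (simp add: le_divide_eq mult_left_le)
  have "G z \<le> C" if zT: "z \<in> T" for z
  proof (cases "z = (\<lambda>_. 0)")
    case True
    have "cmod (g ((\<lambda>i. 0 * (v\<^sub>0 i + 0 * (v\<^sub>0 i - v\<^sub>0 i)))(n := w))) \<le> B" by (rule B[OF v0]) (use \<eta> in auto)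
    then show ?thesis using True BB by (simp add: G_def C_def)
  next
    case False
    have "Cn_norm n z < t * r" using zT \<open>r / 7 < t * r\<close> by (simp add: T_def)
    then have "z \<in> Cn_ball0 n (t * r)" using zT by (simp add: mem_Cn_ball0 T_def)
    then obtain v\<^sub>1 \<zeta> where v1: "v\<^sub>1 \<in> Cn n" "Cn_norm n v\<^sub>1 = r" and \<zeta>: "z = (\<lambda>i. \<zeta> * v\<^sub>1 i)"
      using direction_of_point[OF _ False r] by metis
    have \<zeta>7: "cmod \<zeta> \<le> 1 / 7"
    proof -
      have "Cn_norm n z = cmod \<zeta> * r" unfolding \<zeta> Cn_norm_scale v1(2) ..
      then have "cmod \<zeta> * r \<le> 1 / 7 * r" using zT by (simp add: T_def)
      then show ?thesis using r by simp
    qed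
    define c where "c = (\<lambda>\<xi> i. \<zeta> * (v\<^sub>0 i + \<xi> * (v\<^sub>1 i - v\<^sub>0 i)))"
    have cC: "c \<xi> \<in> Cn n" for \<xi> unfolding c_def by (intro Cn_scale Cn_add Cn_diff v0 v1)
    have cn: "Cn_norm n (c \<xi>) \<le> r * (1 + 2 * cmod \<xi>) / 7" for \<xi>
    proof -
      have "cmod \<zeta> * Cn_norm n (\<lambda>i. v\<^sub>0 i + \<xi> * (v\<^sub>1 i - v\<^sub>0 i)) \<le> 1 / 7 * (r * (1 + 2 * cmod \<xi>))"
        using \<zeta>7 segment_norm(1)[OF v0(2) v1(2)] by (intro mult_mono) auto
      then show ?thesis unfolding c_def Cn_norm_scale by simp
    qed
    define X where "X = (7 * t - 1) / 2"
    have X3: "3 < X" using t1 by (simp add: X_def)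
    have cb: "c \<xi> \<in> Cn_ball0 n (t * r)" if "cmod \<xi> < X" for \<xi>
    proof -
      have "r * (1 + 2 * cmod \<xi>) < r * (7 * t)" using that r by (intro mult_strict_left_mono) (auto simp: X_def)
      then show ?thesis using cn[of \<xi>] cC by (simp add: mem_Cn_ball0 mult.commute)
    qed
    have hol: "(\<lambda>\<xi>. g ((c \<xi>)(n := w))) holomorphic_on ball 0 X"
      by (rule slice_curve_holomorphic[OF holg])
         (use cb cC w in \<open>auto simp: c_def intro!: holomorphic_intros\<close>)
    have "cmod (g ((c 1)(n := w))) \<le> C * cmod (1::complex) powr \<sigma>"
    proof (rule hadamard_three_circles[OF hol open_ball, of \<eta> 3])
      show "cmod (g ((c \<xi>)(n := w))) \<le> C * \<eta> powr \<sigma>" if "cmod \<xi> = \<eta>" for \<xi>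
      proof -
        have "cmod (g ((c \<xi>)(n := w))) \<le> B" unfolding c_def by (rule B[OF v1 _ \<zeta>7]) (use that in simp)
        also have "B = B / \<eta> powr \<sigma> * \<eta> powr \<sigma>" using \<eta>p by simp
        also have "\<dots> \<le> C * \<eta> powr \<sigma>" unfolding C_def by (intro mult_right_mono) auto
        finally show ?thesis .
      qed
      show "cmod (g ((c \<xi>)(n := w))) \<le> C * 3 powr \<sigma>" if "cmod \<xi> = 3" for \<xi>
      proof -
        have "Cn_norm n (c \<xi>) \<le> 1 * r" using cn[of \<xi>] that by simp
        moreover have "Cn_norm n (c \<xi>) < t * r" using cb[of \<xi>] that X3 by (simp add: mem_Cn_ball0)
        ultimately have "G (c \<xi>) \<le> S * (7 * 1) powr s" by (intro spread cC) auto
        also have "S * (7 * 1) powr s = S * 7 powr s / 3 powr \<sigma> * 3 powr \<sigma>" by simp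
        also have "\<dots> \<le> C * 3 powr \<sigma>" unfolding C_def by (intro mult_right_mono) auto
        finally show ?thesis by (simp add: G_def)
      qed
    qed (use \<eta> X3 in auto)
    moreover have "c 1 = z" by (auto simp: c_def \<zeta>)
    ultimately show ?thesis by (simp add: G_def)
  qed
  then have SC: "S \<le> C" unfolding S_def by (intro cSUP_least Tne)
  have SB: "S \<le> B / \<eta> powr \<sigma>"
  proof (rule ccontr)
    assume n: "\<not> ?thesis"
    then have le: "S \<le> S * (7 powr s / 3 powr \<sigma>)" using SC by (simp add: C_def max_def split: if_splits)
    have "0 < S" using n B0 \<eta>p by (smt (verit) divide_nonneg_pos)
    moreover have "7 powr s / 3 powr \<sigma> < 1"
    proof -
      have "(3::real) powr \<sigma> = 9 powr s" unfolding \<sigma>_def powr_powr[symmetric] by simp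
      then show ?thesis using s0 powr_less_mono2[of s 7 9] by simp
    qed
    ultimately show False using le mult_strict_left_mono[of "7 powr s / 3 powr \<sigma>" 1 S] by simp
  qed
  have zz: "z \<in> Cn n" "Cn_norm n z < t * r" using z by (auto simp: mem_Cn_ball0)
  have "G z \<le> S * (7 * t) powr s" by (rule spread[OF zz(1) _ zz(2)]) (use zz t1 in auto)
  also have "\<dots> \<le> B / \<eta> powr \<sigma> * (7 * t) powr s" using SB by (intro mult_right_mono) auto
  also have "B / \<eta> powr \<sigma> = B * \<eta> powr (- 2 * (p / ln t))" by (simp add: \<sigma>_def s_def powr_minus_divide)
  finally show ?thesis by (simp add: G_def s_def)
qed

end

section \<open>Bounds off the graph\<close>

context graph_class
begin

lemma difference_on_direction:
  assumes "v \<in> Cn n" "Cn_norm n v = r" "cmod w\<^sub>0 \<le> M2"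
  shows "(\<lambda>z. f (\<lambda>i. z * v i) - w\<^sub>0) holomorphic_on ball 0 (u\<^sup>2)"
    and "cmod z < u\<^sup>2 \<Longrightarrow> cmod (f (\<lambda>i. z * v i) - w\<^sub>0) \<le> 2 * M2"
proof -
  have vt: "Cn_norm n v * u\<^sup>2 \<le> t * r" using assms by (simp add: t)
  show "(\<lambda>z. f (\<lambda>i. z * v i) - w\<^sub>0) holomorphic_on ball 0 (u\<^sup>2)"
    by (intro holomorphic_intros f_line_holomorphic[OF assms(1) vt])
  show "cmod (f (\<lambda>i. z * v i) - w\<^sub>0) \<le> 2 * M2" if "cmod z < u\<^sup>2"
    using fM2[OF line_in_ball[OF assms(1) vt that]] assms(3) norm_triangle_ineq4[of "f (\<lambda>i. z * v i)" w\<^sub>0] by linarith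
qed

lemma exponent_nonneg: "0 \<le> ((u + 1) / (u - 1))\<^sup>2 + 2 * u\<^sup>2 / (u - 1)\<^sup>2 * ln (336 * exp 1 / (u - 1))"
proof -
  have "u - 1 \<le> 336 * exp 1" using u exp_ge_add_one_self[of 1] by simp
  then have "0 \<le> ln (336 * exp 1 / (u - 1))" using u by (intro ln_ge_zero) (simp add: le_divide_eq)
  then show ?thesis by simp
qed

text \<open>
  Choose the zeros of \<open>f - w\<^sub>0\<close> on the line of \<open>v\<^sub>0\<close> and a circle on which it is at least \<open>\<delta>\<^sub>0\<close>.  The numbers
  \<open>\<eta>\<close> and \<open>\<delta>\<close> say how far direction and value can be moved: each contributes at most \<open>\<kappa> * \<delta>\<^sub>0 / 2\<close> to the change
  of \<open>f - w\<^sub>0\<close>, with \<open>\<kappa> = p\<^sub>1 * exp (- \<Lambda>) / 200\<close>.  This \<open>\<kappa>\<close> is small enough for the contraction because \<open>5 / 8 * p \<le> \<Lambda>\<close>: the function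
  \<open>f - w\<^sub>0\<close> is bounded by \<open>2 * M2\<close> and its zeros make it at most \<open>2 * M2 * exp (- (5 / 8 * p))\<close> at a point where
  it is at least \<open>c\<close>.
\<close>

lemma slices_large_p:
  fixes p\<^sub>1 \<epsilon> M1 c \<Lambda> X \<eta> \<delta> :: real
  assumes n: "1 \<le> n" and M1: "0 < M1" "ereal M1 \<le> sup_abs f (Cn_ball0 n (r / t))"
    and R: "ereal t \<le> R_ratio n f r t (t\<^sup>2)"
    and N: "ereal p \<le> ereal (ln ((1 + t) / (2 * sqrt t))) * N_index n f r t"
    and p1: "0 < p\<^sub>1" "p\<^sub>1 \<le> p" "p\<^sub>1 \<le> 1 / 2"
    and eps: "\<And>z. z \<in> Cn_ball0 n r \<Longrightarrow> cmod (g (z(n := f z))) \<le> \<epsilon>"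
  defines "c \<equiv> M1 * (1 - 1 / t) / 4" and "\<Lambda> \<equiv> ln (2 * M2 / c)"
    and "X \<equiv> ((u + 1) / (u - 1))\<^sup>2 + 2 * u\<^sup>2 / (u - 1)\<^sup>2 * ln (336 * exp 1 / (u - 1))"
    and "\<eta> \<equiv> p\<^sub>1 * (t - 1) / 800 * exp (- (X + 1) * \<Lambda>)" and "\<delta> \<equiv> M2 * p\<^sub>1 / 200 * exp (- (X + 1) * \<Lambda>)"
  shows "0 \<le> \<Lambda> \<and> (\<exists>w\<^sub>0. cmod w\<^sub>0 \<le> M2 \<and> (\<forall>z w. z \<in> Cn_ball0 n (t * r) \<longrightarrow> cmod (w - w\<^sub>0) < \<delta> \<longrightarrow>
    cmod (g (z(n := w))) \<le> 30 * \<epsilon> / p\<^sub>1 * \<eta> powr (- 2 * (p / ln t)) * (7 * t) powr (p / ln t)))"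
proof -
  have p: "0 < p" using p1 by simp
  have f2: "sup_abs f (Cn_ball0 n (t * r)) \<le> ereal M2" using fM2 by (simp add: sup_abs_le_iff)
  obtain v\<^sub>0 w\<^sub>0 \<zeta>\<^sub>0 where v0: "v\<^sub>0 \<in> Cn n" "Cn_norm n v\<^sub>0 = r" and w0: "cmod w\<^sub>0 \<le> M2" and \<zeta>0: "cmod \<zeta>\<^sub>0 \<le> 1 / t"
    and c: "c \<le> cmod (f (\<lambda>i. \<zeta>\<^sub>0 * v\<^sub>0 i) - w\<^sub>0)"
    and prod: "\<And>\<rho> z. 1 - (u - 1) / (4 * u) \<le> \<rho> \<Longrightarrow> \<rho> < 1 \<Longrightarrow> cmod z \<le> \<rho> / u \<Longrightarrow>
      (\<Prod>a\<in>{z \<in> ball 0 \<rho>. f (\<lambda>i. z * v\<^sub>0 i) - w\<^sub>0 = 0}. cmod (blaschke \<rho> a z) ^ nat (zorder (\<lambda>z. f (\<lambda>i. z * v\<^sub>0 i) - w\<^sub>0) a))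
        \<le> exp (- (5 / 8 * p))"
    unfolding c_def using zero_data_exists[OF n r u t holf M1 f2 R p N] by blast
  define F0 where "F0 = (\<lambda>z. f (\<lambda>i. z * v\<^sub>0 i) - w\<^sub>0)"
  have c0: "0 < c" using M1 t1 by (simp add: c_def)
  note F0 = difference_on_direction[OF v0 w0]
  have \<zeta>t: "cmod \<zeta>\<^sub>0 < u\<^sup>2"
  proof -
    have "1 / t < 1" using t1 by simp
    then show ?thesis using \<zeta>0 t1 t by linarith
  qed
  have cK: "c \<le> 2 * M2" using c F0(2)[OF \<zeta>t] by linarith
  then have \<Lambda>0: "0 \<le> \<Lambda>" using c0 by (simp add: \<Lambda>_def)
  have X0: "0 \<le> X" unfolding X_def by (rule exponent_nonneg)
  obtain \<rho> where \<rho>: "1 - (u - 1) / (4 * u) \<le> \<rho>" "\<rho> \<le> 1 - (u - 1) / (8 * u)"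
    and circ: "\<And>z. cmod z = \<rho> \<Longrightarrow> 2 * M2 * exp (- X * \<Lambda>) \<le> cmod (f (\<lambda>i. z * v\<^sub>0 i) - w\<^sub>0)"
    using lower_bound_on_circle[OF u F0 c0 c, folded t, OF _ \<zeta>0] unfolding X_def \<Lambda>_def t by blast
  define \<delta>\<^sub>0 where "\<delta>\<^sub>0 = 2 * M2 * exp (- X * \<Lambda>)"
  define \<kappa> where "\<kappa> = p\<^sub>1 * exp (- \<Lambda>) / 200"
  have \<delta>0: "0 < \<delta>\<^sub>0" using M2 by (simp add: \<delta>\<^sub>0_def)
  have \<kappa>0: "0 < \<kappa>" using p1 by (simp add: \<kappa>_def)
  have ee: "exp (- (X + 1) * \<Lambda>) = exp (- X * \<Lambda>) * exp (- \<Lambda>)" by (simp add: exp_add[symmetric] algebra_simps)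
  have \<delta>\<kappa>: "\<delta> = \<kappa> * \<delta>\<^sub>0 / 2" unfolding \<delta>_def \<kappa>_def \<delta>\<^sub>0_def ee by simp
  have \<eta>\<kappa>: "4 * M2 * \<eta> / (t - 1) = \<kappa> * \<delta>\<^sub>0 / 2" using t1 unfolding \<eta>_def \<kappa>_def \<delta>\<^sub>0_def ee by (simp add: field_simps)
  have e1: "exp (- (X + 1) * \<Lambda>) \<le> 1" using X0 \<Lambda>0
    by (simp only: mult_minus_left exp_le_one_iff neg_le_0_iff_le) (intro mult_nonneg_nonneg, auto)
  have \<rho>': "(3 * u + 1) / (4 * u) \<le> \<rho>" "0 < (u - 1) / (8 * u)" using \<rho>(1) u by (auto simp: field_simps)
  have \<rho>0: "0 < \<rho>" using \<rho>'(1) u by (smt (verit) divide_pos_pos)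
  have \<rho>1: "\<rho> < 1" using \<rho>(2) \<rho>'(2) by linarith
  have \<rho>u: "(3 * u + 1) / (4 * u) / u \<le> \<rho> / u" using \<rho>'(1) u by (intro divide_right_mono) auto
  have "1 / t \<le> (3 * u + 1) / (4 * u) / u" using u by (simp add: t field_simps power2_eq_square)
  then have \<zeta>\<rho>: "cmod \<zeta>\<^sub>0 \<le> \<rho> / u" using \<zeta>0 \<rho>u by linarith
  have "u * u \<le> 3 * u" using u by (intro mult_right_mono) auto
  then have "1 / 7 * (4 * (u * u)) \<le> 3 * u + 1" using u by linarith
  then have "1 / 7 \<le> (3 * u + 1) / (4 * (u * u))" by (rule mult_imp_le_div_pos[rotated]) (use u in simp)
  then have "1 / 7 \<le> (3 * u + 1) / (4 * u) / u" by (simp add: mult.assoc)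
  then have \<rho>7: "1 / 7 \<le> \<rho> / u" using \<rho>u by linarith
  have holF1: "F0 holomorphic_on ball 0 1"
    unfolding F0_def by (rule holomorphic_on_subset[OF F0(1)]) (use t1 t in auto)
  \<comment> \<open>The unperturbed estimate, applied to \<open>F0\<close> itself.\<close>
  have p\<Lambda>: "5 / 8 * p \<le> \<Lambda>"
  proof -
    have zr: "cmod \<zeta>\<^sub>0 \<le> \<rho>" using \<zeta>\<rho> \<rho>0 u by (smt (verit) div_by_1 frac_le)
    have "cmod (F0 \<zeta>\<^sub>0) \<le> 2 * M2 * ((\<Prod>a\<in>{z \<in> ball 0 \<rho>. F0 z = 0}. cmod (blaschke \<rho> a \<zeta>\<^sub>0) ^ nat (zorder F0 a)) + 0) / (1 - 0)"
    proof (rule perturbed_division_estimate[OF holF1 holF1 holF1 \<rho>0 \<rho>1 \<delta>0 _ _ _ _ _ _ zr])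
      show "\<delta>\<^sub>0 \<le> cmod (F0 z)" if "cmod z = \<rho>" for z using circ[OF that] by (simp add: \<delta>\<^sub>0_def F0_def)
      show "cmod (F0 z) \<le> 2 * M2" if "cmod z = \<rho>" for z
        unfolding F0_def by (rule F0(2)) (use that \<rho>1 t1 t in simp)
      show "\<exists>C d. 0 < d \<and> (\<forall>z\<in>ball a d. cmod (F0 z) \<le> C * cmod (F0 z))" for a
        by (intro exI[of _ 1]) auto
    qed auto
    also have "\<dots> \<le> 2 * M2 * exp (- (5 / 8 * p))"
      using prod[OF \<rho>(1) \<rho>1 \<zeta>\<rho>] M2 by (simp add: F0_def)
    finally have "c \<le> 2 * M2 * exp (- (5 / 8 * p))" using c by (simp add: F0_def)
    then have "exp (5 / 8 * p) \<le> 2 * M2 / c" using c0 by (simp add: exp_minus field_simps)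
    then have "ln (exp (5 / 8 * p)) \<le> \<Lambda>" unfolding \<Lambda>_def by (subst ln_le_cancel_iff) (use c0 M2 in auto)
    then show ?thesis by simp
  qed
  have \<kappa>p: "\<kappa> \<le> p\<^sub>1 * exp (- p / 2) / 200"
    unfolding \<kappa>_def using p\<Lambda> p p1 by (intro divide_right_mono mult_left_mono) auto
  have \<eta>0: "0 < \<eta>" using p1 t1 by (simp add: \<eta>_def)
  have \<eta>s: "\<eta> \<le> (t - 1) / 1600"
  proof -
    have "p\<^sub>1 * (t - 1) / 800 * exp (- (X + 1) * \<Lambda>) \<le> (1 / 2) * (t - 1) / 800 * 1"
      using p1 t1 e1 by (intro mult_mono divide_right_mono) auto
    then show ?thesis by (simp add: \<eta>_def)
  qed
  have t9: "t \<le> 9" using power_mono[of u 3 2] u by (simp add: t)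
  have \<delta>M: "\<delta> \<le> M2"
  proof -
    have "M2 * p\<^sub>1 / 200 * exp (- (X + 1) * \<Lambda>) \<le> M2 * 1 / 1 * 1"
      using p1 M2 e1 by (intro mult_mono frac_le) auto
    then show ?thesis by (simp add: \<delta>_def)
  qed
  have \<epsilon>0: "0 \<le> \<epsilon>"
    using eps[of "\<lambda>_. 0"] r by (simp add: mem_Cn_ball0 Cn_def) (metis norm_ge_zero order_trans)
  have main: "cmod (g (z(n := w))) \<le> 30 * \<epsilon> / p\<^sub>1 * \<eta> powr (- 2 * (p / ln t)) * (7 * t) powr (p / ln t)"
    if z: "z \<in> Cn_ball0 n (t * r)" and w: "cmod (w - w\<^sub>0) < \<delta>" for z w
  proof (rule slice_everywhere[OF p _ \<eta>0 _ v0 _ _ z])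
    show w3: "cmod w < 3 * M2" using w w0 \<delta>M M2 norm_triangle_sub[of w w\<^sub>0] by linarith
    show "\<eta> \<le> 1" using \<eta>s t9 by simp
    show "0 \<le> 30 * \<epsilon> / p\<^sub>1" using \<epsilon>0 p1 by simp
    fix v\<^sub>1 \<xi> \<zeta> assume v1: "v\<^sub>1 \<in> Cn n" "Cn_norm n v\<^sub>1 = r" and \<xi>: "cmod \<xi> \<le> \<eta>" and \<zeta>: "cmod \<zeta> \<le> 1 / 7"
    define v where "v = (\<lambda>i. v\<^sub>0 i + \<xi> * (v\<^sub>1 i - v\<^sub>0 i))"
    note sn = segment_norm[OF v0(2) v1(2)]
    have vC: "v \<in> Cn n" unfolding v_def by (intro Cn_add Cn_scale Cn_diff v0 v1)
    have r1: "r * (1 + 2 * cmod \<xi>) \<le> r * (1 + (t - 1) / 800)" using r \<xi> \<eta>s by (intro mult_left_mono) auto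
    have "1 + (t - 1) / 800 \<le> t" using t1 by (simp add: field_simps)
    then have "r * (1 + (t - 1) / 800) \<le> r * t" using r by (intro mult_left_mono) auto
    moreover have nv: "Cn_norm n v \<le> r * (1 + (t - 1) / 800)" unfolding v_def by (rule order_trans[OF sn(1) r1])
    ultimately have vt: "Cn_norm n v \<le> t * r" by (simp add: mult.commute[of t])
    have "0 < r * (1 - 2 * cmod \<xi>)" using r \<xi> \<eta>s t9 by (intro mult_pos_pos) auto
    then have vp: "0 < Cn_norm n v" using sn(2)[of \<xi>] by (simp add: v_def)
    have v\<rho>: "Cn_norm n v * \<rho> < r"
    proof -
      \<comment> \<open>The vector is longer than \<open>r\<close> by at most the factor \<open>1 + y\<close>, and \<open>\<rho> \<le> 1 - y\<close>.\<close>
      define y where "y = (u - 1) / (8 * u)"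
      have y0: "0 < y" using u by (simp add: y_def)
      have "(t - 1) / 800 = (u - 1) * ((u + 1) / 800)" by (simp add: t power2_eq_square algebra_simps)
      also have "\<dots> \<le> (u - 1) * (1 / (8 * u))"
      proof (rule mult_left_mono)
        have "(1::real) / 24 \<le> 1 / (8 * u)" using u by (intro divide_left_mono) auto
        moreover have "(u + 1) / 800 \<le> 1 / 24" using u by (simp add: field_simps)
        ultimately show "(u + 1) / 800 \<le> 1 / (8 * u)" by (rule order_trans[rotated])
      qed (use u in simp)
      finally have ty: "(t - 1) / 800 \<le> y" by (simp add: y_def)
      have "Cn_norm n v * \<rho> \<le> r * (1 + (t - 1) / 800) * (1 - y)"
        using nv \<rho>(2) \<rho>0 r t1 by (intro mult_mono) (auto simp: y_def)
      also have "\<dots> = r * ((1 + (t - 1) / 800) * (1 - y))" by simp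
      also have "\<dots> \<le> r * ((1 + y) * (1 - y))"
        using ty r \<rho>(2) \<rho>0 by (intro mult_left_mono mult_right_mono) (auto simp: y_def)
      also have "\<dots> < r * 1" using y0 r by (intro mult_strict_left_mono) (auto simp: algebra_simps)
      finally show ?thesis by simp
    qed
    have near: "cmod ((f (\<lambda>i. z * v i) - w) - (f (\<lambda>i. z * v\<^sub>0 i) - w\<^sub>0)) \<le> \<kappa> * \<delta>\<^sub>0" if z: "cmod z \<le> \<rho>" for z
    proof -
      define h where "h = (\<lambda>\<xi>. f (\<lambda>i. z * (v\<^sub>0 i + \<xi> * (v\<^sub>1 i - v\<^sub>0 i))))"
      have inb: "(\<lambda>i. z * (v\<^sub>0 i + x * (v\<^sub>1 i - v\<^sub>0 i))) \<in> Cn_ball0 n (t * r)" if "x \<in> ball 0 ((t - 1) / 2)" for x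
      proof -
        have "cmod z * Cn_norm n (\<lambda>i. v\<^sub>0 i + x * (v\<^sub>1 i - v\<^sub>0 i)) \<le> 1 * Cn_norm n (\<lambda>i. v\<^sub>0 i + x * (v\<^sub>1 i - v\<^sub>0 i))"
          using z \<rho>1 by (intro mult_right_mono) auto
        also have "\<dots> \<le> r * (1 + 2 * cmod x)" using sn(1) by simp
        also have "\<dots> < r * t" using that r by (intro mult_strict_left_mono) auto
        finally show ?thesis unfolding mem_Cn_ball0 Cn_norm_scale
          by (simp add: Cn_scale Cn_add Cn_diff v0 v1 mult.commute)
      qed
      have "h holomorphic_on ball 0 ((t - 1) / 2)"
        unfolding h_def
        by (rule Cn_holomorphic_compose[OF holf]) (use inb in \<open>auto intro!: holomorphic_intros Cn_scale Cn_add Cn_diff v0 v1\<close>)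
      moreover have "cmod (h x) \<le> M2" if "x \<in> ball 0 ((t - 1) / 2)" for x
        unfolding h_def by (rule fM2[OF inb[OF that]])
      ultimately have "cmod (h \<xi> - h 0) \<le> 2 * M2 * cmod (\<xi> - 0) / ((t - 1) / 2)"
        using \<xi> \<eta>s t1 by (intro bounded_holomorphic_diff_le) auto
      also have "\<dots> = 4 * M2 * cmod \<xi> / (t - 1)" by simp
      also have "\<dots> \<le> 4 * M2 * \<eta> / (t - 1)" using \<xi> M2 t1 by (intro divide_right_mono mult_left_mono) auto
      finally have "cmod (h \<xi> - h 0) \<le> \<kappa> * \<delta>\<^sub>0 / 2" using \<eta>\<kappa> by simp
      moreover have "cmod ((h \<xi> - h 0) - (w - w\<^sub>0)) \<le> cmod (h \<xi> - h 0) + cmod (w - w\<^sub>0)" by (rule norm_triangle_ineq4)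
      ultimately have "cmod ((h \<xi> - h 0) - (w - w\<^sub>0)) \<le> \<kappa> * \<delta>\<^sub>0" using w \<delta>\<kappa> by linarith
      moreover have "(f (\<lambda>i. z * v i) - w) - (f (\<lambda>i. z * v\<^sub>0 i) - w\<^sub>0) = (h \<xi> - h 0) - (w - w\<^sub>0)"
        by (simp add: h_def v_def)
      ultimately show ?thesis by (simp only:)
    qed
    have "cmod \<zeta> \<le> \<rho> / u" using \<zeta> \<rho>7 by linarith
    from slice_along_direction[OF p1 \<kappa>0 \<kappa>p eps \<rho>0 \<rho>1 v0 \<delta>0 _ prod[OF \<rho>(1) \<rho>1] vC vp v\<rho> w3 near vt this]
    show "cmod (g ((\<lambda>i. \<zeta> * (v\<^sub>0 i + \<xi> * (v\<^sub>1 i - v\<^sub>0 i)))(n := w))) \<le> 30 * \<epsilon> / p\<^sub>1"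
      using circ by (simp add: v_def \<delta>\<^sub>0_def)
  qed
  then show ?thesis using \<Lambda>0 w0 by blast
qed

text \<open>
  Now \<open>w\<^sub>0 = f 0\<close>, so that the Blaschke product of the zeros of \<open>f - w\<^sub>0\<close> is zero at the centre, and the division estimate bounds the
  difference between \<open>g(0, w)\<close> and the graph value there by \<open>\<kappa> / (1 - \<kappa>)\<close> times a supremum.  As the centre dominates, this
  supremum is at most \<open>3 * cmod (g(0, w)) + \<epsilon>\<close>, and the first term is absorbed.
\<close>

lemma slices_small_p:
  fixes p\<^sub>1 \<epsilon> M1 c \<Lambda> X \<eta> \<delta> :: real
  assumes M1: "0 < M1" "ereal M1 \<le> sup_abs f (Cn_ball0 n (r / t))"
    and R: "ereal t \<le> R_ratio n f r t (t\<^sup>2)"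
    and sm: "(t + 1) / (t - 1) * p \<le> 1 / 2"
    and p1: "0 < p\<^sub>1" "p\<^sub>1 \<le> 1 / 2"
    and eps: "\<And>z. z \<in> Cn_ball0 n r \<Longrightarrow> cmod (g (z(n := f z))) \<le> \<epsilon>"
  defines "c \<equiv> M1 * (1 - 1 / t) / 4" and "\<Lambda> \<equiv> ln (2 * M2 / c)"
    and "X \<equiv> ((u + 1) / (u - 1))\<^sup>2 + 2 * u\<^sup>2 / (u - 1)\<^sup>2 * ln (336 * exp 1 / (u - 1))"
    and "\<delta> \<equiv> M2 * p\<^sub>1 / 200 * exp (- (X + 1) * \<Lambda>)"
  shows "0 \<le> \<Lambda> \<and> (\<exists>w\<^sub>0. cmod w\<^sub>0 \<le> M2 \<and> (\<forall>z w. z \<in> Cn_ball0 n (t * r) \<longrightarrow> cmod (w - w\<^sub>0) < \<delta> \<longrightarrow>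
    cmod (g (z(n := w))) \<le> 6 * \<epsilon>))"
proof -
  have f2: "sup_abs f (Cn_ball0 n (t * r)) \<le> ereal M2" using fM2 by (simp add: sup_abs_le_iff)
  obtain A where A: "sup_abs f (Cn_ball0 n (r / t)) = ereal A" "M1 \<le> A" "A \<le> M2" "cmod (f (\<lambda>_. 0)) \<le> A / t"
    using real_sup_and_center[OF r t1 M1 f2 R] by blast
  have A0: "0 < A" using A M1 by simp
  have tt: "0 < 1 - 1 / t" using t1 by simp
  define G where "G = A * (1 + 1 / t) / 2"
  have "G < A" using A0 tt mult_strict_left_mono[of "1 / t" 1 A] by (simp add: G_def distrib_left)
  then have "ereal G < sup_abs f (Cn_ball0 n (r / t))" using A by simp
  then obtain z\<^sub>1 where z1: "z\<^sub>1 \<in> Cn_ball0 n (r / t)" "G < cmod (f z\<^sub>1)" by (rule less_sup_absE)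
  define w\<^sub>0 where "w\<^sub>0 = f (\<lambda>_. 0)"
  define c where c_eq: "c = M1 * (1 - 1 / t) / 4"
  have zero_in: "(\<lambda>_. 0) \<in> Cn_ball0 n (t * r)" "(\<lambda>_. 0) \<in> Cn_ball0 n r" using r t1 by (simp_all add: mem_Cn_ball0 Cn_def)
  have w0: "cmod w\<^sub>0 \<le> M2" unfolding w\<^sub>0_def by (rule fM2[OF zero_in(1)])
  have c0: "0 < c" using M1 tt by (simp add: c_eq)
  have cA: "c \<le> A * (1 - 1 / t) / 4" unfolding c_eq using A tt by (intro divide_right_mono mult_right_mono) auto
  have Gc: "A / t + c \<le> G"
  proof -
    define Q where "Q = A * (1 - 1 / t)"
    have "0 \<le> Q" using A0 tt by (simp add: Q_def)
    moreover have "G = A / t + Q / 2" by (simp add: G_def Q_def field_simps)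
    ultimately show ?thesis using cA unfolding Q_def[symmetric] by linarith
  qed
  have fz1: "c \<le> cmod (f z\<^sub>1 - w\<^sub>0)"
    using norm_triangle_ineq2[of "f z\<^sub>1" w\<^sub>0] z1(2) Gc A(4) by (simp add: w\<^sub>0_def)
  then have "z\<^sub>1 \<noteq> (\<lambda>_. 0)" using c0 by (auto simp: w\<^sub>0_def)
  then obtain v\<^sub>0 \<zeta>\<^sub>0 where v0: "v\<^sub>0 \<in> Cn n" "Cn_norm n v\<^sub>0 = r" and \<zeta>0: "cmod \<zeta>\<^sub>0 < r / t / r" and z1v: "z\<^sub>1 = (\<lambda>i. \<zeta>\<^sub>0 * v\<^sub>0 i)"
    using direction_of_point[OF z1(1) _ r] by metis
  have \<zeta>t: "cmod \<zeta>\<^sub>0 \<le> 1 / t" using \<zeta>0 r by simp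
  note F0 = difference_on_direction[OF v0 w0]
  have cF: "c \<le> cmod (f (\<lambda>i. \<zeta>\<^sub>0 * v\<^sub>0 i) - w\<^sub>0)" using fz1 by (simp add: z1v)
  have "1 / t < 1" using t1 by simp
  then have "cmod \<zeta>\<^sub>0 < u\<^sup>2" using \<zeta>t t1 t by linarith
  then have cK: "c \<le> 2 * M2" using cF F0(2)[of \<zeta>\<^sub>0] by linarith
  have \<Lambda>c: "\<Lambda> = ln (2 * M2 / c)" by (simp add: \<Lambda>_def c_eq assms(8))
  then have \<Lambda>0: "0 \<le> \<Lambda>" using c0 cK by simp
  have X0: "0 \<le> X" unfolding X_def by (rule exponent_nonneg)
  obtain \<rho> where \<rho>: "1 - (u - 1) / (4 * u) \<le> \<rho>" "\<rho> \<le> 1 - (u - 1) / (8 * u)"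
    and circ: "\<And>z. cmod z = \<rho> \<Longrightarrow> 2 * M2 * exp (- X * \<Lambda>) \<le> cmod (f (\<lambda>i. z * v\<^sub>0 i) - w\<^sub>0)"
    using lower_bound_on_circle[OF u F0 c0 cF, folded t, OF _ \<zeta>t] unfolding X_def \<Lambda>c t by blast
  have "(u - 1) / (4 * u) < 1" "0 < (u - 1) / (8 * u)" using u by (auto simp: divide_less_eq)
  then have \<rho>0: "0 < \<rho>" and \<rho>1: "\<rho> < 1" using \<rho> by linarith+
  define \<delta>\<^sub>0 where "\<delta>\<^sub>0 = 2 * M2 * exp (- X * \<Lambda>)"
  define \<kappa> where "\<kappa> = p\<^sub>1 * exp (- \<Lambda>) / 200"
  have \<delta>0: "0 < \<delta>\<^sub>0" using M2 by (simp add: \<delta>\<^sub>0_def)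
  have \<kappa>0: "0 < \<kappa>" using p1 by (simp add: \<kappa>_def)
  have "p\<^sub>1 * exp (- \<Lambda>) \<le> (1 / 2) * 1" using p1 \<Lambda>0 by (intro mult_mono) auto
  then have \<kappa>1: "\<kappa> \<le> 1 / 400" by (simp add: \<kappa>_def)
  have ee: "exp (- (X + 1) * \<Lambda>) = exp (- X * \<Lambda>) * exp (- \<Lambda>)" by (simp add: exp_add[symmetric] algebra_simps)
  have \<delta>\<kappa>: "\<delta> = \<kappa> * \<delta>\<^sub>0 / 2" unfolding \<delta>_def \<kappa>_def \<delta>\<^sub>0_def ee by simp
  have e1: "exp (- (X + 1) * \<Lambda>) \<le> 1" using X0 \<Lambda>0
    by (simp only: mult_minus_left exp_le_one_iff neg_le_0_iff_le) (intro mult_nonneg_nonneg, auto)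
  have \<delta>M: "\<delta> \<le> M2"
  proof -
    have "M2 * p\<^sub>1 / 200 * exp (- (X + 1) * \<Lambda>) \<le> M2 * 1 / 1 * 1"
      using p1 M2 e1 by (intro mult_mono frac_le) auto
    then show ?thesis by (simp add: \<delta>_def)
  qed
  define F where "F = (\<lambda>z. f (\<lambda>i. z * v\<^sub>0 i) - w\<^sub>0)"
  have sub: "ball 0 1 \<subseteq> ball (0::complex) (u\<^sup>2)" using t1 t by auto
  have holF: "F holomorphic_on ball 0 1" unfolding F_def by (rule holomorphic_on_subset[OF F0(1) sub])
  have nz: "\<exists>x\<in>ball 0 1. F x \<noteq> 0"
    using circ[of "of_real \<rho>"] \<rho>0 \<rho>1 \<delta>0 by (intro bexI[of _ "of_real \<rho>"]) (auto simp: F_def \<delta>\<^sub>0_def)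
  obtain H where "\<And>z. cmod z < \<rho> \<Longrightarrow> H z \<noteq> 0"
    "\<And>z. cmod z \<le> \<rho> \<Longrightarrow> F z = H z * (\<Prod>a\<in>{z \<in> ball 0 \<rho>. F z = 0}. blaschke \<rho> a z ^ nat (zorder F a))"
    by (rule blaschke_factorization[OF holF \<rho>0 \<rho>1 nz]) (rule that; blast)
  then have H: "H 0 \<noteq> 0" "F 0 = H 0 * (\<Prod>a\<in>{z \<in> ball 0 \<rho>. F z = 0}. blaschke \<rho> a 0 ^ nat (zorder F a))"
    using \<rho>0 by simp_all
  have "F 0 = 0" by (simp add: F_def w\<^sub>0_def)
  then have prod0: "(\<Prod>a\<in>{z \<in> ball 0 \<rho>. F z = 0}. cmod (blaschke \<rho> a 0) ^ nat (zorder F a)) = 0"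
    using H by (simp only: prod_norm norm_power[symmetric]) simp
  have vt: "Cn_norm n v\<^sub>0 * 1 \<le> t * r" using v0 t1 r by simp
  have "cmod (g (z(n := w))) \<le> 6 * \<epsilon>"
    if z: "z \<in> Cn_ball0 n (t * r)" and w: "cmod (w - w\<^sub>0) < \<delta>" for z w
  proof -
    have w3: "cmod w < 3 * M2" using w w0 \<delta>M M2 norm_triangle_sub[of w w\<^sub>0] by linarith
    define b where "b = cmod (g ((\<lambda>_. 0)(n := w)))"
    have cd: "cmod (g (z(n := w))) \<le> 3 * b" if z: "z \<in> Cn_ball0 n (t * r)" for z
    proof -
      have "exp (2 * ((t + 1) / (t - 1)) * p) \<le> exp 1" using sm by (subst exp_le_cancel_iff) linarith
      also have "\<dots> \<le> (3::real)" by (rule exp_le)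
      finally have "exp (2 * ((t + 1) / (t - 1)) * p) * b \<le> 3 * b" by (intro mult_right_mono) (auto simp: b_def)
      then show ?thesis using center_dominates[OF sm z w3] by (simp add: b_def)
    qed
    define \<phi> where "\<phi> = (\<lambda>\<zeta>. g ((\<lambda>i. \<zeta> * v\<^sub>0 i)(n := w)) - g ((\<lambda>i. \<zeta> * v\<^sub>0 i)(n := f (\<lambda>i. \<zeta> * v\<^sub>0 i))))"
    have "cmod (\<phi> 0) \<le> (3 * b + \<epsilon>) * ((\<Prod>a\<in>{z \<in> ball 0 \<rho>. F z = 0}. cmod (blaschke \<rho> a 0) ^ nat (zorder F a)) + \<kappa>) / (1 - \<kappa>)"
    proof (rule perturbed_division_estimate[OF holF _ _ \<rho>0 \<rho>1 \<delta>0 _ _ _ _ _ _, where F = "\<lambda>z. f (\<lambda>i. z * v\<^sub>0 i) - w"])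
      show "(\<lambda>z. f (\<lambda>i. z * v\<^sub>0 i) - w) holomorphic_on ball 0 1"
        by (intro holomorphic_intros f_line_holomorphic[OF v0(1) vt])
      show "\<phi> holomorphic_on ball 0 1"
        unfolding \<phi>_def by (intro holomorphic_intros g_line_holomorphic[OF v0(1) vt w3] graph_line_holomorphic[OF v0(1) vt])
      show "\<delta>\<^sub>0 \<le> cmod (F x)" if "cmod x = \<rho>" for x using circ[OF that] by (simp add: \<delta>\<^sub>0_def F_def)
      show "cmod (f (\<lambda>i. x * v\<^sub>0 i) - w - F x) \<le> \<kappa> * \<delta>\<^sub>0" for x
      proof -
        have "cmod (f (\<lambda>i. x * v\<^sub>0 i) - w - F x) = cmod (w - w\<^sub>0)" by (simp add: F_def norm_minus_commute)
        moreover have "0 < \<kappa> * \<delta>\<^sub>0" using \<kappa>0 \<delta>0 by simp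
        ultimately show ?thesis using w \<delta>\<kappa> by linarith
      qed
      show "cmod (\<phi> x) \<le> 3 * b + \<epsilon>" if "cmod x = \<rho>" for x
      proof -
        have "cmod x * r < 1 * r" using that \<rho>1 r by (intro mult_strict_right_mono) auto
        then have x1: "(\<lambda>i. x * v\<^sub>0 i) \<in> Cn_ball0 n r"
          unfolding mem_Cn_ball0 Cn_norm_scale using v0 by (simp add: Cn_scale)
        have "r < t * r" using r t1 by simp
        then have "(\<lambda>i. x * v\<^sub>0 i) \<in> Cn_ball0 n (t * r)" using x1 by (auto simp: mem_Cn_ball0)
        from cd[OF this] eps[OF x1] show ?thesis unfolding \<phi>_def
          by (intro order_trans[OF norm_triangle_ineq4] add_mono)
      qed
      show "\<exists>C d. 0 < d \<and> (\<forall>x\<in>ball a d. cmod (\<phi> x) \<le> C * cmod (f (\<lambda>i. x * v\<^sub>0 i) - w))"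
        if "cmod a < \<rho>" "f (\<lambda>i. a * v\<^sub>0 i) - w = 0" for a
        unfolding \<phi>_def by (rule difference_dominated[OF v0(1) vt w3]) (use that \<rho>1 in auto)
    qed (use \<kappa>0 \<kappa>1 \<rho>0 in auto)
    then have \<phi>0: "cmod (\<phi> 0) \<le> (3 * b + \<epsilon>) * (\<kappa> / (1 - \<kappa>))" unfolding prod0 by simp
    have b0: "0 \<le> b" by (simp add: b_def)
    have g0: "cmod (g ((\<lambda>_. 0)(n := f (\<lambda>_. 0)))) \<le> \<epsilon>" by (rule eps[OF zero_in(2)])
    then have \<epsilon>0: "0 \<le> \<epsilon>" by (rule order_trans[OF norm_ge_zero])
    have "\<kappa> / (1 - \<kappa>) \<le> 1 / 399" using \<kappa>1 by (simp add: divide_le_eq)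
    then have "(3 * b + \<epsilon>) * (\<kappa> / (1 - \<kappa>)) \<le> (3 * b + \<epsilon>) * (1 / 399)" using b0 \<epsilon>0 by (intro mult_left_mono) auto
    then have "cmod (\<phi> 0) \<le> (3 * b + \<epsilon>) / 399" using \<phi>0 by linarith
    moreover have "b \<le> cmod (\<phi> 0) + cmod (g ((\<lambda>_. 0)(n := f (\<lambda>_. 0))))"
      using norm_triangle_sub[of "g ((\<lambda>_. 0)(n := w))" "g ((\<lambda>_. 0)(n := f (\<lambda>_. 0)))"] by (simp add: b_def \<phi>_def)
    ultimately have "b \<le> 2 * \<epsilon>" using g0 b0 \<epsilon>0 by simp
    then show ?thesis using cd[OF z] by simp
  qed
  then show ?thesis using \<Lambda>0 w0 by blast
qed

text \<open>
  Below the threshold \<open>p\<^sub>1\<close> the hypothesis \<open>(t + 1) / (t - 1) * p \<le> 1 / 2\<close> of the centre estimate holds, above it the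
  contraction works.  Either way \<open>g\<close> is bounded for \<open>w\<close> in a small disc, and the Bernstein inequality does the
  rest.  The summands of the exponent come from the contraction, from the passage to all directions and from the
  passage to all values.
\<close>

lemma graph_bound_large:
  fixes p\<^sub>1 \<epsilon> M1 c \<Lambda> X :: real
  assumes n: "1 \<le> n" and M1: "0 < M1" "ereal M1 \<le> sup_abs f (Cn_ball0 n (r / t))"
    and R: "ereal t \<le> R_ratio n f r t (t\<^sup>2)"
    and N: "ereal p \<le> ereal (ln ((1 + t) / (2 * sqrt t))) * N_index n f r t"
    and \<epsilon>: "\<forall>z\<in>Cn_ball0 n r. cmod (g (z(n := f z))) \<le> \<epsilon>"
    and z: "z \<in> Cn_ball0 n (t * r)" and w: "cmod w < M2"
  defines "\<Lambda> \<equiv> ln (2 * M2 / (M1 * (1 - 1 / t) / 4))"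
    and "X \<equiv> ((u + 1) / (u - 1))\<^sup>2 + 2 * u\<^sup>2 / (u - 1)\<^sup>2 * ln (336 * exp 1 / (u - 1))"
    and "p\<^sub>1 \<equiv> ((t - 1) / (t + 1))\<^sup>2 / 2"
  shows "0 \<le> \<Lambda> \<and> cmod (g (z(n := w))) \<le> exp (ln (30 / p\<^sub>1)
    + p / ln t * (2 * (ln (800 / ((t - 1) * p\<^sub>1)) + (X + 1) * \<Lambda>) + ln (7 * t))
    + q * ((X + 1) * \<Lambda> + ln (400 / p\<^sub>1) + 1)) * \<epsilon>"
proof -
  note eps = \<epsilon>[rule_format]
  define \<eta> where "\<eta> = p\<^sub>1 * (t - 1) / 800 * exp (- (X + 1) * \<Lambda>)"
  define \<delta> where "\<delta> = M2 * p\<^sub>1 / 200 * exp (- (X + 1) * \<Lambda>)"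
  define E where "E = ln (30 / p\<^sub>1) + p / ln t * (2 * (ln (800 / ((t - 1) * p\<^sub>1)) + (X + 1) * \<Lambda>) + ln (7 * t))"
  have s0: "0 \<le> p / ln t" using p0 t1 by simp
  have frac: "0 < (t - 1) / (t + 1)" "(t - 1) / (t + 1) < 1" using t1 by simp_all
  have p10: "0 < p\<^sub>1" "p\<^sub>1 \<le> 1 / 2" using frac power_le_one[of "(t - 1) / (t + 1)" 2] by (auto simp: p\<^sub>1_def)
  have t9: "t \<le> 9" using power_mono[of u 3 2] u by (simp add: t)
  have \<epsilon>0: "0 \<le> \<epsilon>"
    using eps[of "\<lambda>_. 0"] r by (simp add: mem_Cn_ball0 Cn_def) (metis norm_ge_zero order_trans)
  have \<eta>0: "0 < \<eta>" using p10 t1 by (simp add: \<eta>_def)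
  have ln\<eta>: "- ln \<eta> = ln (800 / ((t - 1) * p\<^sub>1)) + (X + 1) * \<Lambda>"
    using p10 t1 by (simp add: \<eta>_def ln_mult ln_div) (simp add: algebra_simps)
  have X0: "0 \<le> X" unfolding X_def by (rule exponent_nonneg)
  have Eexp: "30 / p\<^sub>1 * \<eta> powr (- 2 * (p / ln t)) * (7 * t) powr (p / ln t) = exp E"
  proof -
    have "\<eta> powr (- 2 * (p / ln t)) = exp (p / ln t * (2 * (- ln \<eta>)))" using \<eta>0 by (simp add: powr_def)
    moreover have "(7 * t) powr (p / ln t) = exp (p / ln t * ln (7 * t))" using t1 by (simp add: powr_def)
    moreover have "30 / p\<^sub>1 = exp (ln (30 / p\<^sub>1))" using p10 by simp
    ultimately show ?thesis unfolding E_def ln\<eta>[symmetric] by (simp only: exp_add distrib_left mult.assoc)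
  qed
  have "0 \<le> \<Lambda> \<and> (\<exists>w\<^sub>0. cmod w\<^sub>0 \<le> M2 \<and> (\<forall>z w. z \<in> Cn_ball0 n (t * r) \<longrightarrow> cmod (w - w\<^sub>0) < \<delta> \<longrightarrow>
    cmod (g (z(n := w))) \<le> exp E * \<epsilon>))"
  proof (cases "p\<^sub>1 \<le> p")
    case True
    from slices_large_p[OF n M1 R N p10(1) True p10(2) eps, folded \<Lambda>_def X_def, folded \<eta>_def \<delta>_def]
    have "0 \<le> \<Lambda> \<and> (\<exists>w\<^sub>0. cmod w\<^sub>0 \<le> M2 \<and> (\<forall>z w. z \<in> Cn_ball0 n (t * r) \<longrightarrow> cmod (w - w\<^sub>0) < \<delta> \<longrightarrow>
      cmod (g (z(n := w))) \<le> 30 * \<epsilon> / p\<^sub>1 * \<eta> powr (- 2 * (p / ln t)) * (7 * t) powr (p / ln t)))" .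
    moreover have "30 * \<epsilon> / p\<^sub>1 * \<eta> powr (- 2 * (p / ln t)) * (7 * t) powr (p / ln t) = exp E * \<epsilon>"
      unfolding Eexp[symmetric] by simp
    ultimately show ?thesis by simp
  next
    case False
    have "(t + 1) / (t - 1) * p \<le> (t + 1) / (t - 1) * p\<^sub>1" using False t1 by (intro mult_left_mono) auto
    also have "\<dots> = (t - 1) / (t + 1) / 2" using t1 by (simp add: p\<^sub>1_def power2_eq_square)
    also have "\<dots> \<le> 1 / 2" by (rule divide_right_mono) (use frac in linarith, simp)
    finally have sm: "(t + 1) / (t - 1) * p \<le> 1 / 2" .
    from slices_small_p[OF M1 R sm p10 eps, folded \<Lambda>_def X_def, folded \<delta>_def]
    have 1: "0 \<le> \<Lambda> \<and> (\<exists>w\<^sub>0. cmod w\<^sub>0 \<le> M2 \<and> (\<forall>z w. z \<in> Cn_ball0 n (t * r) \<longrightarrow> cmod (w - w\<^sub>0) < \<delta> \<longrightarrow>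
      cmod (g (z(n := w))) \<le> 6 * \<epsilon>))" .
    have "6 * \<epsilon> \<le> exp E * \<epsilon>"
    proof (rule mult_right_mono[OF _ \<epsilon>0])
      have "(t - 1) * p\<^sub>1 \<le> 8 * 1" using t9 t1 p10 by (intro mult_mono) auto
      then have "0 \<le> ln (800 / ((t - 1) * p\<^sub>1))" using t1 p10 by (intro ln_ge_zero) (simp add: le_divide_eq)
      then have "0 \<le> p / ln t * (2 * (ln (800 / ((t - 1) * p\<^sub>1)) + (X + 1) * \<Lambda>) + ln (7 * t))"
        using s0 X0 1 t1 by (intro mult_nonneg_nonneg add_nonneg_nonneg) auto
      then have "exp (ln (30 / p\<^sub>1)) \<le> exp E" by (simp add: E_def)
      moreover have "6 \<le> 30 / p\<^sub>1" using p10 by (simp add: le_divide_eq)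
      ultimately show "6 \<le> exp E" using p10 by simp
    qed
    then show ?thesis using 1 by (meson order_trans)
  qed
  then obtain w\<^sub>0 where \<Lambda>0: "0 \<le> \<Lambda>" and w0: "cmod w\<^sub>0 \<le> M2"
    and B: "\<And>w. cmod (w - w\<^sub>0) < \<delta> \<Longrightarrow> cmod (g (z(n := w))) \<le> exp E * \<epsilon>" using z by blast
  have \<delta>0: "0 < \<delta>" using M2 p10 by (simp add: \<delta>_def)
  have \<delta>M: "\<delta> \<le> 2 * M2"
  proof -
    have "exp (- (X + 1) * \<Lambda>) \<le> 1" using X0 \<Lambda>0
    by (simp only: mult_minus_left exp_le_one_iff neg_le_0_iff_le) (intro mult_nonneg_nonneg, auto)
    then have "M2 * p\<^sub>1 / 200 * exp (- (X + 1) * \<Lambda>) \<le> M2 * 1 / 1 * 1"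
      using p10 M2 by (intro mult_mono frac_le) auto
    then show ?thesis using M2 by (simp add: \<delta>_def)
  qed
  have "ln (2 * M2 / \<delta>) = (X + 1) * \<Lambda> + ln (400 / p\<^sub>1)"
  proof -
    define e where "e = exp (- (X + 1) * \<Lambda>)"
    have "exp ((X + 1) * \<Lambda>) = inverse e" unfolding e_def by (simp only: mult_minus_left exp_minus inverse_inverse_eq)
    moreover have "0 < e" by (simp add: e_def)
    ultimately have "2 * M2 / \<delta> = 400 / p\<^sub>1 * exp ((X + 1) * \<Lambda>)"
      unfolding \<delta>_def e_def[symmetric] using M2 p10 by (simp add: field_simps)
    then have "ln (2 * M2 / \<delta>) = ln (400 / p\<^sub>1 * exp ((X + 1) * \<Lambda>))" by (rule arg_cong)
    also have "\<dots> = ln (400 / p\<^sub>1) + ln (exp ((X + 1) * \<Lambda>))" by (subst ln_mult) (use p10 in auto)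
    finally show ?thesis by simp
  qed
  moreover have "cmod (g (z(n := w))) \<le> exp (q * (ln (2 * M2 / \<delta>) + 1)) * (exp E * \<epsilon>)"
    by (rule fibre_spread[OF z w0 \<delta>0 \<delta>M _ w]) (use B in \<open>simp add: dist_norm norm_minus_commute\<close>)
  ultimately show ?thesis using \<Lambda>0 by (simp add: E_def exp_add mult_ac)
qed

end

section \<open>The constants\<close>

text \<open>
  The logarithm \<open>Y\<close> of the base exceeds \<open>\<Lambda>\<close> by \<open>3\<close>.  With \<open>E = u - 1\<close>, the logarithms in the numerators are at most small multiples of \<open>W\<close>,
  \<open>ln t\<close> is at least \<open>2 / 3 * E\<close>, and \<open>E\<^sup>2 * X \<le> (u + 1)\<^sup>2 + 24 * W\<close>.  After multiplication by \<open>E ^ 4\<close>, the coefficients of \<open>\<Lambda>\<close> and the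
  constant terms, for \<open>p\<close> and for \<open>q\<close> separately, stay below those of \<open>(36 * (u + 1)\<^sup>2 + 162 * W) * (\<Lambda> + 3)\<close>.
  The term \<open>ln (30 / p\<^sub>1)\<close> has no factor \<open>p\<close> or \<open>q\<close>; that is why one of the two has to be bounded
  below in the first part.
\<close>

lemma exponent_budget:
  fixes u t \<Lambda> Y p q :: real
  assumes u: "1 < u" "u \<le> 3" and t: "t = u\<^sup>2" and \<Lambda>: "0 \<le> \<Lambda>" and Y: "\<Lambda> + 3 \<le> Y" and pq: "0 \<le> p" "0 \<le> q"
  defines "W \<equiv> ln (108 * exp 1 / (u - 1))"
    and "X \<equiv> ((u + 1) / (u - 1))\<^sup>2 + 2 * u\<^sup>2 / (u - 1)\<^sup>2 * ln (336 * exp 1 / (u - 1))"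
    and "p\<^sub>1 \<equiv> ((t - 1) / (t + 1))\<^sup>2 / 2"
  defines "a \<equiv> (36 * (u + 1)\<^sup>2 + 162 * W) / (u - 1) ^ 4"
  shows "p\<^sub>1 \<le> p \<or> 1 / 5 \<le> q \<Longrightarrow> ln (30 / p\<^sub>1)
    + p / ln t * (2 * (ln (800 / ((t - 1) * p\<^sub>1)) + (X + 1) * \<Lambda>) + ln (7 * t))
    + q * ((X + 1) * \<Lambda> + ln (400 / p\<^sub>1) + 1) \<le> a * (p + q) * Y"
    and "2 * ((t + 1) / (t - 1)) * p + 5 * q \<le> a * (p + q) * Y"
    and "0 < a"
proof -
  define E S D where "E = u - 1" and "S = (u + 1)\<^sup>2" and "D = 36 * S + 162 * W"
  have E: "0 < E" "E \<le> 2" using u by (auto simp: E_def)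
  have W_E: "W = ln (108 * exp 1 / E)" by (simp add: W_def E_def)
  have E2: "E\<^sup>2 \<le> 4" "E ^ 3 \<le> 8" "E ^ 4 \<le> 16"
    using power_mono[of E 2 2] power_mono[of E 2 3] power_mono[of E 2 4] E by simp_all
  have E0: "0 < E\<^sup>2" "0 < E ^ 3" "0 < E ^ 4" using E by simp_all
  have S: "4 \<le> S" using power_mono[of 2 "u + 1" 2] u by (simp add: S_def)
  have e12: "2 \<le> exp (1::real)" "exp (1::real) \<le> 3" using exp_ge_add_one_self[of 1] exp_le by simp_all
  have e4: "exp (3::real) \<le> 27"
  proof -
    have "exp (3::real) = exp 1 ^ 3" by (simp add: exp_of_nat_mult[symmetric])
    also have "\<dots> \<le> 3 ^ 3" using e12 by (intro power_mono) auto
    finally show ?thesis by simp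
  qed
  have W4: "4 \<le> W"
  proof -
    have "exp (4::real) = exp 1 * exp 3" by (simp add: exp_add[symmetric])
    also have "\<dots> \<le> exp 1 * 54" using e4 by simp
    also have "\<dots> \<le> 108 * exp 1 / E" using E by (simp add: le_divide_eq)
    finally have "ln (exp 4) \<le> W" unfolding W_E by (subst ln_le_cancel_iff) (use E in auto)
    then show ?thesis by simp
  qed
  have lnW: "ln y \<le> k * W" if "0 < y" "y \<le> (108 * exp 1 / E) ^ k" for y and k :: nat
  proof -
    have "ln y \<le> ln ((108 * exp 1 / E) ^ k)" using that by (subst ln_le_cancel_iff) (use E in auto)
    then show ?thesis using E by (simp add: ln_realpow W_E)
  qed
  have lnW1: "ln y \<le> k * W" if "0 < y" "y \<le> 216 ^ k / E ^ k" for y and k :: nat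
  proof (rule lnW[OF that(1)])
    have "(216::real) ^ k / E ^ k \<le> (108 * exp 1) ^ k / E ^ k"
      using e12 E by (intro divide_right_mono power_mono) auto
    then show "y \<le> (108 * exp 1 / E) ^ k" using that(2) by (simp add: power_divide)
  qed
  have tE: "t - 1 = E * (u + 1)" by (simp add: t E_def power2_eq_square algebra_simps)
  have uu: "u\<^sup>2 \<le> 3 * u" using u by (simp add: power2_eq_square)
  have C: "(t + 1) / (t - 1) \<le> 5 / 2 / E"
  proof -
    have "t + 1 \<le> 5 / 2 * (u + 1)" using uu u by (simp add: t field_simps)
    then have "(t + 1) / (t - 1) \<le> 5 / 2 * (u + 1) / (t - 1)"
      using E u unfolding tE by (intro divide_right_mono) auto
    also have "\<dots> = 5 / 2 / E"
      unfolding tE by (rule nonzero_mult_divide_mult_cancel_right) (use u in simp)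
    finally show ?thesis .
  qed
  have t1: "1 < t" using E u tE by (smt (verit) mult_pos_pos)
  have p10: "0 < p\<^sub>1" using t1 by (simp add: p\<^sub>1_def)
  have p1: "1 / p\<^sub>1 \<le> 25 / 2 / E\<^sup>2"
  proof -
    have "1 / p\<^sub>1 = 2 * ((t + 1) / (t - 1))\<^sup>2" by (simp add: p\<^sub>1_def power_divide)
    also have "\<dots> \<le> 2 * (5 / 2 / E)\<^sup>2" using C t1 by (intro mult_left_mono power_mono) auto
    finally show ?thesis by (simp add: power_divide)
  qed
  have l400: "ln (400 / p\<^sub>1) \<le> 2 * W"
  proof -
    have "400 / p\<^sub>1 \<le> 400 * (25 / 2 / E\<^sup>2)" using p1 by simp
    also have "\<dots> \<le> 216\<^sup>2 / E\<^sup>2" using E by (simp add: divide_right_mono)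
    finally show ?thesis using lnW1[of "400 / p\<^sub>1" 2] p10 by simp
  qed
  have l30: "ln (30 / p\<^sub>1) \<le> 2 * W"
  proof -
    have "ln (30 / p\<^sub>1) \<le> ln (400 / p\<^sub>1)" using p10 by (subst ln_le_cancel_iff) (auto simp: divide_right_mono)
    then show ?thesis using l400 by simp
  qed
  have l800: "ln (800 / ((t - 1) * p\<^sub>1)) \<le> 3 * W"
  proof -
    have "800 / ((t - 1) * p\<^sub>1) = 800 / (t - 1) * (1 / p\<^sub>1)" by simp
    also have "\<dots> \<le> 800 / (E * 2) * (25 / 2 / E\<^sup>2)"
    proof (rule mult_mono[OF _ p1])
      have "E * 2 \<le> t - 1" unfolding tE using E u by (intro mult_left_mono) auto
      then show "800 / (t - 1) \<le> 800 / (E * 2)" using E by (intro divide_left_mono) auto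
    qed (use E p10 in auto)
    also have "\<dots> = 5000 / E ^ 3" by (simp add: power2_eq_square power3_eq_cube)
    also have "\<dots> \<le> 216 ^ 3 / E ^ 3" using E by (intro divide_right_mono) auto
    finally show ?thesis using lnW1[of "800 / ((t - 1) * p\<^sub>1)" 3] p10 t1 by simp
  qed
  have l7: "ln (7 * t) \<le> W"
  proof -
    have "t \<le> 9" using power_mono[of u 3 2] u by (simp add: t)
    then have "7 * t \<le> 216 / 2" by simp
    also have "\<dots> \<le> 216 / E" using E by (intro divide_left_mono) auto
    finally show ?thesis using lnW1[of "7 * t" 1] t1 by simp
  qed
  have lt: "1 / ln t \<le> 3 / 2 / E" and lt0: "0 < ln t"
  proof -
    show "0 < ln t" using t1 by simp
    have "- ln u \<le> 1 / u - 1" using ln_le_minus_one[of "1 / u"] u by (simp add: ln_div)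
    moreover have "E / 3 \<le> E / u" using E u by (intro divide_left_mono) auto
    moreover have "E / u = 1 - 1 / u" using u by (simp add: E_def diff_divide_distrib)
    ultimately have "E / 3 \<le> ln u" by linarith
    then have l: "2 / 3 * E \<le> ln t" using u by (simp add: t ln_realpow)
    have "1 / ln t \<le> 1 / (2 / 3 * E)" using l E by (intro divide_left_mono) (auto intro!: mult_pos_pos)
    then show "1 / ln t \<le> 3 / 2 / E" by simp
  qed
  have EX: "E\<^sup>2 * X \<le> S + 24 * W" and X0: "0 \<le> X"
  proof -
    define V where "V = ln (336 * exp 1 / E)"
    have V0: "0 \<le> V" unfolding V_def using E e12 by (intro ln_ge_zero) (simp add: le_divide_eq)
    have "V = ln (28 / 9 * (108 * exp 1 / E))" by (simp add: V_def)
    also have "\<dots> = ln (28 / 9) + W" unfolding W_E by (subst ln_mult) (use E in auto)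
    finally have "V = ln (28 / 9) + W" .
    moreover have "ln (28 / 9) \<le> (4 / 3 :: real)"
    proof -
      have "(28 / 9 :: real) \<le> exp (4 / 3)" using exp_lower_Taylor_quadratic[of "4 / 3 :: real"] by (simp add: power2_eq_square)
      then have "ln (28 / 9 :: real) \<le> ln (exp (4 / 3))" by (subst ln_le_cancel_iff) auto
      then show ?thesis by simp
    qed
    ultimately have V: "V \<le> 4 / 3 * W" using W4 by simp
    have X: "X = S / E\<^sup>2 + 2 * u\<^sup>2 / E\<^sup>2 * V" by (simp add: X_def S_def V_def E_def power_divide)
    show "0 \<le> X" unfolding X using V0 S by (intro add_nonneg_nonneg mult_nonneg_nonneg) auto
    have "2 * u\<^sup>2 * V \<le> 18 * (4 / 3 * W)"
      using V V0 power_mono[of u 3 2] u by (intro mult_mono) auto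
    moreover have "E\<^sup>2 * X = S + 2 * u\<^sup>2 * V" using E unfolding X by (simp add: field_simps)
    ultimately show "E\<^sup>2 * X \<le> S + 24 * W" by simp
  qed
  have D0: "144 \<le> D" using S W4 by (simp add: D_def)
  have aD: "a = D / E ^ 4" by (simp add: a_def D_def S_def E_def)
  show a0: "0 < a" using D0 E by (simp add: aD)
  have coeff: "c \<le> a * Y" if "c * E ^ 4 \<le> D * (\<Lambda> + 3)" for c
  proof -
    have "c \<le> D * (\<Lambda> + 3) / E ^ 4" using that E by (simp add: pos_le_divide_eq)
    also have "\<dots> = a * (\<Lambda> + 3)" by (simp add: aD)
    also have "\<dots> \<le> a * Y" using a0 Y by (intro mult_left_mono) auto
    finally show ?thesis .
  qed
  have comb: "x * p + y * q \<le> a * (p + q) * Y" if "x \<le> a * Y" "y \<le> a * Y" for x y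
  proof -
    have "x * p + y * q \<le> a * Y * p + a * Y * q" using that pq by (intro add_mono mult_right_mono) auto
    then show ?thesis by (simp add: algebra_simps)
  qed
  show "2 * ((t + 1) / (t - 1)) * p + 5 * q \<le> a * (p + q) * Y"
  proof (rule comb)
    have D3: "D * 3 \<le> D * (\<Lambda> + 3)" using D0 \<Lambda> by (intro mult_left_mono) auto
    have "2 * ((t + 1) / (t - 1)) * E ^ 4 \<le> 2 * (5 / 2 / E) * E ^ 4"
      using C E by (intro mult_right_mono mult_left_mono) auto
    also have "\<dots> = 5 * E ^ 3" using E by (simp add: power_def numeral_eq_Suc)
    finally show "2 * ((t + 1) / (t - 1)) \<le> a * Y" using E2 D0 D3 by (intro coeff) linarith
    show "5 \<le> a * Y" using E2 D0 D3 by (intro coeff) linarith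
  qed
  assume large: "p\<^sub>1 \<le> p \<or> 1 / 5 \<le> q"
  define Z where "Z = (X + 1) * \<Lambda>"
  have Z0: "0 \<le> Z" using X0 \<Lambda> by (simp add: Z_def)
  \<comment> \<open>The constant term is charged to \<open>p\<close> or to \<open>q\<close>.\<close>
  have Wpq: "2 * W \<le> 25 * W / E\<^sup>2 * p + 10 * W * q"
  proof -
    have "0 \<le> 25 * W / E\<^sup>2 * p" "0 \<le> 10 * W * q" using W4 pq by simp_all
    moreover have "2 * W \<le> 10 * W * q" if "1 / 5 \<le> q"
      using mult_left_mono[OF that, of "10 * W"] W4 by simp
    moreover have "2 * W \<le> 25 * W / E\<^sup>2 * p" if "p\<^sub>1 \<le> p"
    proof -
      have "1 \<le> p / p\<^sub>1" using that p10 by simp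
      also have "p / p\<^sub>1 = p * (1 / p\<^sub>1)" by simp
      also have "\<dots> \<le> p * (25 / 2 / E\<^sup>2)" using p1 pq by (intro mult_left_mono) auto
      finally have "2 * W * 1 \<le> 2 * W * (p * (25 / 2 / E\<^sup>2))" using W4 by (intro mult_left_mono) auto
      then show ?thesis by (simp add: mult_ac)
    qed
    ultimately show ?thesis using large by linarith
  qed
  have Pt: "p / ln t * (2 * (ln (800 / ((t - 1) * p\<^sub>1)) + Z) + ln (7 * t)) \<le> 3 / 2 / E * (7 * W + 2 * Z) * p"
  proof -
    have "p / ln t * (2 * (ln (800 / ((t - 1) * p\<^sub>1)) + Z) + ln (7 * t)) \<le> p / ln t * (7 * W + 2 * Z)"
      using l800 l7 pq lt0 by (intro mult_left_mono) auto
    also have "\<dots> = 1 / ln t * (p * (7 * W + 2 * Z))" by simp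
    also have "\<dots> \<le> 3 / 2 / E * (p * (7 * W + 2 * Z))" using lt pq W4 Z0 by (intro mult_right_mono) auto
    finally show ?thesis by (simp only: mult_ac)
  qed
  have Qt: "q * (Z + ln (400 / p\<^sub>1) + 1) \<le> (Z + 2 * W + 1) * q"
    using mult_left_mono[of "Z + ln (400 / p\<^sub>1) + 1" "Z + 2 * W + 1" q] l400 pq by (simp add: mult.commute)
  have "(25 * W / E\<^sup>2 + 3 / 2 / E * (7 * W + 2 * Z)) * p + (10 * W + (Z + 2 * W + 1)) * q \<le> a * (p + q) * Y"
  proof (rule comb; rule coeff)
    have EZ: "E\<^sup>2 * Z \<le> (S + 24 * W + 4) * \<Lambda>"
    proof -
      have "E\<^sup>2 * (X + 1) \<le> S + 24 * W + 4" using EX E2 by (simp add: distrib_left)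
      then have "E\<^sup>2 * (X + 1) * \<Lambda> \<le> (S + 24 * W + 4) * \<Lambda>" using \<Lambda> by (intro mult_right_mono) auto
      then show ?thesis by (simp add: Z_def mult.assoc)
    qed
    have EZ0: "0 \<le> E\<^sup>2 * Z" using Z0 by simp
    have SL: "4 * \<Lambda> \<le> S * \<Lambda>" "4 * \<Lambda> \<le> W * \<Lambda>" using S W4 \<Lambda> by (auto intro!: mult_right_mono)
    have "(25 * W / E\<^sup>2 + 3 / 2 / E * (7 * W + 2 * Z)) * E ^ 4 = 25 * (W * E\<^sup>2) + 21 / 2 * (W * E ^ 3) + 3 * (E * (E\<^sup>2 * Z))"
      using E by (simp add: field_simps power_def numeral_eq_Suc)
    moreover have "W * E\<^sup>2 \<le> W * 4" "W * E ^ 3 \<le> W * 8" using E2 W4 by (auto intro!: mult_left_mono)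
    moreover have "E * (E\<^sup>2 * Z) \<le> 2 * ((S + 24 * W + 4) * \<Lambda>)" by (rule mult_mono[OF E(2) EZ]) (use EZ0 in auto)
    moreover have "D * (\<Lambda> + 3) = 36 * (S * \<Lambda>) + 162 * (W * \<Lambda>) + 108 * S + 486 * W" by (simp add: D_def algebra_simps)
    moreover have "(S + 24 * W + 4) * \<Lambda> = S * \<Lambda> + 24 * (W * \<Lambda>) + 4 * \<Lambda>" by (simp add: algebra_simps)
    ultimately show "(25 * W / E\<^sup>2 + 3 / 2 / E * (7 * W + 2 * Z)) * E ^ 4 \<le> D * (\<Lambda> + 3)"
      using SL \<Lambda> W4 S by linarith
    have "(10 * W + (Z + 2 * W + 1)) * E ^ 4 = 12 * (W * E ^ 4) + E ^ 4 + E\<^sup>2 * (E\<^sup>2 * Z)"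
      by (simp add: algebra_simps power_def numeral_eq_Suc)
    moreover have "W * E ^ 4 \<le> W * 16" using E2 W4 by (auto intro!: mult_left_mono)
    moreover have "E\<^sup>2 * (E\<^sup>2 * Z) \<le> 4 * ((S + 24 * W + 4) * \<Lambda>)" by (rule mult_mono[OF E2(1) EZ]) (use EZ0 in auto)
    moreover have "D * (\<Lambda> + 3) = 36 * (S * \<Lambda>) + 162 * (W * \<Lambda>) + 108 * S + 486 * W" by (simp add: D_def algebra_simps)
    moreover have "(S + 24 * W + 4) * \<Lambda> = S * \<Lambda> + 24 * (W * \<Lambda>) + 4 * \<Lambda>" by (simp add: algebra_simps)
    ultimately show "(10 * W + (Z + 2 * W + 1)) * E ^ 4 \<le> D * (\<Lambda> + 3)"
      using SL \<Lambda> W4 S E2 by linarith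
  qed
  then show "ln (30 / p\<^sub>1)
    + p / ln t * (2 * (ln (800 / ((t - 1) * p\<^sub>1)) + (X + 1) * \<Lambda>) + ln (7 * t))
    + q * ((X + 1) * \<Lambda> + ln (400 / p\<^sub>1) + 1) \<le> a * (p + q) * Y"
    using l30 Wpq Pt Qt unfolding Z_def[symmetric] by (simp only: distrib_right)
qed

text \<open>
  The base on the right is \<open>75 / 2 * u / (u - 1)\<close> times the argument of the logarithm on the left, and this ratio is more than \<open>27 \<ge> exp 3\<close>.
\<close>

lemma base_budget:
  fixes u t M1 M2 :: real
  assumes u: "1 < u" "u \<le> 3" and t: "t = u\<^sup>2" and M: "0 < M1" "0 < M2"
  shows "ln (2 * M2 / (M1 * (1 - 1 / t) / 4)) + 3 \<le> ln (300 * (u + 1) * t powr (3 / 2) / (t - 1)\<^sup>2 * M2 / M1)"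
proof -
  have tE: "t - 1 = (u - 1) * (u + 1)" by (simp add: t power2_eq_square algebra_simps)
  have pw: "t powr (3 / 2) = u ^ 3"
  proof -
    have "t powr (3 / 2) = (u powr 2) powr (3 / 2)" using u by (simp add: t)
    also have "\<dots> = u powr 3" by (simp add: powr_powr)
    finally show ?thesis using u by simp
  qed
  have lhs: "2 * M2 / (M1 * (1 - 1 / t) / 4) = 8 * u\<^sup>2 / ((u - 1) * (u + 1)) * (M2 / M1)"
  proof -
    have "1 - 1 / t = (t - 1) / t" using t u by (simp add: field_simps)
    then show ?thesis unfolding tE using u M by (simp add: t field_simps)
  qed
  have e4: "exp (3::real) \<le> 27"
  proof -
    have "exp (3::real) = exp 1 ^ 3" by (simp add: exp_of_nat_mult[symmetric])
    also have "\<dots> \<le> 3 ^ 3" using exp_le by (intro power_mono) auto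
    finally show ?thesis by simp
  qed
  have pos: "0 < 8 * u\<^sup>2 / ((u - 1) * (u + 1)) * (M2 / M1)" using u M by simp
  have "8 * u\<^sup>2 / ((u - 1) * (u + 1)) * (M2 / M1) * exp 3 \<le> 8 * u\<^sup>2 / ((u - 1) * (u + 1)) * (M2 / M1) * (75 / 2 * u / (u - 1))"
  proof (rule mult_left_mono)
    have "27 * (u - 1) \<le> 75 / 2 * u" using u by simp
    then have "27 \<le> 75 / 2 * u / (u - 1)" using u by (simp add: pos_le_divide_eq)
    then show "exp 3 \<le> 75 / 2 * u / (u - 1)" using e4 by linarith
  qed (use pos in simp)
  also have "\<dots> = 300 * (u + 1) * t powr (3 / 2) / (t - 1)\<^sup>2 * M2 / M1"
  proof -
    have eq: "8 * u\<^sup>2 / (e * s) * (M2 / M1) * (75 / 2 * u / e) = 300 * s * u ^ 3 / (e * s)\<^sup>2 * M2 / M1"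
      if "0 < e" "0 < s" for e s
      using that M by (simp add: field_simps power2_eq_square power3_eq_cube)
    show ?thesis unfolding pw tE by (rule eq) (use u in auto)
  qed
  finally have "ln (8 * u\<^sup>2 / ((u - 1) * (u + 1)) * (M2 / M1) * exp 3) \<le> ln (300 * (u + 1) * t powr (3 / 2) / (t - 1)\<^sup>2 * M2 / M1)"
    by (intro ln_mono mult_pos_pos[OF pos exp_gt_zero])
  moreover have "ln (8 * u\<^sup>2 / ((u - 1) * (u + 1)) * (M2 / M1) * exp 3) = ln (8 * u\<^sup>2 / ((u - 1) * (u + 1)) * (M2 / M1)) + ln (exp 3)"
    using pos by (subst ln_mult) auto
  ultimately show ?thesis unfolding lhs by simp
qed

section \<open>The main estimate\<close>

context graph_class
begin

text \<open>
  The exponents are compared for \<open>cmod w < M2\<close>.  The boundary \<open>cmod w = M2\<close> follows by continuity; it is needed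
  for the values of \<open>f\<close>, which may attain this modulus.
\<close>

lemma graph_bound:
  fixes \<epsilon> M1 :: real
  assumes n: "1 \<le> n" and M1: "0 < M1" "ereal M1 \<le> sup_abs f (Cn_ball0 n (r / t))"
    and R: "ereal t \<le> R_ratio n f r t (t\<^sup>2)"
    and N: "ereal p \<le> ereal (ln ((1 + t) / (2 * sqrt t))) * N_index n f r t"
    and eps: "\<forall>z\<in>Cn_ball0 n r. cmod (g (z(n := f z))) \<le> \<epsilon>"
    and z: "z \<in> Cn_ball0 n (t * r)" and w: "cmod w \<le> M2"
  shows "cmod (g (z(n := w))) \<le> (300 * (u + 1) * t powr (3 / 2) / (t - 1)\<^sup>2 * M2 / M1) powr
    ((36 * (u + 1)\<^sup>2 + 162 * ln (108 * exp 1 / (u - 1))) / (u - 1) ^ 4 * (p + q)) * \<epsilon>"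
proof -
  define \<beta> where "\<beta> = 300 * (u + 1) * t powr (3 / 2) / (t - 1)\<^sup>2 * M2 / M1"
  define a where "a = (36 * (u + 1)\<^sup>2 + 162 * ln (108 * exp 1 / (u - 1))) / (u - 1) ^ 4"
  define p\<^sub>1 where "p\<^sub>1 = ((t - 1) / (t + 1))\<^sup>2 / 2"
  have \<beta>: "\<beta> powr (a * (p + q)) = exp (a * (p + q) * ln \<beta>)"
    using u t1 M1 M2 by (simp add: \<beta>_def powr_def)
  have z0: "(\<lambda>_. 0) \<in> Cn_ball0 n r" using r by (simp add: mem_Cn_ball0 Cn_def)
  have g0: "cmod (g ((\<lambda>_. 0)(n := f (\<lambda>_. 0)))) \<le> \<epsilon>" using eps z0 by blast
  have \<epsilon>0: "0 \<le> \<epsilon>" using g0 by (rule order_trans[OF norm_ge_zero])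
  have main: "cmod (g (z(n := w))) \<le> \<beta> powr (a * (p + q)) * \<epsilon>" if w: "cmod w < M2" for w
  proof -
    note large = graph_bound_large[OF n M1 R N eps z w]
    note Y = base_budget[OF u t M1(1) M2, folded \<beta>_def]
    show ?thesis
    proof (cases "p\<^sub>1 \<le> p \<or> 1 / 5 \<le> q")
      case True
      from exponent_budget(1)[OF u t conjunct1[OF large] Y p0 q0, folded p\<^sub>1_def a_def, OF True]
      show ?thesis using conjunct2[OF large, folded p\<^sub>1_def] unfolding \<beta>
        by (meson \<epsilon>0 exp_le_cancel_iff mult_right_mono order_trans)
    next
      case False
      have "(t + 1) / (t - 1) * p \<le> (t + 1) / (t - 1) * p\<^sub>1" using False t1 by (intro mult_left_mono) auto
      also have "\<dots> = (t - 1) / (t + 1) / 2" using t1 by (simp add: p\<^sub>1_def power2_eq_square)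
      also have "\<dots> \<le> 1 / 2" by (rule divide_right_mono) (use t1 in auto)
      finally have sm: "(t + 1) / (t - 1) * p \<le> 1 / 2" .
      have "cmod (g (z(n := w))) \<le> exp (2 * ((t + 1) / (t - 1)) * p + 5 * q) * cmod (g ((\<lambda>_. 0)(n := f (\<lambda>_. 0))))"
        by (rule graph_bound_small[OF sm _ z w]) (use False in simp)
      also have "\<dots> \<le> exp (a * (p + q) * ln \<beta>) * \<epsilon>"
        using exponent_budget(2)[OF u t conjunct1[OF large] Y p0 q0, folded a_def] g0 by (intro mult_mono) auto
      finally show ?thesis unfolding \<beta> .
    qed
  qed
  have "w \<in> closure (ball 0 M2)" using w M2 by simp
  moreover have "continuous_on (closure (ball 0 M2)) (\<lambda>w. g (z(n := w)))"
    by (rule continuous_on_subset[OF holomorphic_on_imp_continuous_on[OF slice_fibre_holomorphic[OF z]]]) (use M2 in auto)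
  ultimately show ?thesis
    unfolding \<beta>_def[symmetric] a_def[symmetric]
    using continuous_on_closure_norm_le[of "ball 0 M2" "\<lambda>w. g (z(n := w))"] main by auto
qed

end

theorem theorem1p2:
  fixes t :: real
  assumes "1 < t" and "t \<le> 9"
  shows "\<exists>a1 a2 :: real.
    0 < a1 \<and> a1 \<le> 300 * (sqrt t + 1) * t powr (3 / 2) / (t - 1)\<^sup>2 \<and>
    0 < a2 \<and> a2 \<le> (36 * (sqrt t + 1)\<^sup>2 + 162 * ln (108 * exp 1 / (sqrt t - 1))) / (sqrt t - 1) ^ 4 \<and>
    (\<forall>(n::nat) (r::real) (M1::real) (M2::real) (f :: (nat \<Rightarrow> complex) \<Rightarrow> complex) (p::real) (q::real).
       1 \<le> n \<longrightarrow> 0 < r \<longrightarrow> 0 < M1 \<longrightarrow> 0 < M2 \<longrightarrow>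
       Cn_holomorphic_on n f (Cn_ball0 n (t * r)) \<longrightarrow>
       ereal M1 \<le> sup_abs f (Cn_ball0 n (r / t)) \<longrightarrow>
       sup_abs f (Cn_ball0 n (t * r)) \<le> ereal M2 \<longrightarrow>
       ereal t \<le> R_ratio n f r t (t\<^sup>2) \<longrightarrow>
       0 \<le> p \<longrightarrow> 0 \<le> q \<longrightarrow>
       ereal p \<le> ereal (ln ((1 + t) / (2 * sqrt t))) * N_index n f r t \<longrightarrow>
       (\<forall>g \<in> F_class n p q r t M2.
          sup_abs g (Cn_prod n (Cn_ball0 n r) (ball 0 M2))
            \<le> ereal ((a1 * M2 / M1) powr (a2 * (p + q)))
                * sup_abs (\<lambda>z. g (z(n := f z))) (Cn_ball0 n r) \<and>
          sup_abs (\<lambda>z. g (z(n := f z))) (Cn_ball0 n (t * r))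
            \<le> ereal ((a1 * M2 / M1) powr (a2 * (p + q)))
                * sup_abs (\<lambda>z. g (z(n := f z))) (Cn_ball0 n r)))"
proof -
  define u where "u = sqrt t"
  have u: "1 < u" "u \<le> 3" "t = u\<^sup>2"
    using assms real_sqrt_le_mono[of t 9] by (auto simp: u_def)
  define a1 where "a1 = 300 * (u + 1) * t powr (3 / 2) / (t - 1)\<^sup>2"
  define a2 where "a2 = (36 * (u + 1)\<^sup>2 + 162 * ln (108 * exp 1 / (u - 1))) / (u - 1) ^ 4"
  have a10: "0 < a1" unfolding a1_def using assms u(1) by (intro divide_pos_pos mult_pos_pos) auto
  have a20: "0 < a2" unfolding a2_def by (rule exponent_budget(3)[OF u, of 0 3 0 0]) auto
  have bounds: "sup_abs g (Cn_prod n (Cn_ball0 n r) (ball 0 M2))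
        \<le> ereal ((a1 * M2 / M1) powr (a2 * (p + q))) * sup_abs (\<lambda>z. g (z(n := f z))) (Cn_ball0 n r) \<and>
      sup_abs (\<lambda>z. g (z(n := f z))) (Cn_ball0 n (t * r))
        \<le> ereal ((a1 * M2 / M1) powr (a2 * (p + q))) * sup_abs (\<lambda>z. g (z(n := f z))) (Cn_ball0 n r)"
    if n: "1 \<le> n" and r: "0 < r" and M1: "0 < M1" and M2: "0 < M2" and hol: "Cn_holomorphic_on n f (Cn_ball0 n (t * r))"
      and f1: "ereal M1 \<le> sup_abs f (Cn_ball0 n (r / t))" and f2: "sup_abs f (Cn_ball0 n (t * r)) \<le> ereal M2"
      and R: "ereal t \<le> R_ratio n f r t (t\<^sup>2)" and p: "0 \<le> p" and q: "0 \<le> q"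
      and N: "ereal p \<le> ereal (ln ((1 + t) / (2 * sqrt t))) * N_index n f r t" and g: "g \<in> F_class n p q r t M2"
    for n :: nat and r M1 M2 p q :: real and f g :: "(nat \<Rightarrow> complex) \<Rightarrow> complex"
  proof -
    have fM2: "cmod (f z) \<le> M2" if "z \<in> Cn_ball0 n (t * r)" for z using f2[unfolded sup_abs_le_iff] that by blast
    interpret graph_class n r t u M2 p q f g
      by unfold_locales (use r u M2 hol fM2 g p q in auto)
    define S where "S = sup_abs (\<lambda>z. g (z(n := f z))) (Cn_ball0 n r)"
    define B where "B = (a1 * M2 / M1) powr (a2 * (p + q))"
    have B0: "0 < B" using a10 M1 M2 by (simp add: B_def)
    have rt: "r < t * r" using r assms by simp
    have z0: "(\<lambda>_. 0) \<in> Cn_ball0 n r" using r by (simp add: mem_Cn_ball0 Cn_def)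
    have S0: "0 \<le> S"
      unfolding S_def by (rule order_trans[OF _ le_sup_abs[OF z0]]) simp
    have "sup_abs g (Cn_prod n (Cn_ball0 n r) (ball 0 M2)) \<le> ereal B * S \<and>
      sup_abs (\<lambda>z. g (z(n := f z))) (Cn_ball0 n (t * r)) \<le> ereal B * S"
    proof (cases S)
      case PInf
      then show ?thesis using B0 by simp
    next
      case MInf
      then show ?thesis using S0 by simp
    next
      case (real \<epsilon>)
      then have "\<forall>z\<in>Cn_ball0 n r. cmod (g (z(n := f z))) \<le> \<epsilon>"
        unfolding S_def using sup_abs_le_iff[of "\<lambda>z. g (z(n := f z))" "Cn_ball0 n r" \<epsilon>] by simp
      note bound = graph_bound[OF n M1 f1 R N this, folded a1_def a2_def, folded B_def]
      have "sup_abs g (Cn_prod n (Cn_ball0 n r) (ball 0 M2)) \<le> ereal (B * \<epsilon>)"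
        unfolding sup_abs_le_iff Cn_prod_def using bound rt by (force simp: mem_Cn_ball0)
      moreover have "sup_abs (\<lambda>z. g (z(n := f z))) (Cn_ball0 n (t * r)) \<le> ereal (B * \<epsilon>)"
        unfolding sup_abs_le_iff using bound fM2 by blast
      ultimately show ?thesis by (simp add: real)
    qed
    then show ?thesis by (simp add: S_def B_def)
  qed
  show ?thesis
    unfolding u_def[symmetric]
    by (intro exI[of _ a1] exI[of _ a2] conjI allI impI ballI)
       (use a10 a20 bounds in \<open>auto simp: a1_def a2_def u_def\<close>)
qed

end
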